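(* Let $S\subset C(\mathbf{k})$ be finite and let $F_1,F_2\in K[x_1,\dots,x_n]$ be coprime polynomials of the same degree $d>0$, such that for each $i\in\{1,2\}$ one of the coefficients of $F_i$ equals $1$. For every integer $m\ge2d$ put $M:=M_m:=2\binom{m+n-d}{n}-\binom{m+n-2d}{n}$ and $M':=M'_m:=\binom{m+n}{n}-M$. Then $M'_m=O(m^{n-2})$ as $m\to\infty$. Moreover, suppose that for some $\mathbf g=(g_1,\dots,g_n)\in(\mathcal{O}_S^* )^n$, some integer $m\ge2d$ and some positive integer $r$, the elements $\mathbf g^{\mathbf i}$ with $\mathbf i\in\mathbb{Z}_{\ge0}^n$, $|\mathbf i|\le m$, are linearly nondegenerate over $V_{F_1,F_2}(Mr+1)$. Then $$M\,N_{S,\gcd}(F_1(\mathbf g),F_2(\mathbf g))\le\Bigl(M'+\tfrac{d_{Mr}}{d_{M(r-1)}}M-M\Bigr)mn\max_{1\le i\le n}h(g_i)+cM\bigl(h(F_1)+h(F_2)\bigr)+c'M\max\{0,2\mathfrak g-2+|S|\},$$ where $c:=\frac{d_{Mr}}{d_{M(r-1)}}(1+M(r+1))$ and $c':=\frac{d_{Mr}^2M}{2d_{M(r-1)}}$.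
   Context: $\mathbf{k}$ is an algebraically closed field of characteristic zero, $C$ a smooth projective curve over $\mathbf{k}$ of genus $\mathfrak g$, $K=\mathbf{k}(C)$; $v_{\mathfrak p}$ is the order-of-vanishing valuation at $\mathfrak p\in C(\mathbf{k})$. $\mathcal{O}_S^*=\{f\in K^*: v_{\mathfrak p}(f)=0\ \forall\mathfrak p\notin S\}$. For $f\in K^*$, $h(f)=\sum_{\mathfrak p}\max\{0,-v_{\mathfrak p}(f)\}$; $N_{S,\gcd}(f,g)=\sum_{\mathfrak p\notin S}\min\{\max\{0,v_{\mathfrak p}(f)\},\max\{0,v_{\mathfrak p}(g)\}\}$. For nonzero $F=\sum a_{\mathbf i}\mathbf x^{\mathbf i}$, $h(F)=-\sum_{\mathfrak p}\min_{a_{\mathbf i}\ne0}v_{\mathfrak p}(a_{\mathbf i})$. $\mathbf g^{\mathbf i}=g_1^{i_1}\cdots g_n^{i_n}$, $|\mathbf i|=i_1+\cdots+i_n$. For an integer $s\ge0$, $V_{F_1,F_2}(s)$ is the $\mathbf{k}$-vector subspace of $K$ spanned by all products $\prod_\alpha\alpha^{n_\alpha}$, where $\alpha$ runs over the nonzero coefficients of $F_1$ and $F_2$, $n_\alpha\ge0$, $\sum n_\alpha=s$ (so $V_{F_1,F_2}(0)=\mathbf{k}$); $d_s:=\dim_{\mathbf{k}}V_{F_1,F_2}(s)$. For a $\mathbf{k}$-subspace $E\subset K$, elements $y_1,\dots,y_N\in K$ are linearly nondegenerate over $E$ if $\sum a_iy_i=0$ with all $a_i\in E$ implies all $a_i=0$.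 *)

theory Defs
  imports "HOL-Library.Poly_Mapping" "HOL-Computational_Algebra.Polynomial"
          "HOL-Library.Landau_Symbols"
begin

text \<open>The function field K is the whole type 'a; the constant field k is a subset.\<close>

definition subfield :: "'a::field set \<Rightarrow> bool" where
  "subfield k \<longleftrightarrow> 0 \<in> k \<and> 1 \<in> k \<and> (\<forall>x\<in>k. \<forall>y\<in>k. x + y \<in> k \<and> x * y \<in> k)
     \<and> (\<forall>x\<in>k. - x \<in> k \<and> inverse x \<in> k)"

definition alg_closed_subfield :: "'a::field set \<Rightarrow> bool" where
  "alg_closed_subfield k \<longleftrightarrow> subfield k \<and>
     (\<forall>p :: 'a poly. (\<forall>i. coeff p i \<in> k) \<and> Polynomial.degree p > 0 \<longrightarrow> (\<exists>x\<in>k. poly p x = 0))"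

definition transcendental_over :: "'a::field set \<Rightarrow> 'a \<Rightarrow> bool" where
  "transcendental_over k t \<longleftrightarrow> (\<forall>p :: 'a poly. (\<forall>i. coeff p i \<in> k) \<and> poly p t = 0 \<longrightarrow> p = 0)"

definition rat_fun_field :: "'a::field set \<Rightarrow> 'a \<Rightarrow> 'a set" where
  "rat_fun_field k t = {x. \<exists>p q :: 'a poly. (\<forall>i. coeff p i \<in> k) \<and> (\<forall>i. coeff q i \<in> k)
       \<and> poly q t \<noteq> 0 \<and> x = poly p t / poly q t}"

definition function_field_over :: "'a::field set \<Rightarrow> bool" where
  "function_field_over k \<longleftrightarrow> (\<exists>t. transcendental_over k t \<and>
     (\<exists>B. finite B \<and> (\<forall>x. \<exists>c. (\<forall>b\<in>B. c b \<in> rat_fun_field k t) \<and> x = (\<Sum>b\<in>B. c b * b))))"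

definition lin_nondeg_over :: "'a::field set \<Rightarrow> 'i set \<Rightarrow> ('i \<Rightarrow> 'a) \<Rightarrow> bool" where
  "lin_nondeg_over E I y \<longleftrightarrow>
     (\<forall>a. (\<forall>i\<in>I. a i \<in> E) \<and> (\<Sum>i\<in>I. a i * y i) = 0 \<longrightarrow> (\<forall>i\<in>I. a i = 0))"

definition kspan :: "'a::field set \<Rightarrow> 'a set \<Rightarrow> 'a set" where
  "kspan k X = {x. \<exists>(N::nat) c y. (\<forall>j<N. c j \<in> k \<and> y j \<in> X) \<and> x = (\<Sum>j<N. c j * y j)}"

text \<open>Dimension over k of a subset W (a k-subspace); meaningful for finite-dimensional W.\<close>
definition kdim :: "'a::field set \<Rightarrow> 'a set \<Rightarrow> nat" where
  "kdim k W = Sup {N. \<exists>y::nat \<Rightarrow> 'a. (\<forall>j<N. y j \<in> W) \<and> lin_nondeg_over k {..<N} y}"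

text \<open>Normalized discrete valuations of K trivial on k; v 0 := 0 by convention.
  Since k is algebraically closed, these correspond bijectively to C(k), and
  v_p is the order of vanishing at p.\<close>
definition place :: "'a::field set \<Rightarrow> ('a \<Rightarrow> int) \<Rightarrow> bool" where
  "place k v \<longleftrightarrow> v 0 = 0
     \<and> (\<forall>x y. x \<noteq> 0 \<longrightarrow> y \<noteq> 0 \<longrightarrow> v (x * y) = v x + v y)
     \<and> (\<forall>x y. x \<noteq> 0 \<longrightarrow> y \<noteq> 0 \<longrightarrow> x + y \<noteq> 0 \<longrightarrow> v (x + y) \<ge> min (v x) (v y))
     \<and> (\<forall>c\<in>k. c \<noteq> 0 \<longrightarrow> v c = 0)
     \<and> (\<exists>t. t \<noteq> 0 \<and> v t = 1)"

definition places :: "'a::field set \<Rightarrow> ('a \<Rightarrow> int) set" where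
  "places k = {v. place k v}"

section \<open>Genus (via Riemann's theorem: g = max over divisors D of deg D + 1 - l(D))\<close>

definition divisor :: "'a::field set \<Rightarrow> (('a \<Rightarrow> int) \<Rightarrow> int) \<Rightarrow> bool" where
  "divisor k D \<longleftrightarrow> finite {v. D v \<noteq> 0} \<and> {v. D v \<noteq> 0} \<subseteq> places k"

definition div_deg :: "(('a \<Rightarrow> int) \<Rightarrow> int) \<Rightarrow> int" where
  "div_deg D = (\<Sum>v\<in>{v. D v \<noteq> 0}. D v)"

definition riemann_roch_space :: "'a::field set \<Rightarrow> (('a \<Rightarrow> int) \<Rightarrow> int) \<Rightarrow> 'a set" where
  "riemann_roch_space k D = {f. f = 0 \<or> (\<forall>v\<in>places k. v f + D v \<ge> 0)}"

definition genus :: "'a::field set \<Rightarrow> int" where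
  "genus k = (THE g. (\<forall>D. divisor k D \<longrightarrow>
        div_deg D + 1 - int (kdim k (riemann_roch_space k D)) \<le> g)
     \<and> (\<exists>D. divisor k D \<and> div_deg D + 1 - int (kdim k (riemann_roch_space k D)) = g))"

definition S_units :: "'a::field set \<Rightarrow> ('a \<Rightarrow> int) set \<Rightarrow> 'a set" where
  "S_units k S = {f. f \<noteq> 0 \<and> (\<forall>v\<in>places k - S. v f = 0)}"

definition height :: "'a::field set \<Rightarrow> 'a \<Rightarrow> int" where
  "height k f = (\<Sum>v\<in>{v\<in>places k. v f \<noteq> 0}. max 0 (- v f))"

definition N_gcd :: "'a::field set \<Rightarrow> ('a \<Rightarrow> int) set \<Rightarrow> 'a \<Rightarrow> 'a \<Rightarrow> int" where
  "N_gcd k S f g = (\<Sum>v\<in>{v\<in>places k - S. v f > 0 \<and> v g > 0}. min (max 0 (v f)) (max 0 (v g)))"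

type_synonym 'a mpoly = "(nat \<Rightarrow>\<^sub>0 nat) \<Rightarrow>\<^sub>0 'a"

definition mono_deg :: "(nat \<Rightarrow>\<^sub>0 nat) \<Rightarrow> nat" where
  "mono_deg \<alpha> = (\<Sum>j\<in>Poly_Mapping.keys \<alpha>. Poly_Mapping.lookup \<alpha> j)"

definition in_vars :: "nat \<Rightarrow> 'a::zero mpoly \<Rightarrow> bool" where
  "in_vars n F \<longleftrightarrow> (\<forall>\<alpha>\<in>Poly_Mapping.keys F. Poly_Mapping.keys \<alpha> \<subseteq> {..<n})"

definition total_degree :: "'a::zero mpoly \<Rightarrow> nat" where
  "total_degree F = Max (mono_deg ` Poly_Mapping.keys F)"

definition mono_eval :: "(nat \<Rightarrow> 'a::comm_ring_1) \<Rightarrow> (nat \<Rightarrow>\<^sub>0 nat) \<Rightarrow> 'a" where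
  "mono_eval g \<alpha> = (\<Prod>j\<in>Poly_Mapping.keys \<alpha>. g j ^ Poly_Mapping.lookup \<alpha> j)"

definition mpoly_eval :: "'a::comm_ring_1 mpoly \<Rightarrow> (nat \<Rightarrow> 'a) \<Rightarrow> 'a" where
  "mpoly_eval F g = (\<Sum>\<alpha>\<in>Poly_Mapping.keys F. Poly_Mapping.lookup F \<alpha> * mono_eval g \<alpha>)"

definition mpoly_coprime :: "'a::field mpoly \<Rightarrow> 'a mpoly \<Rightarrow> bool" where
  "mpoly_coprime F G \<longleftrightarrow> (\<forall>H. H dvd F \<and> H dvd G \<longrightarrow> total_degree H = 0)"

definition coeff_set :: "'a::zero mpoly \<Rightarrow> 'a set" where
  "coeff_set F = Poly_Mapping.lookup F ` Poly_Mapping.keys F"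

definition mpoly_height :: "'a::field set \<Rightarrow> 'a mpoly \<Rightarrow> int" where
  "mpoly_height k F = - (\<Sum>v\<in>{v\<in>places k. \<exists>a\<in>coeff_set F. v a \<noteq> 0}. Min (v ` coeff_set F))"

definition Vspace :: "'a::field set \<Rightarrow> 'a mpoly \<Rightarrow> 'a mpoly \<Rightarrow> nat \<Rightarrow> 'a set" where
  "Vspace k F1 F2 s = kspan k {(\<Prod>a\<in>coeff_set F1 \<union> coeff_set F2. a ^ e a) | e.
        (\<Sum>a\<in>coeff_set F1 \<union> coeff_set F2. e a) = s}"

definition dV :: "'a::field set \<Rightarrow> 'a mpoly \<Rightarrow> 'a mpoly \<Rightarrow> nat \<Rightarrow> nat" where
  "dV k F1 F2 s = kdim k (Vspace k F1 F2 s)"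

definition exps_upto :: "nat \<Rightarrow> nat \<Rightarrow> (nat \<Rightarrow>\<^sub>0 nat) set" where
  "exps_upto n m = {\<alpha>. Poly_Mapping.keys \<alpha> \<subseteq> {..<n} \<and> mono_deg \<alpha> \<le> m}"

definition M_num :: "nat \<Rightarrow> nat \<Rightarrow> nat \<Rightarrow> int" where
  "M_num n d m = 2 * int ((m + n - d) choose n) - int ((m + n - 2 * d) choose n)"

definition M'_num :: "nat \<Rightarrow> nat \<Rightarrow> nat \<Rightarrow> int" where
  "M'_num n d m = int ((m + n) choose n) - M_num n d m"

end

theory Submission
  imports Defs "Jordan_Normal_Form.Determinant" "HOL-Computational_Algebra.Formal_Laurent_Series"
begin

text \<open>
  Let \<open>\<mu>\<close> be the leading exponent of \<open>F1\<close>. The \<open>M\<close> polynomials \<open>\<phi>\<^sub>s\<close> of degree at most \<open>m\<close> of the form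
  \<open>x\<^sup>i F1\<close>, or \<open>x\<^sup>i F2\<close> with \<open>\<mu>\<close> not dividing \<open>i\<close>, are linearly independent because \<open>F1\<close> and \<open>F2\<close>
  are coprime. By nondegeneracy the space \<open>U\<close> of combinations of the \<open>\<phi>\<^sub>s(g)\<close> with coefficients in \<open>V(M r)\<close>
  has dimension \<open>D = d(M r) M\<close>, and the order of the Wronskian \<open>W\<close> of a basis of \<open>U\<close> at a place depends
  only on \<open>U\<close>. Outside \<open>S\<close> every element of \<open>U\<close> vanishes to the order counted by the gcd, up to the
  heights of \<open>F1\<close> and \<open>F2\<close>. At a place of \<open>S\<close> choose the nonzero minor of the coefficient matrix of the
  \<open>\<phi>\<^sub>s\<close> whose monomials have the smallest total order at \<open>g\<close>; by Cramer's rule its cofactors turn the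
  \<open>\<phi>\<^sub>s(g)\<close> into functions \<open>e\<^sub>i\<close> of, up to such heights, at least the orders of these monomials, and a basis of \<open>U\<close>
  may start with the products of the \<open>e\<^sub>i\<close> with a basis of \<open>V(M (r - 1))\<close>. All monomials together
  contribute nothing over \<open>S\<close> by the product formula, so only the \<open>M'\<close> omitted ones and the remaining
  \<open>D - d(M (r - 1)) M\<close> basis elements cost a multiple of the heights of the \<open>g\<^sub>j\<close>. Comparing with
  \<open>\<Sum>\<^sub>v v(W) = 0\<close> gives the inequality. The genus enters through the derivation \<open>d/dt\<close>: each differentiation
  costs the order of \<open>dt\<close>, whose sum over all places is at most \<open>2 g - 2\<close>.
\<close>

section \<open>Linear algebra over a subfield\<close>

text \<open>The curve is present only through valuations of its function field, so the geometry is
  built from \<open>function_field_over\<close>: existence of places, weak approximation, finiteness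
  of L(D), the product formula and Riemann's inequality, which also makes the definite description
  in \<open>genus\<close> meaningful. Residue duality is avoided: the degree of dt is bounded by the
  product formula for the discriminant of the trace form, which yields just the inequality needed.
  The index M r leaves room for Cramer's rule: cofactors lie in V(M), so V(M (r - 1)) times a
  cofactor stays in V(M r); dividing the final inequality by d(M (r - 1)) produces the ratio in the
  statement. The 1 in M r + 1 is for the coefficients of the \<phi>, which lie in V(1). A Wronskian
  of size D contains D (D - 1) / 2 differentiations; with D = d(M r) M this is at most (d(M r) M)^2
  / 2, the source of c'. Outside S all columns share one bound and differentiating by a uniformizer
  loses nothing; inside S the columns have different bounds and each differentiation loses one more,
  whence the term card S.\<close>

definition fin_dim :: "'a::field set \<Rightarrow> 'a set \<Rightarrow> bool" where
  "fin_dim F W \<longleftrightarrow> (\<exists>n. \<forall>N (y::nat \<Rightarrow> 'a). (\<forall>j<N. y j \<in> W) \<and> lin_nondeg_over F {..<N} y \<longrightarrow> N \<le> n)"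

definition subsp :: "'a::field set \<Rightarrow> 'a set \<Rightarrow> bool" where
  "subsp F W \<longleftrightarrow> 0 \<in> W \<and> (\<forall>x\<in>W. \<forall>y\<in>W. x + y \<in> W) \<and> (\<forall>c\<in>F. \<forall>x\<in>W. c * x \<in> W)"

lemma subsp_add: "subsp F W \<Longrightarrow> x \<in> W \<Longrightarrow> y \<in> W \<Longrightarrow> x + y \<in> W"
  and subsp_scale: "subsp F W \<Longrightarrow> c \<in> F \<Longrightarrow> x \<in> W \<Longrightarrow> c * x \<in> W"
  and subsp_zero: "subsp F W \<Longrightarrow> 0 \<in> W"
  by (auto simp: subsp_def)

lemma subsp_sum:
  assumes "subsp F W" "\<And>i. i \<in> I \<Longrightarrow> f i \<in> W"
  shows "(\<Sum>i\<in>I. f i) \<in> W"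
  using assms(2) by (induction I rule: infinite_finite_induct) (use assms(1) in \<open>auto simp: subsp_def\<close>)

lemma lin_nondeg_overD:
  "lin_nondeg_over F I y \<Longrightarrow> (\<And>i. i \<in> I \<Longrightarrow> a i \<in> F) \<Longrightarrow> (\<Sum>i\<in>I. a i * y i) = 0 \<Longrightarrow> i \<in> I \<Longrightarrow> a i = 0"
  unfolding lin_nondeg_over_def by blast

lemma lin_nondeg_overI:
  "(\<And>a i. (\<And>i. i \<in> I \<Longrightarrow> a i \<in> F) \<Longrightarrow> (\<Sum>i\<in>I. a i * y i) = 0 \<Longrightarrow> i \<in> I \<Longrightarrow> a i = 0) \<Longrightarrow> lin_nondeg_over F I y"
  unfolding lin_nondeg_over_def by blast

lemma lin_nondeg_over_reindex:
  assumes "bij_betw f J I"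
  shows "lin_nondeg_over F I y \<longleftrightarrow> lin_nondeg_over F J (y \<circ> f)"
proof
  assume L: "lin_nondeg_over F I y"
  show "lin_nondeg_over F J (y \<circ> f)"
    unfolding lin_nondeg_over_def
  proof (intro allI impI, elim conjE)
    fix a assume a: "\<forall>i\<in>J. a i \<in> F" "(\<Sum>i\<in>J. a i * (y \<circ> f) i) = 0"
    define b where "b = a \<circ> the_inv_into J f"
    have ab: "b (f j) = a j" if "j \<in> J" for j
      using that assms by (simp add: b_def bij_betw_def the_inv_into_f_f)
    have "(\<Sum>i\<in>I. b i * y i) = (\<Sum>j\<in>J. b (f j) * y (f j))"
      using sum.reindex_bij_betw[OF assms, of "\<lambda>i. b i * y i"] by simp
    also have "\<dots> = (\<Sum>i\<in>J. a i * (y \<circ> f) i)" by (rule sum.cong) (auto simp: ab)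
    finally have "(\<Sum>i\<in>I. b i * y i) = 0" using a by simp
    moreover have "\<forall>i\<in>I. b i \<in> F" using a(1) ab assms by (auto simp: bij_betw_def)
    ultimately have "\<forall>i\<in>I. b i = 0" using L by (auto simp: lin_nondeg_over_def)
    then show "\<forall>i\<in>J. a i = 0" using ab assms by (metis bij_betw_apply)
  qed
next
  assume L: "lin_nondeg_over F J (y \<circ> f)"
  show "lin_nondeg_over F I y"
    unfolding lin_nondeg_over_def
  proof (intro allI impI, elim conjE)
    fix a assume a: "\<forall>i\<in>I. a i \<in> F" "(\<Sum>i\<in>I. a i * y i) = 0"
    have "(\<Sum>j\<in>J. a (f j) * (y \<circ> f) j) = (\<Sum>i\<in>I. a i * y i)"
      using sum.reindex_bij_betw[OF assms, of "\<lambda>i. a i * y i"] by simp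
    then have z: "(\<Sum>j\<in>J. a (f j) * (y \<circ> f) j) = 0" using a(2) by (rule trans)
    have m: "\<forall>j\<in>J. a (f j) \<in> F" using a(1) assms by (auto simp: bij_betw_def)
    have "\<forall>j\<in>J. a (f j) = 0"
      by (rule mp[OF L[unfolded lin_nondeg_over_def, THEN spec, of "\<lambda>j. a (f j)"] conjI[OF m z]])
    then show "\<forall>i\<in>I. a i = 0" using assms by (auto simp: bij_betw_def)
  qed
qed

lemma fin_dim_mono: "fin_dim F W \<Longrightarrow> W' \<subseteq> W \<Longrightarrow> fin_dim F W'"
  unfolding fin_dim_def by (meson subsetD)

text \<open>\<open>kdim\<close> is a supremum of naturals, which is a maximum only for a bounded
  set. This is why dimension statements carry \<open>fin_dim\<close>.\<close>

lemma kdim_set_finite: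
  assumes "fin_dim F W"
  shows "finite {N. \<exists>y::nat \<Rightarrow> 'a::field. (\<forall>j<N. y j \<in> W) \<and> lin_nondeg_over F {..<N} y}"
proof -
  obtain n where n: "\<And>N (y::nat \<Rightarrow> 'a). \<forall>j<N. y j \<in> W \<Longrightarrow> lin_nondeg_over F {..<N} y \<Longrightarrow> N \<le> n"
    using assms unfolding fin_dim_def by metis
  show ?thesis by (rule finite_subset[of _ "{..n}"]) (use n in auto)
qed

lemma kdim_attained:
  assumes "fin_dim F W"
  obtains y where "\<forall>j<kdim F W. y j \<in> W" "lin_nondeg_over F {..<kdim F W} y"
proof -
  let ?A = "{N. \<exists>y::nat \<Rightarrow> 'a. (\<forall>j<N. y j \<in> W) \<and> lin_nondeg_over F {..<N} y}"
  have ne: "?A \<noteq> {}" by (auto simp: lin_nondeg_over_def intro!: exI[of _ 0])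
  have "Max ?A \<in> ?A" by (rule Max_in[OF kdim_set_finite[OF assms] ne])
  moreover have "kdim F W = Max ?A" unfolding kdim_def Sup_nat_def using ne by (rule if_not_P)
  ultimately have "kdim F W \<in> ?A" by (simp only:)
  then show thesis using that by blast
qed

lemma kdim_ge:
  assumes "fin_dim F W" "finite I" "\<And>i. i \<in> I \<Longrightarrow> y i \<in> W" "lin_nondeg_over F I y"
  shows "card I \<le> kdim F W"
proof -
  obtain f where f: "bij_betw f {..<card I} I"
    using ex_bij_betw_nat_finite[OF assms(2)] unfolding atLeast0LessThan ..
  have "lin_nondeg_over F {..<card I} (y \<circ> f)" by (rule iffD1[OF lin_nondeg_over_reindex[OF f] assms(4)])
  moreover have "\<forall>j<card I. (y \<circ> f) j \<in> W" using bij_betwE[OF f] assms(3) by simp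
  ultimately have "card I \<in> {N. \<exists>y::nat \<Rightarrow> 'a. (\<forall>j<N. y j \<in> W) \<and> lin_nondeg_over F {..<N} y}"
    by (intro CollectI exI[of _ "y \<circ> f"] conjI)
  then show ?thesis unfolding kdim_def by (rule le_cSup_finite[OF kdim_set_finite[OF assms(1)]])
qed

lemma kdim_leI:
  assumes "\<And>N y. (\<forall>j<N. y j \<in> W) \<Longrightarrow> lin_nondeg_over F {..<N} y \<Longrightarrow> N \<le> n"
  shows "kdim F W \<le> n" "fin_dim F W"
proof -
  show f: "fin_dim F W" unfolding fin_dim_def using assms by blast
  show "kdim F W \<le> n" using kdim_attained[OF f] assms by metis
qed

text \<open>One treatment of linear algebra for three scalar fields inside the same type: the
  constants \<open>k\<close>, a rational function field \<open>rat_fun_field k t\<close>, and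
  \<open>UNIV\<close>.\<close>

locale subfld =
  fixes F :: "'a::field set"
  assumes sf: "subfield F"
begin

lemma zero [simp, intro]: "0 \<in> F" and one [simp, intro]: "1 \<in> F"
  and add [intro]: "x \<in> F \<Longrightarrow> y \<in> F \<Longrightarrow> x + y \<in> F"
  and mult [intro]: "x \<in> F \<Longrightarrow> y \<in> F \<Longrightarrow> x * y \<in> F"
  and uminus [intro]: "x \<in> F \<Longrightarrow> - x \<in> F"
  and inv [intro]: "x \<in> F \<Longrightarrow> inverse x \<in> F"
  using sf by (auto simp: subfield_def)

lemma diff [intro]: "x \<in> F \<Longrightarrow> y \<in> F \<Longrightarrow> x - y \<in> F"
  using add[of x "- y"] by auto

lemma divide [intro]: "x \<in> F \<Longrightarrow> y \<in> F \<Longrightarrow> x / y \<in> F"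
  by (simp add: divide_inverse mult inv)

lemma sum [intro]: "(\<And>i. i \<in> I \<Longrightarrow> f i \<in> F) \<Longrightarrow> sum f I \<in> F"
  by (induction I rule: infinite_finite_induct) auto

lemma prod [intro]: "(\<And>i. i \<in> I \<Longrightarrow> f i \<in> F) \<Longrightarrow> prod f I \<in> F"
  by (induction I rule: infinite_finite_induct) auto

lemma power [intro]: "x \<in> F \<Longrightarrow> x ^ n \<in> F"
  by (induction n) auto

lemma of_nat [intro]: "of_nat n \<in> F"
  by (induction n) auto

text \<open>Gaussian elimination: a pivot \<open>j0\<close> in equation \<open>i0\<close> removes
  one equation and one unknown, so the unknowns stay in excess.\<close>

lemma homogeneous_system:
  assumes "finite I" "finite J" "card I < card J" "\<And>j i. j \<in> J \<Longrightarrow> i \<in> I \<Longrightarrow> a j i \<in> F"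
  shows "\<exists>c. (\<forall>j\<in>J. c j \<in> F) \<and> (\<exists>j\<in>J. c j \<noteq> 0) \<and> (\<forall>i\<in>I. (\<Sum>j\<in>J. c j * a j i) = 0)"
  using assms
proof (induction I arbitrary: J a rule: finite_induct)
  case empty
  then obtain j where "j \<in> J" by fastforce
  then show ?case by (intro exI[of _ "\<lambda>_. 1"]) auto
next
  case (insert i0 I)
  show ?case
  proof (cases "\<forall>j\<in>J. a j i0 = 0")
    case True
    then show ?thesis using insert.IH[of J a] insert.prems insert.hyps by auto
  next
    case False
    then obtain j0 where j0: "j0 \<in> J" "a j0 i0 \<noteq> 0" by blast
    define b where "b = (\<lambda>j i. a j i - a j i0 / a j0 i0 * a j0 i)"
    have "card I < card (J - {j0})" using insert.prems insert.hyps j0 by simp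
    moreover have "b j i \<in> F" if "j \<in> J - {j0}" "i \<in> I" for j i
      unfolding b_def using that j0 insert.prems(3) by (intro diff mult divide) auto
    ultimately obtain c where c: "\<forall>j\<in>J-{j0}. c j \<in> F" "\<exists>j\<in>J-{j0}. c j \<noteq> 0"
        "\<forall>i\<in>I. (\<Sum>j\<in>J-{j0}. c j * b j i) = 0"
      using insert.IH[of "J - {j0}" b] insert.prems(1) by auto
    \<comment> \<open>Back substitution: the value at \<open>j0\<close> is forced by equation
      \<open>i0\<close>.\<close>
    define c' where "c' = c(j0 := - (\<Sum>j\<in>J-{j0}. c j * a j i0) / a j0 i0)"
    have S: "(\<Sum>j\<in>J. c' j * a j i) = c' j0 * a j0 i + (\<Sum>j\<in>J-{j0}. c j * a j i)" for i
      using insert.prems(1) j0(1) by (simp add: sum.remove[of J j0] c'_def)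
    have "(\<Sum>j\<in>J. c' j * a j i) = 0" if "i \<in> insert i0 I" for i
    proof (cases "i = i0")
      case True
      then show ?thesis unfolding S using j0 by (simp add: c'_def)
    next
      case False
      then have "i \<in> I" using that by auto
      have "0 = (\<Sum>j\<in>J-{j0}. c j * a j i - c j * a j i0 * (a j0 i / a j0 i0))"
        using c(3) \<open>i \<in> I\<close> by (auto simp: b_def algebra_simps)
      also have "\<dots> = (\<Sum>j\<in>J-{j0}. c j * a j i) - (\<Sum>j\<in>J-{j0}. c j * a j i0) * (a j0 i / a j0 i0)"
        by (simp add: sum_subtractf sum_distrib_right sum_divide_distrib)
      also have "\<dots> = (\<Sum>j\<in>J. c' j * a j i)" unfolding S by (simp add: c'_def)
      finally show ?thesis by simp
    qed
    moreover have "\<forall>j\<in>J. c' j \<in> F"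
      using c(1) j0 insert.prems(3) by (auto simp: c'_def intro!: divide uminus sum mult)
    moreover have "\<exists>j\<in>J. c' j \<noteq> 0" using c(2) by (auto simp: c'_def)
    ultimately show ?thesis by blast
  qed
qed

text \<open>Steinitz bound: with more vectors than generators, the homogeneous system for the
  coefficients of a relation has more unknowns than equations.\<close>

lemma indep_card_le:
  assumes "finite I" "finite J" "lin_nondeg_over F J y"
    and "\<And>j. j \<in> J \<Longrightarrow> \<exists>a. (\<forall>i\<in>I. a i \<in> F) \<and> y j = (\<Sum>i\<in>I. a i * z i)"
  shows "card J \<le> card I"
proof (rule ccontr)
  assume "\<not> card J \<le> card I"
  then have lt: "card I < card J" by simp
  obtain a where a: "\<And>j. j \<in> J \<Longrightarrow> (\<forall>i\<in>I. a j i \<in> F) \<and> y j = (\<Sum>i\<in>I. a j i * z i)"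
    using assms(4) by metis
  obtain c where c: "\<forall>j\<in>J. c j \<in> F" "\<exists>j\<in>J. c j \<noteq> 0" "\<forall>i\<in>I. (\<Sum>j\<in>J. c j * a j i) = 0"
    using homogeneous_system[OF assms(1,2) lt, of a] a by auto
  have "(\<Sum>j\<in>J. c j * y j) = (\<Sum>j\<in>J. \<Sum>i\<in>I. c j * a j i * z i)"
    using a by (simp add: sum_distrib_left mult.assoc)
  also have "\<dots> = (\<Sum>i\<in>I. (\<Sum>j\<in>J. c j * a j i) * z i)"
    by (subst sum.swap) (simp add: sum_distrib_right)
  also have "\<dots> = 0" using c(3) by simp
  finally show False using assms(3) c by (auto simp: lin_nondeg_over_def)
qed

lemma lin_nondeg_over_mono:
  assumes "lin_nondeg_over F I y" "J \<subseteq> I" "finite I"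
  shows "lin_nondeg_over F J y"
  unfolding lin_nondeg_over_def
proof (intro allI impI, elim conjE)
  fix a assume a: "\<forall>i\<in>J. a i \<in> F" "(\<Sum>i\<in>J. a i * y i) = 0"
  define b where "b = (\<lambda>i. if i \<in> J then a i else 0)"
  have "(\<Sum>i\<in>I. b i * y i) = (\<Sum>i\<in>J. b i * y i)"
    by (rule sum.mono_neutral_right) (use assms in \<open>auto simp: b_def\<close>)
  also have "\<dots> = 0" using a(2) by (simp add: b_def)
  finally have "(\<Sum>i\<in>I. b i * y i) = 0" .
  moreover have "\<forall>i\<in>I. b i \<in> F" using a(1) by (auto simp: b_def)
  ultimately have b: "\<forall>i\<in>I. b i = 0" using assms(1) unfolding lin_nondeg_over_def by blast
  show "\<forall>i\<in>J. a i = 0"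
  proof
    fix i assume "i \<in> J"
    then show "a i = 0" using b assms(2) unfolding b_def by (metis subsetD)
  qed
qed

lemma lin_nondeg_over_extend:
  assumes "lin_nondeg_over F {..<s} y"
    and "\<And>c. \<forall>j<s. c j \<in> F \<Longrightarrow> w \<noteq> (\<Sum>j<s. c j * y j)"
  shows "lin_nondeg_over F {..<Suc s} (y(s := w))"
  unfolding lin_nondeg_over_def
proof (intro allI impI, elim conjE)
  fix a assume a: "\<forall>i\<in>{..<Suc s}. a i \<in> F" "(\<Sum>i<Suc s. a i * (y(s := w)) i) = 0"
  then have e: "(\<Sum>i<s. a i * y i) + a s * w = 0" by simp
  have "a s = 0"
  proof (rule ccontr)
    assume "a s \<noteq> 0"
    then have "w = - (\<Sum>i<s. a i * y i) / a s" using e by (simp add: field_simps eq_neg_iff_add_eq_0)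
    also have "\<dots> = (\<Sum>i<s. (- a i / a s) * y i)"
      by (simp add: sum_negf sum_divide_distrib)
    finally show False using assms(2)[of "\<lambda>i. - a i / a s"] a(1) divide uminus
      by (metis lessI less_SucI lessThan_iff)
  qed
  then have "\<forall>i\<in>{..<s}. a i = 0" using assms(1) a(1) e by (auto simp: lin_nondeg_over_def)
  then show "\<forall>i\<in>{..<Suc s}. a i = 0" using \<open>a s = 0\<close> by (auto simp: less_Suc_eq)
qed

lemma kdim_basis_span:
  assumes "fin_dim F W" "\<forall>j<kdim F W. y j \<in> W" "lin_nondeg_over F {..<kdim F W} y" "w \<in> W"
  shows "\<exists>c. (\<forall>j<kdim F W. c j \<in> F) \<and> w = (\<Sum>j<kdim F W. c j * y j)"
proof (rule ccontr)
  assume "\<not> ?thesis"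
  then have L: "lin_nondeg_over F {..<Suc (kdim F W)} (y(kdim F W := w))"
    using lin_nondeg_over_extend[OF assms(3), of w] by blast
  have "card {..<Suc (kdim F W)} \<le> kdim F W"
    by (rule kdim_ge[OF assms(1) _ _ L]) (use assms in \<open>auto simp: less_Suc_eq\<close>)
  then show False by simp
qed

text \<open>The first \<open>s\<close> vectors are kept in place because the Wronskian at a place of
  \<open>S\<close> is computed in a basis that starts with prescribed elements.\<close>

lemma extend_basis:
  assumes "fin_dim F W" "\<forall>j<s. y j \<in> W" "lin_nondeg_over F {..<s} y"
  shows "\<exists>y'. (\<forall>j<s. y' j = y j) \<and> (\<forall>j<kdim F W. y' j \<in> W) \<and> lin_nondeg_over F {..<kdim F W} y'"
  using assms(2,3)
proof (induction "kdim F W - s" arbitrary: s y)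
  case 0
  have "card {..<s} \<le> kdim F W" by (rule kdim_ge[OF assms(1) _ _ 0(3)]) (use 0(2) in auto)
  then have "s = kdim F W" using 0(1) by simp
  then show ?case using 0(2,3) by (intro exI[of _ y]) simp
next
  case (Suc d)
  have "\<exists>w\<in>W. \<forall>c. (\<forall>j<s. c j \<in> F) \<longrightarrow> w \<noteq> (\<Sum>j<s. c j * y j)"
  proof (rule ccontr)
    assume "\<not> ?thesis"
    then have "\<forall>w\<in>W. \<exists>c. (\<forall>j<s. c j \<in> F) \<and> w = (\<Sum>j<s. c j * y j)" by simp
    then have sp: "\<And>w. w \<in> W \<Longrightarrow> \<exists>c. (\<forall>j<s. c j \<in> F) \<and> w = (\<Sum>j<s. c j * y j)" by (rule bspec)
    obtain z where z: "\<forall>j<kdim F W. z j \<in> W" "lin_nondeg_over F {..<kdim F W} z"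
      using kdim_attained[OF assms(1)] by blast
    have "card {..<kdim F W} \<le> card {..<s}"
    proof (rule indep_card_le[OF _ _ z(2)])
      fix j assume "j \<in> {..<kdim F W}"
      then show "\<exists>a. (\<forall>i\<in>{..<s}. a i \<in> F) \<and> z j = (\<Sum>i<s. a i * y i)"
        using sp[of "z j"] z(1)
        by (metis lessThan_iff)
    qed auto
    then show False using Suc(2) by simp
  qed
  then obtain w where w: "w \<in> W" and w': "\<forall>c. (\<forall>j<s. c j \<in> F) \<longrightarrow> w \<noteq> (\<Sum>j<s. c j * y j)" ..
  have L: "lin_nondeg_over F {..<Suc s} (y(s := w))"
    by (rule lin_nondeg_over_extend[OF Suc.prems(2)]) (rule w'[rule_format], simp)
  have "\<exists>y'. (\<forall>j<Suc s. y' j = (y(s := w)) j) \<and> (\<forall>j<kdim F W. y' j \<in> W) \<and> lin_nondeg_over F {..<kdim F W} y'"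
    by (rule Suc.hyps(1)[OF _ _ L]) (use Suc(2) Suc.prems(1) w in \<open>simp_all add: less_Suc_eq\<close>)
  then show ?case by (metis fun_upd_apply less_Suc_eq nat_neq_iff)
qed

lemma kdim_le_span:
  assumes "finite I" "\<And>w. w \<in> W \<Longrightarrow> \<exists>a. (\<forall>i\<in>I. a i \<in> F) \<and> w = (\<Sum>i\<in>I. a i * z i)"
  shows "kdim F W \<le> card I" "fin_dim F W"
proof -
  have *: "N \<le> card I" if "\<forall>j<N. y j \<in> W" "lin_nondeg_over F {..<N} y" for N y
  proof -
    have "card {..<N} \<le> card I"
    proof (rule indep_card_le[OF assms(1) _ that(2)])
      fix j assume "j \<in> {..<N}"
      then show "\<exists>a. (\<forall>i\<in>I. a i \<in> F) \<and> y j = (\<Sum>i\<in>I. a i * z i)" using that(1) assms(2) by blast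
    qed auto
    then show ?thesis by simp
  qed
  show "kdim F W \<le> card I" using * by (rule kdim_leI(1))
  show "fin_dim F W" using * by (rule kdim_leI(2))
qed

lemma kdim_mono:
  assumes "fin_dim F W" "W' \<subseteq> W"
  shows "kdim F W' \<le> kdim F W"
proof -
  obtain y where "\<forall>j<kdim F W'. y j \<in> W'" "lin_nondeg_over F {..<kdim F W'} y"
    using kdim_attained[OF fin_dim_mono[OF assms]] by blast
  then show ?thesis using kdim_ge[OF assms(1), of "{..<kdim F W'}" y] assms(2) by auto
qed

text \<open>A vector \<open>y i\<close> outside the kernel corrects all the others into it, so the
  kernel of one functional has codimension at most 1. The functional used later is a leading
  coefficient at a place.\<close>

lemma kdim_functional:
  assumes W': "fin_dim F W'" and W: "subsp F W"
    and l: "\<And>x. x \<in> W \<Longrightarrow> l x \<in> F"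
    and ladd: "\<And>x y. x \<in> W \<Longrightarrow> y \<in> W \<Longrightarrow> l (x + y) = l x + l y"
    and lmult: "\<And>c x. c \<in> F \<Longrightarrow> x \<in> W \<Longrightarrow> l (c * x) = c * l x"
    and ker: "\<And>x. x \<in> W \<Longrightarrow> l x = 0 \<Longrightarrow> x \<in> W'"
  shows "kdim F W \<le> kdim F W' + 1" "fin_dim F W"
proof -
  have *: "N \<le> kdim F W' + 1" if y: "\<forall>j<N. y j \<in> W" and L: "lin_nondeg_over F {..<N} y" for N y
  proof (cases "\<forall>j<N. l (y j) = 0")
    case True
    then have "card {..<N} \<le> kdim F W'" by (intro kdim_ge[OF W' _ _ L]) (use y ker in auto)
    then show ?thesis by simp
  next
    case False
    then obtain i where i: "i < N" "l (y i) \<noteq> 0" by blast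
    define c where "c = (\<lambda>j. - l (y j) / l (y i))"
    have cF: "c j \<in> F" if "j < N" for j using l y that i unfolding c_def by (intro divide uminus) auto
    define z where "z = (\<lambda>j. y j + c j * y i)"
    have "lin_nondeg_over F ({..<N} - {i}) z"
      unfolding lin_nondeg_over_def
    proof (intro allI impI, elim conjE)
      fix a assume a: "\<forall>j\<in>{..<N} - {i}. a j \<in> F" "(\<Sum>j\<in>{..<N} - {i}. a j * z j) = 0"
      define b where "b = a(i := (\<Sum>j\<in>{..<N} - {i}. a j * c j))"
      have "(\<Sum>j<N. b j * y j) = b i * y i + (\<Sum>j\<in>{..<N} - {i}. a j * y j)"
        using i by (simp add: sum.remove[of "{..<N}" i] b_def)
      also have "\<dots> = (\<Sum>j\<in>{..<N} - {i}. a j * z j)"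
        by (simp add: b_def z_def sum_distrib_left sum_distrib_right sum.distrib algebra_simps)
      finally have "(\<Sum>j<N. b j * y j) = 0" using a by simp
      moreover have "\<forall>j\<in>{..<N}. b j \<in> F" using a(1) cF by (auto simp: b_def)
      ultimately have "\<forall>j\<in>{..<N}. b j = 0" using L by (auto simp: lin_nondeg_over_def)
      then show "\<forall>j\<in>{..<N} - {i}. a j = 0" by (metis DiffE b_def fun_upd_other singletonI)
    qed
    moreover have "z j \<in> W'" if "j < N" for j
    proof (rule ker)
      have yj: "y j \<in> W" and yi: "y i \<in> W" using y that i(1) by simp_all
      have W1: "c j * y i \<in> W" by (rule subsp_scale[OF W cF[OF that] yi])
      show "z j \<in> W" unfolding z_def by (rule subsp_add[OF W yj W1])
      have "l (z j) = l (y j) + c j * l (y i)"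
        unfolding z_def ladd[OF yj W1] lmult[OF cF[OF that] yi] ..
      also have "\<dots> = 0" unfolding c_def using i(2) by simp
      finally show "l (z j) = 0" .
    qed
    ultimately have "card ({..<N} - {i}) \<le> kdim F W'" by (intro kdim_ge[OF W']) auto
    then show ?thesis using i by simp
  qed
  show "kdim F W \<le> kdim F W' + 1" using * by (rule kdim_leI(1))
  show "fin_dim F W" using * by (rule kdim_leI(2))
qed

lemma kdim_scale:
  assumes "z \<noteq> 0" "fin_dim F W'" "\<And>w. w \<in> W \<Longrightarrow> z * w \<in> W'"
  shows "kdim F W \<le> kdim F W'" "fin_dim F W"
proof -
  have *: "N \<le> kdim F W'" if y: "\<forall>j<N. y j \<in> W" and L: "lin_nondeg_over F {..<N} y" for N y
  proof -
    have "lin_nondeg_over F {..<N} (\<lambda>j. z * y j)"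
      unfolding lin_nondeg_over_def
    proof (intro allI impI, elim conjE)
      fix a assume a: "\<forall>j\<in>{..<N}. a j \<in> F" "(\<Sum>j<N. a j * (z * y j)) = 0"
      have "z * (\<Sum>j<N. a j * y j) = (\<Sum>j<N. a j * (z * y j))"
        unfolding sum_distrib_left by (rule sum.cong) (auto simp: mult_ac)
      then have "(\<Sum>j<N. a j * y j) = 0" using a(2) assms(1) by simp
      then show "\<forall>j\<in>{..<N}. a j = 0" using L a(1) unfolding lin_nondeg_over_def by blast
    qed
    then have "card {..<N} \<le> kdim F W'"
      using kdim_ge[OF assms(2), of "{..<N}" "\<lambda>j. z * y j"] y assms(3) by simp
    then show ?thesis by simp
  qed
  show "kdim F W \<le> kdim F W'" using * by (rule kdim_leI(1))
  show "fin_dim F W" using * by (rule kdim_leI(2))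
qed

end

section \<open>Polynomials over a subfield\<close>

definition pol_over :: "'a::field set \<Rightarrow> 'a poly \<Rightarrow> bool" where
  "pol_over F p \<longleftrightarrow> (\<forall>i. Polynomial.coeff p i \<in> F)"

lemma poly_eq_sum_atMost:
  fixes p :: "'a::comm_semiring_1 poly"
  assumes "Polynomial.degree p \<le> q"
  shows "poly p x = (\<Sum>i\<le>q. Polynomial.coeff p i * x ^ i)"
  unfolding poly_altdef
  by (rule sum.mono_neutral_left) (use assms in \<open>auto simp: coeff_eq_0\<close>)

context subfld
begin

lemma pol_0 [simp]: "pol_over F 0"
  by (simp add: pol_over_def)

lemma pol_pCons: "pol_over F (pCons a p) \<longleftrightarrow> a \<in> F \<and> pol_over F p"
  unfolding pol_over_def
proof safe
  fix i assume *: "\<forall>i. poly.coeff (pCons a p) i \<in> F"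
  show "a \<in> F" using *[rule_format, of 0] by simp
  show "poly.coeff p i \<in> F" using *[rule_format, of "Suc i"] by simp
next
  fix i assume "a \<in> F" "\<forall>i. poly.coeff p i \<in> F"
  then show "poly.coeff (pCons a p) i \<in> F" by (cases i) auto
qed

lemma pol_1 [simp]: "pol_over F 1"
  unfolding one_pCons by (simp add: pol_pCons)

lemma pol_add: "pol_over F p \<Longrightarrow> pol_over F q \<Longrightarrow> pol_over F (p + q)"
  by (auto simp: pol_over_def)

lemma pol_diff: "pol_over F p \<Longrightarrow> pol_over F q \<Longrightarrow> pol_over F (p - q)"
  by (auto simp: pol_over_def)

lemma pol_uminus: "pol_over F p \<Longrightarrow> pol_over F (- p)"
  by (auto simp: pol_over_def)

lemma pol_smult: "c \<in> F \<Longrightarrow> pol_over F p \<Longrightarrow> pol_over F (Polynomial.smult c p)"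
  by (auto simp: pol_over_def)

lemma pol_mult: "pol_over F p \<Longrightarrow> pol_over F q \<Longrightarrow> pol_over F (p * q)"
  unfolding pol_over_def coeff_mult by (intro allI sum mult) auto

lemma pol_power: "pol_over F p \<Longrightarrow> pol_over F (p ^ n)"
  by (induction n) (auto intro: pol_mult)

lemma pol_monom: "c \<in> F \<Longrightarrow> pol_over F (Polynomial.monom c n)"
  by (auto simp: pol_over_def)

lemma pol_sum: "(\<And>i. i \<in> I \<Longrightarrow> pol_over F (f i)) \<Longrightarrow> pol_over F (sum f I)"
  by (induction I rule: infinite_finite_induct) (auto intro: pol_add)

lemma pol_prod: "(\<And>i. i \<in> I \<Longrightarrow> pol_over F (f i)) \<Longrightarrow> pol_over F (prod f I)"
  by (induction I rule: infinite_finite_induct) (auto intro: pol_mult)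

lemma poly_in: "pol_over F p \<Longrightarrow> x \<in> F \<Longrightarrow> poly p x \<in> F"
  unfolding poly_altdef by (intro sum mult power) (auto simp: pol_over_def)

lemma pol_pderiv: "pol_over F p \<Longrightarrow> pol_over F (pderiv p)"
  unfolding pol_over_def coeff_pderiv by (intro allI mult of_nat) auto

lemma pol_synthetic_div: "pol_over F p \<Longrightarrow> c \<in> F \<Longrightarrow> pol_over F (synthetic_div p c)"
  by (induction p) (auto simp: pol_pCons poly_in)

lemma pol_linear_factor:
  assumes "pol_over F p" "c \<in> F" "poly p c = 0"
  obtains q where "pol_over F q" "p = [:- c, 1:] * q"
  using synthetic_div_correct'[of c p] assms pol_synthetic_div[OF assms(1,2)] that
  by (metis add.right_neutral pCons_0_0)

lemma pol_split_root:
  assumes "pol_over F p" "p \<noteq> 0" "c \<in> F"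
  obtains q m where "pol_over F q" "p = [:- c, 1:] ^ m * q" "poly q c \<noteq> 0"
proof -
  have "\<exists>q m. pol_over F q \<and> p = [:- c, 1:] ^ m * q \<and> poly q c \<noteq> 0"
    using assms(1,2)
  proof (induction "Polynomial.degree p" arbitrary: p rule: less_induct)
    case less
    show ?case
    proof (cases "poly p c = 0")
      case False
      then show ?thesis using less.prems by (intro exI[of _ p] exI[of _ 0]) simp
    next
      case True
      obtain q where q: "pol_over F q" "p = [:- c, 1:] * q"
        using pol_linear_factor[OF less.prems(1) assms(3) True] by blast
      have q0: "q \<noteq> 0" using q less.prems by auto
      then have "Polynomial.degree p = Suc (Polynomial.degree q)"
        unfolding q by (subst degree_mult_eq) auto
      then obtain r m where "pol_over F r" "q = [:- c, 1:] ^ m * r" "poly r c \<noteq> 0"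
        using less.hyps[of q] q q0 by auto
      then show ?thesis using q by (intro exI[of _ r] exI[of _ "Suc m"]) (simp only: power_Suc mult.assoc simp_thms)
    qed
  qed
  then show thesis using that by blast
qed

lemma rat_fun_fieldI:
  "pol_over F p \<Longrightarrow> pol_over F q \<Longrightarrow> poly q t \<noteq> 0 \<Longrightarrow> poly p t / poly q t \<in> rat_fun_field F t"
  unfolding rat_fun_field_def pol_over_def by blast

lemma rat_fun_fieldE:
  assumes "x \<in> rat_fun_field F t"
  obtains p q where "pol_over F p" "pol_over F q" "poly q t \<noteq> 0" "x = poly p t / poly q t"
  using assms unfolding rat_fun_field_def pol_over_def by blast

lemma poly_in_rat: "pol_over F p \<Longrightarrow> poly p t \<in> rat_fun_field F t"
  using rat_fun_fieldI[of p 1 t] by simp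

lemma const_in_rat: "c \<in> F \<Longrightarrow> c \<in> rat_fun_field F t"
  using poly_in_rat[of "[:c:]" t] by (simp add: pol_pCons)

lemma gen_in_rat: "t \<in> rat_fun_field F t"
  using poly_in_rat[of "[:0, 1:]" t] by (simp add: pol_pCons)

lemma subfield_rat_fun_field: "subfield (rat_fun_field F t)"
  unfolding subfield_def
proof (intro conjI ballI)
  show "0 \<in> rat_fun_field F t" "1 \<in> rat_fun_field F t" by (auto intro: const_in_rat)
next
  fix x y assume "x \<in> rat_fun_field F t" "y \<in> rat_fun_field F t"
  then obtain p q p' q' where
    *: "pol_over F p" "pol_over F q" "poly q t \<noteq> 0" "x = poly p t / poly q t"
       "pol_over F p'" "pol_over F q'" "poly q' t \<noteq> 0" "y = poly p' t / poly q' t"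
    by (metis rat_fun_fieldE)
  have "poly (p * q' + p' * q) t / poly (q * q') t \<in> rat_fun_field F t"
    by (rule rat_fun_fieldI) (use * in \<open>auto intro: pol_add pol_mult\<close>)
  moreover have "x + y = poly (p * q' + p' * q) t / poly (q * q') t"
    unfolding *(4) *(8) using *(3,7) by (simp add: field_simps)
  ultimately show "x + y \<in> rat_fun_field F t" by simp
  have "poly (p * p') t / poly (q * q') t \<in> rat_fun_field F t"
    by (rule rat_fun_fieldI) (use * in \<open>auto intro: pol_add pol_mult\<close>)
  then show "x * y \<in> rat_fun_field F t" using * by simp
next
  fix x assume "x \<in> rat_fun_field F t"
  then obtain p q where
    *: "pol_over F p" "pol_over F q" "poly q t \<noteq> 0" "x = poly p t / poly q t"
    by (metis rat_fun_fieldE)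
  have "poly (- p) t / poly q t \<in> rat_fun_field F t"
    by (rule rat_fun_fieldI) (use * in \<open>auto intro: pol_uminus\<close>)
  then show "- x \<in> rat_fun_field F t" using * by simp
  show "inverse x \<in> rat_fun_field F t"
  proof (cases "poly p t = 0")
    case True
    then show ?thesis using * by (auto intro: const_in_rat)
  next
    case False
    then show ?thesis using rat_fun_fieldI[OF *(2,1)] * by simp
  qed
qed

lemma rat_fun_field_min:
  assumes "subfield L" "F \<subseteq> L" "t \<in> L"
  shows "rat_fun_field F t \<subseteq> L"
proof
  fix x assume "x \<in> rat_fun_field F t"
  then obtain p q where
    *: "pol_over F p" "pol_over F q" "poly q t \<noteq> 0" "x = poly p t / poly q t"
    by (metis rat_fun_fieldE)
  interpret L: subfld L using assms by unfold_locales
  have "poly p t \<in> L" "poly q t \<in> L"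
    using * assms(2,3) by (auto intro!: L.poly_in simp: pol_over_def subset_iff)
  then show "x \<in> L" using * by auto
qed

lemma common_denominator:
  assumes "finite I" "\<And>i. i \<in> I \<Longrightarrow> c i \<in> rat_fun_field F t"
  shows "\<exists>q p. pol_over F q \<and> poly q t \<noteq> 0 \<and> (\<forall>i\<in>I. pol_over F (p i) \<and> poly q t * c i = poly (p i) t)"
  using assms
proof (induction I rule: finite_induct)
  case empty
  show ?case by (intro exI[of _ 1]) auto
next
  case (insert j I)
  obtain q p where qp: "pol_over F q" "poly q t \<noteq> 0" "\<forall>i\<in>I. pol_over F (p i) \<and> poly q t * c i = poly (p i) t"
    using insert by auto
  obtain a b where ab: "pol_over F a" "pol_over F b" "poly b t \<noteq> 0" "c j = poly a t / poly b t"
    using insert.prems[of j] by (metis insertI1 rat_fun_fieldE)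
  define p' where "p' = (\<lambda>i. if i = j then q * a else b * p i)"
  have "pol_over F (p' i) \<and> poly (q * b) t * c i = poly (p' i) t" if "i \<in> insert j I" for i
  proof (cases "i = j")
    case True
    then show ?thesis using qp ab by (auto simp: p'_def intro: pol_mult)
  next
    case False
    then have "pol_over F (p i)" "poly q t * c i = poly (p i) t" using qp that by auto
    then show ?thesis using False ab by (auto simp: p'_def intro: pol_mult)
  qed
  then show ?case using qp ab by (intro exI[of _ "q * b"] exI[of _ p']) (auto intro: pol_mult)
qed

text \<open>Multiplying a relation by a common denominator leaves polynomial coefficients, so only
  relations over k[t] have to be excluded.\<close>

lemma lin_nondeg_over_ratI:
  assumes "finite I"
    and "\<And>p. (\<And>i. i \<in> I \<Longrightarrow> pol_over F (p i)) \<Longrightarrow> (\<Sum>i\<in>I. poly (p i) t * y i) = 0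
           \<Longrightarrow> \<forall>i\<in>I. poly (p i) t = 0"
  shows "lin_nondeg_over (rat_fun_field F t) I y"
proof (rule lin_nondeg_overI)
  fix a i assume a: "\<And>i. i \<in> I \<Longrightarrow> a i \<in> rat_fun_field F t" "(\<Sum>i\<in>I. a i * y i) = 0" and i: "i \<in> I"
  obtain q p where qp: "poly q t \<noteq> 0" "\<forall>i\<in>I. pol_over F (p i) \<and> poly q t * a i = poly (p i) t"
    using common_denominator[OF assms(1), of a t] a(1) by blast
  have "(\<Sum>i\<in>I. poly (p i) t * y i) = (\<Sum>i\<in>I. poly q t * (a i * y i))"
    by (rule sum.cong) (use qp(2) in \<open>auto simp: mult.assoc[symmetric]\<close>)
  also have "\<dots> = 0" unfolding sum_distrib_left[symmetric] a(2) by simp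
  finally have "\<forall>i\<in>I. poly (p i) t = 0" using assms(2) qp(2) by blast
  then show "a i = 0" using qp i by (metis mult_eq_0_iff)
qed

end

section \<open>Function fields of one variable\<close>

locale ffield =
  fixes k :: "'a::field_char_0 set"
  assumes alg: "alg_closed_subfield k" and ff: "function_field_over k"
begin

sublocale k: subfld k
  using alg by unfold_locales (simp add: alg_closed_subfield_def)

abbreviation Kx :: "'a \<Rightarrow> 'a set" where "Kx \<equiv> rat_fun_field k"

lemma subfld_Kx: "subfld (Kx t)"
  by unfold_locales (rule k.subfield_rat_fun_field)

lemma ex_root:
  assumes "pol_over k p" "Polynomial.degree p > 0"
  obtains c where "c \<in> k" "poly p c = 0"
  using assms alg unfolding alg_closed_subfield_def pol_over_def by blast

text \<open>Linear factors split off one at a time because \<open>k\<close> is algebraically closed,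
  so \<open>x\<close> must be one of the constants removed. Hence \<open>x \<notin> k\<close> means
  that \<open>x\<close> is transcendental.\<close>

lemma algebraic_in_k:
  assumes "pol_over k p" "p \<noteq> 0" "poly p x = 0"
  shows "x \<in> k"
  using assms
proof (induction "Polynomial.degree p" arbitrary: p rule: less_induct)
  case less
  show ?case
  proof (cases "Polynomial.degree p = 0")
    case True
    then obtain c where "p = [:c:]" by (rule degree_eq_zeroE)
    then show ?thesis using less.prems by simp
  next
    case False
    then obtain c where c: "c \<in> k" "poly p c = 0" using ex_root less.prems(1) by blast
    then obtain q where q: "pol_over k q" "p = [:- c, 1:] * q"
      using k.pol_linear_factor less.prems(1) by blast
    have q0: "q \<noteq> 0" using q less.prems by auto
    then have d: "Polynomial.degree p = Suc (Polynomial.degree q)"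
      unfolding q by (subst degree_mult_eq) auto
    have "x = c \<or> poly q x = 0" using less.prems(3) unfolding q(2) by auto
    then show ?thesis using less.hyps[of q] d q(1) q0 c(1) by auto
  qed
qed

lemma poly_eq_0_iff_notin: "x \<notin> k \<Longrightarrow> pol_over k p \<Longrightarrow> poly p x = 0 \<longleftrightarrow> p = 0"
  using algebraic_in_k by auto

text \<open>If \<open>s\<close> elements are independent over \<open>k(x)\<close>, then after clearing denominators over \<open>k[t]\<close> the
  elements \<open>x\<^sup>i y\<^sub>j\<close> with \<open>i \<le> l\<close> are \<open>(l + 1) s\<close> independent elements of a space whose dimension
  grows linearly in \<open>l\<close> with a slope that does not depend on \<open>s\<close>.\<close>

lemma fin_dim_Kx:
  assumes x: "x \<notin> k"
  shows "fin_dim (Kx x) UNIV"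
proof -
  obtain t B where B: "finite B" "\<And>x. \<exists>c. (\<forall>b\<in>B. c b \<in> Kx t) \<and> x = (\<Sum>b\<in>B. c b * b)"
    using ff unfolding function_field_over_def by blast
  \<comment> \<open>The k[t]-span of \<open>B\<close>, filtered by degree; \<open>G q\<close> has
    dimension at most \<open>card B * (q + 1)\<close> over \<open>k\<close>.\<close>
  define G where "G = (\<lambda>q. {(\<Sum>b\<in>B. poly (p b) t * b) | p. \<forall>b\<in>B. pol_over k (p b) \<and> Polynomial.degree (p b) \<le> q})"
  have GI: "(\<Sum>b\<in>B. poly (p b) t * b) \<in> G q" if "\<And>b. b \<in> B \<Longrightarrow> pol_over k (p b) \<and> Polynomial.degree (p b) \<le> q" for p q
    unfolding G_def using that by blast
  have G0: "0 \<in> G q" for q using GI[of "\<lambda>_. 0" q] by simp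
  have Gadd: "u + v \<in> G q" if "u \<in> G q" "v \<in> G q" for u v q
  proof -
    obtain p1 p2 where p: "\<forall>b\<in>B. pol_over k (p1 b) \<and> Polynomial.degree (p1 b) \<le> q" "u = (\<Sum>b\<in>B. poly (p1 b) t * b)"
      "\<forall>b\<in>B. pol_over k (p2 b) \<and> Polynomial.degree (p2 b) \<le> q" "v = (\<Sum>b\<in>B. poly (p2 b) t * b)"
      using \<open>u \<in> G q\<close> \<open>v \<in> G q\<close> unfolding G_def by auto
    have "(\<Sum>b\<in>B. poly (p1 b + p2 b) t * b) \<in> G q"
      by (rule GI) (use p in \<open>auto intro: k.pol_add degree_add_le\<close>)
    then show ?thesis unfolding p by (simp add: sum.distrib algebra_simps)
  qed
  have Gsum: "(\<Sum>i\<in>I. f i) \<in> G q" if "\<And>i. i \<in> I \<Longrightarrow> f i \<in> G q" for I :: "'a set" and f q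
    using that by (induction I rule: infinite_finite_induct) (auto intro: G0 Gadd)
  have Gmult: "poly h t * u \<in> G q'" if "u \<in> G q" "pol_over k h" "q + Polynomial.degree h \<le> q'" for u q q' h
  proof -
    obtain p where p: "\<forall>b\<in>B. pol_over k (p b) \<and> Polynomial.degree (p b) \<le> q" "u = (\<Sum>b\<in>B. poly (p b) t * b)"
      using \<open>u \<in> G q\<close> unfolding G_def by auto
    have "(\<Sum>b\<in>B. poly (h * p b) t * b) \<in> G q'"
    proof (rule GI)
      fix b assume "b \<in> B"
      then have "pol_over k (p b)" "Polynomial.degree (p b) \<le> q" using p by auto
      then show "pol_over k (h * p b) \<and> Polynomial.degree (h * p b) \<le> q'"
        using that degree_mult_le[of h "p b"] by (auto intro: k.pol_mult)
    qed
    then show ?thesis unfolding p by (simp add: sum_distrib_left mult.assoc)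
  qed
  have ex1: "\<exists>h q. pol_over k h \<and> poly h t \<noteq> 0 \<and> poly h t * z \<in> G q" for z
  proof -
    obtain c where c: "\<forall>b\<in>B. c b \<in> Kx t" "z = (\<Sum>b\<in>B. c b * b)" using B(2) by blast
    obtain h p where hp: "pol_over k h" "poly h t \<noteq> 0" "\<forall>b\<in>B. pol_over k (p b) \<and> poly h t * c b = poly (p b) t"
      using k.common_denominator[OF B(1), of c t] c(1) by blast
    have "(\<Sum>b\<in>B. poly (p b) t * b) \<in> G (\<Sum>b\<in>B. Polynomial.degree (p b))"
      by (rule GI) (use hp B(1) in \<open>auto intro: member_le_sum\<close>)
    moreover have "poly h t * z = (\<Sum>b\<in>B. poly (p b) t * b)"
      unfolding c(2) sum_distrib_left by (rule sum.cong) (use hp(3) in \<open>auto simp: mult.assoc[symmetric]\<close>)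
    ultimately show ?thesis using hp by metis
  qed
  have exZ: "\<exists>h q. pol_over k h \<and> poly h t \<noteq> 0 \<and> (\<forall>z\<in>Z. poly h t * z \<in> G q)" if "finite Z" for Z
    using that
  proof (induction Z rule: finite_induct)
    case empty
    show ?case by (intro exI[of _ 1]) simp
  next
    case (insert z Z)
    obtain h1 q1 where 1: "pol_over k h1" "poly h1 t \<noteq> 0" "\<forall>z\<in>Z. poly h1 t * z \<in> G q1"
      using insert.IH by blast
    obtain h2 q2 where 2: "pol_over k h2" "poly h2 t \<noteq> 0" "poly h2 t * z \<in> G q2" using ex1 by blast
    let ?q = "q1 + q2 + Polynomial.degree h1 + Polynomial.degree h2"
    have "poly (h1 * h2) t * w \<in> G ?q" if "w \<in> insert z Z" for w
    proof (cases "w = z")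
      case True
      have "poly h1 t * (poly h2 t * z) \<in> G ?q" by (rule Gmult[OF 2(3) 1(1)]) simp
      then show ?thesis using True by (simp add: mult.assoc)
    next
      case False
      then have "poly h1 t * w \<in> G q1" using 1(3) that by simp
      then have "poly h2 t * (poly h1 t * w) \<in> G ?q" by (rule Gmult[OF _ 2(1)]) simp
      then show ?thesis by (simp add: mult_ac)
    qed
    then show ?case using 1 2 by (intro exI[of _ "h1 * h2"] exI[of _ ?q]) (auto intro: k.pol_mult)
  qed
  \<comment> \<open>\<open>h0\<close> clears the denominators of multiplication by \<open>x\<close>
    on \<open>B\<close>; multiplying by \<open>h0\<close>, or by \<open>h0\<close> and
    \<open>x\<close>, then raises the index of the filtration by a fixed amount
    \<open>c\<close>.\<close>
  obtain h0 q0 where h0: "pol_over k h0" "poly h0 t \<noteq> 0" "\<forall>z\<in>(\<lambda>b. x * b) ` B. poly h0 t * z \<in> G q0"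
    using exZ[of "(\<lambda>b. x * b) ` B"] B(1) by auto
  define c where "c = q0 + Polynomial.degree h0"
  have hG: "poly h0 t * u \<in> G (q + c)" if "u \<in> G q" for u q
    by (rule Gmult[OF that h0(1)]) (simp add: c_def)
  have hxG: "poly h0 t * (x * u) \<in> G (q + c)" if "u \<in> G q" for u q
  proof -
    obtain p where p: "\<forall>b\<in>B. pol_over k (p b) \<and> Polynomial.degree (p b) \<le> q" "u = (\<Sum>b\<in>B. poly (p b) t * b)"
      using \<open>u \<in> G q\<close> unfolding G_def by auto
    have "poly h0 t * (x * u) = (\<Sum>b\<in>B. poly (p b) t * (poly h0 t * (x * b)))"
      unfolding p sum_distrib_left by (rule sum.cong) (auto simp: mult_ac)
    also have "\<dots> \<in> G (q + c)"
    proof (rule Gsum)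
      fix b assume "b \<in> B"
      then have "poly h0 t * (x * b) \<in> G q0" "pol_over k (p b)" "q0 + Polynomial.degree (p b) \<le> q + c"
        using p(1) h0(3) by (auto simp: c_def intro: add_mono)
      then show "poly (p b) t * (poly h0 t * (x * b)) \<in> G (q + c)" by (rule Gmult)
    qed
    finally show ?thesis .
  qed
  have bound: "s \<le> card B * c" if L: "lin_nondeg_over (Kx x) {..<s} y" for s and y :: "nat \<Rightarrow> 'a"
  proof (rule ccontr)
    assume "\<not> s \<le> card B * c"
    then have s: "card B * c + 1 \<le> s" by simp
    obtain h c' where h: "pol_over k h" "poly h t \<noteq> 0" "\<forall>z\<in>y ` {..<s}. poly h t * z \<in> G c'"
      using exZ[of "y ` {..<s}"] by auto
    \<comment> \<open>Large enough that \<open>(l + 1) * (card B * c + 1)\<close> exceeds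
      \<open>card B * (c' + l * c + 1)\<close>; the difference is
      \<open>card B * c + 1\<close>.\<close>
    define l where "l = card B * (c' + 1)"
    have inG: "poly h0 t ^ m * (x ^ i * (poly h t * y j)) \<in> G (c' + m * c)" if "i \<le> m" "j < s" for m i j
      using that(1)
    proof (induction m arbitrary: i)
      case 0
      then show ?case using h(3) that(2) by auto
    next
      case (Suc m)
      show ?case
      proof (cases "i \<le> m")
        case True
        then have "poly h0 t * (poly h0 t ^ m * (x ^ i * (poly h t * y j))) \<in> G (c' + m * c + c)"
          using Suc.IH hG by blast
        then show ?thesis by (simp add: mult_ac add_ac)
      next
        case False
        then have i: "i = Suc m" using Suc.prems by simp
        have "poly h0 t * (x * (poly h0 t ^ m * (x ^ m * (poly h t * y j)))) \<in> G (c' + m * c + c)"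
          using Suc.IH[of m] hxG by blast
        then show ?thesis unfolding i by (simp add: mult_ac add_ac)
      qed
    qed
    \<comment> \<open>The power of \<open>h0\<close> is the same for all \<open>i\<close>: it
      cancels from a relation and puts all these elements into a single \<open>G\<close>.\<close>
    define f where "f = (\<lambda>(i, j). poly h0 t ^ l * (x ^ i * (poly h t * y j)))"
    have "lin_nondeg_over k ({..l} \<times> {..<s}) f"
    proof (rule lin_nondeg_overI)
      fix a ij assume a: "\<And>ij. ij \<in> {..l} \<times> {..<s} \<Longrightarrow> a ij \<in> k"
        and a0: "(\<Sum>ij\<in>{..l} \<times> {..<s}. a ij * f ij) = 0" and ij: "ij \<in> {..l} \<times> {..<s}"
      define P where "P = (\<lambda>j. \<Sum>i\<le>l. Polynomial.monom (a (i, j)) i)"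
      have Pk: "pol_over k (P j)" if "j < s" for j
        unfolding P_def by (intro k.pol_sum k.pol_monom a) (use that in auto)
      have "(\<Sum>ij\<in>{..l} \<times> {..<s}. a ij * f ij) = (\<Sum>j<s. \<Sum>i\<le>l. a (i, j) * f (i, j))"
        unfolding sum.cartesian_product' by (rule sum.swap)
      also have "\<dots> = (\<Sum>j<s. (poly h0 t ^ l * poly h t) * (poly (P j) x * y j))"
        unfolding P_def f_def
        by (simp add: poly_sum poly_monom sum_distrib_left sum_distrib_right mult_ac)
      finally have "(\<Sum>j<s. (poly h0 t ^ l * poly h t) * (poly (P j) x * y j)) = 0" using a0 by simp
      then have s0: "(\<Sum>j<s. poly (P j) x * y j) = 0"
        unfolding sum_distrib_left[symmetric] using h0(2) h(2) by simp
      have P0: "poly (P j) x = 0" if "j < s" for j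
        by (rule lin_nondeg_overD[OF L _ s0]) (use Pk that in \<open>auto intro: k.poly_in_rat\<close>)
      obtain i j where [simp]: "ij = (i, j)" and "i \<le> l" "j < s" using ij by auto
      then have "P j = 0" using poly_eq_0_iff_notin[OF x] P0 Pk by blast
      then have "Polynomial.coeff (P j) i = 0" by simp
      then show "a ij = 0" using \<open>i \<le> l\<close> unfolding P_def by (simp add: coeff_sum)
    qed
    then have "card ({..l} \<times> {..<s}) \<le> card (B \<times> {..c' + l * c})"
    proof (rule k.indep_card_le[rotated 2])
      fix ij assume "ij \<in> {..l} \<times> {..<s}"
      then have "f ij \<in> G (c' + l * c)" using inG by (auto simp: f_def)
      then obtain p where p: "\<forall>b\<in>B. pol_over k (p b) \<and> Polynomial.degree (p b) \<le> c' + l * c" "f ij = (\<Sum>b\<in>B. poly (p b) t * b)"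
        unfolding G_def by auto
      have "f ij = (\<Sum>b\<in>B. \<Sum>e\<le>c' + l * c. Polynomial.coeff (p b) e * (b * t ^ e))"
        unfolding p(2)
      proof (rule sum.cong[OF refl])
        fix b assume "b \<in> B"
        then show "poly (p b) t * b = (\<Sum>e\<le>c' + l * c. Polynomial.coeff (p b) e * (b * t ^ e))"
          using poly_eq_sum_atMost[of "p b" "c' + l * c" t] p(1) by (simp add: sum_distrib_left mult_ac)
      qed
      also have "\<dots> = (\<Sum>be\<in>B \<times> {..c' + l * c}. (case be of (b, e) \<Rightarrow> Polynomial.coeff (p b) e) * (case be of (b, e) \<Rightarrow> b * t ^ e))"
        by (simp add: sum.cartesian_product case_prod_beta)
      finally show "\<exists>a. (\<forall>i\<in>B \<times> {..c' + l * c}. a i \<in> k) \<and>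
         f ij = (\<Sum>i\<in>B \<times> {..c' + l * c}. a i * (case i of (b, e) \<Rightarrow> b * t ^ e))"
        by (intro exI[of _ "\<lambda>be. case be of (b, e) \<Rightarrow> Polynomial.coeff (p b) e"] conjI)
          (use p(1) in \<open>auto simp: pol_over_def\<close>)
    qed (use B in auto)
    then have "(l + 1) * s \<le> card B * (c' + l * c + 1)" by (simp add: card_cartesian_product)
    moreover have "(l + 1) * (card B * c + 1) \<le> (l + 1) * s" using s by (intro mult_le_mono) auto
    ultimately have "(l + 1) * (card B * c + 1) \<le> card B * (c' + l * c + 1)" by linarith
    then show False unfolding l_def by (simp add: algebra_simps)
  qed
  then show ?thesis by (intro kdim_leI(2)[of _ _ "card B * c"]) blast
qed

end

section \<open>Places\<close>

text \<open>Since a valuation is \<open>0\<close> at \<open>0\<close> by convention, lower bounds are stated with this predicate.\<close>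

definition vge :: "('a::zero \<Rightarrow> int) \<Rightarrow> int \<Rightarrow> 'a \<Rightarrow> bool" where
  "vge v n x \<longleftrightarrow> x = 0 \<or> n \<le> v x"

context ffield
begin

lemma placeD:
  assumes "place k v"
  shows "v 0 = 0"
    and "x \<noteq> 0 \<Longrightarrow> y \<noteq> 0 \<Longrightarrow> v (x * y) = v x + v y"
    and "x \<noteq> 0 \<Longrightarrow> y \<noteq> 0 \<Longrightarrow> x + y \<noteq> 0 \<Longrightarrow> v (x + y) \<ge> min (v x) (v y)"
    and "c \<in> k \<Longrightarrow> v c = 0"
    and "\<exists>t. t \<noteq> 0 \<and> v t = 1"
  using assms unfolding place_def by auto

lemma v_power:
  assumes "place k v" "x \<noteq> 0"
  shows "v (x ^ n) = int n * v x"
proof (induction n)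
  case 0
  then show ?case using placeD(4)[OF assms(1), of 1] by simp
next
  case (Suc n)
  then show ?case using placeD(2)[OF assms, of "x ^ n"] assms(2) by (simp add: algebra_simps)
qed

lemma v_inverse:
  assumes "place k v" "x \<noteq> 0"
  shows "v (inverse x) = - v x"
proof -
  have "v (x * inverse x) = v x + v (inverse x)" using assms by (intro placeD(2)) auto
  then show ?thesis using assms placeD(4)[OF assms(1), of 1] by simp
qed

lemma v_divide:
  assumes "place k v" "x \<noteq> 0" "y \<noteq> 0"
  shows "v (x / y) = v x - v y"
  unfolding divide_inverse using placeD(2)[OF assms(1,2), of "inverse y"] v_inverse[OF assms(1,3)] assms by simp

lemma v_uminus:
  assumes "place k v"
  shows "v (- x) = v x"
proof (cases "x = 0")
  case False
  have "v (- 1 * x) = v (- 1) + v x" using assms False by (intro placeD(2)) auto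
  moreover have "v (- 1) = 0" by (rule placeD(4)[OF assms]) auto
  ultimately show ?thesis by simp
qed simp

lemma v_prod:
  assumes "place k v" "\<And>i. i \<in> I \<Longrightarrow> f i \<noteq> 0"
  shows "v (prod f I) = (\<Sum>i\<in>I. v (f i))"
  using assms(2)
proof (induction I rule: infinite_finite_induct)
  case (insert i I)
  then have "v (f i * prod f I) = v (f i) + v (prod f I)"
    by (intro placeD(2)[OF assms(1)]) auto
  then show ?case using insert by simp
qed (use placeD(4)[OF assms(1), of 1] in auto)

lemma vge_0 [simp]: "vge v n 0"
  by (simp add: vge_def)

lemma vge_refl [simp]: "vge v (v x) x"
  by (simp add: vge_def)

lemma vge_mono: "vge v n x \<Longrightarrow> m \<le> n \<Longrightarrow> vge v m x"
  by (auto simp: vge_def)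

lemma vge_add: "place k v \<Longrightarrow> vge v n x \<Longrightarrow> vge v n y \<Longrightarrow> vge v n (x + y)"
  using placeD(3)[of v x y] unfolding vge_def by (cases "x = 0"; cases "y = 0") fastforce+

lemma vge_uminus: "place k v \<Longrightarrow> vge v n x \<Longrightarrow> vge v n (- x)"
  by (simp add: vge_def v_uminus)

lemma vge_diff: "place k v \<Longrightarrow> vge v n x \<Longrightarrow> vge v n y \<Longrightarrow> vge v n (x - y)"
  using vge_add[of v n x "- y"] vge_uminus by simp

lemma vge_mult: "place k v \<Longrightarrow> vge v n x \<Longrightarrow> vge v m y \<Longrightarrow> vge v (n + m) (x * y)"
  using placeD(2)[of v x y] unfolding vge_def by (cases "x = 0"; cases "y = 0") simp_all

lemma vge_const: "place k v \<Longrightarrow> c \<in> k \<Longrightarrow> vge v 0 c"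
  by (simp add: vge_def placeD(4))

lemma vge_cmult: "place k v \<Longrightarrow> c \<in> k \<Longrightarrow> vge v n x \<Longrightarrow> vge v n (c * x)"
  using vge_mult[of v 0 c n x] vge_const by simp

lemma vge_sum: "place k v \<Longrightarrow> (\<And>i. i \<in> I \<Longrightarrow> vge v n (f i)) \<Longrightarrow> vge v n (sum f I)"
  by (induction I rule: infinite_finite_induct) (auto intro: vge_add)

lemma vge_prod:
  "place k v \<Longrightarrow> (\<And>i. i \<in> I \<Longrightarrow> vge v (n i) (f i)) \<Longrightarrow> finite I \<Longrightarrow> vge v (sum n I) (prod f I)"
proof (induction I rule: infinite_finite_induct)
  case empty
  then show ?case using vge_const[of v 1] by simp
next
  case (insert x F)
  then show ?case by (simp add: vge_mult)
qed auto

lemma vge_power: "place k v \<Longrightarrow> vge v n x \<Longrightarrow> vge v (int m * n) (x ^ m)"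
  using vge_prod[of v "{..<m}" "\<lambda>_. n" "\<lambda>_. x"] by simp

lemma vge_poly: "place k v \<Longrightarrow> vge v 0 x \<Longrightarrow> pol_over k p \<Longrightarrow> vge v 0 (poly p x)"
  unfolding poly_altdef
  by (intro vge_sum vge_cmult) (use vge_power[of v 0 x] in \<open>auto simp: pol_over_def\<close>)

text \<open>The ultrametric inequality is sharp when one order is strictly smaller: the reverse
  bound comes from writing \<open>x\<close> as \<open>(x + y) - y\<close>.\<close>

lemma v_add_eq:
  assumes "place k v" "x \<noteq> 0" "vge v (v x + 1) y"
  shows "x + y \<noteq> 0" "v (x + y) = v x"
proof -
  show ne: "x + y \<noteq> 0"
  proof
    assume "x + y = 0"
    then have "y = - x" by (simp add: eq_neg_iff_add_eq_0 add.commute)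
    then show False using assms v_uminus[of v x] by (simp add: vge_def)
  qed
  show "v (x + y) = v x"
  proof (cases "y = 0")
    case False
    then have y: "v y \<ge> v x + 1" using assms(3) by (simp add: vge_def)
    have 1: "v (x + y) \<ge> min (v x) (v y)" using placeD(3)[OF assms(1,2) False ne] .
    have "vge v (min (v (x + y)) (v y)) (x + y - y)"
      by (rule vge_diff[OF assms(1)]) (auto simp: vge_def)
    then have "min (v (x + y)) (v y) \<le> v x" using assms(2) by (simp add: vge_def)
    then show ?thesis using 1 y by simp
  qed simp
qed

text \<open>Inclusion of the valuation rings makes units of \<open>v\<close> units of
  \<open>w\<close>, so \<open>w\<close> is a multiple of \<open>v\<close>. The factor
  \<open>w t\<close> is nonnegative and divides 1, because both valuations are normalized.\<close>

lemma place_eqI: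
  assumes "place k v" "place k w" "\<And>x. vge v 0 x \<Longrightarrow> vge w 0 x"
  shows "v = w"
proof -
  have unit: "w x = 0" if "v x = 0" "x \<noteq> 0" for x
  proof -
    have "w x \<ge> 0" using assms(3)[of x] that by (simp add: vge_def)
    moreover have "w (inverse x) \<ge> 0"
      using assms(3)[of "inverse x"] that v_inverse[OF assms(1), of x] by (simp add: vge_def)
    ultimately show ?thesis using v_inverse[OF assms(2), of x] that by simp
  qed
  obtain t where t: "t \<noteq> 0" "v t = 1" using placeD(5)[OF assms(1)] by blast
  have pw: "place k u \<Longrightarrow> u (t powi n) = n * u t" for u n
    by (cases "n \<ge> 0") (auto simp: power_int_def v_power v_inverse t)
  have eq: "w x = v x * w t" if x: "x \<noteq> 0" for x
  proof -
    have "v (x / t powi v x) = 0" using v_divide[OF assms(1) x] pw[OF assms(1)] t by simp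
    then have "w (x / t powi v x) = 0" using unit x t by simp
    then show ?thesis using v_divide[OF assms(2) x] pw[OF assms(2)] t by simp
  qed
  obtain s where s: "s \<noteq> 0" "w s = 1" using placeD(5)[OF assms(2)] by blast
  have "w t \<ge> 0" using assms(3)[of t] t by (simp add: vge_def)
  moreover have "v s * w t = 1" using eq[OF s(1)] s(2) by simp
  ultimately have "w t = 1" by (metis zmult_eq_1_iff le_minus_one_simps(3))
  then show ?thesis using eq placeD(1) assms(1,2) by (intro ext) (metis mult.right_neutral)
qed

lemma notin_k_of_v: "place k v \<Longrightarrow> v x \<noteq> 0 \<Longrightarrow> x \<notin> k"
  using placeD(4) by blast

text \<open>As long as all coefficients vanish at 0, a factor \<open>t\<close> can be cancelled; the
  degree of the nonzero \<open>p i0\<close> limits how often.\<close>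

lemma divide_relation:
  assumes "finite I" "\<And>i. i \<in> I \<Longrightarrow> pol_over k (p i)" "i0 \<in> I" "p i0 \<noteq> 0" "t \<noteq> 0"
    "(\<Sum>i\<in>I. poly (p i) t * y i) = 0"
  shows "\<exists>p. (\<forall>i\<in>I. pol_over k (p i)) \<and> (\<exists>i\<in>I. poly (p i) 0 \<noteq> 0) \<and> (\<Sum>i\<in>I. poly (p i) t * y i) = 0"
  using assms(2,4,6)
proof (induction "Polynomial.degree (p i0)" arbitrary: p rule: less_induct)
  case less
  show ?case
  proof (cases "\<exists>i\<in>I. poly (p i) 0 \<noteq> 0")
    case True
    then show ?thesis using less.prems by blast
  next
    case False
    have *: "\<exists>q. pol_over k q \<and> p i = [:0, 1:] * q" if "i \<in> I" for i
    proof -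
      have "pol_over k (p i)" "poly (p i) 0 = 0" using False less.prems(1) that by blast+
      then obtain q where "pol_over k q" "p i = [:- 0, 1:] * q"
        using k.pol_linear_factor[OF _ k.zero] by blast
      then show ?thesis by (intro exI[of _ q]) simp
    qed
    define q where "q = (\<lambda>i. SOME q. pol_over k q \<and> p i = [:0, 1:] * q)"
    have q: "pol_over k (q i)" "p i = [:0, 1:] * q i" if "i \<in> I" for i
      using someI_ex[OF *[OF that]] by (auto simp: q_def)
    have q0: "q i0 \<noteq> 0" using q[OF assms(3)] less.prems(2) by auto
    have "Polynomial.degree (p i0) = Suc (Polynomial.degree (q i0))"
      unfolding q(2)[OF assms(3)] using q0 by (subst degree_mult_eq) auto
    then have d: "Polynomial.degree (q i0) < Polynomial.degree (p i0)" by simp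
    have "(\<Sum>i\<in>I. poly (p i) t * y i) = t * (\<Sum>i\<in>I. poly (q i) t * y i)"
      unfolding sum_distrib_left by (rule sum.cong) (auto simp: q(2))
    then have "(\<Sum>i\<in>I. poly (q i) t * y i) = 0" using less.prems(3) assms(5) by auto
    then show ?thesis by (intro less.hyps[of q, OF d] q(1) q0)
  qed
qed

text \<open>The form in which independence over k(t) is proved throughout: a polynomial relation may
  be assumed nontrivial modulo \<open>t\<close>, and is then reduced modulo
  \<open>t\<close>.\<close>

lemma lin_nondeg_over_KxI:
  assumes "finite I" "t \<noteq> 0"
    and "\<And>p. (\<And>i. i \<in> I \<Longrightarrow> pol_over k (p i)) \<Longrightarrow> (\<Sum>i\<in>I. poly (p i) t * y i) = 0
           \<Longrightarrow> \<exists>i\<in>I. poly (p i) 0 \<noteq> 0 \<Longrightarrow> False"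
  shows "lin_nondeg_over (Kx t) I y"
proof (rule k.lin_nondeg_over_ratI[OF assms(1)])
  fix p assume p: "\<And>i. i \<in> I \<Longrightarrow> pol_over k (p i)" "(\<Sum>i\<in>I. poly (p i) t * y i) = 0"
  show "\<forall>i\<in>I. poly (p i) t = 0"
  proof (rule ccontr)
    assume "\<not> ?thesis"
    then obtain i0 where "i0 \<in> I" "poly (p i0) t \<noteq> 0" by blast
    moreover from this have "p i0 \<noteq> 0" by auto
    ultimately have "i0 \<in> I" "p i0 \<noteq> 0" by blast+
    then obtain p' where "\<forall>i\<in>I. pol_over k (p' i)" "\<exists>i\<in>I. poly (p' i) 0 \<noteq> 0" "(\<Sum>i\<in>I. poly (p' i) t * y i) = 0"
      using divide_relation[OF assms(1) p(1) _ _ assms(2) p(2)] by blast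
    then show False using assms(3)[of p'] by blast
  qed
qed

lemma algebraic_relation':
  assumes "t \<notin> k"
  obtains p :: "nat \<Rightarrow> 'a poly" and n where "\<And>i. i \<le> n \<Longrightarrow> pol_over k (p i)" "\<exists>i\<le>n. poly (p i) 0 \<noteq> 0"
    "(\<Sum>i\<le>n. poly (p i) t * x ^ i) = 0"
proof -
  define n where "n = kdim (Kx t) UNIV"
  have t0: "t \<noteq> 0" using assms by auto
  have "\<not> lin_nondeg_over (Kx t) {..n} (\<lambda>i. x ^ i)"
    using kdim_ge[OF fin_dim_Kx[OF assms], of "{..n}" "\<lambda>i. x ^ i"] by (auto simp: n_def)
  then obtain p where "\<And>i. i \<in> {..n} \<Longrightarrow> pol_over k (p i)" "\<exists>i\<in>{..n}. poly (p i) 0 \<noteq> 0"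
     "(\<Sum>i\<le>n. poly (p i) t * x ^ i) = 0"
    using lin_nondeg_over_KxI[of "{..n}" t "\<lambda>i. x ^ i"] t0 by blast
  then show thesis by (intro that[of n p]) auto
qed

text \<open>An algebraic relation between \<open>x\<close> and a uniformizer \<open>t\<close>, reduced modulo \<open>t\<close>, is a polynomial
  over \<open>k\<close> that has a root in the residue class of \<open>x\<close>.\<close>

lemma residue_exists:
  assumes v: "place k v" and x: "vge v 0 x"
  obtains c where "c \<in> k" "vge v 1 (x - c)"
proof -
  obtain t where t: "t \<noteq> 0" "v t = 1" using placeD(5)[OF v] by blast
  then have tk: "t \<notin> k" using notin_k_of_v[OF v] by auto
  obtain p n where p: "\<And>i. i \<le> n \<Longrightarrow> pol_over k (p i)" "\<exists>i\<le>n. poly (p i) 0 \<noteq> 0"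
      "(\<Sum>i\<le>n. poly (p i) t * x ^ i) = 0"
    by (rule algebraic_relation'[OF tk, of x]) blast
  define P where "P = (\<Sum>i\<le>n. Polynomial.monom (poly (p i) 0) i)"
  have Pk: "pol_over k P"
    unfolding P_def by (intro k.pol_sum k.pol_monom k.poly_in p) auto
  have P0: "P \<noteq> 0"
  proof
    assume "P = 0"
    moreover have "Polynomial.coeff P i = poly (p i) 0" if "i \<le> n" for i
      using that unfolding P_def by (simp add: coeff_sum)
    ultimately have "poly (p i) 0 = 0" if "i \<le> n" for i using that by (metis coeff_0)
    then show False using p(2) by blast
  qed
  have "vge v 1 (poly P x)"
  proof -
    have dv: "vge v 1 (poly (p i) 0 - poly (p i) t)" if i: "i \<le> n" for i
    proof -
      have "pol_over k (p i - [:poly (p i) 0:])"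
        using p(1)[OF i] k.poly_in[OF p(1)[OF i]] by (intro k.pol_diff) (auto simp: k.pol_pCons)
      moreover have "poly (p i - [:poly (p i) 0:]) 0 = 0" by simp
      ultimately obtain q where q: "pol_over k q" "p i - [:poly (p i) 0:] = [:- 0, 1:] * q"
        using k.pol_linear_factor[OF _ k.zero] by blast
      have "poly (p i - [:poly (p i) 0:]) t = t * poly q t" unfolding q(2) by simp
      then have e: "poly (p i) 0 - poly (p i) t = - (t * poly q t)" by (simp add: algebra_simps)
      have "vge v (1 + 0) (t * poly q t)"
        by (rule vge_mult[OF v _ vge_poly[OF v _ q(1)]]) (use t in \<open>simp_all add: vge_def\<close>)
      then show ?thesis unfolding e using vge_uminus[OF v] by simp
    qed
    have "poly P x = (\<Sum>i\<le>n. (poly (p i) 0 - poly (p i) t) * x ^ i)"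
      using p(3) unfolding P_def by (simp add: poly_sum poly_monom left_diff_distrib sum_subtractf)
    moreover have "vge v (1 + 0) ((poly (p i) 0 - poly (p i) t) * x ^ i)" if "i \<le> n" for i
      by (rule vge_mult[OF v dv[OF that]]) (use vge_power[OF v x] in auto)
    ultimately show ?thesis using vge_sum[OF v, of "{..n}" 1] by simp
  qed
  \<comment> \<open>The linear factors of \<open>P\<close> at \<open>x\<close> are integral and
    their product has positive order, so one of them has positive order.\<close>
  then have "\<exists>c\<in>k. vge v 1 (x - c)" using Pk P0
  proof (induction "Polynomial.degree P" arbitrary: P rule: less_induct)
    case less
    show ?case
    proof (cases "Polynomial.degree P = 0")
      case True
      then obtain c where "P = [:c:]" by (rule degree_eq_zeroE)
      then show ?thesis using less.prems placeD(4)[OF v, of c] by (auto simp: vge_def k.pol_pCons)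
    next
      case False
      then obtain c where c: "c \<in> k" "poly P c = 0" using ex_root less.prems(2) by blast
      then obtain q where q: "pol_over k q" "P = [:- c, 1:] * q"
        using k.pol_linear_factor less.prems(2) by blast
      have q0: "q \<noteq> 0" using q less.prems by auto
      then have d: "Polynomial.degree P = Suc (Polynomial.degree q)"
        unfolding q by (subst degree_mult_eq) auto
      show ?thesis
      proof (cases "vge v 1 (poly q x)")
        case True
        then show ?thesis using less.hyps[of q] d q(1) q0 by auto
      next
        case False
        have "vge v 0 (poly q x)" by (rule vge_poly[OF v x q(1)])
        then have q1: "poly q x \<noteq> 0" "v (poly q x) = 0" using False by (auto simp: vge_def)
        have "poly P x = (x - c) * poly q x" unfolding q(2) by (simp add: algebra_simps)
        then have "vge v 1 (x - c)"
          using less.prems(1) q1 placeD(2)[OF v, of "x - c" "poly q x"]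
          unfolding vge_def by (cases "x - c = 0") simp_all
        then show ?thesis using c(1) by blast
      qed
    qed
  qed
  then show thesis using that by blast
qed

lemma residue_unique:
  assumes "place k v" "c \<in> k" "d \<in> k" "vge v 1 (x - c)" "vge v 1 (x - d)"
  shows "c = d"
proof -
  have "vge v 1 ((x - c) - (x - d))" by (rule vge_diff[OF assms(1,4,5)])
  then have "vge v 1 (d - c)" by simp
  then show ?thesis using placeD(4)[OF assms(1) k.diff[OF assms(3,2)]] by (auto simp: vge_def)
qed

subsection \<open>Weak approximation\<close>

lemma one_le_mult: "1 \<le> a \<Longrightarrow> 1 \<le> b \<Longrightarrow> 1 \<le> a * (b :: int)"
  using mult_mono[of 1 a 1 b] by simp

text \<open>By \<open>place_eqI\<close> neither valuation ring contains the other; the quotient of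
  two witnesses has a zero at \<open>v\<close> and a pole at \<open>w\<close>.\<close>

lemma separate_two:
  assumes "place k v" "place k w" "v \<noteq> w"
  obtains u where "u \<noteq> 0" "v u > 0" "w u < 0"
proof -
  obtain a where a: "vge v 0 a" "\<not> vge w 0 a" using place_eqI[OF assms(1,2)] assms(3) by blast
  obtain b where b: "vge w 0 b" "\<not> vge v 0 b" using place_eqI[OF assms(2,1)] assms(3) by blast
  have "a \<noteq> 0" "b \<noteq> 0" using a b by auto
  then have "v (a / b) > 0" "w (a / b) < 0"
    using a b v_divide[OF assms(1), of a b] v_divide[OF assms(2), of a b] by (auto simp: vge_def)
  then show thesis using that[of "a / b"] \<open>a \<noteq> 0\<close> \<open>b \<noteq> 0\<close> by simp
qed

text \<open>If \<open>u\<close> has no pole at the new place \<open>w\<close>, a function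
  \<open>z\<close> that separates \<open>v\<close> from \<open>w\<close> is added to a high power.
  At \<open>w\<close> the power dominates, and at each old place \<open>u\<close> and the power have
  different orders, so no cancellation can destroy the pole.\<close>

lemma separate_many:
  assumes v: "place k v" and T: "finite T" "T \<subseteq> places k" "v \<notin> T"
  shows "\<exists>u. u \<noteq> 0 \<and> v u > 0 \<and> (\<forall>w\<in>T. w u < 0)"
  using T
proof (induction T rule: finite_induct)
  case empty
  then show ?case using placeD(5)[OF v] by force
next
  case (insert w T)
  then have w: "place k w" and wT: "\<And>w'. w' \<in> T \<Longrightarrow> place k w'" by (auto simp: places_def)
  obtain u where u: "u \<noteq> 0" "v u > 0" "\<forall>w\<in>T. w u < 0" using insert by auto
  obtain z where z: "z \<noteq> 0" "v z > 0" "w z < 0" using separate_two[OF v w] insert by auto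
  show ?case
  proof (cases "w u < 0")
    case True
    then show ?thesis using u by blast
  next
    case False
    \<comment> \<open>Larger than the pole order of \<open>u\<close> at every old place, so a pole
      of \<open>z\<close> there outweighs that of \<open>u\<close>.\<close>
    define m where "m = nat (\<Sum>w'\<in>T. \<bar>w' u\<bar>) + 1"
    have pm: "w' (z ^ m) = int m * w' z" if "place k w'" for w' by (rule v_power[OF that z(1)])
    have zm: "z ^ m \<noteq> 0" using z by simp
    have m1: "m \<ge> 1" by (simp add: m_def)
    have *: "u + z ^ m \<noteq> 0 \<and> w' (u + z ^ m) < 0" if "w' \<in> insert w T" for w'
    proof (cases "w' = w")
      case True
      have zn: "w (z ^ m) < 0" using pm[OF w] z m1 by (simp add: mult_pos_neg)
      have "vge w (w (z ^ m) + 1) u" using zn False by (simp add: vge_def)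
      then show ?thesis using v_add_eq[OF w zm, of u] True zn by (simp add: add.commute)
    next
      case False
      then have w'T: "w' \<in> T" using that by simp
      then have w': "place k w'" and un: "w' u < 0" using wT u by auto
      have le: "\<bar>w' u\<bar> \<le> (\<Sum>w'\<in>T. \<bar>w' u\<bar>)" using w'T insert.hyps(1) by (intro member_le_sum) auto
      show ?thesis
      proof (cases "w' z \<ge> 0")
        case True
        have "int m * w' z \<ge> 0" using True by simp
        then have "vge w' (w' u + 1) (z ^ m)" unfolding vge_def pm[OF w'] using un by linarith
        then show ?thesis using v_add_eq[OF w' u(1)] un by simp
      next
        case False
        then have "int m * w' z \<le> int m * (- 1)" by (intro mult_left_mono) auto
        then have "w' (z ^ m) < w' u" using pm[OF w'] le by (simp add: m_def)
        then have "vge w' (w' (z ^ m) + 1) u" by (simp add: vge_def)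
        then show ?thesis using v_add_eq[OF w' zm, of u] \<open>w' (z ^ m) < w' u\<close> un by (simp add: add.commute)
      qed
    qed
    have "vge v 1 (u + z ^ m)"
      by (rule vge_add[OF v]) (use u z pm[OF v] one_le_mult[of "int m" "v z"] m1 in \<open>auto simp: vge_def\<close>)
    then show ?thesis using * by (intro exI[of _ "u + z ^ m"]) (auto simp: vge_def)
  qed
qed

text \<open>If \<open>u\<close> has a zero at \<open>v\<close> and poles on \<open>T\<close>, then
  \<open>1 / (1 + u ^ m)\<close> is a unit at \<open>v\<close> and vanishes to order at least
  \<open>m\<close> on \<open>T\<close>. A power of a uniformizer adjusts the order at
  \<open>v\<close>, and \<open>m\<close> outweighs its effect on \<open>T\<close>.\<close>

lemma approximation:
  assumes v: "place k v" and T: "finite T" "T \<subseteq> places k" "v \<notin> T"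
  obtains y where "y \<noteq> 0" "v y = j" "\<And>w. w \<in> T \<Longrightarrow> w y \<ge> E"
proof -
  obtain u where u: "u \<noteq> 0" "v u > 0" "\<forall>w\<in>T. w u < 0" using separate_many[OF assms] by blast
  obtain t where t: "t \<noteq> 0" "v t = 1" using placeD(5)[OF v] by blast
  define m where "m = nat (\<Sum>w\<in>T. \<bar>E - j * w t\<bar>) + 1"
  have um: "u ^ m \<noteq> 0" using u by simp
  define y where "y = inverse (1 + u ^ m)"
  have pwt: "w (t powi j) = j * w t" if "place k w" for w
    by (cases "j \<ge> 0") (use that t in \<open>auto simp: power_int_def v_power v_inverse\<close>)
  have v1: "v 1 = 0" using placeD(4)[OF v, of 1] by simp
  have m1: "int m = (\<Sum>w\<in>T. \<bar>E - j * w t\<bar>) + 1" by (simp add: m_def sum_nonneg)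
  have m2: "int m \<ge> 1" by (simp add: m_def)
  have "int m * v u \<ge> 1" using one_le_mult[OF m2, of "v u"] u by simp
  then have "vge v (v 1 + 1) (u ^ m)" using v_power[OF v u(1)] v1 by (simp add: vge_def)
  then have y1: "1 + u ^ m \<noteq> 0" "v (1 + u ^ m) = 0" using v_add_eq[OF v, of 1 "u ^ m"] v1 by auto
  have vy: "v (y * t powi j) = j" using y1 t pwt[OF v] placeD(2)[OF v, of y "t powi j"] v_inverse[OF v y1(1)]
    by (simp add: y_def)
  have wy: "w (y * t powi j) \<ge> E" if "w \<in> T" for w
  proof -
    have w: "place k w" and un: "w u < 0" using that T u by (auto simp: places_def)
    have le: "\<bar>E - j * w t\<bar> \<le> (\<Sum>w\<in>T. \<bar>E - j * w t\<bar>)" using that T(1) by (intro member_le_sum) auto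
    have "int m * w u \<le> int m * (- 1)" using un by (intro mult_left_mono) auto
    then have um': "w (u ^ m) \<le> - int m" "w (u ^ m) < 0" using v_power[OF w u(1), of m] m2 by linarith+
    have "vge w (w (u ^ m) + 1) 1" using um' placeD(4)[OF w, of 1] by (simp add: vge_def)
    then have "w (1 + u ^ m) = w (u ^ m)" using v_add_eq[OF w um, of 1] by (simp add: add.commute)
    then have "w y \<ge> int m" using v_inverse[OF w y1(1)] um' by (simp add: y_def)
    moreover have "w (y * t powi j) = w y + j * w t"
      using y1 t pwt[OF w] placeD(2)[OF w, of y "t powi j"] by (simp add: y_def)
    ultimately show ?thesis using le m1 by simp
  qed
  show thesis using that[of "y * t powi j"] vy wy y1 t by (simp add: y_def)
qed

end

subsection \<open>Existence of places\<close>

context ffield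
begin

definition sring :: "'a set \<Rightarrow> bool" where
  "sring R \<longleftrightarrow> k \<subseteq> R \<and> (\<forall>a\<in>R. \<forall>b\<in>R. a + b \<in> R \<and> a * b \<in> R)"

lemma sringD:
  assumes "sring R"
  shows "c \<in> k \<Longrightarrow> c \<in> R" "a \<in> R \<Longrightarrow> b \<in> R \<Longrightarrow> a + b \<in> R" "a \<in> R \<Longrightarrow> b \<in> R \<Longrightarrow> a * b \<in> R"
    "a \<in> R \<Longrightarrow> - a \<in> R" "a \<in> R \<Longrightarrow> b \<in> R \<Longrightarrow> a - b \<in> R" "a \<in> R \<Longrightarrow> a ^ n \<in> R"
proof -
  show 1: "c \<in> k \<Longrightarrow> c \<in> R" and 2: "a \<in> R \<Longrightarrow> b \<in> R \<Longrightarrow> a + b \<in> R" and 3: "a \<in> R \<Longrightarrow> b \<in> R \<Longrightarrow> a * b \<in> R"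
    for a b c using assms unfolding sring_def by blast+
  have m1: "- 1 \<in> R" by (rule 1) auto
  show 4: "a \<in> R \<Longrightarrow> - a \<in> R" for a using 3[OF m1, of a] by simp
  show "a \<in> R \<Longrightarrow> b \<in> R \<Longrightarrow> a - b \<in> R" using 2[of a "- b"] 4[of b] by simp
  show "a \<in> R \<Longrightarrow> a ^ n \<in> R" by (induction n) (auto intro: 1 3)
qed

lemma sring_poly:
  assumes R: "sring R" and p: "pol_over R p" "z \<in> R"
  shows "poly p z \<in> R"
proof -
  have "(\<Sum>i\<in>I. Polynomial.coeff p i * z ^ i) \<in> R" for I
    by (induction I rule: infinite_finite_induct)
       (use p sringD[OF R] in \<open>auto simp: pol_over_def\<close>)
  then show ?thesis unfolding poly_altdef .
qed

lemma sring_adjoin: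
  assumes R: "sring R"
  shows "sring {poly p z | p. pol_over R p}" "R \<subseteq> {poly p z | p. pol_over R p}"
    "z \<in> {poly p z | p. pol_over R p}"
proof -
  define A where "A = {poly p z | p. pol_over R p}"
  have c: "c \<in> A" if "c \<in> R" for c
    unfolding A_def using that sringD(1)[OF R, of 0]
    by (intro CollectI exI[of _ "[:c:]"]) (auto simp: pol_over_def coeff_pCons split: nat.splits)
  then show "R \<subseteq> {poly p z | p. pol_over R p}" unfolding A_def by blast
  show "z \<in> {poly p z | p. pol_over R p}"
    using sringD(1)[OF R, of 0] sringD(1)[OF R, of 1]
    by (intro CollectI exI[of _ "[:0, 1:]"]) (auto simp: pol_over_def coeff_pCons split: nat.splits)
  have add: "pol_over R (p + q)" if "pol_over R p" "pol_over R q" for p q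
    using that sringD(2)[OF R] unfolding pol_over_def by auto
  have sum: "sum f I \<in> R" if "\<And>i. i \<in> I \<Longrightarrow> f i \<in> R" for f and I :: "nat set"
    using that by (induction I rule: infinite_finite_induct) (use sringD(1,2)[OF R] in auto)
  have mult: "pol_over R (p * q)" if "pol_over R p" "pol_over R q" for p q
    using that sringD(3)[OF R] unfolding pol_over_def coeff_mult by (intro allI sum) auto
  have "a + b \<in> A \<and> a * b \<in> A" if "a \<in> A" "b \<in> A" for a b
  proof -
    obtain p q where pq: "pol_over R p" "pol_over R q" "a = poly p z" "b = poly q z"
      using \<open>a \<in> A\<close> \<open>b \<in> A\<close> unfolding A_def by blast
    then have "a + b = poly (p + q) z" "a * b = poly (p * q) z" by simp_all
    then show ?thesis unfolding A_def using add[OF pq(1,2)] mult[OF pq(1,2)] by blast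
  qed
  moreover have "k \<subseteq> A" using c sringD(1)[OF R] by blast
  ultimately have "sring A" unfolding sring_def by blast
  then show "sring {poly p z | p. pol_over R p}" unfolding A_def .
qed

definition vring :: "'a set \<Rightarrow> bool" where
  "vring R \<longleftrightarrow> sring R \<and> (\<forall>z. z \<in> R \<or> inverse z \<in> R)"

text \<open>By Zorn: a maximal subring in which \<open>x\<close> is not invertible is a valuation ring.\<close>

lemma ex_vring:
  assumes x: "x \<notin> k"
  shows "\<exists>R. vring R \<and> x \<in> R \<and> inverse x \<notin> R"
proof -
  have x0: "x \<noteq> 0" using x by auto
  define A where "A = {R. sring R \<and> x \<in> R \<and> inverse x \<notin> R}"
  let ?R0 = "{poly p x | p. pol_over k p}"
  have k: "sring k" unfolding sring_def by auto
  have "inverse x \<notin> ?R0"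
  proof
    assume "inverse x \<in> ?R0"
    then obtain p where p: "pol_over k p" "inverse x = poly p x" by blast
    have "poly (1 - [:0, 1:] * p) x = 0" using p(2)[symmetric] x0 by simp
    moreover have "pol_over k (1 - [:0, 1:] * p)"
      using p by (intro k.pol_diff k.pol_mult) (auto simp: k.pol_pCons)
    ultimately have "1 - [:0, 1:] * p = 0" using poly_eq_0_iff_notin[OF x] by blast
    then have "poly (1 - [:0, 1:] * p) 0 = 0" by simp
    then show False by simp
  qed
  then have "?R0 \<in> A" unfolding A_def using sring_adjoin[OF k, of x] by blast
  then have ne: "A \<noteq> {}" by blast
  have "\<exists>M\<in>A. \<forall>X\<in>A. M \<subseteq> X \<longrightarrow> X = M"
  proof (rule subset_Zorn_nonempty[OF ne])
    fix C assume C: "C \<noteq> {}" "subset.chain A C"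
    have CA: "R \<in> C \<Longrightarrow> sring R \<and> x \<in> R \<and> inverse x \<notin> R" for R using C unfolding A_def subset.chain_def by blast
    have tot: "R \<in> C \<Longrightarrow> R' \<in> C \<Longrightarrow> R \<subseteq> R' \<or> R' \<subseteq> R" for R R' using C unfolding subset.chain_def by blast
    have "sring (\<Union>C)"
      unfolding sring_def
    proof (intro conjI ballI)
      show "k \<subseteq> \<Union>C" using C(1) CA unfolding sring_def by blast
      fix a b assume "a \<in> \<Union>C" "b \<in> \<Union>C"
      then obtain R R' where R: "R \<in> C" "R' \<in> C" "a \<in> R" "b \<in> R'" by blast
      have "\<exists>Q\<in>C. a \<in> Q \<and> b \<in> Q"
        using tot[OF R(1,2)] R by (elim disjE) (blast intro: bexI[of _ R'] bexI[of _ R])+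
      then obtain Q where Q: "Q \<in> C" "a \<in> Q" "b \<in> Q" by blast
      then have "a + b \<in> Q" "a * b \<in> Q" using CA[OF Q(1)] sringD(2,3)[of Q a b] by simp_all
      then show "a + b \<in> \<Union>C" "a * b \<in> \<Union>C" using Q(1) by (blast intro: UnionI)+
    qed
    then show "\<Union>C \<in> A" unfolding A_def using CA C(1) by blast
  qed
  then obtain R where R: "R \<in> A" and max: "\<And>X. X \<in> A \<Longrightarrow> R \<subseteq> X \<Longrightarrow> X = R" by blast
  have sR: "sring R" and xR: "x \<in> R" and ixR: "inverse x \<notin> R" using R by (auto simp: A_def)
  note D = sringD[OF sR]
  \<comment> \<open>Maximality of \<open>R\<close>: adjoining any new element makes \<open>x\<close>
    invertible.\<close>
  have notA: "inverse x \<in> X" if "sring X" "R \<subseteq> X" "z \<in> X" "z \<notin> R" for X z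
    using max[of X] that xR unfolding A_def by blast
  text \<open>\<open>1 - x b\<close> is invertible, since inverting it does not invert \<open>x\<close>.\<close>
  have unit: "inverse (1 - x * b) \<in> R \<and> 1 - x * b \<noteq> 0" if b: "b \<in> R" for b
  proof -
    define u where "u = 1 - x * b"
    have uR: "u \<in> R" unfolding u_def by (intro D(5) D(3) b xR D(1)) auto
    have u0: "u \<noteq> 0"
    proof
      assume "u = 0"
      then have "inverse x = b" unfolding u_def using x0 by (metis eq_iff_diff_eq_0 inverse_unique)
      then show False using ixR b by simp
    qed
    have upow: "\<exists>r\<in>R. u ^ n = 1 - x * r" for n
    proof (induction n)
      case 0
      show ?case using D(1)[of 0] by (intro bexI[of _ 0]) auto
    next
      case (Suc n)
      then obtain r where r: "r \<in> R" "u ^ n = 1 - x * r" by blast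
      have "u ^ Suc n = 1 - x * (b + r - x * (b * r))" 
        unfolding power_Suc r(2) unfolding u_def by (simp add: algebra_simps)
      moreover have "b + r - x * (b * r) \<in> R" by (intro D(2-6) b r xR)
      ultimately show ?case by blast
    qed
    have "inverse u \<in> R"
    proof (rule ccontr)
      assume iu: "inverse u \<notin> R"
      let ?X = "{poly p (inverse u) | p. pol_over R p}"
      have "inverse x \<in> ?X" using notA[of ?X "inverse u"] sring_adjoin[OF sR, of "inverse u"] iu by blast
      then obtain p where p: "pol_over R p" "inverse x = poly p (inverse u)" by blast
      define n where "n = Polynomial.degree p"
      have "u ^ n * poly p (inverse u) = (\<Sum>i\<le>n. Polynomial.coeff p i * u ^ (n - i))"
        unfolding poly_altdef sum_distrib_left n_def[symmetric]
      proof (rule sum.cong[OF refl])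
        fix i assume "i \<in> {..n}"
        then have "u ^ n = u ^ (n - i) * u ^ i" by (simp flip: power_add)
        then show "u ^ n * (Polynomial.coeff p i * inverse u ^ i) = Polynomial.coeff p i * u ^ (n - i)"
          using u0 by (simp add: power_inverse)
      qed
      moreover have "(\<Sum>i\<in>I. Polynomial.coeff p i * u ^ (n - i)) \<in> R" for I
        by (induction I rule: infinite_finite_induct)
           (use p(1) D uR in \<open>auto simp: pol_over_def\<close>)
      ultimately have "u ^ n * inverse x \<in> R" using p(2) by simp
      moreover obtain r where r: "r \<in> R" "u ^ n = 1 - x * r" using upow by blast
      moreover have "(1 - x * r) * inverse x = inverse x - r" using x0 by (simp add: field_simps)
      ultimately have "inverse x - r \<in> R" by simp
      then have "inverse x - r + r \<in> R" by (rule D(2)[OF _ r(1)])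
      then show False using ixR by simp
    qed
    then show ?thesis using u0 by (simp add: u_def)
  qed
  \<comment> \<open>\<open>P z d\<close> says that \<open>x\<close> becomes invertible in R[z], with
    an inverse of degree at most \<open>d\<close> in \<open>z\<close>.\<close>
  define P where "P = (\<lambda>z d. \<exists>p. pol_over R p \<and> Polynomial.degree p \<le> d \<and> inverse x = poly p z)"
  have P0: "\<not> P z 0" for z
  proof
    assume "P z 0"
    then obtain p where p: "pol_over R p" "Polynomial.degree p = 0" "inverse x = poly p z" by (auto simp: P_def)
    from p(2) obtain c where "p = [:c:]" by (rule degree_eq_zeroE)
    then have "inverse x = c" "c \<in> R" using p(1,3) unfolding pol_over_def by (auto dest: spec[of _ 0])
    then show False using ixR by simp
  qed
  \<comment> \<open>The expression of \<open>inverse x\<close> in \<open>inverse z\<close>, whose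
    constant term is absorbed in a unit of \<open>R\<close>, rewrites \<open>z ^ Suc n\<close> as
    \<open>x\<close> times a polynomial in \<open>z\<close> of degree at most \<open>n\<close>. This
    removes the leading term of the expression in \<open>z\<close>.\<close>
  have red: "P z n" if z0: "z \<noteq> 0" and Pn: "P z (Suc n)" and Pm: "P (inverse z) m" and mn: "m \<le> Suc n" for z n m
  proof -
    obtain q where q: "pol_over R q" "Polynomial.degree q \<le> m" "inverse x = poly q (inverse z)"
      using Pm by (auto simp: P_def)
    obtain p where p: "pol_over R p" "Polynomial.degree p \<le> Suc n" "inverse x = poly p z"
      using Pn by (auto simp: P_def)
    have pR: "Polynomial.coeff p i \<in> R" and qR: "Polynomial.coeff q i \<in> R" for i
      using p q by (auto simp: pol_over_def)
    define b where "b = Polynomial.coeff q 0"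
    define w where "w = inverse (1 - x * b)"
    have w: "w \<in> R" "1 - x * b \<noteq> 0" using unit[of b] qR by (auto simp: w_def b_def)
    define r where "r = (\<Sum>j\<in>{1..m}. Polynomial.monom (w * Polynomial.coeff q j) (Suc n - j))"
    have rR: "pol_over R r"
    proof -
      have "(\<Sum>j\<in>J. Polynomial.coeff (Polynomial.monom (w * Polynomial.coeff q j) (Suc n - j)) i) \<in> R" for i J
        by (induction J rule: infinite_finite_induct) (use D w qR in auto)
      then show ?thesis unfolding pol_over_def r_def coeff_sum by blast
    qed
    have rd: "Polynomial.degree r \<le> n"
      unfolding r_def by (rule degree_sum_le) (auto intro!: order_trans[OF degree_monom_le])
    have "1 = x * poly q (inverse z)" using q(3) x0 by (metis right_inverse)
    also have "poly q (inverse z) = b + (\<Sum>j\<in>{1..m}. Polynomial.coeff q j * inverse z ^ j)"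
    proof -
      have "{..m} = insert 0 {1..m}" by auto
      then show ?thesis unfolding poly_eq_sum_atMost[OF q(2)] b_def by simp
    qed
    finally have "1 - x * b = x * (\<Sum>j\<in>{1..m}. Polynomial.coeff q j * inverse z ^ j)" by (simp add: algebra_simps)
    then have "z ^ Suc n * (1 - x * b) * w = x * (\<Sum>j\<in>{1..m}. z ^ Suc n * w * (Polynomial.coeff q j * inverse z ^ j))"
      by (simp add: sum_distrib_left mult_ac)
    also have "(\<Sum>j\<in>{1..m}. z ^ Suc n * w * (Polynomial.coeff q j * inverse z ^ j)) = poly r z"
      unfolding r_def poly_sum poly_monom
    proof (rule sum.cong[OF refl])
      fix j assume "j \<in> {1..m}"
      then have "z ^ Suc n = z ^ (Suc n - j) * z ^ j" using mn by (simp flip: power_add del: power_Suc)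
      then show "z ^ Suc n * w * (Polynomial.coeff q j * inverse z ^ j) = w * Polynomial.coeff q j * z ^ (Suc n - j)"
        using z0 by (simp add: power_inverse del: power_Suc)
    qed
    finally have zn: "z ^ Suc n = x * poly r z" using w(2) by (simp add: w_def mult.assoc)
    define a where "a = Polynomial.coeff p (Suc n)"
    define p' where "p' = (\<Sum>i\<le>n. Polynomial.monom (Polynomial.coeff p i) i) + Polynomial.smult (a * x) r"
    have "Polynomial.degree p' \<le> n"
      unfolding p'_def using rd
      by (intro degree_add_le degree_sum_le) (auto intro: order_trans[OF degree_monom_le] order_trans[OF degree_smult_le])
    moreover have "pol_over R p'"
      using rR pR D xR D(1)[of 0] unfolding pol_over_def p'_def a_def by (auto simp: coeff_sum)
    moreover have "inverse x = poly p' z"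
      unfolding p(3) poly_eq_sum_atMost[OF p(2)] p'_def a_def
      by (simp add: poly_sum poly_monom zn[unfolded power_Suc] del: power_Suc) (simp add: zn[unfolded power_Suc] mult_ac)
    ultimately show ?thesis unfolding P_def by blast
  qed
  \<comment> \<open>Always shortening the longer of the two expressions ends in degree 0, where
    \<open>inverse x\<close> would lie in \<open>R\<close>.\<close>
  have noboth: "\<not> (P z n \<and> P (inverse z) m)" if "z \<noteq> 0" for z n m
    using that
  proof (induction "n + m" arbitrary: n m z rule: less_induct)
    case less
    show ?case
    proof
      assume PP: "P z n \<and> P (inverse z) m"
      then obtain n' m' where nm: "n = Suc n'" "m = Suc m'" using P0 by (metis not0_implies_Suc)
      show False
      proof (cases "m \<le> n")
        case True
        then have "P z n'" using red[of z n' m] PP nm less.prems by auto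
        then show False using less.hyps[of n' m z] PP nm less.prems by auto
      next
        case False
        then have "P (inverse z) m'" using red[of "inverse z" m' n] PP nm less.prems by auto
        then show False using less.hyps[of n m' z] PP nm less.prems by auto
      qed
    qed
  qed
  have Pex: "\<exists>d. P z d" if "z \<notin> R" for z
    using notA[of "{poly p z | p. pol_over R p}" z] sring_adjoin[OF sR, of z] that unfolding P_def by blast
  have "z \<in> R \<or> inverse z \<in> R" for z
  proof (cases "z = 0")
    case True
    then show ?thesis using D(1)[of 0] by auto
  next
    case False
    then show ?thesis using Pex noboth by blast
  qed
  then show ?thesis using sR xR ixR unfolding vring_def by blast
qed

text \<open>Discreteness is forced by \<open>fin_dim_Kx\<close>: the number of factors of
  \<open>z\<close> inside the maximal ideal \<open>m\<close> is at most the degree of K over k(z).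
  The valuation counts powers of an element \<open>\<tau>\<close> that is not a product of two
  elements of \<open>m\<close>.\<close>

lemma vring_place:
  assumes R: "vring R" and x: "x \<in> R" "inverse x \<notin> R"
  obtains v where "place k v" "v x > 0"
proof -
  have sR: "sring R" and tot: "\<And>z. z \<in> R \<or> inverse z \<in> R" using R by (auto simp: vring_def)
  note D = sringD[OF sR]
  define m where "m = {z \<in> R. z = 0 \<or> inverse z \<notin> R}"
  have mR: "z \<in> m \<Longrightarrow> z \<in> R" for z by (simp add: m_def)
  have m0: "0 \<in> m" using D(1)[of 0] by (simp add: m_def)
  have mmult: "a * r \<in> m" if "a \<in> m" "r \<in> R" for a r
  proof (cases "a * r = 0")
    case False
    have "inverse (a * r) \<notin> R"
    proof
      assume "inverse (a * r) \<in> R"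
      then have "r * inverse (a * r) \<in> R" by (rule D(3)[OF that(2)])
      moreover have "r * inverse (a * r) = inverse a" using False by (simp add: field_simps)
      ultimately have "inverse a \<in> R" by (simp only:)
      then show False using that(1) False by (simp add: m_def)
    qed
    moreover have "a * r \<in> R" using D(3) mR that by blast
    ultimately show ?thesis by (simp add: m_def)
  next
    case True
    show ?thesis unfolding True by (rule m0)
  qed
  have madd: "a + b \<in> m" if "a \<in> m" "b \<in> m" for a b
  proof (cases "a = 0 \<or> b = 0")
    case False
    have 1: "b * (1 + a / b) \<in> m" if "a / b \<in> R" by (rule mmult[OF \<open>b \<in> m\<close>]) (intro D(2) that D(1), auto)
    have 2: "a * (1 + b / a) \<in> m" if "b / a \<in> R" by (rule mmult[OF \<open>a \<in> m\<close>]) (intro D(2) that D(1), auto)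
    have "b * (1 + a / b) = a + b" "a * (1 + b / a) = a + b" "inverse (a / b) = b / a"
      using False by (simp_all add: field_simps)
    then show ?thesis using tot[of "a / b"] 1 2 by metis
  qed (use that in auto)
  have msum: "sum f I \<in> m" if "\<And>i. i \<in> I \<Longrightarrow> f i \<in> m" for f and I :: "nat set"
    using that by (induction I rule: infinite_finite_induct) (use m0 madd in auto)
  have mk: "c = 0" if "c \<in> m" "c \<in> k" for c
    using that D(1)[of "inverse c"] k.inv by (auto simp: m_def)
  have xm: "x \<in> m" using x by (simp add: m_def)
  have x0: "x \<noteq> 0" using x D(1)[of 0] by auto
  have notk: "z \<notin> k" if "z \<in> m" "z \<noteq> 0" for z using mk that by blast
  text \<open>A strictly increasing chain of divisors of \<open>z\<close> is linearly independent over \<open>k(z)\<close>.\<close>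
  have chain: "n \<le> kdim (Kx (f 0)) UNIV"
    if f: "\<And>i. i < n \<Longrightarrow> f i \<in> m \<and> f i \<noteq> 0" "\<And>i j. i < j \<Longrightarrow> j < n \<Longrightarrow> f i / f j \<in> m" and n: "n > 0"
    for n and f :: "nat \<Rightarrow> 'a"
  proof -
    define z where "z = f 0"
    have z: "z \<in> m" "z \<noteq> 0" using f(1)[OF n] by (auto simp: z_def)
    have "lin_nondeg_over (Kx z) {..<n} f"
    proof (rule lin_nondeg_over_KxI)
      fix p assume p: "\<And>i. i \<in> {..<n} \<Longrightarrow> pol_over k (p i)" "(\<Sum>i<n. poly (p i) z * f i) = 0"
        "\<exists>i\<in>{..<n}. poly (p i) 0 \<noteq> 0"
      \<comment> \<open>After division by \<open>f j\<close> for the last index with a nonzero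
        residue, every other term of the relation lies in \<open>m\<close>: earlier ones by the
        chain condition, later ones because their coefficients are divisible by
        \<open>z\<close>.\<close>
      define j where "j = Max {i. i < n \<and> poly (p i) 0 \<noteq> 0}"
      have "j \<in> {i. i < n \<and> poly (p i) 0 \<noteq> 0}" unfolding j_def by (rule Max_in) (use p(3) in auto)
      then have j: "j < n" "poly (p j) 0 \<noteq> 0" by auto
      have jmax: "poly (p i) 0 = 0" if "j < i" "i < n" for i
      proof (rule ccontr)
        assume "poly (p i) 0 \<noteq> 0"
        then have "i \<le> j" unfolding j_def using that by (intro Max_ge) auto
        then show False using that by simp
      qed
      have pz: "\<exists>g\<in>R. poly (p i) z = poly (p i) 0 + z * g" if "i < n" for i
      proof -
        have "pol_over k (p i - [:poly (p i) 0:])"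
          using p(1) that by (intro k.pol_diff) (auto simp: k.pol_pCons k.poly_in)
        then obtain q where q: "pol_over k q" "p i - [:poly (p i) 0:] = [:- 0, 1:] * q"
          by (rule k.pol_linear_factor[OF _ k.zero]) auto
        have "poly (p i - [:poly (p i) 0:]) z = z * poly q z" unfolding q(2) by simp
        then have e: "poly (p i) z = poly (p i) 0 + z * poly q z" by (simp add: algebra_simps)
        have "pol_over R q" using q(1) D(1) by (auto simp: pol_over_def)
        then have "poly q z \<in> R" by (rule sring_poly[OF sR]) (use z mR in auto)
        then show ?thesis using e by blast
      qed
      have pR: "poly (p i) z \<in> R" if "i < n" for i
        using pz[OF that] p(1) that k.poly_in[of "p i" 0] D z mR by force
      have fj: "f j \<noteq> 0" using f(1) j by auto
      have "poly (p i) z * f i / f j \<in> m" if i_n: "i < n" and i_j: "i \<noteq> j" for i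
      proof (cases "i < j")
        case True
        have "f i / f j * poly (p i) z \<in> m" by (rule mmult) (use f(2)[OF True] j pR that in auto)
        then show ?thesis by (simp add: mult.commute)
      next
        case False
        then have ij: "j < i" using that by simp
        obtain g where g: "g \<in> R" "poly (p i) z = z * g" using pz[OF i_n] unfolding jmax[OF ij i_n] by auto
        have "z / f j \<in> R"
        proof (cases "j = 0")
          case True
          then show ?thesis using z D(1)[of 1] by (simp add: z_def)
        next
          case False
          then show ?thesis using f(2)[of 0 j] j mR by (simp add: z_def)
        qed
        then have "f i * (z / f j * g) \<in> m" by (intro mmult D(3) g) (use f(1) that in auto)
        then show ?thesis unfolding g by (simp add: mult_ac)
      qed
      then have "(\<Sum>i\<in>{..<n} - {j}. poly (p i) z * f i / f j) \<in> m" by (intro msum) auto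
      moreover have "(\<Sum>i\<in>{..<n} - {j}. poly (p i) z * f i / f j) = - poly (p j) z"
      proof -
        have "(\<Sum>i<n. poly (p i) z * f i / f j) = 0" unfolding sum_divide_distrib[symmetric] p(2) by simp
        then have "poly (p j) z * f j / f j + (\<Sum>i\<in>{..<n} - {j}. poly (p i) z * f i / f j) = 0"
          using j sum.remove[of "{..<n}" j "\<lambda>i. poly (p i) z * f i / f j"] by simp
        then show ?thesis using fj by (simp add: eq_neg_iff_add_eq_0 add.commute)
      qed
      ultimately have "- poly (p j) z \<in> m" by simp
      moreover obtain g where g: "g \<in> R" "poly (p j) z = poly (p j) 0 + z * g" using pz[OF j(1)] by blast
      moreover have "z * g \<in> m" by (rule mmult[OF z(1) g(1)])
      ultimately have "- poly (p j) z + z * g \<in> m" using madd by blast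
      then have "- poly (p j) 0 \<in> m" using g(2) by simp
      moreover have "- poly (p j) 0 \<in> k" using p(1)[of j] j k.poly_in by auto
      ultimately have "- poly (p j) 0 = 0" by (rule mk)
      then show False using j by simp
    qed (use z in auto)
    then have "card {..<n} \<le> kdim (Kx z) UNIV"
      by (intro kdim_ge[OF fin_dim_Kx]) (use notk z in auto)
    then show ?thesis by (simp add: z_def)
  qed
  have bound: "s \<le> kdim (Kx z) UNIV"
    if "\<And>i. i < s \<Longrightarrow> a i \<in> m \<and> a i \<noteq> 0" "z = (\<Prod>i<s. a i)" "s > 0" for s z and a :: "nat \<Rightarrow> 'a"
  proof -
    \<comment> \<open>Factors are dropped from the end: \<open>f 0\<close> is \<open>z\<close>, and
      \<open>f i / f j\<close> with \<open>i < j\<close> is a nonempty product of elements of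
      \<open>m\<close>.\<close>
    define f where "f = (\<lambda>i. \<Prod>l<s - i. a l)"
    have prodm: "(\<Prod>l\<in>{c..<d}. a l) \<in> m" if "c < d" "d \<le> s" for c d
      using that
    proof (induction d)
      case (Suc d)
      show ?case
      proof (cases "c = d")
        case True
        then show ?thesis using \<open>\<And>i. i < s \<Longrightarrow> a i \<in> m \<and> a i \<noteq> 0\<close>[of c] Suc.prems by simp
      next
        case False
        then have "(\<Prod>l\<in>{c..<d}. a l) * a d \<in> m"
          using Suc mR \<open>\<And>i. i < s \<Longrightarrow> a i \<in> m \<and> a i \<noteq> 0\<close>[of d] by (intro mmult) auto
        then show ?thesis using False Suc.prems by simp
      qed
    qed simp
    have f0: "f i \<noteq> 0" for i unfolding f_def using that(1) by auto
    have "s \<le> kdim (Kx (f 0)) UNIV"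
    proof (rule chain)
      show "f i \<in> m \<and> f i \<noteq> 0" if "i < s" for i
        using prodm[of 0 "s - i"] that f0 by (simp add: f_def atLeast0LessThan)
      fix i j assume ij: "i < j" "j < s"
      have "f i = f j * (\<Prod>l\<in>{s - j..<s - i}. a l)"
        unfolding f_def using ij prod.atLeastLessThan_concat[of 0 "s - j" "s - i" a]
        by (simp add: atLeast0LessThan)
      then have "f i / f j = (\<Prod>l\<in>{s - j..<s - i}. a l)" using f0 by simp
      then show "f i / f j \<in> m" using prodm[of "s - j" "s - i"] ij by simp
    qed (use that in auto)
    then show ?thesis using that(2) by (simp add: f_def)
  qed
  text \<open>A factor of a longest factorization of \<open>x\<close> in the maximal ideal is a uniformizer.\<close>
  define Q where "Q = (\<lambda>s::nat. \<exists>a. (\<forall>i<s. a i \<in> m \<and> a i \<noteq> 0) \<and> x = (\<Prod>i<s. a i) \<and> s > 0)"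
  have "Q 1" unfolding Q_def using xm x0 by (intro exI[of _ "\<lambda>_. x"]) auto
  moreover have "Q s \<Longrightarrow> s \<le> kdim (Kx x) UNIV" for s unfolding Q_def using bound[of s _ x] by blast
  ultimately obtain s where s: "Q s" "\<And>s'. Q s' \<Longrightarrow> s' \<le> s" using Nat.ex_has_greatest_nat[of Q 1] by blast
  then obtain a where a: "\<And>i. i < s \<Longrightarrow> a i \<in> m \<and> a i \<noteq> 0" "x = (\<Prod>i<s. a i)" "s > 0" unfolding Q_def by blast
  define \<tau> where "\<tau> = a (s - 1)"
  have \<tau>: "\<tau> \<in> m" "\<tau> \<noteq> 0" using a(1)[of "s - 1"] a(3) by (auto simp: \<tau>_def)
  have irr: "False" if "\<tau> = b * c" "b \<in> m" "c \<in> m" for b c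
  proof -
    define a' where "a' = a(s - 1 := b, s := c)"
    have bc0: "b \<noteq> 0" "c \<noteq> 0" using that \<tau> by auto
    have "x = (\<Prod>i<s - 1. a i) * \<tau>" using a(2,3) by (cases s) (auto simp: \<tau>_def)
    also have "(\<Prod>i<s - 1. a i) = (\<Prod>i<s - 1. a' i)" by (rule prod.cong) (auto simp: a'_def)
    also have "(\<Prod>i<s - 1. a' i) * \<tau> = (\<Prod>i<Suc s. a' i)"
      using that(1) a(3) by (cases s) (auto simp: a'_def mult_ac)
    finally have "x = (\<Prod>i<Suc s. a' i)" .
    moreover have "\<forall>i<Suc s. a' i \<in> m \<and> a' i \<noteq> 0"
    proof (intro allI impI)
      fix i assume "i < Suc s"
      then show "a' i \<in> m \<and> a' i \<noteq> 0" using a(1)[of i] that bc0 by (auto simp: a'_def less_Suc_eq)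
    qed
    ultimately have "Q (Suc s)" unfolding Q_def by blast
    then show False using s(2) by fastforce
  qed
  have div: "w / \<tau> \<in> R" if "w \<in> m" for w
  proof (rule ccontr)
    assume n: "w / \<tau> \<notin> R"
    then have w0: "w \<noteq> 0" using D(1)[of 0] by auto
    have "inverse (w / \<tau>) \<in> R" using tot n by blast
    then have "\<tau> / w \<in> m" using n w0 by (simp add: m_def)
    then show False using irr[of w "\<tau> / w"] that w0 by simp
  qed
  define U where "U = (\<lambda>z. z \<in> R \<and> inverse z \<in> R \<and> z \<noteq> 0)"
  have Umult: "U (a * b)" if "U a" "U b" for a b using that D by (auto simp: U_def)
  have Uinv: "U (inverse a)" if "U a" for a using that by (auto simp: U_def)
  have Uk: "U c" if "c \<in> k" "c \<noteq> 0" for c using that D(1) k.inv by (auto simp: U_def)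
  have exN: "\<exists>n::nat. U (z / \<tau> ^ n)" if z: "z \<in> R" "z \<noteq> 0" for z
  proof (cases "z \<in> m")
    case False
    then show ?thesis using z by (intro exI[of _ 0]) (auto simp: U_def m_def)
  next
    case zm: True
    have "n \<le> kdim (Kx z) UNIV" if n: "z / \<tau> ^ n \<in> R" for n
    proof (cases "n = 0")
      case False
      then obtain n' where n': "n = Suc n'" by (cases n) auto
      define b where "b = (\<lambda>i. if i = n' then \<tau> * (z / \<tau> ^ n) else \<tau>)"
      have "b i \<in> m \<and> b i \<noteq> 0" if "i < n" for i
        unfolding b_def using mmult[OF \<tau>(1) n] \<tau> z by auto
      moreover have "z = (\<Prod>i<n. b i)"
      proof -
        have "(\<Prod>i<n'. b i) = \<tau> ^ n'" by (simp add: b_def)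
        then show ?thesis unfolding n' using \<tau> by (simp add: b_def n')
      qed
      ultimately show ?thesis using bound[of n b z] n' by blast
    qed simp
    moreover have "z / \<tau> ^ 0 \<in> R" using z by simp
    ultimately obtain n where n: "z / \<tau> ^ n \<in> R" "\<And>n'. z / \<tau> ^ n' \<in> R \<Longrightarrow> n' \<le> n"
      using Nat.ex_has_greatest_nat[of "\<lambda>n. z / \<tau> ^ n \<in> R" 0] by blast
    have "z / \<tau> ^ n \<notin> m"
    proof
      assume "z / \<tau> ^ n \<in> m"
      then have "z / \<tau> ^ Suc n \<in> R" using div[of "z / \<tau> ^ n"] by (simp add: mult.commute)
      then show False using n(2) by fastforce
    qed
    then show ?thesis using n(1) z \<tau> by (intro exI[of _ n]) (auto simp: U_def m_def)
  qed
  have exZ: "\<exists>n::int. U (z / \<tau> powi n)" if z0: "z \<noteq> 0" for z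
  proof (cases "z \<in> R")
    case True
    then obtain n where "U (z / \<tau> ^ n)" using exN z0 by blast
    then show ?thesis by (intro exI[of _ "int n"]) simp
  next
    case False
    then have "inverse z \<in> R" using tot by blast
    then obtain n where "U (inverse z / \<tau> ^ n)" using exN[of "inverse z"] z0 by auto
    then have "U (inverse (inverse z / \<tau> ^ n))" by (rule Uinv)
    then have "U (z / \<tau> powi (- int n))" using z0 \<tau> by (simp add: power_int_minus field_simps)
    then show ?thesis by blast
  qed
  have powR: "\<tau> powi n \<in> m" if n0: "n > 0" for n
  proof -
    obtain n' where "nat n = Suc n'" using n0 by (cases "nat n") auto
    then have "\<tau> powi n = \<tau> * \<tau> ^ n'" using that by (simp add: power_int_def)
    then show ?thesis using mmult[OF \<tau>(1)] D(6) mR \<tau> by metis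
  qed
  have unitpow: "n = 0" if u: "U (\<tau> powi n)" for n
  proof (rule ccontr)
    assume "n \<noteq> 0"
    moreover have "False" if "n > 0" using powR[OF that] u by (auto simp: U_def m_def)
    moreover have "False" if "n < 0"
    proof -
      have "U (inverse (\<tau> powi n))" by (rule Uinv[OF u])
      then have "U (\<tau> powi (- n))" by (simp add: power_int_minus)
      then show False using powR[of "- n"] that by (auto simp: U_def m_def)
    qed
    ultimately show False by linarith
  qed
  define v where "v = (\<lambda>z. if z = 0 then 0 else (SOME n::int. U (z / \<tau> powi n)))"
  have vU: "U (z / \<tau> powi v z)" if "z \<noteq> 0" for z
    using someI_ex[OF exZ[OF that]] that by (simp add: v_def)
  have veq: "v z = n" if "z \<noteq> 0" "U (z / \<tau> powi n)" for z n
  proof -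
    have "U (inverse (z / \<tau> powi v z) * (z / \<tau> powi n))" by (intro Umult Uinv vU that)
    moreover have "inverse (z / \<tau> powi v z) * (z / \<tau> powi n) = \<tau> powi (v z - n)"
      using that \<tau> by (simp add: power_int_diff field_simps)
    ultimately show ?thesis using unitpow[of "v z - n"] by simp
  qed
  have vR: "v z \<ge> 0 \<longleftrightarrow> z \<in> R" if z0: "z \<noteq> 0" for z
  proof
    assume "v z \<ge> 0"
    then have "\<tau> powi v z \<in> R" using D(6)[OF mR[OF \<tau>(1)]] by (simp add: power_int_def)
    moreover have "z / \<tau> powi v z \<in> R" using vU[OF z0] by (simp add: U_def)
    ultimately have "z / \<tau> powi v z * \<tau> powi v z \<in> R" using D(3) by blast
    moreover have "z / \<tau> powi v z * \<tau> powi v z = z" using \<tau> by simp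
    ultimately show "z \<in> R" by (simp only:)
  next
    assume zR: "z \<in> R"
    show "v z \<ge> 0"
    proof (rule ccontr)
      assume "\<not> v z \<ge> 0"
      then have "\<tau> powi (- v z) * z \<in> m" using powR[of "- v z"] mmult zR by simp
      moreover have "\<tau> powi (- v z) * z = z / \<tau> powi v z" by (simp add: power_int_minus field_simps)
      ultimately show False using vU[OF z0] by (auto simp: U_def m_def)
    qed
  qed
  have vmult: "v (a * b) = v a + v b" if "a \<noteq> 0" "b \<noteq> 0" for a b
  proof (rule veq)
    have "U (a / \<tau> powi v a * (b / \<tau> powi v b))" by (intro Umult vU that)
    then show "U (a * b / \<tau> powi (v a + v b))" using \<tau> by (simp add: power_int_add)
  qed (use that in simp)
  have vadd: "v (a + b) \<ge> v a" if "a \<noteq> 0" "b \<noteq> 0" "a + b \<noteq> 0" "v a \<le> v b" for a b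
  proof -
    have "v (b / a) + v a = v b" using vmult[of "b / a" a] that by simp
    then have "b / a \<in> R" using vR[of "b / a"] that by simp
    then have "1 + b / a \<in> R" using D(1)[of 1] D(2) by auto
    moreover have e: "a + b = a * (1 + b / a)" using that by (simp add: field_simps)
    moreover have "1 + b / a \<noteq> 0" using e that by auto
    ultimately show ?thesis using vmult[of a "1 + b / a"] vR[of "1 + b / a"] that by simp
  qed
  have "place k v"
    unfolding place_def
  proof (intro conjI allI impI ballI)
    show "v 0 = 0" by (simp add: v_def)
    show "v (a * b) = v a + v b" if "a \<noteq> 0" "b \<noteq> 0" for a b by (rule vmult[OF that])
    show "min (v a) (v b) \<le> v (a + b)" if "a \<noteq> 0" "b \<noteq> 0" "a + b \<noteq> 0" for a b
      using vadd[of a b] vadd[of b a] that by (cases "v a \<le> v b") (auto simp: add.commute)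
    show "v c = 0" if "c \<in> k" "c \<noteq> 0" for c by (rule veq) (use Uk that in auto)
    show "\<exists>t. t \<noteq> 0 \<and> v t = 1"
      using \<tau> Uk[of 1] by (intro exI[of _ \<tau>] conjI veq) auto
  qed
  moreover have "v x > 0"
  proof -
    have "v x \<ge> 0" using vR x x0 by blast
    moreover have "v x \<noteq> 0"
    proof
      assume "v x = 0"
      then have "U x" using vU[OF x0] by simp
      then show False using x by (simp add: U_def)
    qed
    ultimately show ?thesis by simp
  qed
  ultimately show thesis by (rule that)
qed

lemma ex_zero:
  assumes "x \<notin> k"
  obtains v where "place k v" "v x > 0"
  using ex_vring[OF assms] vring_place by blast

end

subsection \<open>Zeros, divisors and the product formula\<close>

context ffield
begin

abbreviation kdeg :: "'a \<Rightarrow> nat" where "kdeg x \<equiv> kdim (Kx x) UNIV"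

lemma Kx_subset: "y \<in> Kx x \<Longrightarrow> Kx y \<subseteq> Kx x"
  by (rule k.rat_fun_field_min) (auto intro: k.subfield_rat_fun_field k.const_in_rat)

lemma Kx_inverse: "Kx (inverse x) = Kx x"
proof
  interpret x: subfld "Kx x" by (rule subfld_Kx)
  interpret y: subfld "Kx (inverse x)" by (rule subfld_Kx)
  show "Kx (inverse x) \<subseteq> Kx x" by (rule Kx_subset) (rule x.inv, rule k.gen_in_rat)
  show "Kx x \<subseteq> Kx (inverse x)"
    using y.inv[OF k.gen_in_rat] by (intro Kx_subset) simp
qed

lemma Kx_diff:
  assumes "c \<in> k"
  shows "Kx (x - c) = Kx x"
proof
  interpret x: subfld "Kx x" by (rule subfld_Kx)
  interpret y: subfld "Kx (x - c)" by (rule subfld_Kx)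
  show "Kx (x - c) \<subseteq> Kx x" by (intro Kx_subset x.diff k.gen_in_rat k.const_in_rat assms)
  have "(x - c) + c \<in> Kx (x - c)" by (intro y.add k.gen_in_rat k.const_in_rat assms)
  then show "Kx x \<subseteq> Kx (x - c)" by (intro Kx_subset) simp
qed

lemma inverse_notin: "x \<notin> k \<Longrightarrow> inverse x \<notin> k"
  using k.inv[of "inverse x"] by auto

lemma diff_notin: "x \<notin> k \<Longrightarrow> c \<in> k \<Longrightarrow> x - c \<notin> k"
  using k.add[of "x - c" c] by auto

text \<open>A system adapted to the residue ring modulo \<open>x\<close>: at \<open>v\<close> the
  orders of \<open>\<eta> (v, j)\<close> are all different, and at the other places of
  \<open>Z\<close> the element is 0 modulo \<open>x\<close>, as in the Chinese remainder
  theorem.\<close>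

definition etas :: "('a \<Rightarrow> int) set \<Rightarrow> 'a \<Rightarrow> (('a \<Rightarrow> int) \<times> nat \<Rightarrow> 'a) \<Rightarrow> bool" where
  "etas Z x \<eta> \<longleftrightarrow> (\<forall>v\<in>Z. \<forall>j. \<eta> (v, j) \<noteq> 0 \<and> v (\<eta> (v, j)) = int j \<and> (\<forall>w\<in>Z - {v}. w x \<le> w (\<eta> (v, j))))"

abbreviation eta_index :: "('a \<Rightarrow> int) set \<Rightarrow> 'a \<Rightarrow> (('a \<Rightarrow> int) \<times> nat) set" where
  "eta_index Z x \<equiv> Sigma Z (\<lambda>v. {..<nat (v x)})"

lemma etas_exist:
  assumes "finite Z" "Z \<subseteq> places k"
  obtains \<eta> where "etas Z x \<eta>"
proof -
  have "\<exists>y. y \<noteq> 0 \<and> v y = int j \<and> (\<forall>w\<in>Z - {v}. w x \<le> w y)" if v: "v \<in> Z" for v j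
  proof -
    have "place k v" "finite (Z - {v})" "Z - {v} \<subseteq> places k" "v \<notin> Z - {v}"
      using assms v by (auto simp: places_def)
    then obtain y where y: "y \<noteq> 0" "v y = int j" "\<And>w. w \<in> Z - {v} \<Longrightarrow> w y \<ge> (\<Sum>w\<in>Z. \<bar>w x\<bar>)"
      by (rule approximation) blast
    have "w x \<le> (\<Sum>w\<in>Z. \<bar>w x\<bar>)" if "w \<in> Z" for w
      using member_le_sum[of w Z "\<lambda>w. \<bar>w x\<bar>"] that assms(1) by auto
    then show ?thesis using y by (intro exI[of _ y]) force
  qed
  then obtain f where "\<And>v j. v \<in> Z \<Longrightarrow> f v j \<noteq> 0 \<and> v (f v j) = int j \<and> (\<forall>w\<in>Z - {v}. w x \<le> w (f v j))"
    by metis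
  then show thesis using that[of "\<lambda>(v, j). f v j"] unfolding etas_def by auto
qed

text \<open>Modulo \<open>x\<close> at \<open>v\<close> only the terms \<open>\<eta> (v, i)\<close>
  survive, with constant coefficients and distinct orders. A sum of order at least \<open>J\<close>
  therefore forces the constants with index below \<open>J\<close> to vanish, one after the
  other.\<close>

lemma etas_lead:
  assumes Z: "finite Z" "Z \<subseteq> places k" and pos: "\<And>v. v \<in> Z \<Longrightarrow> v x > 0" and \<eta>: "etas Z x \<eta>"
    and a: "\<And>s. s \<in> eta_index Z x \<Longrightarrow> a s \<in> k"
    and ca: "\<And>s w. s \<in> eta_index Z x \<Longrightarrow> w \<in> Z \<Longrightarrow> vge w (w x) (c s - a s)"
    and v: "v \<in> Z" and ge: "vge v (int J) (\<Sum>s\<in>eta_index Z x. c s * \<eta> s)"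
    and j: "j < J" "int j < v x"
  shows "a (v, j) = 0"
  using j
proof (induction j rule: less_induct)
  case (less j)
  let ?I = "eta_index Z x"
  have pv: "place k v" using v Z by (auto simp: places_def)
  have fin: "finite ?I" using Z by auto
  have vI: "(v, j) \<in> ?I" using v less.prems by auto
  have c0: "vge v 0 (c s)" if "s \<in> ?I" for s
  proof -
    have "vge v 0 (a s)" by (rule vge_const[OF pv a[OF that]])
    moreover have "vge v 0 (c s - a s)" using ca[OF that v] by (rule vge_mono) (use pos[OF v] in simp)
    ultimately have "vge v 0 (a s + (c s - a s))" by (rule vge_add[OF pv])
    then show ?thesis by simp
  qed
  have rest: "vge v (int j + 1) (c s * \<eta> s)" if s: "s \<in> ?I - {(v, j)}" for s
  proof -
    obtain w i where wi0: "s = (w, i)" by (cases s)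
    have wi: "s = (w, i)" "w \<in> Z" "int i < w x" using s wi0 by auto
    show ?thesis
    proof (cases "w = v")
      case False
      then have "vge v (v x) (\<eta> s)" using \<eta> wi v unfolding etas_def vge_def by auto
      then have "vge v (0 + v x) (c s * \<eta> s)" using c0 s by (intro vge_mult[OF pv]) auto
      then show ?thesis by (rule vge_mono) (use less.prems in simp)
    next
      case True
      then have "v (\<eta> s) = int i" using \<eta> wi unfolding etas_def by auto
      then have \<eta>i: "vge v (int i) (\<eta> s)" by (simp add: vge_def)
      show ?thesis
      proof (cases "i < j")
        case i: True
        then have "a s = 0" using less.IH[of i] less.prems wi True by auto
        then have "vge v (v x) (c s)" using ca[of s v] s v by auto
        then have "vge v (v x + int i) (c s * \<eta> s)" by (rule vge_mult[OF pv _ \<eta>i])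
        then show ?thesis by (rule vge_mono) (use less.prems in simp)
      next
        case False
        then have "i > j" using s wi True by auto
        moreover have "vge v (0 + int i) (c s * \<eta> s)" using c0 s by (intro vge_mult[OF pv _ \<eta>i]) auto
        ultimately show ?thesis by (auto elim: vge_mono)
      qed
    qed
  qed
  have "vge v (int j + 1) ((\<Sum>s\<in>?I. c s * \<eta> s) - (\<Sum>s\<in>?I - {(v, j)}. c s * \<eta> s))"
    by (intro vge_diff[OF pv] vge_sum[OF pv] rest vge_mono[OF ge]) (use less.prems in auto)
  also have "(\<Sum>s\<in>?I. c s * \<eta> s) - (\<Sum>s\<in>?I - {(v, j)}. c s * \<eta> s) = c (v, j) * \<eta> (v, j)"
    using sum.remove[OF fin vI, of "\<lambda>s. c s * \<eta> s"] by simp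
  finally have 1: "vge v (int j + 1) (c (v, j) * \<eta> (v, j))" .
  have \<eta>j: "v (\<eta> (v, j)) = int j" "\<eta> (v, j) \<noteq> 0" using \<eta> v unfolding etas_def by auto
  have "vge v (v x + int j) ((c (v, j) - a (v, j)) * \<eta> (v, j))"
    by (rule vge_mult[OF pv ca[OF vI v]]) (simp add: vge_def \<eta>j)
  then have "vge v (int j + 1) ((c (v, j) - a (v, j)) * \<eta> (v, j))"
    by (rule vge_mono) (use pos[OF v] in simp)
  from vge_diff[OF pv 1 this] have "vge v (int j + 1) (a (v, j) * \<eta> (v, j))"
    by (simp add: algebra_simps)
  then show "a (v, j) = 0"
    using placeD(2)[OF pv, of "a (v, j)" "\<eta> (v, j)"] placeD(4)[OF pv a[OF vI]] \<eta>j
    unfolding vge_def by (cases "a (v, j) = 0") simp_all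
qed

lemma poly_minus_const:
  assumes "pol_over k p"
  obtains q where "pol_over k q" "\<And>x. poly p x - poly p 0 = x * poly q x"
proof -
  have "pol_over k (p - [:poly p 0:])"
    using assms k.poly_in[OF assms k.zero] by (intro k.pol_diff) (auto simp: k.pol_pCons)
  then obtain q where q: "pol_over k q" "p - [:poly p 0:] = [:- 0, 1:] * q"
    by (rule k.pol_linear_factor[OF _ k.zero]) auto
  have "poly p x - poly p 0 = x * poly q x" for x
    using arg_cong[OF q(2), of "\<lambda>p. poly p x"] by simp
  then show thesis using that q(1) by blast
qed

text \<open>A polynomial in \<open>x\<close> is congruent to its constant term modulo
  \<open>x\<close>, so \<open>etas_lead\<close> makes all constant terms of a relation
  vanish.\<close>

lemma etas_independent:
  assumes Z: "finite Z" "Z \<subseteq> places k" and pos: "\<And>v. v \<in> Z \<Longrightarrow> v x > 0" and \<eta>: "etas Z x \<eta>" and x: "x \<notin> k"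
  shows "lin_nondeg_over (Kx x) (eta_index Z x) \<eta>"
proof (rule lin_nondeg_over_KxI)
  show "finite (eta_index Z x)" "x \<noteq> 0" using Z x by auto
  fix p assume p: "\<And>i. i \<in> eta_index Z x \<Longrightarrow> pol_over k (p i)" "(\<Sum>i\<in>eta_index Z x. poly (p i) x * \<eta> i) = 0"
    "\<exists>i\<in>eta_index Z x. poly (p i) 0 \<noteq> 0"
  have "poly (p (v, j)) 0 = 0" if vj: "(v, j) \<in> eta_index Z x" for v j
  proof (rule etas_lead[where Z = Z and x = x and \<eta> = \<eta> and v = v and J = "Suc j" and j = j and
        a = "\<lambda>s. poly (p s) 0" and c = "\<lambda>s. poly (p s) x"])
    fix s assume s: "s \<in> eta_index Z x"
    show "poly (p s) 0 \<in> k" using p(1)[OF s] by (rule k.poly_in) simp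
    fix w assume w: "w \<in> Z"
    then have pw: "place k w" using Z by (auto simp: places_def)
    obtain q where q: "pol_over k q" "poly (p s) x - poly (p s) 0 = x * poly q x"
      using poly_minus_const[OF p(1)[OF s]] by metis
    have "vge w (w x + 0) (x * poly q x)"
      by (intro vge_mult[OF pw] vge_poly[OF pw _ q(1)]) (use pos[OF w] in \<open>auto simp: vge_def\<close>)
    then show "vge w (w x) (poly (p s) x - poly (p s) 0)" unfolding q(2) by simp
  qed (use vj p(2) Z pos \<eta> in auto)
  then show False using p(3) by blast
qed

text \<open>The elements \<open>\<eta> (v, j)\<close> with \<open>j < v x\<close> are independent
  over k(x), and their number is the sum of the orders.\<close>

lemma zero_sum_le:
  assumes x: "x \<notin> k" and Z: "finite Z" "Z \<subseteq> places k" "\<And>v. v \<in> Z \<Longrightarrow> v x > 0"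
  shows "(\<Sum>v\<in>Z. v x) \<le> int (kdeg x)"
proof -
  obtain \<eta> where \<eta>: "etas Z x \<eta>" using etas_exist[OF Z(1,2)] by blast
  have "card (eta_index Z x) \<le> kdeg x"
    by (rule kdim_ge[OF fin_dim_Kx[OF x] _ _ etas_independent[where Z = Z and x = x and \<eta> = \<eta>]])
      (use Z \<eta> x in auto)
  moreover have "int (card (eta_index Z x)) = (\<Sum>v\<in>Z. v x)"
    using Z(3) by (subst card_SigmaI[OF Z(1)]) (auto intro!: sum.cong simp: less_imp_le)
  ultimately show ?thesis by linarith
qed

lemma finite_zeros:
  assumes x: "x \<notin> k"
  shows "finite {v \<in> places k. v x > 0}"
proof -
  have "card G \<le> kdeg x" if G: "G \<subseteq> {v \<in> places k. v x > 0}" "finite G" for G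
  proof -
    have "int (card G) = (\<Sum>v\<in>G. 1)" by simp
    also have "\<dots> \<le> (\<Sum>v\<in>G. v x)" by (rule sum_mono) (use G in force)
    also have "\<dots> \<le> int (kdeg x)" by (rule zero_sum_le[OF x G(2)]) (use G in auto)
    finally show ?thesis by simp
  qed
  then show ?thesis using finite_if_finite_subsets_card_bdd by blast
qed

lemma finite_support:
  assumes "x \<noteq> 0"
  shows "finite {v \<in> places k. v x \<noteq> 0}"
proof (cases "x \<in> k")
  case True
  then have "{v \<in> places k. v x \<noteq> 0} = {}" using placeD(4) by (auto simp: places_def)
  then show ?thesis by (simp only: finite.emptyI)
next
  case False
  have "{v \<in> places k. v x \<noteq> 0} \<subseteq> {v \<in> places k. v x > 0} \<union> {v \<in> places k. v (inverse x) > 0}"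
    by (auto simp: places_def v_inverse[OF _ assms])
  then show ?thesis using finite_zeros[OF False] finite_zeros[OF inverse_notin[OF False]] finite_subset by blast
qed

section \<open>Divisors and the spaces L(D)\<close>

lemma div_deg_eq:
  assumes "finite T" "{v. D v \<noteq> 0} \<subseteq> T"
  shows "div_deg D = (\<Sum>v\<in>T. D v)"
  unfolding div_deg_def by (rule sum.mono_neutral_left) (use assms in auto)

lemma divisor_add: "divisor k D \<Longrightarrow> divisor k E \<Longrightarrow> divisor k (\<lambda>v. D v + E v)"
proof -
  assume "divisor k D" "divisor k E"
  then have 1: "finite ({v. D v \<noteq> 0} \<union> {v. E v \<noteq> 0})" and 2: "{v. D v \<noteq> 0} \<union> {v. E v \<noteq> 0} \<subseteq> places k"
    by (auto simp: divisor_def)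
  have 3: "{v. D v + E v \<noteq> 0} \<subseteq> {v. D v \<noteq> 0} \<union> {v. E v \<noteq> 0}" by auto
  show "divisor k (\<lambda>v. D v + E v)"
    unfolding divisor_def using finite_subset[OF 3 1] subset_trans[OF 3 2] by blast
qed

lemma divisor_diff: "divisor k D \<Longrightarrow> divisor k E \<Longrightarrow> divisor k (\<lambda>v. D v - E v)"
proof -
  assume "divisor k D" "divisor k E"
  then have 1: "finite ({v. D v \<noteq> 0} \<union> {v. E v \<noteq> 0})" and 2: "{v. D v \<noteq> 0} \<union> {v. E v \<noteq> 0} \<subseteq> places k"
    by (auto simp: divisor_def)
  have 3: "{v. D v - E v \<noteq> 0} \<subseteq> {v. D v \<noteq> 0} \<union> {v. E v \<noteq> 0}" by auto
  show "divisor k (\<lambda>v. D v - E v)"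
    unfolding divisor_def using finite_subset[OF 3 1] subset_trans[OF 3 2] by blast
qed

lemma divisor_scale: "divisor k D \<Longrightarrow> divisor k (\<lambda>v. n * D v)"
  unfolding divisor_def by (auto intro: finite_subset[of _ "{v. D v \<noteq> 0}"])

lemma divisor_sum: "(\<And>i. i \<in> I \<Longrightarrow> divisor k (f i)) \<Longrightarrow> divisor k (\<lambda>v. \<Sum>i\<in>I. f i v)"
  by (induction I rule: infinite_finite_induct) (auto intro: divisor_add simp: divisor_def[of k "\<lambda>_. 0"])

lemma div_deg_add:
  assumes "divisor k D" "divisor k E"
  shows "div_deg (\<lambda>v. D v + E v) = div_deg D + div_deg E"
proof -
  let ?T = "{v. D v \<noteq> 0} \<union> {v. E v \<noteq> 0}"
  have T: "finite ?T" using assms by (auto simp: divisor_def)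
  show ?thesis
    using div_deg_eq[OF T, of D] div_deg_eq[OF T, of E] div_deg_eq[OF T, of "\<lambda>v. D v + E v"]
    by (simp add: sum.distrib Collect_mono_iff subset_Un_eq Un_def subset_iff)
qed

lemma div_deg_scale:
  assumes "divisor k D"
  shows "div_deg (\<lambda>v. n * D v) = n * div_deg D"
proof -
  have T: "finite {v. D v \<noteq> 0}" using assms by (auto simp: divisor_def)
  show ?thesis
    using div_deg_eq[OF T, of D] div_deg_eq[OF T, of "\<lambda>v. n * D v"]
    by (simp add: sum_distrib_left subset_iff)
qed

lemma div_deg_diff:
  assumes "divisor k D" "divisor k E"
  shows "div_deg (\<lambda>v. D v - E v) = div_deg D - div_deg E"
  using div_deg_add[OF divisor_diff[OF assms] assms(2)] by simp

lemma div_deg_nonneg: "(\<And>v. D v \<ge> 0) \<Longrightarrow> div_deg D \<ge> 0"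
  unfolding div_deg_def by (rule sum_nonneg)

abbreviation L :: "(('a \<Rightarrow> int) \<Rightarrow> int) \<Rightarrow> 'a set" where "L \<equiv> riemann_roch_space k"

lemma L_iff: "f \<in> L D \<longleftrightarrow> (\<forall>v. place k v \<longrightarrow> vge v (- D v) f)"
  unfolding riemann_roch_space_def places_def vge_def by (cases "f = 0") (auto simp: algebra_simps)

lemma subsp_L: "subsp k (L D)"
  unfolding subsp_def by (auto simp: L_iff intro: vge_add vge_cmult)

lemma L_mono: "(\<And>v. D v \<le> E v) \<Longrightarrow> L D \<subseteq> L E"
  unfolding L_iff subset_iff by (auto elim!: vge_mono)

definition res :: "('a \<Rightarrow> int) \<Rightarrow> 'a \<Rightarrow> 'a" where
  "res v x = (THE c. c \<in> k \<and> vge v 1 (x - c))"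

lemma res:
  assumes "place k v" "vge v 0 x"
  shows "res v x \<in> k" "vge v 1 (x - res v x)"
proof -
  have "\<exists>!c. c \<in> k \<and> vge v 1 (x - c)"
    using residue_exists[OF assms] residue_unique[OF assms(1)] by metis
  from theI'[OF this] show "res v x \<in> k" "vge v 1 (x - res v x)" unfolding res_def by auto
qed

lemma res_eqI:
  assumes "place k v" "vge v 0 x" "c \<in> k" "vge v 1 (x - c)"
  shows "res v x = c"
  using residue_unique[OF assms(1) res(1)[OF assms(1,2)] assms(3) res(2)[OF assms(1,2)] assms(4)] .

lemma res_add:
  assumes "place k v" "vge v 0 x" "vge v 0 y"
  shows "res v (x + y) = res v x + res v y"
proof (rule res_eqI[OF assms(1)])
  have "vge v 1 ((x - res v x) + (y - res v y))" by (intro vge_add res assms)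
  then show "vge v 1 (x + y - (res v x + res v y))" by (simp add: algebra_simps)
qed (intro vge_add k.add res assms)+

lemma res_mult:
  assumes v: "place k v" and x: "vge v 0 x" and y: "vge v 0 y"
  shows "res v (x * y) = res v x * res v y"
proof (rule res_eqI[OF v])
  show "vge v 0 (x * y)" using vge_mult[OF v x y] by simp
  have "vge v (1 + 0) ((x - res v x) * y)" "vge v (1 + 0) ((y - res v y) * res v x)"
    by (intro vge_mult v res x y vge_const)+
  then have "vge v 1 ((x - res v x) * y + (y - res v y) * res v x)" by (intro vge_add v) auto
  then show "vge v 1 (x * y - res v x * res v y)" by (simp add: algebra_simps)
qed (intro k.mult res assms)

lemma res_const: "place k v \<Longrightarrow> c \<in> k \<Longrightarrow> res v c = c"
  by (rule res_eqI) (auto intro: vge_const)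

text \<open>Multiplication by \<open>y\<close>, of order \<open>D v + 1\<close> at \<open>v\<close>,
  turns the leading coefficient at \<open>v\<close> into a residue; this functional has its kernel
  inside \<open>L D\<close>.\<close>

lemma L_step:
  assumes v: "place k v" and f: "fin_dim k (L D)"
  shows "kdim k (L (D(v := D v + 1))) \<le> kdim k (L D) + 1" "fin_dim k (L (D(v := D v + 1)))"
proof -
  define E where "E = D(v := D v + 1)"
  obtain t where t: "t \<noteq> 0" "v t = 1" using placeD(5)[OF v] by blast
  define y where "y = t powi E v"
  have vy: "v y = E v" "y \<noteq> 0"
    unfolding y_def by (cases "E v \<ge> 0") (use t in \<open>auto simp: power_int_def v_power[OF v] v_inverse[OF v]\<close>)
  have ge: "vge v 0 (y * f)" if "f \<in> L E" for f
  proof -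
    have "vge v (- E v) f" using that v unfolding L_iff by blast
    then have "vge v (E v + - E v) (y * f)" by (intro vge_mult[OF v]) (use vy in \<open>auto simp: vge_def\<close>)
    then show ?thesis by simp
  qed
  have ker: "f \<in> L D" if fE: "f \<in> L E" and r: "res v (y * f) = 0" for f
    unfolding L_iff
  proof (intro allI impI)
    fix w assume w: "place k w"
    show "vge w (- D w) f"
    proof (cases "w = v")
      case False
      then show ?thesis using fE w unfolding L_iff E_def by auto
    next
      case True
      have "vge v 1 (y * f)" using res(2)[OF v ge[OF fE]] r by simp
      then show ?thesis
        using True vy placeD(2)[OF v vy(2), of f] by (cases "f = 0") (auto simp: vge_def E_def)
    qed
  qed
  have lk: "res v (y * f) \<in> k" if "f \<in> L E" for f by (rule res(1)[OF v ge[OF that]])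
  have lmult: "res v (y * (c * f)) = c * res v (y * f)" if c: "c \<in> k" and f: "f \<in> L E" for c f
  proof -
    have "res v (c * (y * f)) = res v c * res v (y * f)"
      by (rule res_mult[OF v vge_const[OF v c] ge[OF f]])
    then show ?thesis by (simp add: res_const[OF v c] mult_ac)
  qed
  have ladd: "res v (y * (f + g)) = res v (y * f) + res v (y * g)" if "f \<in> L E" "g \<in> L E" for f g
    unfolding distrib_left by (intro res_add[OF v] ge that)
  have "kdim k (L E) \<le> kdim k (L D) + 1"
    by (rule k.kdim_functional(1)[where l = "\<lambda>f. res v (y * f)", OF f subsp_L lk ladd lmult ker])
  moreover have "fin_dim k (L E)"
    by (rule k.kdim_functional(2)[where l = "\<lambda>f. res v (y * f)", OF f subsp_L lk ladd lmult ker])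
  ultimately have "kdim k (L E) \<le> kdim k (L D) + 1 \<and> fin_dim k (L E)" by blast
  then show "kdim k (L (D(v := D v + 1))) \<le> kdim k (L D) + 1" "fin_dim k (L (D(v := D v + 1)))"
    unfolding E_def by auto
qed

text \<open>One place is removed from \<open>E\<close> at a time; the difference of degrees counts
  the steps, and \<open>L_step\<close> charges one dimension for each.\<close>

lemma L_compare:
  assumes "divisor k D" "divisor k E" "\<And>v. D v \<le> E v" "fin_dim k (L D)"
  shows "int (kdim k (L E)) \<le> int (kdim k (L D)) + (div_deg E - div_deg D) \<and> fin_dim k (L E)"
  using assms
proof (induction "nat (div_deg E - div_deg D)" arbitrary: E rule: less_induct)
  case less
  show ?case
  proof (cases "D = E")
    case True
    then show ?thesis using less.prems by simp
  next
    case False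
    then obtain v where v: "D v \<noteq> E v" by auto
    then have Dv: "D v < E v" using less.prems(3)[of v] by simp
    have "D v \<noteq> 0 \<or> E v \<noteq> 0" using v by auto
    then have pv: "place k v" using less.prems(1,2) unfolding divisor_def places_def by blast
    define E' where "E' = E(v := E v - 1)"
    define P where "P = (\<lambda>w. if w = v then 1 else (0::int))"
    have P: "divisor k P" using pv by (auto simp: divisor_def P_def places_def)
    have dP: "div_deg P = 1" using div_deg_eq[of "{v}" P] by (auto simp: P_def)
    have E'P: "E' = (\<lambda>w. E w - P w)" by (auto simp: E'_def P_def)
    have E': "divisor k E'" unfolding E'P by (rule divisor_diff[OF less.prems(2) P])
    have dE': "div_deg E' = div_deg E - 1" unfolding E'P using div_deg_diff[OF less.prems(2) P] dP by simp
    have DE': "D w \<le> E' w" for w using less.prems(3)[of w] Dv by (auto simp: E'_def)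
    have "div_deg (\<lambda>w. E' w - D w) \<ge> 0" by (rule div_deg_nonneg) (use DE' in simp)
    then have "div_deg E' \<ge> div_deg D" using div_deg_diff[OF E' less.prems(1)] by simp
    then have "int (kdim k (L E')) \<le> int (kdim k (L D)) + (div_deg E' - div_deg D) \<and> fin_dim k (L E')"
      using less.hyps[of E'] E' DE' less.prems dE' by simp
    moreover have "E'(v := E' v + 1) = E" by (simp add: E'_def)
    ultimately show ?thesis using L_step[OF pv, of E'] dE' by auto
  qed
qed

lemma zero_divisor: "divisor k (\<lambda>_. 0)" "div_deg (\<lambda>_ :: 'a \<Rightarrow> int. 0) = 0"
  by (auto simp: divisor_def div_deg_def)

text \<open>A nonconstant function has a pole, namely a zero of its inverse.\<close>

lemma L_0: "L (\<lambda>_. 0) = k"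
proof
  show "L (\<lambda>_. 0) \<subseteq> k"
  proof
    fix f assume f: "f \<in> L (\<lambda>_. 0)"
    show "f \<in> k"
    proof (rule ccontr)
      assume n: "f \<notin> k"
      then obtain v where v: "place k v" "v (inverse f) > 0" using ex_zero[OF inverse_notin] by blast
      moreover have "f \<noteq> 0" using n by auto
      ultimately show False using f v_inverse[OF v(1)] unfolding L_iff vge_def by force
    qed
  qed
qed (auto simp: L_iff vge_const)

lemma kdim_L_0: "fin_dim k (L (\<lambda>_. 0))" "kdim k (L (\<lambda>_. 0)) \<le> 1"
proof -
  have *: "\<exists>a. (\<forall>i\<in>{0::nat}. a i \<in> k) \<and> w = (\<Sum>i\<in>{0::nat}. a i * 1)" if "w \<in> L (\<lambda>_. 0)" for w
    using that unfolding L_0 by (intro exI[of _ "\<lambda>_. w"]) auto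
  show "kdim k (L (\<lambda>_. 0)) \<le> 1" using k.kdim_le_span(1)[of "{0::nat}", OF _ *] by simp
  show "fin_dim k (L (\<lambda>_. 0))" using k.kdim_le_span(2)[of "{0::nat}", OF _ *] by simp
qed

lemma fin_dim_L:
  assumes D: "divisor k D"
  shows "fin_dim k (L D)"
proof -
  let ?E = "\<lambda>v. max 0 (D v)"
  have E: "divisor k ?E" using D unfolding divisor_def by (auto intro: finite_subset[of _ "{v. D v \<noteq> 0}"])
  have "fin_dim k (L ?E)" using L_compare[OF zero_divisor(1) E] kdim_L_0(1) by auto
  then show ?thesis by (rule fin_dim_mono) (rule L_mono, simp)
qed

lemma kdim_L_le:
  assumes "divisor k D" "divisor k E" "\<And>v. D v \<le> E v"
  shows "int (kdim k (L E)) \<le> int (kdim k (L D)) + (div_deg E - div_deg D)"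
  using L_compare[OF assms fin_dim_L[OF assms(1)]] by blast

lemma kdim_L_effective:
  assumes "divisor k D" "\<And>v. D v \<ge> 0"
  shows "int (kdim k (L D)) \<le> div_deg D + 1"
  using kdim_L_le[OF zero_divisor(1) assms] kdim_L_0(2) zero_divisor(2) by simp

section \<open>Degrees of pole divisors\<close>

definition poles :: "'a \<Rightarrow> ('a \<Rightarrow> int) \<Rightarrow> int" where
  "poles x = (\<lambda>v. if place k v then max 0 (- v x) else 0)"

lemma poles_nonneg [simp]: "poles x v \<ge> 0"
  by (simp add: poles_def)

lemma divisor_poles: "divisor k (poles x)"
proof (cases "x = 0")
  case True
  have "poles x v = 0" for v unfolding True poles_def by (simp add: placeD(1))
  then show ?thesis by (auto simp: divisor_def)
next
  case False
  then show ?thesis unfolding divisor_def poles_def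
    by (auto intro: finite_subset[OF _ finite_support[OF False]] simp: places_def split: if_splits)
qed

lemma mem_L_poles: "x \<in> L (poles x)"
  unfolding L_iff vge_def poles_def by auto

text \<open>The products of \<open>x ^ i\<close>, \<open>i \<le> l\<close>, with a basis of K over
  k(x) are independent over \<open>k\<close>; \<open>C\<close> absorbs the poles of that
  basis.\<close>

lemma pole_growth:
  assumes x: "x \<notin> k"
  obtains C where "divisor k C" "\<And>v. C v \<ge> 0"
    "\<And>l. (l + 1) * kdeg x \<le> kdim k (L (\<lambda>v. int l * poles x v + C v))"
proof -
  obtain u where u: "lin_nondeg_over (Kx x) {..<kdeg x} u" using kdim_attained[OF fin_dim_Kx[OF x]] by blast
  define C where "C = (\<lambda>v. \<Sum>j<kdeg x. poles (u j) v)"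
  have C: "divisor k C" unfolding C_def by (intro divisor_sum divisor_poles)
  have C0: "C v \<ge> 0" for v unfolding C_def by (intro sum_nonneg) auto
  have "(l + 1) * kdeg x \<le> kdim k (L (\<lambda>v. int l * poles x v + C v))" for l
  proof -
    define f where "f = (\<lambda>(i, j). x ^ i * u j)"
    have "lin_nondeg_over k ({..l} \<times> {..<kdeg x}) f"
    proof (rule lin_nondeg_overI)
      fix a ij assume a: "\<And>ij. ij \<in> {..l} \<times> {..<kdeg x} \<Longrightarrow> a ij \<in> k"
        and a0: "(\<Sum>ij\<in>{..l} \<times> {..<kdeg x}. a ij * f ij) = 0" and ij: "ij \<in> {..l} \<times> {..<kdeg x}"
      define P where "P = (\<lambda>j. \<Sum>i\<le>l. Polynomial.monom (a (i, j)) i)"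
      have Pk: "pol_over k (P j)" if "j < kdeg x" for j
        unfolding P_def by (intro k.pol_sum k.pol_monom a) (use that in auto)
      have "(\<Sum>ij\<in>{..l} \<times> {..<kdeg x}. a ij * f ij) = (\<Sum>j<kdeg x. \<Sum>i\<le>l. a (i, j) * f (i, j))"
        unfolding sum.cartesian_product' by (rule sum.swap)
      also have "\<dots> = (\<Sum>j<kdeg x. poly (P j) x * u j)"
        unfolding P_def f_def by (simp add: poly_sum poly_monom sum_distrib_left sum_distrib_right mult_ac)
      finally have s0: "(\<Sum>j<kdeg x. poly (P j) x * u j) = 0" using a0 by simp
      have P0: "poly (P j) x = 0" if "j < kdeg x" for j
        by (rule lin_nondeg_overD[OF u _ s0]) (use Pk that in \<open>auto intro: k.poly_in_rat\<close>)
      obtain i j where [simp]: "ij = (i, j)" and "i \<le> l" "j < kdeg x" using ij by auto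
      then have "P j = 0" using poly_eq_0_iff_notin[OF x] P0 Pk by blast
      then have "Polynomial.coeff (P j) i = 0" by simp
      then show "a ij = 0" using \<open>i \<le> l\<close> unfolding P_def by (simp add: coeff_sum)
    qed
    then have "card ({..l} \<times> {..<kdeg x}) \<le> kdim k (L (\<lambda>v. int l * poles x v + C v))"
    proof (rule kdim_ge[rotated 3])
      show "fin_dim k (L (\<lambda>v. int l * poles x v + C v))"
        by (intro fin_dim_L divisor_add divisor_scale divisor_poles C)
      fix ij assume "ij \<in> {..l} \<times> {..<kdeg x}"
      then obtain i j where ij: "ij = (i, j)" "i \<le> l" "j < kdeg x" by auto
      show "f ij \<in> L (\<lambda>v. int l * poles x v + C v)"
        unfolding L_iff
      proof (intro allI impI)
        fix v assume v: "place k v"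
        have "vge v (- poles x v) x" "vge v (- poles (u j) v) (u j)"
          using mem_L_poles v unfolding L_iff by blast+
        then have "vge v (int i * (- poles x v) + - poles (u j) v) (x ^ i * u j)"
          by (intro vge_mult[OF v] vge_power[OF v])
        moreover have "poles (u j) v \<le> C v"
          unfolding C_def using ij by (intro member_le_sum) auto
        moreover have "int i * poles x v \<le> int l * poles x v" using ij by (intro mult_right_mono) auto
        ultimately show "vge v (- (int l * poles x v + C v)) (f ij)"
          unfolding f_def ij by (auto elim!: vge_mono)
      qed
    qed auto
    then show ?thesis by (simp add: card_cartesian_product)
  qed
  then show thesis using that C C0 by blast
qed

text \<open>The upper bound is \<open>zero_sum_le\<close> for \<open>inverse x\<close>. The lower
  bound compares two linear functions of \<open>l\<close>: the dimension grows with slope at least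
  \<open>kdeg x\<close> by \<open>pole_growth\<close>, and at most with the slope of the
  degree.\<close>

lemma deg_poles:
  assumes x: "x \<notin> k"
  shows "div_deg (poles x) = int (kdeg x)"
proof (rule antisym)
  let ?Z = "{v \<in> places k. v (inverse x) > 0}"
  have x0: "x \<noteq> 0" using x by auto
  have "div_deg (poles x) = (\<Sum>v\<in>?Z. poles x v)"
    by (rule div_deg_eq[OF finite_zeros[OF inverse_notin[OF x]]])
       (auto simp: poles_def places_def v_inverse[OF _ x0] split: if_splits)
  also have "\<dots> = (\<Sum>v\<in>?Z. v (inverse x))"
    by (rule sum.cong) (auto simp: poles_def places_def v_inverse[OF _ x0])
  also have "\<dots> \<le> int (kdeg (inverse x))"
    by (rule zero_sum_le[OF inverse_notin[OF x] finite_zeros[OF inverse_notin[OF x]]]) auto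
  finally show "div_deg (poles x) \<le> int (kdeg x)" by (simp add: Kx_inverse)
  obtain C where C: "divisor k C" "\<And>v. C v \<ge> 0"
    "\<And>l. (l + 1) * kdeg x \<le> kdim k (L (\<lambda>v. int l * poles x v + C v))" using pole_growth[OF x] by blast
  show "int (kdeg x) \<le> div_deg (poles x)"
  proof (rule ccontr)
    assume "\<not> ?thesis"
    then have lt: "div_deg (poles x) + 1 \<le> int (kdeg x)" by simp
    \<comment> \<open>Beyond the degree of \<open>C\<close> a defect in the slope can no longer be
      compensated by the constant term.\<close>
    define l where "l = nat (div_deg C) + 1"
    have p0: "div_deg (poles x) \<ge> 0" and c0: "div_deg C \<ge> 0" by (auto intro!: div_deg_nonneg C)
    have "int ((l + 1) * kdeg x) \<le> int (kdim k (L (\<lambda>v. int l * poles x v + C v)))" using C(3)[of l] by linarith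
    also have "\<dots> \<le> div_deg (\<lambda>v. int l * poles x v + C v) + 1"
      by (intro kdim_L_effective divisor_add divisor_scale divisor_poles C(1)) (use C(2) in auto)
    also have "div_deg (\<lambda>v. int l * poles x v + C v) = int l * div_deg (poles x) + div_deg C"
      by (simp add: div_deg_add div_deg_scale divisor_scale divisor_poles C(1))
    finally have 1: "int ((l + 1) * kdeg x) \<le> int l * div_deg (poles x) + div_deg C + 1" by simp
    have "(int l + 1) * (div_deg (poles x) + 1) \<le> (int l + 1) * int (kdeg x)"
      by (rule mult_left_mono) (use lt in auto)
    also have "\<dots> = int ((l + 1) * kdeg x)" by (simp add: algebra_simps)
    finally have "(int l + 1) * (div_deg (poles x) + 1) \<le> int l * div_deg (poles x) + div_deg C + 1" using 1 by linarith
    then have "int l + div_deg (poles x) \<le> div_deg C" by (simp add: algebra_simps)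
    then show False using p0 c0 unfolding l_def by simp
  qed
qed

lemma zeros_sum:
  assumes x: "x \<notin> k"
  shows "(\<Sum>v\<in>{v \<in> places k. v x > 0}. v x) = int (kdeg x)"
proof -
  have x0: "x \<noteq> 0" using x by auto
  have "div_deg (poles (inverse x)) = (\<Sum>v\<in>{v \<in> places k. v x > 0}. poles (inverse x) v)"
    by (rule div_deg_eq[OF finite_zeros[OF x]])
       (auto simp: poles_def places_def v_inverse[OF _ x0] split: if_splits)
  also have "\<dots> = (\<Sum>v\<in>{v \<in> places k. v x > 0}. v x)"
    by (rule sum.cong) (auto simp: poles_def places_def v_inverse[OF _ x0])
  finally show ?thesis using deg_poles[OF inverse_notin[OF x]] by (simp add: Kx_inverse)
qed

text \<open>Zeros and poles of \<open>x\<close> have the same degree because \<open>x\<close> and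
  \<open>inverse x\<close> generate the same subfield.\<close>

theorem product_formula:
  assumes x: "x \<noteq> 0" and T: "finite T" "T \<subseteq> places k" "{v \<in> places k. v x \<noteq> 0} \<subseteq> T"
  shows "(\<Sum>v\<in>T. v x) = 0"
proof (cases "x \<in> k")
  case True
  then show ?thesis using T(2) placeD(4) by (intro sum.neutral) (auto simp: places_def)
next
  case False
  have p: "div_deg (poles y) = (\<Sum>v\<in>T. poles y v)" if "y = x \<or> y = inverse x" for y
    by (rule div_deg_eq[OF T(1)])
       (use T(3) that in \<open>auto simp: poles_def places_def v_inverse[OF _ x] split: if_splits\<close>)
  have "(\<Sum>v\<in>T. v x) = (\<Sum>v\<in>T. poles (inverse x) v - poles x v)"
    by (rule sum.cong) (use T(2) in \<open>auto simp: poles_def places_def v_inverse[OF _ x]\<close>)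
  also have "\<dots> = div_deg (poles (inverse x)) - div_deg (poles x)" by (simp add: p sum_subtractf)
  also have "\<dots> = 0" using deg_poles[OF False] deg_poles[OF inverse_notin[OF False]] by (simp add: Kx_inverse)
  finally show ?thesis .
qed

subsection \<open>Riemann's theorem\<close>

definition index_of :: "(('a \<Rightarrow> int) \<Rightarrow> int) \<Rightarrow> int" where
  "index_of D = div_deg D + 1 - int (kdim k (L D))"

lemma index_mono: "divisor k D \<Longrightarrow> divisor k E \<Longrightarrow> (\<And>v. D v \<le> E v) \<Longrightarrow> index_of D \<le> index_of E"
  unfolding index_of_def using kdim_L_le[of D E] by simp

lemma ex_notin: "\<exists>x. x \<notin> k"
proof -
  obtain t where "transcendental_over k t" using ff unfolding function_field_over_def by blast
  then have "t \<notin> k"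
    unfolding transcendental_over_def
    using k.pol_pCons[of "- t" "[:1:]"] k.pol_pCons[of 1 0]
    by (auto dest!: spec[of _ "[:- t, 1:]"] simp: pol_over_def k.uminus)
  then show ?thesis by blast
qed

text \<open>On the multiples \<open>B l\<close> of a pole divisor the index is bounded by
  \<open>pole_growth\<close>. Every divisor lies below some \<open>B l\<close> after subtraction of
  a principal divisor, which does not decrease the index, and the index is monotone.\<close>

theorem index_bounded: "\<exists>\<gamma>. \<forall>D. divisor k D \<longrightarrow> index_of D \<le> \<gamma>"
proof -
  obtain x where x: "x \<notin> k" using ex_notin by blast
  obtain C where C: "divisor k C" "\<And>v. C v \<ge> 0"
    "\<And>l. (l + 1) * kdeg x \<le> kdim k (L (\<lambda>v. int l * poles x v + C v))" using pole_growth[OF x] by blast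
  define B where "B = (\<lambda>l::nat. \<lambda>v. int l * poles x v)"
  have Bd: "divisor k (B l)" for l unfolding B_def by (intro divisor_scale divisor_poles)
  have dB: "div_deg (B l) = int l * int (kdeg x)" for l
    unfolding B_def by (simp add: div_deg_scale divisor_poles deg_poles[OF x])
  have lB: "int (kdim k (L (B l))) \<ge> (int l + 1) * int (kdeg x) - div_deg C" for l
  proof -
    have "int ((l + 1) * kdeg x) \<le> int (kdim k (L (\<lambda>v. B l v + C v)))" using C(3)[of l] unfolding B_def by linarith
    also have "\<dots> \<le> int (kdim k (L (B l))) + (div_deg (\<lambda>v. B l v + C v) - div_deg (B l))"
      by (rule kdim_L_le[OF Bd divisor_add[OF Bd C(1)]]) (use C(2) in auto)
    also have "div_deg (\<lambda>v. B l v + C v) = div_deg (B l) + div_deg C" by (rule div_deg_add[OF Bd C(1)])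
    finally show ?thesis by (simp add: algebra_simps)
  qed
  define \<gamma> where "\<gamma> = 1 + div_deg C"
  have iB: "index_of (B l) \<le> \<gamma>" for l
    using lB[of l] unfolding index_of_def dB \<gamma>_def by (simp add: algebra_simps)
  have pos: "kdeg x > 0"
  proof -
    obtain v where v: "place k v" "v x > 0" using ex_zero[OF x] by blast
    have "v x \<le> (\<Sum>v\<in>{v \<in> places k. v x > 0}. v x)"
      using v finite_zeros[OF x] by (intro member_le_sum) (auto simp: places_def)
    then show ?thesis using zeros_sum[OF x] v by simp
  qed
  have "index_of A \<le> \<gamma>" if A: "divisor k A" for A
  proof -
    define A' where "A' = (\<lambda>v. max 0 (A v))"
    have A': "divisor k A'" using A unfolding divisor_def A'_def by (auto intro: finite_subset[of _ "{v. A v \<noteq> 0}"])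
    \<comment> \<open>Chosen so that L(B l - A') contains a nonzero \<open>z\<close>; the divisor of
      \<open>z\<close> moves \<open>A'\<close> below \<open>B l\<close>.\<close>
    define l where "l = nat (div_deg A') + nat (div_deg C)"
    have a0: "div_deg A' \<ge> 0" and c0: "div_deg C \<ge> 0" by (auto intro!: div_deg_nonneg C simp: A'_def)
    have "int (kdim k (L (B l))) \<le> int (kdim k (L (\<lambda>v. B l v - A' v))) + (div_deg (B l) - div_deg (\<lambda>v. B l v - A' v))"
      by (rule kdim_L_le[OF divisor_diff[OF Bd A'] Bd]) (simp add: A'_def)
    then have "int (kdim k (L (\<lambda>v. B l v - A' v))) \<ge> (int l + 1) * int (kdeg x) - div_deg C - div_deg A'"
      using lB[of l] div_deg_diff[OF Bd A', of l] by linarith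
    moreover have "(int l + 1) * int (kdeg x) \<ge> (int l + 1) * 1" by (rule mult_left_mono) (use pos in auto)
    ultimately have "int (kdim k (L (\<lambda>v. B l v - A' v))) \<ge> int l + 1 - div_deg C - div_deg A'" unfolding mult_1_right by linarith
    moreover have "int l = div_deg A' + div_deg C" unfolding l_def using a0 c0 by simp
    ultimately have lpos: "kdim k (L (\<lambda>v. B l v - A' v)) > 0" by simp
    obtain y where y: "\<forall>j<kdim k (L (\<lambda>v. B l v - A' v)). y j \<in> L (\<lambda>v. B l v - A' v)"
        "lin_nondeg_over k {..<kdim k (L (\<lambda>v. B l v - A' v))} y"
      using kdim_attained[OF fin_dim_L[OF divisor_diff[OF Bd A']]] by blast
    define z where "z = y 0"
    have z: "z \<in> L (\<lambda>v. B l v - A' v)" using y(1) lpos by (simp add: z_def)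
    have z0: "z \<noteq> 0"
    proof
      assume "z = 0"
      then have "(\<Sum>j<kdim k (L (\<lambda>v. B l v - A' v)). (if j = 0 then 1 else 0) * y j) = 0"
        by (intro sum.neutral) (auto simp: z_def)
      then have "(if (0::nat) = 0 then 1 else 0) = (0::'a)"
        by (rule lin_nondeg_overD[OF y(2), rotated]) (use lpos in auto)
      then show False by simp
    qed
    define P where "P = (\<lambda>v. if place k v then v z else 0)"
    have P: "divisor k P" unfolding divisor_def P_def
      by (auto intro: finite_subset[OF _ finite_support[OF z0]] simp: places_def split: if_splits)
    have dP: "div_deg P = 0"
    proof -
      have "div_deg P = (\<Sum>v\<in>{v \<in> places k. v z \<noteq> 0}. P v)"
        by (rule div_deg_eq[OF finite_support[OF z0]]) (auto simp: P_def places_def split: if_splits)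
      also have "\<dots> = (\<Sum>v\<in>{v \<in> places k. v z \<noteq> 0}. v z)" by (rule sum.cong) (auto simp: P_def places_def)
      also have "\<dots> = 0" by (rule product_formula[OF z0 finite_support[OF z0]]) auto
      finally show ?thesis .
    qed
    have E: "divisor k (\<lambda>v. A' v - P v)" by (rule divisor_diff[OF A' P])
    have "index_of A \<le> index_of A'" by (rule index_mono[OF A A']) (simp add: A'_def)
    also have "index_of A' \<le> index_of (\<lambda>v. A' v - P v)"
    proof -
      have "kdim k (L (\<lambda>v. A' v - P v)) \<le> kdim k (L A')"
      proof (rule k.kdim_scale(1)[of "inverse z"])
        fix w assume w: "w \<in> L (\<lambda>v. A' v - P v)"
        show "inverse z * w \<in> L A'"
          unfolding L_iff
        proof (intro allI impI)
          fix v assume v: "place k v"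
          have "vge v (- v z + - (A' v - P v)) (inverse z * w)"
            by (rule vge_mult[OF v]) (use w v v_inverse[OF v z0] in \<open>auto simp: L_iff vge_def\<close>)
          then show "vge v (- A' v) (inverse z * w)" using v by (simp add: P_def)
        qed
      qed (use z0 fin_dim_L[OF A'] in auto)
      then show ?thesis unfolding index_of_def using div_deg_diff[OF A' P] dP by simp
    qed
    also have "\<dots> \<le> index_of (B l)"
    proof (rule index_mono[OF E Bd])
      fix v show "A' v - P v \<le> B l v"
      proof (cases "place k v")
        case True
        then show ?thesis using z z0 unfolding L_iff vge_def P_def by force
      next
        case False
        then have "A' v = 0" "B l v \<ge> 0" using A' unfolding divisor_def by (auto simp: places_def B_def)
        then show ?thesis using False by (simp add: P_def)
      qed
    qed
    also have "\<dots> \<le> \<gamma>" by (rule iB)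
    finally show ?thesis .
  qed
  then show ?thesis by blast
qed

text \<open>\<open>genus\<close> is a definite description, so the maximum of the index must be
  attained; boundedness turns it into a least natural number.\<close>

theorem index_le_genus:
  assumes "divisor k D"
  shows "div_deg D + 1 - int (kdim k (L D)) \<le> genus k"
proof -
  obtain \<gamma> where \<gamma>: "\<And>D. divisor k D \<Longrightarrow> index_of D \<le> \<gamma>" using index_bounded by blast
  define A where "A = {nat (\<gamma> - index_of D) | D. divisor k D}"
  have "A \<noteq> {}" using assms unfolding A_def by blast
  then have "(LEAST n. n \<in> A) \<in> A" by (metis LeastI ex_in_conv)
  then obtain D0 where D0: "divisor k D0" "(LEAST n. n \<in> A) = nat (\<gamma> - index_of D0)" unfolding A_def by blast
  have max: "index_of D \<le> index_of D0" if D: "divisor k D" for D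
  proof -
    have "nat (\<gamma> - index_of D0) \<le> nat (\<gamma> - index_of D)"
      unfolding D0(2)[symmetric] by (rule Least_le) (use D in \<open>auto simp: A_def\<close>)
    then show ?thesis using \<gamma>[OF D] \<gamma>[OF D0(1)] by linarith
  qed
  have "genus k = index_of D0"
    unfolding genus_def index_of_def[symmetric]
  proof (rule the_equality)
    show "(\<forall>D. divisor k D \<longrightarrow> index_of D \<le> index_of D0) \<and> (\<exists>D. divisor k D \<and> index_of D = index_of D0)"
      using max D0(1) by blast
    fix g assume g: "(\<forall>D. divisor k D \<longrightarrow> index_of D \<le> g) \<and> (\<exists>D. divisor k D \<and> index_of D = g)"
    then obtain D where "divisor k D" "index_of D = g" by blast
    then show "g = index_of D0" using g max D0(1) by (metis order_antisym)
  qed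
  then show ?thesis using max[OF assms] unfolding index_of_def by simp
qed

end

section \<open>The trace form and ramification\<close>

locale ffield_gen = ffield k for k :: "'a::field_char_0 set" +
  fixes t :: 'a
  assumes t: "t \<notin> k"
begin

abbreviation F :: "'a set" where "F \<equiv> Kx t"
abbreviation N :: nat where "N \<equiv> kdeg t"

sublocale F: subfld F
  by (rule subfld_Kx)

definition basis :: "(nat \<Rightarrow> 'a) \<Rightarrow> bool" where
  "basis \<omega> \<longleftrightarrow> lin_nondeg_over F {..<N} \<omega>"

definition co :: "(nat \<Rightarrow> 'a) \<Rightarrow> 'a \<Rightarrow> nat \<Rightarrow> 'a" where
  "co \<omega> z = (SOME c. (\<forall>j<N. c j \<in> F) \<and> z = (\<Sum>j<N. c j * \<omega> j))"

lemma co: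
  assumes "basis \<omega>"
  shows "j < N \<Longrightarrow> co \<omega> z j \<in> F" "z = (\<Sum>j<N. co \<omega> z j * \<omega> j)"
proof -
  have "\<exists>c. (\<forall>j<N. c j \<in> F) \<and> z = (\<Sum>j<N. c j * \<omega> j)"
    by (rule F.kdim_basis_span[OF fin_dim_Kx[OF t]]) (use assms in \<open>auto simp: basis_def\<close>)
  from someI_ex[OF this] show "j < N \<Longrightarrow> co \<omega> z j \<in> F" "z = (\<Sum>j<N. co \<omega> z j * \<omega> j)"
    unfolding co_def by auto
qed

lemma co_unique:
  assumes b: "basis \<omega>" and c: "\<And>j. j < N \<Longrightarrow> c j \<in> F" and z: "z = (\<Sum>j<N. c j * \<omega> j)" and j: "j < N"
  shows "co \<omega> z j = c j"
proof -
  have "(\<Sum>j<N. (co \<omega> z j - c j) * \<omega> j) = (\<Sum>j<N. co \<omega> z j * \<omega> j) - (\<Sum>j<N. c j * \<omega> j)"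
    by (simp add: left_diff_distrib sum_subtractf)
  also have "\<dots> = 0" using co(2)[OF b, of z] z by simp
  finally have s: "(\<Sum>j<N. (co \<omega> z j - c j) * \<omega> j) = 0" .
  have "co \<omega> z j - c j = 0"
    by (rule lin_nondeg_overD[OF b[unfolded basis_def] _ s]) (use co(1)[OF b] c j in \<open>auto intro: F.diff\<close>)
  then show ?thesis by simp
qed

lemma co_add:
  assumes b: "basis \<omega>" and j: "j < N"
  shows "co \<omega> (z + w) j = co \<omega> z j + co \<omega> w j"
proof (rule co_unique[OF b _ _ j])
  show "z + w = (\<Sum>j<N. (co \<omega> z j + co \<omega> w j) * \<omega> j)"
    using co(2)[OF b, of z] co(2)[OF b, of w] by (simp add: distrib_right sum.distrib)
qed (use co(1)[OF b] in auto)

lemma co_scale: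
  assumes b: "basis \<omega>" and j: "j < N" and c: "c \<in> F"
  shows "co \<omega> (c * z) j = c * co \<omega> z j"
proof (rule co_unique[OF b _ _ j])
  have "c * z = c * (\<Sum>j<N. co \<omega> z j * \<omega> j)" using co(2)[OF b, of z] by simp
  then show "c * z = (\<Sum>j<N. (c * co \<omega> z j) * \<omega> j)"
    by (simp add: sum_distrib_left mult.assoc)
qed (use co(1)[OF b] c in auto)

lemma co_sum:
  assumes b: "basis \<omega>" and j: "j < N"
  shows "co \<omega> (\<Sum>i\<in>I. f i) j = (\<Sum>i\<in>I. co \<omega> (f i) j)"
proof -
  have "co \<omega> 0 j = 0" using co_scale[OF b j, of 0 0] by simp
  then show ?thesis by (induction I rule: infinite_finite_induct) (auto simp: co_add[OF b j])
qed

lemma co_basis: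
  assumes b: "basis \<omega>" and i: "i < N" and j: "j < N"
  shows "co \<omega> (\<omega> i) j = (if i = j then 1 else 0)"
proof -
  have "\<omega> i = (\<Sum>j<N. (if i = j then 1 else 0) * \<omega> j)" using i by (simp add: if_distrib[of "\<lambda>x. x * _"] cong: if_cong)
  then show ?thesis using co_unique[OF b, of "\<lambda>j. if i = j then 1 else 0"] j by auto
qed

lemma co_trans:
  assumes b: "basis \<omega>" and b': "basis \<eta>" and j: "j < N"
  shows "co \<eta> z j = (\<Sum>i<N. co \<omega> z i * co \<eta> (\<omega> i) j)"
proof -
  have "co \<eta> z j = co \<eta> (\<Sum>i<N. co \<omega> z i * \<omega> i) j" using co(2)[OF b, of z] by simp
  also have "\<dots> = (\<Sum>i<N. co \<omega> z i * co \<eta> (\<omega> i) j)"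
    unfolding co_sum[OF b' j] by (rule sum.cong) (auto simp: co_scale[OF b' j co(1)[OF b]])
  finally show ?thesis .
qed

definition tr :: "(nat \<Rightarrow> 'a) \<Rightarrow> 'a \<Rightarrow> 'a" where
  "tr \<omega> z = (\<Sum>i<N. co \<omega> (z * \<omega> i) i)"

text \<open>Integrality of the trace is proved in a different basis for each place of k(t), so its
  value must not depend on the basis.\<close>

lemma tr_basis_indep:
  assumes b: "basis \<omega>" and b': "basis \<eta>"
  shows "tr \<omega> z = tr \<eta> z"
proof -
  have "tr \<omega> z = (\<Sum>i<N. \<Sum>s<N. co \<eta> (\<omega> i) s * co \<omega> (z * \<eta> s) i)"
    unfolding tr_def
  proof (rule sum.cong[OF refl])
    fix i assume "i \<in> {..<N}"
    then have i: "i < N" by simp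
    have "z * \<omega> i = z * (\<Sum>s<N. co \<eta> (\<omega> i) s * \<eta> s)" using co(2)[OF b', of "\<omega> i"] by simp
    then have "co \<omega> (z * \<omega> i) i = co \<omega> (\<Sum>s<N. co \<eta> (\<omega> i) s * (z * \<eta> s)) i"
      by (simp add: sum_distrib_left mult.left_commute)
    also have "\<dots> = (\<Sum>s<N. co \<eta> (\<omega> i) s * co \<omega> (z * \<eta> s) i)"
      unfolding co_sum[OF b i] by (rule sum.cong) (auto simp: co_scale[OF b i co(1)[OF b']])
    finally show "co \<omega> (z * \<omega> i) i = (\<Sum>s<N. co \<eta> (\<omega> i) s * co \<omega> (z * \<eta> s) i)" .
  qed
  also have "\<dots> = (\<Sum>s<N. \<Sum>i<N. co \<omega> (z * \<eta> s) i * co \<eta> (\<omega> i) s)"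
    by (subst sum.swap) (simp add: mult.commute)
  also have "\<dots> = tr \<eta> z"
    unfolding tr_def by (rule sum.cong) (auto simp: co_trans[OF b b'])
  finally show ?thesis .
qed

lemma ex_basis: "\<exists>\<omega>. basis \<omega>"
  using kdim_attained[OF fin_dim_Kx[OF t]] unfolding basis_def by blast

definition T :: "'a \<Rightarrow> 'a" where "T = tr (SOME \<omega>. basis \<omega>)"

lemma T_eq: "basis \<omega> \<Longrightarrow> T z = tr \<omega> z"
  unfolding T_def by (rule tr_basis_indep) (use someI_ex[OF ex_basis] in auto)

lemma T_in: "T z \<in> F"
proof -
  obtain \<omega> where b: "basis \<omega>" using ex_basis by blast
  show ?thesis unfolding T_eq[OF b] tr_def by (intro F.sum co(1)[OF b]) auto
qed

lemma T_add: "T (z + w) = T z + T w"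
proof -
  obtain \<omega> where b: "basis \<omega>" using ex_basis by blast
  show ?thesis unfolding T_eq[OF b] tr_def distrib_right by (simp add: co_add[OF b] sum.distrib)
qed

lemma T_scale:
  assumes c: "c \<in> F"
  shows "T (c * z) = c * T z"
proof -
  obtain \<omega> where b: "basis \<omega>" using ex_basis by blast
  show ?thesis unfolding T_eq[OF b] tr_def mult.assoc by (simp add: co_scale[OF b _ c] sum_distrib_left)
qed

lemma T_sum: "T (\<Sum>i\<in>I. f i) = (\<Sum>i\<in>I. T (f i))"
proof -
  have "T 0 = 0" using T_scale[of 0 0] by simp
  then show ?thesis by (induction I rule: infinite_finite_induct) (auto simp: T_add)
qed

lemma T_1: "T 1 = of_nat N"
proof -
  obtain \<omega> where b: "basis \<omega>" using ex_basis by blast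
  show ?thesis unfolding T_eq[OF b] tr_def by (simp add: co_basis[OF b])
qed

lemma N_pos: "N > 0"
proof -
  obtain v where v: "place k v" "v t > 0" using ex_zero[OF t] by blast
  have "v t \<le> (\<Sum>v\<in>{v \<in> places k. v t > 0}. v t)"
    using v finite_zeros[OF t] by (intro member_le_sum) (auto simp: places_def)
  then show ?thesis using zeros_sum[OF t] v by simp
qed

definition gram :: "(nat \<Rightarrow> 'a) \<Rightarrow> 'a mat" where
  "gram \<omega> = mat N N (\<lambda>(i, j). T (\<omega> i * \<omega> j))"

definition disc :: "(nat \<Rightarrow> 'a) \<Rightarrow> 'a" where
  "disc \<omega> = Determinant.det (gram \<omega>)"

definition change :: "(nat \<Rightarrow> 'a) \<Rightarrow> (nat \<Rightarrow> 'a) \<Rightarrow> 'a mat" where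
  "change \<omega> \<eta> = mat N N (\<lambda>(i, s). co \<eta> (\<omega> i) s)"

text \<open>By bilinearity over k(t) the Gram matrix transforms as \<open>H G H^T\<close>.\<close>

lemma disc_change:
  assumes b': "basis \<eta>"
  shows "disc \<omega> = Determinant.det (change \<omega> \<eta>) ^ 2 * disc \<eta>"
proof -
  let ?H = "change \<omega> \<eta>"
  have H: "?H \<in> carrier_mat N N" and G: "gram \<eta> \<in> carrier_mat N N" by (auto simp: change_def gram_def)
  have "gram \<omega> = ?H * gram \<eta> * transpose_mat ?H"
  proof (rule eq_matI)
    fix i j assume "i < dim_row (?H * gram \<eta> * transpose_mat ?H)" "j < dim_col (?H * gram \<eta> * transpose_mat ?H)"
    then have i: "i < N" and j: "j < N" using H by auto
    have "\<omega> i * \<omega> j = (\<Sum>s<N. co \<eta> (\<omega> i) s * \<eta> s) * (\<Sum>r<N. co \<eta> (\<omega> j) r * \<eta> r)"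
      using co(2)[OF b', of "\<omega> i"] co(2)[OF b', of "\<omega> j"] by simp
    also have "\<dots> = (\<Sum>s<N. \<Sum>r<N. (co \<eta> (\<omega> i) s * co \<eta> (\<omega> j) r) * (\<eta> s * \<eta> r))"
      by (simp add: sum_product mult_ac)
    finally have "T (\<omega> i * \<omega> j) = (\<Sum>s<N. \<Sum>r<N. (co \<eta> (\<omega> i) s * co \<eta> (\<omega> j) r) * T (\<eta> s * \<eta> r))"
      by (simp add: T_sum T_scale F.mult co(1)[OF b'])
    also have "\<dots> = (\<Sum>r<N. (\<Sum>s<N. co \<eta> (\<omega> i) s * T (\<eta> s * \<eta> r)) * co \<eta> (\<omega> j) r)"
      by (subst sum.swap) (simp add: sum_distrib_left sum_distrib_right mult_ac)
    finally show "gram \<omega> $$ (i, j) = (?H * gram \<eta> * transpose_mat ?H) $$ (i, j)"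
      using i j H G by (simp add: gram_def change_def scalar_prod_def atLeast0LessThan)
  qed (auto simp: gram_def change_def)
  then have "disc \<omega> = Determinant.det (?H * gram \<eta>) * Determinant.det (transpose_mat ?H)"
    unfolding disc_def using H G by (simp add: det_mult[of _ N])
  also have "\<dots> = Determinant.det ?H * Determinant.det (gram \<eta>) * Determinant.det ?H"
    by (simp add: det_mult[OF H G] det_transpose[OF H])
  finally show ?thesis by (simp add: disc_def power2_eq_square)
qed

text \<open>The trace form is nondegenerate: an element \<open>z\<close> orthogonal to the whole
  basis would give trace 0 to \<open>inverse z * z\<close>, but the trace of 1 is \<open>N\<close>,
  nonzero in characteristic zero.\<close>

lemma disc_nonzero:
  assumes b: "basis \<omega>"
  shows "disc \<omega> \<noteq> 0"
proof
  assume "disc \<omega> = 0"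
  moreover have G: "gram \<omega> \<in> carrier_mat N N" by (simp add: gram_def)
  ultimately obtain v where v: "v \<in> carrier_vec N" "v \<noteq> 0\<^sub>v N" "gram \<omega> *\<^sub>v v = 0\<^sub>v N"
    using det_0_iff_vec_prod_zero[OF G] unfolding disc_def by blast
  obtain j0 where j0: "j0 < N" "v $ j0 \<noteq> 0"
    using v(1,2) by (metis carrier_vecD eq_vecI index_zero_vec(1) index_zero_vec(2))
  have e: "(\<Sum>j<N. T (\<omega> i * \<omega> j) * v $ j) = 0" if i: "i < N" for i
  proof -
    have "(gram \<omega> *\<^sub>v v) $ i = (\<Sum>j<N. T (\<omega> i * \<omega> j) * v $ j)"
      using v(1) i by (simp add: gram_def scalar_prod_def atLeast0LessThan)
    then show ?thesis using v(3) i by simp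
  qed
  text \<open>A coordinate of the kernel vector gives a kernel vector over the subfield.\<close>
  have "\<exists>s<N. co \<omega> (v $ j0) s \<noteq> 0"
  proof (rule ccontr)
    assume "\<not> ?thesis"
    then have "v $ j0 = 0" using co(2)[OF b, of "v $ j0"] by simp
    then show False using j0 by simp
  qed
  then obtain s where s: "s < N" "co \<omega> (v $ j0) s \<noteq> 0" by blast
  define z where "z = (\<Sum>j<N. co \<omega> (v $ j) s * \<omega> j)"
  have z0: "z \<noteq> 0"
  proof
    assume "z = 0"
    then have "co \<omega> (v $ j0) s = 0"
      unfolding z_def by (rule lin_nondeg_overD[OF b[unfolded basis_def], rotated]) (use co(1)[OF b s(1)] j0 in auto)
    then show False using s by simp
  qed
  have Tz: "T (\<omega> i * z) = 0" if i: "i < N" for i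
  proof -
    have "T (\<omega> i * z) = (\<Sum>j<N. T (\<omega> i * \<omega> j) * co \<omega> (v $ j) s)"
      unfolding z_def sum_distrib_left T_sum
    proof (rule sum.cong[OF refl])
      fix j
      have "\<omega> i * (co \<omega> (v $ j) s * \<omega> j) = co \<omega> (v $ j) s * (\<omega> i * \<omega> j)" by (simp add: mult_ac)
      then show "T (\<omega> i * (co \<omega> (v $ j) s * \<omega> j)) = T (\<omega> i * \<omega> j) * co \<omega> (v $ j) s"
        using T_scale[OF co(1)[OF b s(1)], of "v $ j" "\<omega> i * \<omega> j"] by (metis mult.commute)
    qed
    also have "\<dots> = (\<Sum>j<N. co \<omega> (T (\<omega> i * \<omega> j) * v $ j) s)"
      by (rule sum.cong) (auto simp: co_scale[OF b s(1) T_in])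
    also have "\<dots> = co \<omega> 0 s" unfolding co_sum[OF b s(1), symmetric] e[OF i] ..
    also have "\<dots> = 0" using co_scale[OF b s(1) F.zero, of 0] by simp
    finally show ?thesis .
  qed
  have "T (inverse z * z) = (\<Sum>i<N. co \<omega> (inverse z) i * T (\<omega> i * z))"
  proof -
    have "inverse z * z = (\<Sum>i<N. co \<omega> (inverse z) i * \<omega> i) * z" using co(2)[OF b, of "inverse z"] by simp
    also have "\<dots> = (\<Sum>i<N. co \<omega> (inverse z) i * (\<omega> i * z))" by (simp add: sum_distrib_right mult.assoc)
    finally have "T (inverse z * z) = T (\<Sum>i<N. co \<omega> (inverse z) i * (\<omega> i * z))" by (rule arg_cong)
    also have "\<dots> = (\<Sum>i<N. co \<omega> (inverse z) i * T (\<omega> i * z))"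
      unfolding T_sum by (rule sum.cong) (auto simp: T_scale co(1)[OF b])
    finally show ?thesis .
  qed
  also have "\<dots> = 0" using Tz by simp
  finally have "T 1 = 0" using z0 by simp
  then show False using T_1 N_pos by simp
qed

lemma basis_scale:
  assumes b: "basis \<omega>" and c: "\<And>i. i < N \<Longrightarrow> c i \<in> F \<and> c i \<noteq> 0"
  shows "basis (\<lambda>i. c i * \<omega> i)"
  unfolding basis_def
proof (rule lin_nondeg_overI)
  fix a i assume a: "\<And>i. i \<in> {..<N} \<Longrightarrow> a i \<in> F" "(\<Sum>i<N. a i * (c i * \<omega> i)) = 0" and i: "i \<in> {..<N}"
  have "(\<Sum>i<N. (a i * c i) * \<omega> i) = 0" using a(2) by (simp add: mult.assoc)
  then have "a i * c i = 0"
    by (rule lin_nondeg_overD[OF b[unfolded basis_def], rotated]) (use a(1) c i in auto)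
  then show "a i = 0" using c i by auto
qed

text \<open>Serves at the poles of \<open>t\<close>, where a basis has to be multiplied by powers of
  \<open>1 / t\<close> to become integral.\<close>

lemma disc_scale:
  assumes c: "\<And>i. i < N \<Longrightarrow> c i \<in> F"
  shows "disc (\<lambda>i. c i * \<omega> i) = (\<Prod>i<N. c i) ^ 2 * disc \<omega>"
proof -
  let ?G = "gram (\<lambda>i. c i * \<omega> i)"
  have G: "?G \<in> carrier_mat N N" "gram \<omega> \<in> carrier_mat N N" by (auto simp: gram_def)
  have e: "?G $$ (i, j) = c i * c j * gram \<omega> $$ (i, j)" if "i < N" "j < N" for i j
  proof -
    have "c i * \<omega> i * (c j * \<omega> j) = (c i * c j) * (\<omega> i * \<omega> j)" by (simp add: mult_ac)
    then have "T (c i * \<omega> i * (c j * \<omega> j)) = c i * c j * T (\<omega> i * \<omega> j)"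
      using T_scale[OF F.mult[OF c[OF that(1)] c[OF that(2)]]] by metis
    then show ?thesis using that by (simp add: gram_def)
  qed
  have "disc (\<lambda>i. c i * \<omega> i) = (\<Sum>p | p permutes {0..<N}. signof p * ((\<Prod>i<N. c i) ^ 2 * (\<Prod>i=0..<N. gram \<omega> $$ (i, p i))))"
    unfolding disc_def det_def'[OF G(1)]
  proof (rule sum.cong[OF refl])
    fix p assume "p \<in> {p. p permutes {0..<N}}"
    then have p: "p permutes {0..<N}" by simp
    then have pN: "p i < N" if "i < N" for i using permutes_in_image[OF p, of i] that by simp
    have "(\<Prod>i=0..<N. ?G $$ (i, p i)) = (\<Prod>i=0..<N. c i * c (p i) * gram \<omega> $$ (i, p i))"
      by (rule prod.cong) (use e pN in auto)
    also have "\<dots> = (\<Prod>i=0..<N. c i) * (\<Prod>i=0..<N. c (p i)) * (\<Prod>i=0..<N. gram \<omega> $$ (i, p i))"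
      by (simp add: prod.distrib)
    also have "(\<Prod>i=0..<N. c (p i)) = (\<Prod>i=0..<N. c i)"
      using prod.permute[OF p, of c] by (simp add: comp_def)
    finally show "signof p * (\<Prod>i=0..<N. ?G $$ (i, p i)) = signof p * ((\<Prod>i<N. c i) ^ 2 * (\<Prod>i=0..<N. gram \<omega> $$ (i, p i)))"
      by (simp add: power2_eq_square atLeast0LessThan)
  qed
  also have "\<dots> = (\<Prod>i<N. c i) ^ 2 * disc \<omega>"
    unfolding disc_def det_def'[OF G(2)] sum_distrib_left by (rule sum.cong) (auto simp: mult_ac)
  finally show ?thesis .
qed

text \<open>The valuation of k(x) at x = 0: a power of \<open>x\<close> times a quotient that is a
  unit at all zeros of \<open>x\<close> simultaneously.\<close>

lemma local_element:
  assumes x: "Kx x = F" "x \<notin> k" and c: "c \<in> F" "c \<noteq> 0"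
  obtains m P Q where "pol_over k P" "pol_over k Q" "poly P 0 \<noteq> 0" "poly Q 0 \<noteq> 0"
    "c = x powi m * (poly P x / poly Q x)"
proof -
  obtain p q where pq: "pol_over k p" "pol_over k q" "poly q x \<noteq> 0" "c = poly p x / poly q x"
    using c(1) unfolding x(1)[symmetric] by (rule k.rat_fun_fieldE)
  have "p \<noteq> 0" "q \<noteq> 0" using pq c by auto
  obtain P a where P: "pol_over k P" "p = [:- 0, 1:] ^ a * P" "poly P 0 \<noteq> 0"
    using k.pol_split_root[OF pq(1) \<open>p \<noteq> 0\<close> k.zero] by blast
  obtain Q b where Q: "pol_over k Q" "q = [:- 0, 1:] ^ b * Q" "poly Q 0 \<noteq> 0"
    using k.pol_split_root[OF pq(2) \<open>q \<noteq> 0\<close> k.zero] by blast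
  have x0: "x \<noteq> 0" using x by auto
  have "c = x powi (int a - int b) * (poly P x / poly Q x)"
    unfolding pq(4) P(2) Q(2) using x0 by (simp add: power_int_diff)
  then show thesis using that P Q by blast
qed

lemma v_poly_unit:
  assumes v: "place k v" "v x > 0" and P: "pol_over k P" "poly P 0 \<noteq> 0"
  shows "poly P x \<noteq> 0" "v (poly P x) = 0"
proof -
  obtain q where q: "pol_over k q" "poly P x - poly P 0 = x * poly q x" using poly_minus_const[OF P(1)] by metis
  have c: "poly P 0 \<in> k" using P(1) by (rule k.poly_in) simp
  have "vge v (v x + 0) (x * poly q x)"
    by (intro vge_mult[OF v(1)] vge_poly[OF v(1) _ q(1)]) (use v in \<open>auto simp: vge_def\<close>)
  then have "vge v (v (poly P 0) + 1) (x * poly q x)"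
    by (rule vge_mono) (use v placeD(4)[OF v(1) c] in simp)
  then have "vge v (v (poly P 0) + 1) (poly P x - poly P 0)" unfolding q(2) .
  from v_add_eq[OF v(1) P(2) this] show "poly P x \<noteq> 0" "v (poly P x) = 0"
    using placeD(4)[OF v(1) c] by auto
qed

lemma v_powi:
  assumes v: "place k v" "x \<noteq> 0"
  shows "v (x powi m) = m * v x"
  by (cases "m \<ge> 0") (use assms in \<open>auto simp: power_int_def v_power v_inverse\<close>)

lemma local_value:
  assumes x: "x \<notin> k" and PQ: "pol_over k P" "pol_over k Q" "poly P 0 \<noteq> 0" "poly Q 0 \<noteq> 0"
    and v: "place k v" "v x > 0"
  shows "v (x powi m * (poly P x / poly Q x)) = m * v x"
proof -
  have x0: "x \<noteq> 0" using x by auto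
  note P = v_poly_unit[OF v PQ(1,3)] and Q = v_poly_unit[OF v PQ(2,4)]
  have "v (x powi m * (poly P x / poly Q x)) = v (x powi m) + v (poly P x / poly Q x)"
    using x0 P(1) Q(1) by (intro placeD(2)[OF v(1)]) auto
  then show ?thesis using v_powi[OF v(1) x0] v_divide[OF v(1) P(1) Q(1)] P(2) Q(2) by simp
qed

text \<open>Elements of k(x) see a single place x = 0. One constant \<open>a\<close> therefore
  serves at all zeros of \<open>x\<close>, and integrality at one of them suffices.\<close>

lemma local_residue:
  assumes x: "Kx x = F" "x \<notin> k" and c: "c \<in> F" and w: "place k w" "w x > 0" "vge w 0 c"
  obtains a where "a \<in> k" "\<And>v. place k v \<Longrightarrow> v x > 0 \<Longrightarrow> vge v (v x) (c - a)"
proof (cases "c = 0")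
  case True
  then show thesis using that[of 0] by simp
next
  case False
  obtain m P Q where PQ: "pol_over k P" "pol_over k Q" "poly P 0 \<noteq> 0" "poly Q 0 \<noteq> 0"
    and ce: "c = x powi m * (poly P x / poly Q x)" using local_element[OF x c False] by blast
  have val: "v c = m * v x" if "place k v" "v x > 0" for v
    unfolding ce by (rule local_value[OF x(2) PQ that])
  have m: "m \<ge> 0" using val[OF w(1,2)] w(2,3) False by (auto simp: vge_def zero_le_mult_iff)
  show thesis
  proof (cases "m = 0")
    case False
    have "vge v (v x) (c - 0)" if "place k v" "v x > 0" for v
    proof -
      have "1 * v x \<le> m * v x" using m False that by (intro mult_right_mono) auto
      then show ?thesis using val[OF that] by (simp add: vge_def)
    qed
    then show thesis using that[of 0] by simp
  next
    case True
    define R where "R = Polynomial.smult (poly Q 0) P - Polynomial.smult (poly P 0) Q"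
    have kk: "poly Q 0 \<in> k" "poly P 0 \<in> k" using PQ by (auto intro: k.poly_in)
    have "pol_over k R" unfolding R_def by (intro k.pol_diff k.pol_smult kk PQ)
    then obtain q where q: "pol_over k q" "poly R x - poly R 0 = x * poly q x" using poly_minus_const by metis
    have R0: "poly R 0 = 0" by (simp add: R_def)
    have "vge v (v x) (c - poly P 0 / poly Q 0)" if v: "place k v" "v x > 0" for v
    proof -
      note Qv = v_poly_unit[OF v PQ(2,4)]
      have "c - poly P 0 / poly Q 0 = (x * poly q x) * inverse (poly Q x * poly Q 0)"
        unfolding ce True using q(2) R0 Qv(1) PQ(4) by (simp add: R_def field_simps)
      moreover have "vge v (v x + 0 + 0) (x * poly q x * inverse (poly Q x * poly Q 0))"
      proof (intro vge_mult[OF v(1)] vge_poly[OF v(1) _ q(1)])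
        have "v (poly Q x * poly Q 0) = 0"
          using placeD(2)[OF v(1) Qv(1) PQ(4)] Qv(2) placeD(4)[OF v(1) kk(1)] by simp
        then show "vge v 0 (inverse (poly Q x * poly Q 0))"
          using v_inverse[OF v(1), of "poly Q x * poly Q 0"] Qv(1) PQ(4) by (simp add: vge_def)
      qed (use v in \<open>auto simp: vge_def\<close>)
      ultimately show ?thesis by simp
    qed
    moreover have "poly P 0 / poly Q 0 \<in> k" using kk by auto
    ultimately show thesis using that by blast
  qed
qed

end

text \<open>In use, \<open>x\<close> is \<open>1 / t\<close> or \<open>t - a\<close> for a constant
  \<open>a\<close>, and \<open>Z\<close> is the fibre over the corresponding place of k(t).\<close>

locale local_gen = ffield_gen +
  fixes x :: 'a
  assumes x: "Kx x = F" "x \<notin> k"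
begin

definition Z :: "('a \<Rightarrow> int) set" where "Z = {v \<in> places k. v x > 0}"

lemma Z: "finite Z" "Z \<subseteq> places k" "v \<in> Z \<Longrightarrow> v x > 0" "v \<in> Z \<Longrightarrow> place k v"
  using finite_zeros[OF x(2)] by (auto simp: Z_def places_def)

lemma Z_sum: "(\<Sum>v\<in>Z. v x) = int N"
  using zeros_sum[OF x(2)] x(1) by (simp add: Z_def)

lemma Z_nonempty: "Z \<noteq> {}"
  using Z_sum N_pos by auto

definition \<eta> :: "('a \<Rightarrow> int) \<times> nat \<Rightarrow> 'a" where "\<eta> = (SOME \<eta>. etas Z x \<eta>)"

lemma \<eta>: "etas Z x \<eta>"
proof -
  have "\<exists>\<eta>. etas Z x \<eta>" using etas_exist[OF Z(1,2)] by blast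
  from someI_ex[OF this] show ?thesis unfolding \<eta>_def .
qed

lemma card_index: "card (eta_index Z x) = N"
proof -
  have "int (card (eta_index Z x)) = (\<Sum>v\<in>Z. v x)"
    using Z(3) by (subst card_SigmaI[OF Z(1)]) (auto intro!: sum.cong simp: less_imp_le)
  then show ?thesis using Z_sum by simp
qed

definition en :: "nat \<Rightarrow> ('a \<Rightarrow> int) \<times> nat" where
  "en = (SOME e. bij_betw e {..<N} (eta_index Z x))"

lemma en: "bij_betw en {..<N} (eta_index Z x)"
proof -
  have "finite (eta_index Z x)" using Z by auto
  then have "\<exists>e. bij_betw e {..<N} (eta_index Z x)"
    using ex_bij_betw_nat_finite[of "eta_index Z x"] unfolding card_index atLeast0LessThan by blast
  from someI_ex[OF this] show ?thesis unfolding en_def .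
qed

lemma en_in: "i < N \<Longrightarrow> en i \<in> eta_index Z x"
  using bij_betwE[OF en] by simp

lemma basis_en: "basis (\<lambda>i. \<eta> (en i))"
proof -
  have "lin_nondeg_over (Kx x) (eta_index Z x) \<eta>"
    by (rule etas_independent) (use Z \<eta> x in auto)
  then show ?thesis unfolding basis_def x(1) lin_nondeg_over_reindex[OF en] comp_def .
qed

lemma \<eta>_props:
  assumes "i < N"
  shows "fst (en i) \<in> Z" "\<eta> (en i) \<noteq> 0" "fst (en i) (\<eta> (en i)) = int (snd (en i))"
    "w \<in> Z \<Longrightarrow> w \<noteq> fst (en i) \<Longrightarrow> w x \<le> w (\<eta> (en i))" "int (snd (en i)) < fst (en i) x"
proof -
  obtain v j where vj: "en i = (v, j)" by (cases "en i")
  have "v \<in> Z" "j < nat (v x)" using en_in[OF assms] vj by auto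
  then show "fst (en i) \<in> Z" "\<eta> (en i) \<noteq> 0" "fst (en i) (\<eta> (en i)) = int (snd (en i))"
    "w \<in> Z \<Longrightarrow> w \<noteq> fst (en i) \<Longrightarrow> w x \<le> w (\<eta> (en i))" "int (snd (en i)) < fst (en i) x"
    using \<eta> unfolding etas_def vj by auto
qed

lemma \<eta>_integral:
  assumes i: "i < N" and w: "w \<in> Z"
  shows "vge w 0 (\<eta> (en i))"
  using \<eta>_props[OF i] Z(3)[OF w] w by (cases "w = fst (en i)") (force simp: vge_def)+

definition integral :: "'a \<Rightarrow> bool" where "integral z \<longleftrightarrow> (\<forall>v\<in>Z. vge v 0 z)"

text \<open>\<open>etas_lead\<close> for integral coefficients from k(x): by
  \<open>local_residue\<close> a vanishing constant at one place means divisibility by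
  \<open>x\<close> at all of them.\<close>

lemma lead:
  assumes c: "\<And>i. i < N \<Longrightarrow> c i \<in> F \<and> integral (c i)"
    and v: "v \<in> Z" and ge: "vge v (int J) (\<Sum>i<N. c i * \<eta> (en i))"
    and i: "i < N" "fst (en i) = v" "snd (en i) < J" and w: "w \<in> Z"
  shows "vge w (w x) (c i)"
proof -
  obtain w0 where w0: "w0 \<in> Z" using Z_nonempty by blast
  have "\<exists>a. a \<in> k \<and> (\<forall>v. place k v \<longrightarrow> v x > 0 \<longrightarrow> vge v (v x) (c i - a))" if i: "i < N" for i
  proof -
    have "vge w0 0 (c i)" using c[OF i] w0 by (simp add: integral_def)
    from local_residue[OF x conjunct1[OF c[OF i]] Z(4)[OF w0] Z(3)[OF w0] this] show ?thesis by blast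
  qed
  then obtain a where a: "\<And>i. i < N \<Longrightarrow> a i \<in> k"
     "\<And>i v. i < N \<Longrightarrow> place k v \<Longrightarrow> v x > 0 \<Longrightarrow> vge v (v x) (c i - a i)" by metis
  define ne where "ne = the_inv_into {..<N} en"
  have ne: "ne (en i) = i" if "i < N" for i
    using en that unfolding ne_def bij_betw_def by (simp add: the_inv_into_f_f)
  have neN: "ne s < N" "en (ne s) = s" if "s \<in> eta_index Z x" for s
  proof -
    obtain j where "j < N" "s = en j" using en \<open>s \<in> eta_index Z x\<close> unfolding bij_betw_def by auto
    then show "ne s < N" "en (ne s) = s" using ne by auto
  qed
  have "(\<Sum>i<N. c i * \<eta> (en i)) = (\<Sum>s\<in>eta_index Z x. c (ne s) * \<eta> s)"
    using sum.reindex_bij_betw[OF en, of "\<lambda>s. c (ne s) * \<eta> s"] by (simp add: ne)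
  then have ge': "vge v (int J) (\<Sum>s\<in>eta_index Z x. c (ne s) * \<eta> s)" using ge by simp
  have "a (ne (v, snd (en i))) = 0"
    by (rule etas_lead[where Z = Z and x = x and \<eta> = \<eta> and v = v and J = J and
         a = "\<lambda>s. a (ne s)" and c = "\<lambda>s. c (ne s)"])
       (use Z \<eta> neN a v ge' i \<eta>_props[OF i(1)] in auto)
  moreover have "(v, snd (en i)) = en i" using i(2) by (cases "en i") auto
  ultimately have "a i = 0" using ne[OF i(1)] by simp
  then show ?thesis using a(2)[OF i(1) Z(4)[OF w] Z(3)[OF w]] by simp
qed

text \<open>The \<open>\<eta>\<close> form an integral basis. Multiplying by the least power of
  \<open>x\<close> that makes all coefficients integral leaves one coefficient a unit, while the sum
  becomes divisible by \<open>x\<close>; this contradicts \<open>lead\<close>.\<close>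

lemma integral_coeffs:
  assumes c: "\<And>i. i < N \<Longrightarrow> c i \<in> F" and z: "integral (\<Sum>i<N. c i * \<eta> (en i))" and i: "i < N"
  shows "integral (c i)"
proof -
  have "\<exists>m. c i \<noteq> 0 \<longrightarrow> (\<forall>v\<in>Z. v (c i) = m * v x)" if i: "i < N" for i
  proof (cases "c i = 0")
    case False
    from local_element[OF x c[OF i] False] local_value[OF x(2)] show ?thesis
      by (metis Z(3) Z(4))
  qed simp
  then obtain m where m: "\<And>i v. i < N \<Longrightarrow> c i \<noteq> 0 \<Longrightarrow> v \<in> Z \<Longrightarrow> v (c i) = m i * v x" by metis
  show ?thesis
  proof (rule ccontr)
    assume ni: "\<not> integral (c i)"
    define I where "I = {j. j < N \<and> c j \<noteq> 0}"
    have finI: "finite I" by (simp add: I_def)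
    obtain v0 where v0: "v0 \<in> Z" "\<not> vge v0 0 (c i)" using ni by (auto simp: integral_def)
    then have iI: "i \<in> I" using i by (auto simp: I_def vge_def)
    have "v0 (c i) < 0" "c i \<noteq> 0" using v0 by (auto simp: vge_def)
    then have "m i * v0 x < 0" using m[OF i _ v0(1)] by simp
    then have "m i < 0" using Z(3)[OF v0(1)] by (auto simp: mult_less_0_iff)
    \<comment> \<open>The largest pole order among the coefficients, measured in powers of
      \<open>x\<close>; \<open>j\<close> below attains it.\<close>
    define q where "q = - Min (m ` I)"
    have Mle: "Min (m ` I) \<le> m j" if "j \<in> I" for j using that finI by auto
    then have q: "q > 0" using \<open>m i < 0\<close> iI by (force simp: q_def)
    have "Min (m ` I) \<in> m ` I" by (rule Min_in) (use finI iI in auto)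
    then obtain j where j: "j \<in> I" "m j = - q" by (auto simp: q_def)
    have x0: "x \<noteq> 0" using x by auto
    have xF: "x \<in> F" unfolding x(1)[symmetric] by (rule k.gen_in_rat)
    define b where "b = (\<lambda>j. x ^ nat q * c j)"
    have vb: "v (b j) = (q + m j) * v x" if "j \<in> I" "v \<in> Z" for j v
      using placeD(2)[OF Z(4)[OF that(2)], of "x ^ nat q" "c j"] x0 that q m[of j v] v_power[OF Z(4)[OF that(2)] x0]
      by (simp add: b_def I_def algebra_simps)
    have bF: "b j \<in> F \<and> integral (b j)" if "j < N" for j
    proof (cases "j \<in> I")
      case True
      have "vge v 0 (b j)" if v: "v \<in> Z" for v
        unfolding vge_def vb[OF True v] using Mle[OF True] Z(3)[OF v] by (simp add: q_def)
      then show ?thesis using c[OF that] xF unfolding b_def integral_def by (auto intro!: F.mult F.power)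
    next
      case False
      then show ?thesis using that by (auto simp: I_def b_def integral_def)
    qed
    have jN: "j < N" using j by (simp add: I_def)
    define v where "v = fst (en j)"
    have v: "v \<in> Z" using \<eta>_props(1)[OF jN] by (simp add: v_def)
    have s: "(\<Sum>i<N. b i * \<eta> (en i)) = x ^ nat q * (\<Sum>i<N. c i * \<eta> (en i))"
      by (simp add: b_def sum_distrib_left mult.assoc)
    have "vge v (q * v x + 0) (x ^ nat q * (\<Sum>i<N. c i * \<eta> (en i)))"
    proof (rule vge_mult[OF Z(4)[OF v]])
      show "vge v (q * v x) (x ^ nat q)" using v_power[OF Z(4)[OF v] x0, of "nat q"] q by (simp add: vge_def)
      show "vge v 0 (\<Sum>i<N. c i * \<eta> (en i))" using z v by (simp add: integral_def)
    qed
    then have ge: "vge v (int (nat (v x))) (\<Sum>i<N. b i * \<eta> (en i))"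
      unfolding s by (rule vge_mono) (use q Z(3)[OF v] mult_right_mono[of 1 q "v x"] in simp)
    have "vge v (v x) (b j)"
    proof (rule lead[of b v "nat (v x)" j v])
      show "snd (en j) < nat (v x)" using \<eta>_props(5)[OF jN] by (simp add: v_def)
    qed (use bF v ge jN in \<open>simp_all add: v_def\<close>)
    moreover have "v (b j) = 0" using vb[OF j(1) v] j(2) by simp
    moreover have "b j \<noteq> 0" using j x0 by (simp add: b_def I_def)
    ultimately show False using Z(3)[OF v] by (simp add: vge_def)
  qed
qed

lemma co_integral:
  assumes "integral z" "i < N"
  shows "integral (co (\<lambda>i. \<eta> (en i)) z i)"
  by (rule integral_coeffs[OF co(1)[OF basis_en] _ assms(2)])
     (use assms(1) co(2)[OF basis_en, of z] in simp_all)

lemma integral_mult: "integral a \<Longrightarrow> integral b \<Longrightarrow> integral (a * b)"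
  unfolding integral_def using vge_mult[OF Z(4), of _ 0 _ 0] by auto

lemma integral_\<eta>: "i < N \<Longrightarrow> integral (\<eta> (en i))"
  using \<eta>_integral by (simp add: integral_def)

lemma T_integral:
  assumes "integral z"
  shows "integral (T z)"
  unfolding integral_def T_eq[OF basis_en] tr_def
  by (intro ballI vge_sum[OF Z(4)])
     (use co_integral[OF integral_mult[OF assms integral_\<eta>]] in \<open>auto simp: integral_def\<close>)

text \<open>Multiplication by \<open>z\<close> sends \<open>\<eta> (v, j)\<close> to order at least
  \<open>j + 1\<close> at \<open>v\<close>, so by \<open>lead\<close> its own coefficient is
  divisible by \<open>x\<close>: modulo \<open>x\<close> the matrix has zero diagonal.\<close>

lemma T_nilpotent:
  assumes z: "\<And>v. v \<in> Z \<Longrightarrow> vge v 1 z" and w: "w \<in> Z"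
  shows "vge w (w x) (T z)"
  unfolding T_eq[OF basis_en] tr_def
proof (rule vge_sum[OF Z(4)[OF w]])
  fix i assume "i \<in> {..<N}"
  then have i: "i < N" by simp
  have iz: "integral z" unfolding integral_def by (auto intro: vge_mono[OF z])
  let ?v = "fst (en i)"
  have v: "?v \<in> Z" by (rule \<eta>_props(1)[OF i])
  have "vge ?v (1 + int (snd (en i))) (z * \<eta> (en i))"
    by (rule vge_mult[OF Z(4)[OF v] z[OF v]]) (use \<eta>_props(3)[OF i] in \<open>simp add: vge_def\<close>)
  then have g: "vge ?v (int (Suc (snd (en i)))) (\<Sum>j<N. co (\<lambda>i. \<eta> (en i)) (z * \<eta> (en i)) j * \<eta> (en j))"
    using co(2)[OF basis_en, of "z * \<eta> (en i)"] by simp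
  show "vge w (w x) (co (\<lambda>i. \<eta> (en i)) (z * \<eta> (en i)) i)"
    by (rule lead[OF _ v g i _ _ w])
       (use co(1)[OF basis_en] co_integral[OF integral_mult[OF iz integral_\<eta>[OF i]]] in auto)
qed

lemma vge_det:
  assumes w: "place k w" and A: "A \<in> carrier_mat n n"
    and e: "\<And>i j. i < n \<Longrightarrow> j < n \<Longrightarrow> vge w (m i) (A $$ (i, j))"
  shows "vge w (\<Sum>i<n. m i) (Determinant.det A)"
  unfolding det_def'[OF A]
proof (rule vge_sum[OF w])
  fix p assume "p \<in> {p. p permutes {0..<n}}"
  then have p: "p permutes {0..<n}" by simp
  then have pN: "p i < n" if "i < n" for i using permutes_in_image[OF p, of i] that by simp
  have "vge w (\<Sum>i\<in>{0..<n}. m i) (\<Prod>i\<in>{0..<n}. A $$ (i, p i))"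
    by (rule vge_prod[OF w]) (use e pN in auto)
  moreover have "signof p \<in> k" by (auto simp: sign_def)
  ultimately show "vge w (\<Sum>i<n. m i) (signof p * (\<Prod>i=0..<n. A $$ (i, p i)))"
    by (intro vge_cmult[OF w]) (simp_all add: atLeast0LessThan)
qed

text \<open>The rows of the Gram matrix that belong to the basis elements \<open>\<eta>\<^sub>v\<^sub>,\<^sub>j\<close> with \<open>j > 0\<close> are divisible by \<open>x\<close>.\<close>

lemma disc_local:
  assumes b: "basis \<omega>" and \<omega>: "\<And>i. i < N \<Longrightarrow> integral (\<omega> i)" and w: "w \<in> Z"
  shows "w (disc \<omega>) \<ge> w x * (int N - int (card Z))"
proof -
  have pw: "place k w" by (rule Z(4)[OF w])
  have "vge w (\<Sum>i<N. if snd (en i) = 0 then 0 else w x) (disc (\<lambda>i. \<eta> (en i)))"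
    unfolding disc_def
  proof (rule vge_det[OF pw])
    fix i j assume ij: "i < N" "j < N"
    have "vge w (if snd (en i) = 0 then 0 else w x) (T (\<eta> (en i) * \<eta> (en j)))"
    proof (cases "snd (en i) = 0")
      case True
      then show ?thesis using T_integral[OF integral_mult[OF integral_\<eta> integral_\<eta>]] ij w by (simp add: integral_def)
    next
      case False
      have "vge v 1 (\<eta> (en i) * \<eta> (en j))" if v: "v \<in> Z" for v
      proof -
        have "vge v 1 (\<eta> (en i))"
          using \<eta>_props[OF ij(1)] False v Z(3)[OF v] by (cases "v = fst (en i)") (force simp: vge_def)+
        then have "vge v (1 + 0) (\<eta> (en i) * \<eta> (en j))"
          by (rule vge_mult[OF Z(4)[OF v] _ \<eta>_integral[OF ij(2) v]])
        then show ?thesis by simp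
      qed
      then show ?thesis using T_nilpotent[OF _ w] False by simp
    qed
    then show "vge w (if snd (en i) = 0 then 0 else w x) (gram (\<lambda>i. \<eta> (en i)) $$ (i, j))"
      using ij by (simp add: gram_def)
  qed (simp add: gram_def)
  \<comment> \<open>Above each \<open>v\<close> all but one of the \<open>v x\<close> indices are
    positive, and the numbers \<open>v x\<close> add up to \<open>N\<close>.\<close>
  also have "(\<Sum>i<N. if snd (en i) = 0 then 0 else w x) = w x * (int N - int (card Z))"
  proof -
    have "(\<Sum>i<N. if snd (en i) = 0 then 0 else w x) = (\<Sum>s\<in>eta_index Z x. if snd s = 0 then 0 else w x)"
      using sum.reindex_bij_betw[OF en, of "\<lambda>s. if snd s = 0 then 0 else w x"] by simp
    also have "\<dots> = (\<Sum>v\<in>Z. \<Sum>j<nat (v x). if j = 0 then 0 else w x)"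
      by (subst sum.Sigma) (use Z(1) in \<open>auto intro!: sum.cong\<close>)
    also have "\<dots> = (\<Sum>v\<in>Z. w x * (v x - 1))"
    proof (rule sum.cong[OF refl])
      fix v assume v: "v \<in> Z"
      obtain n where n: "nat (v x) = Suc n" using Z(3)[OF v] by (cases "nat (v x)") auto
      then have "v x = int n + 1" by simp
      then show "(\<Sum>j<nat (v x). if j = 0 then 0 else w x) = w x * (v x - 1)"
        unfolding n by (subst sum.lessThan_Suc_shift) simp
    qed
    also have "\<dots> = w x * (int N - int (card Z))"
      by (simp add: sum_distrib_left[symmetric] sum_subtractf Z_sum)
    finally show ?thesis .
  qed
  finally have 1: "vge w (w x * (int N - int (card Z))) (disc (\<lambda>i. \<eta> (en i)))" .
  \<comment> \<open>An integral basis has integral coordinates in the \<open>\<eta>\<close>, so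
    passing to it can only raise the order of the discriminant.\<close>
  have "vge w (\<Sum>i<N. 0) (Determinant.det (change \<omega> (\<lambda>i. \<eta> (en i))))"
  proof (rule vge_det[OF pw])
    fix i j assume "i < N" "j < N"
    then show "vge w 0 (change \<omega> (\<lambda>i. \<eta> (en i)) $$ (i, j))"
      using co_integral[OF \<omega>, of i j] w by (simp add: change_def integral_def)
  qed (simp add: change_def)
  then have "vge w (int 2 * 0) (Determinant.det (change \<omega> (\<lambda>i. \<eta> (en i))) ^ 2)"
    by (intro vge_power[OF pw]) simp
  then have "vge w (int 2 * 0 + w x * (int N - int (card Z))) (disc \<omega>)"
    unfolding disc_change[OF basis_en, of \<omega>] by (intro vge_mult[OF pw] 1)
  then show ?thesis using disc_nonzero[OF b] by (simp add: vge_def)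
qed

end

subsection \<open>The ramification bound\<close>

context ffield_gen
begin

section \<open>Bases over k(t) with small poles\<close>

definition Lz :: "int \<Rightarrow> 'a set" where
  "Lz n = {y. \<forall>v. place k v \<longrightarrow> (if v t < 0 then vge v (n * v t) y else vge v 0 y)}"

lemma Lz_eq: "Lz n = L (\<lambda>v. n * poles t v)"
  unfolding Lz_def L_iff[abs_def] set_eq_iff mem_Collect_eq L_iff poles_def
  by (intro allI iffI; force simp: max_def vge_def split: if_splits)

lemma LzI:
  "(\<And>v. place k v \<Longrightarrow> v t \<ge> 0 \<Longrightarrow> vge v 0 y) \<Longrightarrow> (\<And>v. place k v \<Longrightarrow> v t < 0 \<Longrightarrow> vge v (n * v t) y) \<Longrightarrow> y \<in> Lz n"
  unfolding Lz_def by auto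

lemma LzD:
  assumes "y \<in> Lz n" "place k v"
  shows "v t \<ge> 0 \<Longrightarrow> vge v 0 y" "v t < 0 \<Longrightarrow> vge v (n * v t) y"
  using assms unfolding Lz_def by auto

lemma Lz_mono: "y \<in> Lz n \<Longrightarrow> n \<le> m \<Longrightarrow> y \<in> Lz m"
  by (rule LzI) (auto dest: LzD intro: vge_mono mult_right_mono_neg)

lemma Lz_add: "y \<in> Lz n \<Longrightarrow> z \<in> Lz n \<Longrightarrow> y + z \<in> Lz n"
  by (rule LzI) (auto dest: LzD intro: vge_add)

lemma Lz_diff: "y \<in> Lz n \<Longrightarrow> z \<in> Lz n \<Longrightarrow> y - z \<in> Lz n"
  by (rule LzI) (auto dest: LzD intro: vge_diff)

lemma Lz_0 [simp]: "0 \<in> Lz n"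
  by (rule LzI) auto

lemma Lz_sum: "(\<And>i. i \<in> I \<Longrightarrow> f i \<in> Lz n) \<Longrightarrow> sum f I \<in> Lz n"
  by (induction I rule: infinite_finite_induct) (auto intro: Lz_add)

lemma Lz_mult: "y \<in> Lz n \<Longrightarrow> z \<in> Lz m \<Longrightarrow> y * z \<in> Lz (n + m)"
proof (rule LzI)
  fix v assume yz: "y \<in> Lz n" "z \<in> Lz m" and v: "place k v"
  show "vge v 0 (y * z)" if "v t \<ge> 0"
    using vge_mult[OF v LzD(1)[OF yz(1) v that] LzD(1)[OF yz(2) v that]] by simp
  show "vge v ((n + m) * v t) (y * z)" if "v t < 0"
    using vge_mult[OF v LzD(2)[OF yz(1) v that] LzD(2)[OF yz(2) v that]] by (simp add: distrib_right)
qed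

lemma Lz_const: "c \<in> k \<Longrightarrow> c \<in> Lz 0"
  by (rule LzI) (auto intro: vge_const)

lemma Lz_t: "t \<in> Lz 1"
  by (rule LzI) (auto simp: vge_def)

lemma Lz_power: "t ^ n \<in> Lz (int n)"
proof (induction n)
  case 0
  then show ?case using Lz_const[of 1] by simp
next
  case (Suc n)
  then show ?case using Lz_mult[OF Lz_t, of "t ^ n" "int n"] by simp
qed

lemma Lz_poly:
  assumes "pol_over k p" "int (Polynomial.degree p) \<le> n"
  shows "poly p t \<in> Lz n"
  unfolding poly_altdef
proof (rule Lz_sum)
  fix i assume "i \<in> {..Polynomial.degree p}"
  then have "int i \<le> n" using assms(2) by simp
  moreover have "Polynomial.coeff p i * t ^ i \<in> Lz (0 + int i)"
    using assms(1) by (intro Lz_mult Lz_const Lz_power) (auto simp: pol_over_def)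
  ultimately show "Polynomial.coeff p i * t ^ i \<in> Lz n" using Lz_mono[of _ "int i" n] by simp
qed

lemma t0: "t \<noteq> 0"
  using t by auto

lemma v_t_diff:
  assumes v: "place k v" "v t < 0" and a: "a \<in> k"
  shows "t - a \<noteq> 0" "v (t - a) = v t"
proof -
  have "vge v (v t + 1) (- a)" using vge_const[OF v(1) k.uminus[OF a]] by (rule vge_mono) (use v in simp)
  from v_add_eq[OF v(1) t0 this] show "t - a \<noteq> 0" "v (t - a) = v t" by simp_all
qed

lemma ex_infinite: "\<exists>v. place k v \<and> v t < 0"
proof -
  obtain v where v: "place k v" "v (inverse t) > 0" using ex_zero[OF inverse_notin[OF t]] by blast
  then show ?thesis using v_inverse[OF v(1) t0] by auto
qed

lemma Lz_neg: "y \<in> Lz n \<Longrightarrow> n < 0 \<Longrightarrow> y = 0"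
proof (rule ccontr)
  assume y: "y \<in> Lz n" "n < 0" "y \<noteq> 0"
  obtain v where v: "place k v" "v t < 0" using ex_infinite by blast
  have "y \<in> Lz 0" using Lz_mono[OF y(1), of 0] y(2) by simp
  then have "y \<in> k" unfolding Lz_eq using L_0 by simp
  moreover have "n * v t > 0" using y(2) v(2) by (simp add: mult_neg_neg)
  moreover have "v y \<ge> n * v t" using LzD(2)[OF y(1) v] y(3) by (simp add: vge_def)
  ultimately show False using placeD(4)[OF v(1)] by simp
qed

text \<open>A pole of \<open>u\<close> that is not a pole of \<open>t\<close> is a zero of
  \<open>t\<close> minus its residue there, so a polynomial in \<open>t\<close> removes it.\<close>

lemma clear_poles:
  obtains h n where "pol_over k h" "poly h t \<noteq> 0" "poly h t * u \<in> Lz (int n)"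
proof (cases "u = 0")
  case True
  then show thesis using that[of 1 0] by simp
next
  case u0: False
  define S where "S = {v \<in> places k. v u \<noteq> 0 \<and> v t \<ge> 0}"
  have S: "finite S" by (rule finite_subset[OF _ finite_support[OF u0]]) (auto simp: S_def)
  define h where "h = (\<Prod>v\<in>S. [:- res v t, 1:] ^ nat \<bar>v u\<bar>)"
  have rk: "res v t \<in> k \<and> vge v 1 (t - res v t)" if "v \<in> S" for v
    using that res[of v t] by (auto simp: S_def places_def vge_def)
  have h: "pol_over k h" unfolding h_def
    by (intro k.pol_prod k.pol_power) (use rk in \<open>auto simp: k.pol_pCons k.uminus\<close>)
  have pt: "poly h t = (\<Prod>v\<in>S. (t - res v t) ^ nat \<bar>v u\<bar>)"
    unfolding h_def poly_prod by simp
  have nz: "t - res v t \<noteq> 0" if "v \<in> S" for v using rk[OF that] t by auto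
  then have h0: "poly h t \<noteq> 0" unfolding pt using S by simp
  have hp: "h \<noteq> 0" using h0 by auto
  have fin: "vge w 0 (poly h t * u)" if w: "place k w" "w t \<ge> 0" for w
  proof (cases "w u \<ge> 0")
    case True
    have "vge w (0 + 0) (poly h t * u)"
      by (intro vge_mult[OF w(1)] vge_poly[OF w(1) _ h]) (use w True in \<open>auto simp: vge_def\<close>)
    then show ?thesis by simp
  next
    case False
    then have wS: "w \<in> S" using w by (auto simp: S_def places_def)
    have "vge w (\<Sum>v\<in>S. if v = w then \<bar>w u\<bar> else 0) (poly h t)"
      unfolding pt
    proof (rule vge_prod[OF w(1) _ S])
      fix v assume v: "v \<in> S"
      show "vge w (if v = w then \<bar>w u\<bar> else 0) ((t - res v t) ^ nat \<bar>v u\<bar>)"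
      proof (cases "v = w")
        case True
        then show ?thesis using vge_power[OF w(1) conjunct2[OF rk[OF wS]], of "nat \<bar>w u\<bar>"] by simp
      next
        case False
        have "vge w 0 (t - res v t)"
          by (rule vge_diff[OF w(1) _ vge_const[OF w(1) conjunct1[OF rk[OF v]]]]) (use w in \<open>simp add: vge_def\<close>)
        from vge_power[OF w(1) this] show ?thesis using False by simp
      qed
    qed
    then have "vge w \<bar>w u\<bar> (poly h t)" using wS S by simp
    then have "vge w (\<bar>w u\<bar> + w u) (poly h t * u)" by (intro vge_mult[OF w(1)]) auto
    then show ?thesis by (rule vge_mono) simp
  qed
  let ?y = "poly h t * u"
  have y0: "?y \<noteq> 0" using h0 u0 by simp
  define n where "n = nat (\<Sum>v\<in>{v \<in> places k. v ?y \<noteq> 0}. \<bar>v ?y\<bar>)"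
  have "?y \<in> Lz (int n)"
  proof (rule LzI[OF fin])
    fix v assume v: "place k v" "v t < 0"
    have "\<bar>v ?y\<bar> \<le> int n"
    proof (cases "v ?y = 0")
      case False
      then have "\<bar>v ?y\<bar> \<le> (\<Sum>v\<in>{v \<in> places k. v ?y \<noteq> 0}. \<bar>v ?y\<bar>)"
        using v by (intro member_le_sum finite_support[OF y0]) (auto simp: places_def)
      then show ?thesis by (simp add: n_def)
    qed (simp add: n_def)
    moreover have "int n * v t \<le> int n * (- 1)" using v by (intro mult_left_mono) auto
    ultimately show "vge v (int n * v t) ?y" unfolding vge_def by (intro disjI2) linarith
  qed
  then show thesis using that h h0 by blast
qed

text \<open>A basis of minimal total degree is reduced, as in lattice reduction over k[t]: it
  generates everything regular away from the poles of \<open>t\<close>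
  (\<open>min_polynomial\<close>), and leading terms do not cancel at these poles
  (\<open>min_degree\<close>).\<close>

definition gooddeg :: "nat \<Rightarrow> bool" where
  "gooddeg E \<longleftrightarrow> (\<exists>\<omega> e. basis \<omega> \<and> (\<forall>i<N. \<omega> i \<in> Lz (int (e i))) \<and> (\<Sum>i<N. e i) = E)"

lemma ex_gooddeg: "\<exists>E. gooddeg E"
proof -
  obtain u where u: "basis u" using ex_basis by blast
  have "\<exists>h n. pol_over k h \<and> poly h t \<noteq> 0 \<and> poly h t * u i \<in> Lz (int n)" for i
    using clear_poles[of "u i"] by blast
  then obtain h n where h: "\<And>i. pol_over k (h i) \<and> poly (h i) t \<noteq> 0 \<and> poly (h i) t * u i \<in> Lz (int (n i))"
    by metis
  have "basis (\<lambda>i. poly (h i) t * u i)" by (rule basis_scale[OF u]) (use h k.poly_in_rat in auto)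
  then show ?thesis unfolding gooddeg_def using h by blast
qed

lemma basis_exchange:
  assumes b: "basis \<omega>" and c: "\<And>j. j < N \<Longrightarrow> c j \<in> F" and i: "i < N" "c i \<noteq> 0"
  shows "basis (fun_upd \<omega> i (\<Sum>j<N. c j * \<omega> j))"
  unfolding basis_def
proof (rule lin_nondeg_overI)
  let ?y = "\<Sum>j<N. c j * \<omega> j"
  fix a s assume a: "\<And>i. i \<in> {..<N} \<Longrightarrow> a i \<in> F" and a0: "(\<Sum>s<N. a s * (fun_upd \<omega> i ?y) s) = 0" and s: "s \<in> {..<N}"
  define d where "d = (\<lambda>j. (if j = i then 0 else a j) + a i * c j)"
  have "(\<Sum>s<N. a s * (fun_upd \<omega> i ?y) s) = (\<Sum>s<N. (if s = i then 0 else a s) * \<omega> s) + a i * ?y"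
    using i(1) by (simp add: sum.remove[of "{..<N}" i])
  also have "\<dots> = (\<Sum>s<N. d s * \<omega> s)"
    unfolding d_def by (simp add: sum_distrib_left distrib_right sum.distrib mult.assoc)
  finally have d0: "(\<Sum>s<N. d s * \<omega> s) = 0" using a0 by simp
  have dz: "d j = 0" if "j < N" for j
    by (rule lin_nondeg_overD[OF b[unfolded basis_def] _ d0]) (use a c i that in \<open>auto simp: d_def intro!: F.add F.mult\<close>)
  have ai: "a i = 0" using dz[OF i(1)] i(2) by (simp add: d_def)
  show "a s = 0" using dz[of s] s ai by (cases "s = i") (auto simp: d_def)
qed

text \<open>A combination that involves \<open>\<omega> i\<close> and has smaller poles could
  replace it and lower the total degree. If \<open>e i\<close> is 0, the combination is 0 by
  \<open>Lz_neg\<close>, against independence.\<close>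

lemma min_exchange:
  assumes b: "basis \<omega>" and \<omega>: "\<And>i. i < N \<Longrightarrow> \<omega> i \<in> Lz (int (e i))"
    and min: "\<And>E. gooddeg E \<Longrightarrow> (\<Sum>i<N. e i) \<le> E"
    and c: "\<And>j. j < N \<Longrightarrow> c j \<in> F" and i: "i < N" "c i \<noteq> 0"
    and y: "(\<Sum>j<N. c j * \<omega> j) \<in> Lz (int (e i) - 1)"
  shows False
proof (cases "e i")
  case 0
  then have "(\<Sum>j<N. c j * \<omega> j) = 0" using Lz_neg[OF y] by simp
  then have "c i = 0" by (rule lin_nondeg_overD[OF b[unfolded basis_def], rotated]) (use c i in auto)
  then show False using i by simp
next
  case (Suc m)
  let ?y = "\<Sum>j<N. c j * \<omega> j"
  have "gooddeg (\<Sum>j<N. (e(i := m)) j)"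
    unfolding gooddeg_def
  proof (intro exI conjI)
    show "basis (fun_upd \<omega> i ?y)" by (rule basis_exchange[where c = c and i = i and \<omega> = \<omega>]) (use b c i in auto)
    show "\<forall>j<N. (fun_upd \<omega> i ?y) j \<in> Lz (int ((e(i := m)) j))" using \<omega> y Suc by auto
  qed simp
  then have "(\<Sum>i<N. e i) \<le> (\<Sum>j<N. (e(i := m)) j)" by (rule min)
  moreover have "(\<Sum>j<N. (e(i := m)) j) < (\<Sum>i<N. e i)"
    by (rule sum_strict_mono_ex1) (use i Suc in auto)
  ultimately show False by simp
qed

text \<open>The denominator \<open>q\<close> is removed root by root. If the coefficients do not all
  vanish at a root \<open>a\<close>, their values at \<open>a\<close>, divided by
  \<open>t - a\<close>, combine the \<open>\<omega>\<close> to an element with poles smaller than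
  the largest \<open>e i\<close> involved, which \<open>min_exchange\<close> excludes.\<close>

lemma min_polynomial:
  assumes b: "basis \<omega>" and \<omega>: "\<And>i. i < N \<Longrightarrow> \<omega> i \<in> Lz (int (e i))"
    and min: "\<And>E. gooddeg E \<Longrightarrow> (\<Sum>i<N. e i) \<le> E"
    and y: "y \<in> Lz (int n)"
  obtains p where "\<And>i. i < N \<Longrightarrow> pol_over k (p i)" "y = (\<Sum>i<N. poly (p i) t * \<omega> i)"
proof -
  obtain q p where "pol_over k q" "poly q t \<noteq> 0" "\<forall>i\<in>{..<N}. pol_over k (p i) \<and> poly q t * co \<omega> y i = poly (p i) t"
    using k.common_denominator[of "{..<N}" "co \<omega> y" t] co(1)[OF b] by auto
  moreover from this have "(\<Sum>i<N. poly (p i) t * \<omega> i) = poly q t * y"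
    using arg_cong[OF co(2)[OF b, of y], of "\<lambda>z. poly q t * z"]
    by (simp add: sum_distrib_left mult.assoc[symmetric])
  ultimately have "\<exists>p. (\<forall>i<N. pol_over k (p i)) \<and> (\<Sum>i<N. poly (p i) t * \<omega> i) = poly q t * y"
    and q: "pol_over k q" "q \<noteq> 0" by auto
  then have "\<exists>p. (\<forall>i<N. pol_over k (p i)) \<and> (\<Sum>i<N. poly (p i) t * \<omega> i) = y"
  proof (induction "Polynomial.degree q" arbitrary: q rule: less_induct)
    case less
    obtain p where p: "\<And>i. i < N \<Longrightarrow> pol_over k (p i)" "(\<Sum>i<N. poly (p i) t * \<omega> i) = poly q t * y"
      using less.prems(1) by blast
    show ?case
    proof (cases "Polynomial.degree q = 0")
      case True
      then obtain c where c: "q = [:c:]" by (rule degree_eq_zeroE)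
      then have ck: "c \<in> k" "c \<noteq> 0" using less.prems(2,3) by (auto simp: k.pol_pCons)
      have "(\<Sum>i<N. poly (Polynomial.smult (inverse c) (p i)) t * \<omega> i) = inverse c * (poly q t * y)"
        unfolding p(2)[symmetric] by (simp add: sum_distrib_left mult.assoc)
      also have "\<dots> = y" using c ck by simp
      finally show ?thesis using p(1) ck
        by (intro exI[of _ "\<lambda>i. Polynomial.smult (inverse c) (p i)"]) (auto intro: k.pol_smult)
    next
      case False
      then obtain a where a: "a \<in> k" "poly q a = 0" using ex_root less.prems(2) by blast
      then obtain q' where q': "pol_over k q'" "q = [:- a, 1:] * q'"
        using k.pol_linear_factor less.prems(2) by blast
      have q0: "q' \<noteq> 0" using q' less.prems by auto
      then have d: "Polynomial.degree q = Suc (Polynomial.degree q')"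
        unfolding q' by (subst degree_mult_eq) auto
      have ta: "t - a \<noteq> 0" using t a(1) by auto
      have qt: "poly q t = (t - a) * poly q' t" unfolding q'(2) by (simp add: algebra_simps)
      have "\<exists>r. pol_over k r \<and> p i = [:poly (p i) a:] + [:- a, 1:] * r" if i: "i < N" for i
      proof -
        have "pol_over k (p i - [:poly (p i) a:])"
          using p(1)[OF i] k.poly_in[OF p(1)[OF i] a(1)] by (intro k.pol_diff) (auto simp: k.pol_pCons)
        moreover have "poly (p i - [:poly (p i) a:]) a = 0" by simp
        ultimately obtain r where "pol_over k r" "p i - [:poly (p i) a:] = [:- a, 1:] * r"
          using k.pol_linear_factor a(1) by blast
        then show ?thesis by (intro exI[of _ r]) (metis add.commute diff_add_cancel)
      qed
      then obtain r where r: "\<And>i. i < N \<Longrightarrow> pol_over k (r i) \<and> p i = [:poly (p i) a:] + [:- a, 1:] * r i" by metis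
      have pr: "poly (p i) t = poly (p i) a + (t - a) * poly (r i) t" if "i < N" for i
      proof -
        have "poly (p i) t = poly ([:poly (p i) a:] + [:- a, 1:] * r i) t" using r[OF that] by simp
        then show ?thesis by (simp add: algebra_simps)
      qed
      show ?thesis
      proof (cases "\<forall>i<N. poly (p i) a = 0")
        case True
        have "(t - a) * (\<Sum>i<N. poly (r i) t * \<omega> i) = (\<Sum>i<N. poly (p i) t * \<omega> i)"
          unfolding sum_distrib_left by (rule sum.cong) (auto simp: pr True)
        also have "\<dots> = (t - a) * (poly q' t * y)" unfolding p(2) q'(2) by (simp add: algebra_simps)
        finally have "(\<Sum>i<N. poly (r i) t * \<omega> i) = poly q' t * y" using ta by simp
        then show ?thesis using less.hyps[of q'] d q0 q'(1) r by auto
      next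
        case nz: False
        define I where "I = {i. i < N \<and> poly (p i) a \<noteq> 0}"
        have I: "finite I" "I \<noteq> {}" using nz by (auto simp: I_def)
        have "Max (e ` I) \<in> e ` I" by (rule Max_in) (use I in auto)
        then obtain i where i: "i \<in> I" "e i = Max (e ` I)" by (metis imageE)
        have imax: "e j \<le> e i" if "j \<in> I" for j using i(2) that I(1) by simp
        define z where "z = (\<Sum>j<N. (poly (p j) a / (t - a)) * \<omega> j)"
        have z1: "(t - a) * z = (\<Sum>j<N. poly (p j) a * \<omega> j)"
          unfolding z_def sum_distrib_left using ta by simp
        have z2: "z = poly q' t * y - (\<Sum>j<N. poly (r j) t * \<omega> j)"
        proof -
          have "(\<Sum>j<N. poly (p j) t * \<omega> j) = (\<Sum>j<N. poly (p j) a * \<omega> j) + (t - a) * (\<Sum>j<N. poly (r j) t * \<omega> j)"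
            unfolding sum_distrib_left sum.distrib[symmetric] by (rule sum.cong) (auto simp: pr algebra_simps)
          then have "(t - a) * z = (t - a) * (poly q' t * y - (\<Sum>j<N. poly (r j) t * \<omega> j))"
            using p(2) z1 qt by (simp add: right_diff_distrib mult.assoc)
          then show ?thesis using ta by simp
        qed
        have "z \<in> Lz (int (e i) - 1)"
        proof (rule LzI)
          fix v assume v: "place k v" "v t \<ge> 0"
          have vt: "vge v 0 t" using v by (simp add: vge_def)
          have "vge v (0 + 0) (poly q' t * y)"
            by (intro vge_mult[OF v(1)] vge_poly[OF v(1) vt] q'(1) LzD(1)[OF y v])
          moreover have "vge v (0 + 0) (poly (r j) t * \<omega> j)" if "j < N" for j
            using r[OF that] by (intro vge_mult[OF v(1)] vge_poly[OF v(1) vt] LzD(1)[OF \<omega>[OF that] v]) auto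
          ultimately show "vge v 0 z" unfolding z2 by (intro vge_diff[OF v(1)] vge_sum[OF v(1)]) auto
        next
          fix v assume v: "place k v" "v t < 0"
          have "vge v (int (e i) * v t) (poly (p j) a * \<omega> j)" if j: "j < N" for j
          proof (cases "j \<in> I")
            case True
            have "vge v (int (e j) * v t) (poly (p j) a * \<omega> j)"
              by (intro vge_cmult[OF v(1)] k.poly_in[OF p(1)[OF j] a(1)] LzD(2)[OF \<omega>[OF j] v])
            then show ?thesis by (rule vge_mono) (use imax[OF True] v in \<open>simp add: mult_right_mono_neg\<close>)
          next
            case False
            then show ?thesis using j by (simp add: I_def)
          qed
          then have "vge v (int (e i) * v t) ((t - a) * z)" unfolding z1 by (intro vge_sum[OF v(1)]) auto
          then show "vge v ((int (e i) - 1) * v t) z"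
            using placeD(2)[OF v(1) ta, of z] v_t_diff[OF v a(1)] by (cases "z = 0") (auto simp: vge_def algebra_simps)
        qed
        moreover have "poly (p j) a / (t - a) \<in> F" if "j < N" for j
          by (intro F.divide F.diff k.gen_in_rat k.const_in_rat a(1) k.poly_in[OF p(1)[OF that] a(1)])
        ultimately have False
          by (intro min_exchange[where \<omega> = \<omega> and e = e and c = "\<lambda>j. poly (p j) a / (t - a)" and i = i])
             (use b \<omega> min i(1) ta in \<open>auto simp: z_def I_def\<close>)
        then show ?thesis ..
      qed
    qed
  qed
  then show thesis using that by blast
qed

text \<open>If the bound failed, the terms of top degree would cancel at the poles of
  \<open>t\<close>; divided by a power of \<open>t\<close> they give a combination that
  \<open>min_exchange\<close> excludes.\<close>

lemma min_degree:
  assumes b: "basis \<omega>" and \<omega>: "\<And>i. i < N \<Longrightarrow> \<omega> i \<in> Lz (int (e i))"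
    and min: "\<And>E. gooddeg E \<Longrightarrow> (\<Sum>i<N. e i) \<le> E"
    and p: "\<And>i. i < N \<Longrightarrow> pol_over k (p i)" and y: "(\<Sum>i<N. poly (p i) t * \<omega> i) \<in> Lz (int n)"
    and i: "i < N" "p i \<noteq> 0"
  shows "Polynomial.degree (p i) + e i \<le> n"
proof (rule ccontr)
  assume ni: "\<not> ?thesis"
  let ?y = "\<Sum>i<N. poly (p i) t * \<omega> i"
  define f where "f = (\<lambda>j. Polynomial.degree (p j) + e j)"
  define J where "J = {j. j < N \<and> p j \<noteq> 0}"
  have J: "finite J" "i \<in> J" using i by (auto simp: J_def)
  define D where "D = Max (f ` J)"
  have fD: "f j \<le> D" if "j \<in> J" for j using that J(1) by (simp add: D_def)
  have Dn: "D > n" using fD[OF J(2)] ni by (simp add: f_def)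
  define I where "I = {j \<in> J. f j = D}"
  have "D \<in> f ` J" unfolding D_def by (rule Max_in) (use J in auto)
  then have I: "finite I" "I \<noteq> {}" using J(1) by (auto simp: I_def)
  have "Max (e ` I) \<in> e ` I" by (rule Max_in) (use I in auto)
  then obtain l where l: "l \<in> I" "e l = Max (e ` I)" by (metis imageE)
  have lmax: "e j \<le> e l" if "j \<in> I" for j using l(2) that I(1) by simp
  define m where "m = Polynomial.degree (p l)"
  have lD: "m + e l = D" using l(1) by (simp add: I_def f_def m_def)
  \<comment> \<open>The terms of top degree \<open>D\<close>, divided by \<open>t ^ m\<close>. Since
    \<open>e l\<close> is largest in \<open>I\<close>, \<open>m\<close> is the smallest degree there
    and the subtraction is exact.\<close>
  define c where "c = (\<lambda>j. if j \<in> I then lead_coeff (p j) * t ^ (Polynomial.degree (p j) - m) else 0)"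
  define z where "z = (\<Sum>j<N. c j * \<omega> j)"
  have ck: "lead_coeff (p j) \<in> k" if "j < N" for j using p[OF that] by (simp add: pol_over_def)
  define r where "r = (\<lambda>j. p j - (if j \<in> I then Polynomial.monom (lead_coeff (p j)) (Polynomial.degree (p j)) else 0))"
  have rk: "pol_over k (r j)" if "j < N" for j
    unfolding r_def using p[OF that] ck[OF that] by (intro k.pol_diff) (auto intro: k.pol_monom)
  have rd: "r j = 0 \<or> int (Polynomial.degree (r j)) + int (e j) \<le> int D - 1" if j: "j < N" for j
  proof (cases "j \<in> I")
    case True
    show ?thesis
    proof (cases "Polynomial.degree (p j) = 0")
      case True
      then obtain c where "p j = [:c:]" by (rule degree_eq_zeroE)
      then have "r j = 0" using \<open>j \<in> I\<close> unfolding r_def by (simp add: monom_0)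
      then show ?thesis by simp
    next
      case False
      have "Polynomial.degree (r j) \<le> Polynomial.degree (p j) - 1"
      proof (rule degree_le, intro allI impI)
        fix a assume "Polynomial.degree (p j) - 1 < a"
        then have "a \<ge> Polynomial.degree (p j)" by simp
        then show "Polynomial.coeff (r j) a = 0"
          unfolding r_def using True by (cases "a = Polynomial.degree (p j)") (auto simp: coeff_eq_0)
      qed
      moreover have "Polynomial.degree (p j) + e j = D" using True by (simp add: I_def f_def)
      ultimately show ?thesis using False by linarith
    qed
  next
    case False
    then show ?thesis using fD[of j] j by (cases "p j = 0") (auto simp: r_def I_def J_def f_def)
  qed
  have tm: "t ^ m * z = ?y - (\<Sum>j<N. poly (r j) t * \<omega> j)"
  proof -
    have "t ^ m * z = (\<Sum>j<N. t ^ m * (c j * \<omega> j))" by (simp add: z_def sum_distrib_left)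
    also have "\<dots> = (\<Sum>j<N. poly (p j) t * \<omega> j - poly (r j) t * \<omega> j)"
    proof (rule sum.cong[OF refl])
      fix j assume "j \<in> {..<N}"
      show "t ^ m * (c j * \<omega> j) = poly (p j) t * \<omega> j - poly (r j) t * \<omega> j"
      proof (cases "j \<in> I")
        case True
        have "m \<le> Polynomial.degree (p j)" using lmax[OF True] lD True by (simp add: I_def f_def)
        then have "t ^ Polynomial.degree (p j) = t ^ m * t ^ (Polynomial.degree (p j) - m)" by (simp flip: power_add)
        then show ?thesis using True by (simp add: c_def r_def poly_monom algebra_simps)
      next
        case False
        then show ?thesis by (simp add: c_def r_def)
      qed
    qed
    finally show ?thesis by (simp add: sum_subtractf)
  qed
  have cF: "c j \<in> F" if "j < N" for j
    unfolding c_def using F.mult[OF k.const_in_rat[OF ck[OF that]] F.power[OF k.gen_in_rat]] by simp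
  have z: "z \<in> Lz (int (e l) - 1)"
  proof (rule LzI)
    fix v assume v: "place k v" "v t \<ge> 0"
    have vt: "vge v 0 t" using v by (simp add: vge_def)
    have "vge v 0 (c j)" if "j < N" for j
      unfolding c_def using vge_cmult[OF v(1) ck[OF that] vge_power[OF v(1) vt]] by simp
    then have "vge v (0 + 0) (c j * \<omega> j)" if "j < N" for j
      using that by (intro vge_mult[OF v(1)] LzD(1)[OF \<omega>[OF that] v]) auto
    then show "vge v 0 z" unfolding z_def by (intro vge_sum[OF v(1)]) auto
  next
    fix v assume v: "place k v" "v t < 0"
    have "poly (r j) t * \<omega> j \<in> Lz (int D - 1)" if j: "j < N" for j
      using rd[OF j]
    proof
      assume "int (Polynomial.degree (r j)) + int (e j) \<le> int D - 1"
      then show ?thesis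
        by (rule Lz_mono[OF Lz_mult[OF Lz_poly[OF rk[OF j] order_refl] \<omega>[OF j]]])
    qed simp
    then have "(\<Sum>j<N. poly (r j) t * \<omega> j) \<in> Lz (int D - 1)" by (intro Lz_sum) auto
    moreover have "?y \<in> Lz (int D - 1)" by (rule Lz_mono[OF y]) (use Dn in simp)
    ultimately have "t ^ m * z \<in> Lz (int D - 1)" unfolding tm by (intro Lz_diff)
    then have "vge v ((int D - 1) * v t) (t ^ m * z)" by (rule LzD(2)[OF _ v])
    then show "vge v ((int (e l) - 1) * v t) z"
      using placeD(2)[OF v(1), of "t ^ m" z] t0 v_power[OF v(1) t0, of m] lD[symmetric]
      by (cases "z = 0") (auto simp: vge_def algebra_simps)
  qed
  have cl: "c l \<noteq> 0" "l < N" using l(1) t0 by (auto simp: c_def I_def J_def)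
  show False
    by (rule min_exchange[where \<omega> = \<omega> and e = e and c = c and i = l])
       (use b \<omega> min cF cl z in \<open>simp_all add: z_def\<close>)
qed

text \<open>Two counts of \<open>Lz E\<close> for the minimal total degree \<open>E\<close>: the
  reduced basis gives dimension at most \<open>N E + N - E\<close>, Riemann's inequality at least
  \<open>N E + 1 - genus\<close>.\<close>

lemma small_basis:
  obtains \<omega> e where "basis \<omega>" "\<And>i. i < N \<Longrightarrow> \<omega> i \<in> Lz (int (e i))" "int (\<Sum>i<N. e i) \<le> genus k + int N - 1"
proof -
  define E where "E = (LEAST E. gooddeg E)"
  have gE: "gooddeg E" unfolding E_def using ex_gooddeg by (rule LeastI_ex)
  obtain \<omega> e where b: "basis \<omega>" and \<omega>: "\<And>i. i < N \<Longrightarrow> \<omega> i \<in> Lz (int (e i))" and e: "(\<Sum>i<N. e i) = E"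
    using gE unfolding gooddeg_def by blast
  have min: "(\<Sum>i<N. e i) \<le> E'" if "gooddeg E'" for E' unfolding e E_def using that by (rule Least_le)
  have ei: "e i \<le> E" if "i < N" for i unfolding e[symmetric] using that by (intro member_le_sum) auto
  \<comment> \<open>Indices of the spanning elements \<open>t ^ q * \<omega> i\<close>; the bound
    \<open>E\<close> itself guarantees \<open>e i \<le> E\<close>, so no subtraction is
    truncated.\<close>
  define I where "I = Sigma {..<N} (\<lambda>i. {..E - e i})"
  have "kdim k (Lz (int E)) \<le> card I"
  proof (rule k.kdim_le_span(1))
    show "finite I" by (simp add: I_def)
    fix y assume y: "y \<in> Lz (int E)"
    obtain p where p: "\<And>i. i < N \<Longrightarrow> pol_over k (p i)" "y = (\<Sum>i<N. poly (p i) t * \<omega> i)"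
      using min_polynomial[OF b \<omega> min y] by blast
    have d: "Polynomial.degree (p i) \<le> E - e i" if i: "i < N" for i
    proof (cases "p i = 0")
      case False
      have "Polynomial.degree (p i) + e i \<le> E"
        by (rule min_degree[of \<omega> e p E i]) (use b \<omega> min p(1) i False y p(2) in auto)
      then show ?thesis by simp
    qed simp
    have "y = (\<Sum>i<N. \<Sum>q\<le>E - e i. Polynomial.coeff (p i) q * (t ^ q * \<omega> i))"
      unfolding p(2)
    proof (rule sum.cong[OF refl])
      fix i assume "i \<in> {..<N}"
      then have "poly (p i) t = (\<Sum>q\<le>E - e i. Polynomial.coeff (p i) q * t ^ q)"
        using d by (intro poly_eq_sum_atMost) auto
      then show "poly (p i) t * \<omega> i = (\<Sum>q\<le>E - e i. Polynomial.coeff (p i) q * (t ^ q * \<omega> i))"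
        by (simp add: sum_distrib_right mult.assoc)
    qed
    also have "\<dots> = (\<Sum>s\<in>I. Polynomial.coeff (p (fst s)) (snd s) * (t ^ snd s * \<omega> (fst s)))"
      unfolding I_def by (subst sum.Sigma) (auto simp: case_prod_beta)
    finally show "\<exists>a. (\<forall>i\<in>I. a i \<in> k) \<and> y = (\<Sum>i\<in>I. a i * (t ^ snd i * \<omega> (fst i)))"
      using p(1) by (intro exI[of _ "\<lambda>s. Polynomial.coeff (p (fst s)) (snd s)"]) (auto simp: I_def pol_over_def)
  qed
  moreover have "int (card I) = int N * int E + int N - int E"
  proof -
    have "int (card I) = (\<Sum>i<N. int (E - e i) + 1)" unfolding I_def by (simp add: add.commute)
    also have "\<dots> = (\<Sum>i<N. int E + 1 - int (e i))" by (rule sum.cong) (use ei in \<open>auto simp: of_nat_diff\<close>)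
    also have "\<dots> = int N * (int E + 1) - int E"
      by (simp add: sum_subtractf e[symmetric])
    finally show ?thesis by (simp add: algebra_simps)
  qed
  moreover have "int N * int E + 1 - int (kdim k (Lz (int E))) \<le> genus k"
  proof -
    have "div_deg (\<lambda>v. int E * poles t v) = int E * int N"
      by (simp add: div_deg_scale divisor_poles deg_poles[OF t])
    then show ?thesis
      using index_le_genus[OF divisor_scale[OF divisor_poles, of "int E" t]] by (simp add: Lz_eq mult.commute)
  qed
  ultimately have "int E \<le> genus k + int N - 1" by linarith
  then show thesis using that[OF b \<omega>] e by simp
qed

text \<open>A uniformizer of k(t) at the place below \<open>v\<close>; \<open>fib\<close> and
  \<open>ram\<close> are then the fibre and the ramification index of the covering given by
  \<open>t\<close>.\<close>

definition xi :: "('a \<Rightarrow> int) \<Rightarrow> 'a" where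
  "xi v = (if v t < 0 then inverse t else t - res v t)"

lemma xi:
  assumes v: "place k v"
  shows "xi v \<notin> k" "Kx (xi v) = F" "v (xi v) > 0"
    "place k w \<Longrightarrow> w (xi v) > 0 \<Longrightarrow> xi w = xi v" "v t < 0 \<Longrightarrow> place k w \<Longrightarrow> w (xi v) > 0 \<longleftrightarrow> w t < 0"
    "v t \<ge> 0 \<Longrightarrow> place k w \<Longrightarrow> w (xi v) > 0 \<Longrightarrow> w t \<ge> 0"
proof -
  have inf: "w (inverse t) > 0 \<longleftrightarrow> w t < 0" if "place k w" for w using v_inverse[OF that t0] by simp
  have fin: "w (t - a) > 0 \<longleftrightarrow> w t \<ge> 0 \<and> res w t = a" if w: "place k w" and a: "a \<in> k" for w a
  proof
    assume p: "w (t - a) > 0"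
    then have "vge w 1 (t - a)" by (simp add: vge_def)
    moreover have wt: "w t \<ge> 0" using v_t_diff[OF w _ a] p by fastforce
    ultimately show "w t \<ge> 0 \<and> res w t = a" using res_eqI[OF w _ a] by (simp add: vge_def)
  next
    assume p: "w t \<ge> 0 \<and> res w t = a"
    then have "vge w 1 (t - a)" using res(2)[OF w, of t] by (auto simp: vge_def)
    moreover have "t - a \<noteq> 0" using t a by auto
    ultimately show "w (t - a) > 0" by (simp add: vge_def)
  qed
  have r: "res v t \<in> k" if "v t \<ge> 0" using res(1)[OF v] that by (simp add: vge_def)
  show "xi v \<notin> k" using inverse_notin[OF t] diff_notin[OF t r] by (auto simp: xi_def)
  show "Kx (xi v) = F" using Kx_inverse Kx_diff[OF r] by (auto simp: xi_def)
  show "v (xi v) > 0" using inf[OF v] fin[OF v r] by (auto simp: xi_def)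
  show "place k w \<Longrightarrow> w (xi v) > 0 \<Longrightarrow> xi w = xi v" using inf[of w] fin[OF _ r, of w] by (auto simp: xi_def split: if_splits)
  show "v t < 0 \<Longrightarrow> place k w \<Longrightarrow> w (xi v) > 0 \<longleftrightarrow> w t < 0" using inf by (simp add: xi_def)
  show "v t \<ge> 0 \<Longrightarrow> place k w \<Longrightarrow> w (xi v) > 0 \<Longrightarrow> w t \<ge> 0" using fin[OF _ r] by (auto simp: xi_def)
qed

definition fib :: "('a \<Rightarrow> int) \<Rightarrow> ('a \<Rightarrow> int) set" where
  "fib v = {w \<in> places k. w (xi v) > 0}"

definition ram :: "('a \<Rightarrow> int) \<Rightarrow> int" where
  "ram v = v (xi v)"

lemma fib:
  assumes v: "place k v"
  shows "finite (fib v)" "v \<in> fib v" "(\<Sum>w\<in>fib v. ram w) = int N" "w \<in> fib v \<Longrightarrow> fib w = fib v" "w \<in> fib v \<Longrightarrow> place k w"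
    "w \<in> fib v \<Longrightarrow> ram w = w (xi v)"
proof -
  note x = xi[OF v]
  show "finite (fib v)" unfolding fib_def by (rule finite_zeros[OF x(1)])
  show "v \<in> fib v" using v x(3) by (simp add: fib_def places_def)
  show xw: "ram w = w (xi v)" if "w \<in> fib v" for w using x(4)[of w] that by (auto simp: fib_def places_def ram_def)
  have "(\<Sum>w\<in>fib v. ram w) = (\<Sum>w\<in>fib v. w (xi v))" using xw by (rule sum.cong[OF refl])
  then show "(\<Sum>w\<in>fib v. ram w) = int N" using zeros_sum[OF x(1)] x(2) by (simp add: fib_def)
  show "w \<in> fib v \<Longrightarrow> fib w = fib v" using x(4)[of w] by (auto simp: fib_def places_def)
  show "w \<in> fib v \<Longrightarrow> place k w" by (simp add: fib_def places_def)
qed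

lemma ram_pos: "place k v \<Longrightarrow> ram v \<ge> 1"
  using xi(3)[of v] by (simp add: ram_def)

text \<open>The order of \<open>dt\<close> at \<open>v\<close> is \<open>- dord v\<close>.\<close>

definition dord :: "('a \<Rightarrow> int) \<Rightarrow> int" where
  "dord v = (if v t < 0 then ram v + 1 else 1 - ram v)"

text \<open>One half of the Riemann-Hurwitz formula. Summing the local orders of the discriminant
  gives at most \<open>2 * E\<close> for the total of \<open>ram v - 1\<close>, with
  \<open>E \<le> genus k + N - 1\<close>, and the poles of \<open>t\<close> contribute
  \<open>2 * N\<close> to the sum of \<open>dord\<close>.\<close>

theorem ramification_bound:
  shows "finite {v \<in> places k. dord v \<noteq> 0}"
    and "finite S \<Longrightarrow> S \<subseteq> places k \<Longrightarrow> {v \<in> places k. dord v \<noteq> 0} \<subseteq> S \<Longrightarrow> (\<Sum>v\<in>S. dord v) \<ge> 2 - 2 * genus k"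
proof -
  obtain \<omega> e where b: "basis \<omega>" and \<omega>: "\<And>i. i < N \<Longrightarrow> \<omega> i \<in> Lz (int (e i))"
    and eg: "int (\<Sum>i<N. e i) \<le> genus k + int N - 1" using small_basis by blast
  define E where "E = int (\<Sum>i<N. e i)"
  define d where "d = disc \<omega>"
  have d0: "d \<noteq> 0" unfolding d_def by (rule disc_nonzero[OF b])
  have loc: "v d \<ge> ram v * (int N - int (card (fib v))) - (if v t < 0 then 2 * E * ram v else 0)" if v: "place k v" for v
  proof -
    note x = xi[OF v]
    interpret l: local_gen k t "xi v" by unfold_locales (use x in auto)
    have Z: "l.Z = fib v" by (simp add: l.Z_def fib_def)
    show ?thesis
    proof (cases "v t < 0")
      case False
      have "v d \<ge> v (xi v) * (int N - int (card l.Z))"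
        unfolding d_def
      proof (rule l.disc_local[OF b])
        fix i assume i: "i < N"
        show "l.integral (\<omega> i)"
          unfolding l.integral_def
        proof
          fix w assume "w \<in> l.Z"
          then have w: "place k w" "w (xi v) > 0" using l.Z by auto
          have "w t \<ge> 0" by (rule x(6)) (use False w in auto)
          then show "vge w 0 (\<omega> i)" by (rule LzD(1)[OF \<omega>[OF i] w(1)])
        qed
      qed (use fib(2)[OF v] Z in simp)
      then show ?thesis using False Z by (simp add: ram_def)
    next
      case True
      \<comment> \<open>Powers of \<open>1 / t\<close> make the basis integral at the poles of
        \<open>t\<close>; their effect on the discriminant is the correction
        \<open>2 * E * ram v\<close>.\<close>
      define c where "c = (\<lambda>i. inverse t ^ e i)"
      have cF: "c i \<in> F \<and> c i \<noteq> 0" for i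
        unfolding c_def using t0 k.gen_in_rat[of t] by auto
      have b': "basis (\<lambda>i. c i * \<omega> i)" by (rule basis_scale[OF b cF])
      have "v (disc (\<lambda>i. c i * \<omega> i)) \<ge> v (xi v) * (int N - int (card l.Z))"
      proof (rule l.disc_local[OF b'])
        fix i assume i: "i < N"
        show "l.integral (c i * \<omega> i)"
          unfolding l.integral_def
        proof
          fix w assume "w \<in> l.Z"
          then have w: "place k w" "w t < 0" using l.Z x(5)[OF True] by auto
          have "w (c i) = - (int (e i) * w t)"
            unfolding c_def using v_power[OF w(1), of "inverse t" "e i"] v_inverse[OF w(1) t0] t0 by simp
          then have "vge w (- (int (e i) * w t) + int (e i) * w t) (c i * \<omega> i)"
            by (intro vge_mult[OF w(1)] LzD(2)[OF \<omega>[OF i] w]) (simp add: vge_def)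
          then show "vge w 0 (c i * \<omega> i)" by simp
        qed
      qed (use fib(2)[OF v] Z in simp)
      moreover have "v (disc (\<lambda>i. c i * \<omega> i)) = v d + 2 * E * ram v"
      proof -
        have P: "(\<Prod>i<N. c i) = inverse t ^ (\<Sum>i<N. e i)" by (simp add: c_def power_sum)
        have "disc (\<lambda>i. c i * \<omega> i) = (inverse t ^ (\<Sum>i<N. e i)) ^ 2 * d"
          unfolding d_def P[symmetric] by (rule disc_scale) (use cF in blast)
        moreover have "v ((inverse t ^ (\<Sum>i<N. e i)) ^ 2) = 2 * (E * ram v)"
          using v_power[OF v, of "inverse t ^ (\<Sum>i<N. e i)" 2] v_power[OF v, of "inverse t" "\<Sum>i<N. e i"] t0 True
          by (simp add: E_def ram_def xi_def)
        moreover have "v ((inverse t ^ (\<Sum>i<N. e i)) ^ 2 * d) = v ((inverse t ^ (\<Sum>i<N. e i)) ^ 2) + v d"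
          by (rule placeD(2)[OF v]) (use t0 d0 in auto)
        ultimately show ?thesis by simp
      qed
      ultimately show ?thesis using True Z by (simp add: ram_def)
    qed
  qed
  have cardfib: "int N - int (card (fib v)) = (\<Sum>w\<in>fib v. ram w - 1)" if v: "place k v" for v
    using fib(3)[OF v] by (simp add: sum_subtractf)
  define S0 where "S0 = {v \<in> places k. v d \<noteq> 0} \<union> {v \<in> places k. v (inverse t) > 0}"
  have S0: "finite S0" "S0 \<subseteq> places k"
    using finite_support[OF d0] finite_zeros[OF inverse_notin[OF t]] by (auto simp: S0_def)
  define T0 where "T0 = (\<Union>v\<in>S0. fib v)"
  have T0: "finite T0" "T0 \<subseteq> places k"
    using S0 fib(1) by (auto simp: T0_def fib_def places_def)
  have pT0: "place k v" if "v \<in> T0" for v using T0 that by (auto simp: places_def)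
  have sat: "fib v \<subseteq> T0" if vT: "v \<in> T0" for v
  proof -
    obtain u where u: "u \<in> S0" "v \<in> fib u" using vT by (auto simp: T0_def)
    then have "place k u" using S0 by (auto simp: places_def)
    from fib(4)[OF this u(2)] show ?thesis using u(1) by (auto simp: T0_def)
  qed
  have S0T0: "S0 \<subseteq> T0" using S0 fib(2) by (auto simp: T0_def places_def)
  \<comment> \<open>Where \<open>t\<close> has no pole and the discriminant has order 0,
    \<open>loc\<close> leaves no room for ramification in the fibre.\<close>
  have unram: "ram v = 1 \<and> v t \<ge> 0" if v: "place k v" "v \<notin> T0" for v
  proof -
    have n: "v \<notin> S0" using v S0T0 by blast
    then have vt: "v t \<ge> 0" using v v_inverse[OF v(1) t0] by (auto simp: S0_def places_def)
    have "v d = 0" using n v by (auto simp: S0_def places_def)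
    then have "ram v * (\<Sum>w\<in>fib v. ram w - 1) \<le> 0" using loc[OF v(1)] vt cardfib[OF v(1)] by simp
    moreover have "ram v - 1 \<le> (\<Sum>w\<in>fib v. ram w - 1)"
      by (rule member_le_sum) (use fib(1,2,5)[OF v(1)] ram_pos in force)+
    ultimately have "ram v - 1 \<le> 0" using ram_pos[OF v(1)] by (smt (verit) mult_le_0_iff)
    then show ?thesis using ram_pos[OF v(1)] vt by simp
  qed
  have infT0: "{v \<in> T0. v t < 0} = {v \<in> places k. v (inverse t) > 0}"
  proof (intro equalityI subsetI)
    fix v assume "v \<in> {v \<in> T0. v t < 0}"
    then show "v \<in> {v \<in> places k. v (inverse t) > 0}" using T0(2) v_inverse[of v, OF pT0 t0] by auto
  next
    fix v assume v: "v \<in> {v \<in> places k. v (inverse t) > 0}"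
    then have "v \<in> T0" using S0T0 by (auto simp: S0_def)
    then show "v \<in> {v \<in> T0. v t < 0}" using v v_inverse[of v, OF pT0 t0] by auto
  qed
  have ram_inf: "(\<Sum>v\<in>{v \<in> T0. v t < 0}. ram v) = int N"
  proof -
    have "(\<Sum>v\<in>{v \<in> T0. v t < 0}. ram v) = (\<Sum>v\<in>{v \<in> T0. v t < 0}. v (inverse t))"
      by (rule sum.cong) (auto simp: ram_def xi_def)
    also have "\<dots> = (\<Sum>v\<in>{v \<in> places k. v (inverse t) > 0}. v (inverse t))" unfolding infT0 ..
    also have "\<dots> = int N" using zeros_sum[OF inverse_notin[OF t]] by (simp add: Kx_inverse)
    finally show ?thesis .
  qed
  have ram_sum: "(\<Sum>v\<in>T0. ram v - 1) \<le> 2 * E"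
  proof -
    have "0 = (\<Sum>v\<in>T0. v d)"
      by (rule product_formula[OF d0 T0, symmetric]) (use S0T0 in \<open>auto simp: S0_def\<close>)
    also have "\<dots> \<ge> (\<Sum>v\<in>T0. ram v * (\<Sum>w\<in>fib v. ram w - 1) - (if v t < 0 then 2 * E * ram v else 0))"
      by (rule sum_mono) (use loc cardfib pT0 in simp)
    also have "(\<Sum>v\<in>T0. ram v * (\<Sum>w\<in>fib v. ram w - 1) - (if v t < 0 then 2 * E * ram v else 0))
       = (\<Sum>v\<in>T0. ram v * (\<Sum>w\<in>fib v. ram w - 1)) - 2 * E * int N"
      unfolding sum_subtractf using T0(1) ram_inf
      by (simp add: sum.inter_filter[symmetric] sum_distrib_left[symmetric])
    \<comment> \<open>Being in the same fibre is symmetric and \<open>T0\<close> is a union of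
      fibres. Exchanging the sums and adding the ramification indices of each fibre to
      \<open>N\<close> produces a common factor \<open>N\<close>.\<close>
    also have "(\<Sum>v\<in>T0. ram v * (\<Sum>w\<in>fib v. ram w - 1)) = (\<Sum>v\<in>T0. \<Sum>w\<in>T0. if w \<in> fib v then ram v * (ram w - 1) else 0)"
    proof (rule sum.cong[OF refl])
      fix v assume v: "v \<in> T0"
      have "(\<Sum>w\<in>T0. if w \<in> fib v then ram v * (ram w - 1) else 0) = (\<Sum>w\<in>fib v. ram v * (ram w - 1))"
        using sat[OF v] T0(1) by (subst sum.inter_restrict[symmetric]) (auto intro!: sum.cong)
      then show "ram v * (\<Sum>w\<in>fib v. ram w - 1) = (\<Sum>w\<in>T0. if w \<in> fib v then ram v * (ram w - 1) else 0)"
        by (simp add: sum_distrib_left)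
    qed
    also have "\<dots> = (\<Sum>w\<in>T0. \<Sum>v\<in>T0. if w \<in> fib v then ram v * (ram w - 1) else 0)" by (rule sum.swap)
    also have "\<dots> = (\<Sum>w\<in>T0. (ram w - 1) * int N)"
    proof (rule sum.cong[OF refl])
      fix w assume w: "w \<in> T0"
      have "(\<Sum>v\<in>T0. if w \<in> fib v then ram v * (ram w - 1) else 0) = (\<Sum>v\<in>fib w. ram v * (ram w - 1))"
      proof -
        have "w \<in> fib v \<longleftrightarrow> v \<in> fib w" if "v \<in> T0" for v
          using fib(4)[OF pT0[OF that], of w] fib(4)[OF pT0[OF w], of v] fib(2)[OF pT0[OF that]] fib(2)[OF pT0[OF w]] by blast
        then have "(\<Sum>v\<in>T0. if w \<in> fib v then ram v * (ram w - 1) else 0) = (\<Sum>v\<in>T0. if v \<in> fib w then ram v * (ram w - 1) else 0)"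
          by (intro sum.cong) auto
        also have "\<dots> = (\<Sum>v\<in>fib w. ram v * (ram w - 1))"
          using sat[OF w] T0(1) by (subst sum.inter_restrict[symmetric]) (auto intro!: sum.cong)
        finally show ?thesis .
      qed
      also have "\<dots> = (ram w - 1) * int N"
        unfolding fib(3)[OF pT0[OF w], symmetric] by (simp add: sum_distrib_left mult.commute)
      finally show "(\<Sum>v\<in>T0. if w \<in> fib v then ram v * (ram w - 1) else 0) = (ram w - 1) * int N" .
    qed
    finally have "(\<Sum>w\<in>T0. ram w - 1) * int N \<le> 2 * E * int N" by (simp add: sum_distrib_right)
    then show ?thesis using N_pos by simp
  qed
  have sub: "{v \<in> places k. dord v \<noteq> 0} \<subseteq> T0"
    using unram by (force simp: dord_def places_def)
  then show "finite {v \<in> places k. dord v \<noteq> 0}" using T0(1) finite_subset by blast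
  show "(\<Sum>v\<in>S. dord v) \<ge> 2 - 2 * genus k" if S: "finite S" "S \<subseteq> places k" "{v \<in> places k. dord v \<noteq> 0} \<subseteq> S"
  proof -
    have "(\<Sum>v\<in>S. dord v) = (\<Sum>v\<in>{v \<in> places k. dord v \<noteq> 0}. dord v)"
      by (rule sum.mono_neutral_right) (use S in auto)
    also have "\<dots> = (\<Sum>v\<in>T0. dord v)"
      by (rule sum.mono_neutral_left) (use T0 sub in auto)
    also have "\<dots> = (\<Sum>v\<in>T0. (if v t < 0 then 2 * ram v else 0) - (ram v - 1))"
      by (rule sum.cong) (auto simp: dord_def)
    also have "\<dots> = 2 * int N - (\<Sum>v\<in>T0. ram v - 1)"
      unfolding sum_subtractf using T0(1) ram_inf
      by (simp add: sum.inter_filter[symmetric] sum_distrib_left[symmetric])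
    finally show ?thesis using ram_sum eg unfolding E_def by linarith
  qed
qed

end

section \<open>Local expansions and the derivation\<close>

context ffield
begin

definition un :: "('a \<Rightarrow> int) \<Rightarrow> 'a" where "un v = (SOME u. u \<noteq> 0 \<and> v u = 1)"

lemma un:
  assumes "place k v"
  shows "un v \<noteq> 0" "v (un v) = 1"
  using someI_ex[OF placeD(5)[OF assms]] unfolding un_def by auto

text \<open>Shifts the power series expansion in \<open>un v\<close> by one place: the residue is
  the constant coefficient, and iteration reads off the rest.\<close>

definition stp :: "('a \<Rightarrow> int) \<Rightarrow> 'a \<Rightarrow> 'a" where "stp v x = (x - res v x) / un v"

definition expn :: "('a \<Rightarrow> int) \<Rightarrow> 'a \<Rightarrow> 'a fps" where
  "expn v x = Abs_fps (\<lambda>n. res v ((stp v ^^ n) x))"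

lemma stp:
  assumes v: "place k v" and x: "vge v 0 x"
  shows "vge v 0 (stp v x)"
proof -
  have "vge v (- 1) (inverse (un v))" using un[OF v] v_inverse[OF v] by (simp add: vge_def)
  then have "vge v (1 + - 1) ((x - res v x) * inverse (un v))" by (rule vge_mult[OF v res(2)[OF v x]])
  then show ?thesis by (simp add: stp_def divide_inverse)
qed

lemma expn_0: "expn v x $ 0 = res v x"
  by (simp add: expn_def)

lemma expn_Suc: "expn v x $ Suc n = expn v (stp v x) $ n"
  by (simp add: expn_def funpow_Suc_right del: funpow.simps)

lemma expn_add:
  assumes v: "place k v" and "vge v 0 x" "vge v 0 y"
  shows "expn v (x + y) = expn v x + expn v y"
proof (rule fps_ext)
  fix n show "expn v (x + y) $ n = (expn v x + expn v y) $ n"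
    using assms(2,3)
  proof (induction n arbitrary: x y)
    case 0
    then show ?case by (simp add: expn_0 res_add[OF v])
  next
    case (Suc n)
    have "stp v (x + y) = stp v x + stp v y"
      by (simp add: stp_def res_add[OF v Suc.prems] add_divide_distrib diff_divide_distrib)
    then show ?case using Suc stp[OF v] by (simp add: expn_Suc)
  qed
qed

lemma expn_cmult:
  assumes v: "place k v" and c: "c \<in> k" and "vge v 0 x"
  shows "expn v (c * x) $ n = c * expn v x $ n"
  using assms(3)
proof (induction n arbitrary: x)
  case 0
  then show ?case by (simp add: expn_0 res_mult[OF v vge_const[OF v c]] res_const[OF v c])
next
  case (Suc n)
  have "stp v (c * x) = c * stp v x"
    by (simp add: stp_def res_mult[OF v vge_const[OF v c] Suc.prems] res_const[OF v c] right_diff_distrib)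
  then show ?case using Suc stp[OF v] by (simp add: expn_Suc)
qed

lemma fps_shift_decomp: "f = fps_const (f $ 0) + fps_X * fps_shift 1 (f :: 'b::comm_ring_1 fps)"
  by (rule fps_ext) (auto simp: fps_mult_fps_X_nonzero gr0_conv_Suc split: nat.splits)

lemma expn_mult:
  assumes v: "place k v" and "vge v 0 x" "vge v 0 y"
  shows "expn v (x * y) = expn v x * expn v y"
proof (rule fps_ext)
  fix n show "expn v (x * y) $ n = (expn v x * expn v y) $ n"
    using assms(2,3)
  proof (induction n arbitrary: x y)
    case 0
    then show ?case by (simp add: expn_0 res_mult[OF v])
  next
    case (Suc n)
    have r: "res v x \<in> k" by (rule res(1)[OF v Suc.prems(1)])
    \<comment> \<open>The twisted product rule of the shift; it matches the decomposition of a
      series into constant term and shifted series.\<close>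
    have "stp v (x * y) = stp v x * y + res v x * stp v y"
      using un(1)[OF v] by (simp add: stp_def res_mult[OF v Suc.prems] field_simps)
    moreover have "vge v 0 (stp v x * y)" using vge_mult[OF v stp[OF v Suc.prems(1)] Suc.prems(2)] by simp
    moreover have "vge v 0 (res v x * stp v y)" by (rule vge_cmult[OF v r stp[OF v Suc.prems(2)]])
    ultimately have "expn v (x * y) $ Suc n = expn v (stp v x * y) $ n + res v x * expn v (stp v y) $ n"
      using expn_cmult[OF v r stp[OF v Suc.prems(2)], of n] by (simp add: expn_Suc expn_add[OF v])
    also have "expn v (stp v x * y) $ n = (expn v (stp v x) * expn v y) $ n"
      by (rule Suc.IH[OF stp[OF v Suc.prems(1)] Suc.prems(2)])
    also have "expn v (stp v x) = fps_shift 1 (expn v x)"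
      by (rule fps_ext) (simp add: expn_Suc)
    also have "(fps_shift 1 (expn v x) * expn v y) $ n + res v x * expn v (stp v y) $ n
      = (fps_X * (fps_shift 1 (expn v x) * expn v y) + fps_const (res v x) * expn v y) $ Suc n"
      by (simp add: expn_Suc fps_mult_fps_X_nonzero)
    also have "fps_X * (fps_shift 1 (expn v x) * expn v y) + fps_const (res v x) * expn v y
       = (fps_const (expn v x $ 0) + fps_X * fps_shift 1 (expn v x)) * expn v y"
      by (simp add: expn_0 algebra_simps)
    also have "\<dots> = expn v x * expn v y" by (simp only: fps_shift_decomp[symmetric])
    finally show ?case .
  qed
qed

lemma expn_const:
  assumes v: "place k v" and c: "c \<in> k"
  shows "expn v c = fps_const c"
proof (rule fps_ext)
  have s0: "stp v 0 = 0" using res_const[OF v k.zero] by (simp add: stp_def)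
  have 0: "expn v 0 $ n = 0" for n
    by (induction n) (auto simp: expn_0 expn_Suc s0 res_const[OF v k.zero])
  have "stp v c = 0" using res_const[OF v c] by (simp add: stp_def)
  then show "expn v c $ n = fps_const c $ n" for n
    by (cases n) (auto simp: expn_0 expn_Suc res_const[OF v c] 0)
qed

lemma expn_un:
  assumes v: "place k v"
  shows "expn v (un v) = fps_X"
proof (rule fps_ext)
  have r: "res v (un v) = 0"
    by (rule res_eqI[OF v]) (use un[OF v] in \<open>auto simp: vge_def\<close>)
  then have s: "stp v (un v) = 1" using un[OF v] by (simp add: stp_def)
  show "expn v (un v) $ n = fps_X $ n" for n
  proof (cases n)
    case (Suc m)
    have "expn v 1 $ m = (fps_const 1 :: 'a fps) $ m" using expn_const[OF v k.one] by simp
    then show ?thesis by (simp add: Suc expn_Suc s fps_X_def)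
  qed (simp add: expn_0 r)
qed

lemma expn_un_power:
  assumes v: "place k v"
  shows "expn v (un v ^ n) = fps_X ^ n"
proof (induction n)
  case 0
  then show ?case using expn_const[OF v k.one] by simp
next
  case (Suc n)
  have "vge v 0 (un v)" using un[OF v] by (simp add: vge_def)
  then show ?case using Suc vge_power[OF v, of 0 "un v" n] by (simp add: expn_mult[OF v] expn_un[OF v])
qed

text \<open>The pole is cleared by a power of the uniformizer that is divided out again among
  Laurent series. By \<open>emb_eq\<close> any sufficient exponent gives the same value, which is
  what additivity and multiplicativity rest on.\<close>

definition emb :: "('a \<Rightarrow> int) \<Rightarrow> 'a \<Rightarrow> 'a fls" where
  "emb v x = fps_to_fls (expn v (x * un v ^ nat (- v x))) / fls_X ^ nat (- v x)"

lemma vge_un_power: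
  assumes v: "place k v"
  shows "vge v (int n) (un v ^ n)"
  using vge_power[OF v, of 1 "un v" n] un[OF v] by (simp add: vge_def)

lemma emb_eq:
  assumes v: "place k v" and x: "vge v 0 (x * un v ^ m)"
  shows "emb v x = fps_to_fls (expn v (x * un v ^ m)) / fls_X ^ m"
proof (cases "x = 0")
  case True
  then show ?thesis using expn_const[OF v k.zero] by (simp add: emb_def)
next
  case False
  define n where "n = nat (- v x)"
  have "v (x * un v ^ m) = v x + int m"
    using placeD(2)[OF v False, of "un v ^ m"] un[OF v] v_power[OF v, of "un v" m] by simp
  then have nm: "n \<le> m" using x False un[OF v] by (auto simp: vge_def n_def)
  have "v (x * un v ^ n) = v x + int n"
    using placeD(2)[OF v False, of "un v ^ n"] un[OF v] v_power[OF v, of "un v" n] by simp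
  then have xn: "vge v 0 (x * un v ^ n)" by (simp add: vge_def n_def)
  have e1: "x * un v ^ m = (x * un v ^ n) * un v ^ (m - n)" using nm by (simp add: mult.assoc flip: power_add)
  have u1: "vge v 0 (un v ^ (m - n))" using vge_un_power[OF v, of "m - n"] by (rule vge_mono) simp
  have "expn v (x * un v ^ m) = expn v (x * un v ^ n) * fps_X ^ (m - n)"
    unfolding e1 expn_mult[OF v xn u1] expn_un_power[OF v] ..
  then have "fps_to_fls (expn v (x * un v ^ m)) = fps_to_fls (expn v (x * un v ^ n)) * fls_X ^ (m - n)"
    by (simp add: fls_times_fps_to_fls fps_to_fls_power)
  moreover have "(fls_X :: 'a fls) ^ m = fls_X ^ n * fls_X ^ (m - n)" using nm by (simp flip: power_add)
  ultimately show ?thesis by (simp add: emb_def n_def)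
qed

lemma ex_clear:
  assumes v: "place k v"
  shows "\<exists>m0. \<forall>m\<ge>m0. vge v 0 (x * un v ^ m)"
proof -
  have "vge v (v x + int m) (x * un v ^ m)" for m
    by (rule vge_mult[OF v vge_refl vge_un_power[OF v]])
  then have "vge v 0 (x * un v ^ m)" if "m \<ge> nat (- v x)" for m by (rule vge_mono) (use that in simp)
  then show ?thesis by blast
qed

lemma emb_add:
  assumes v: "place k v"
  shows "emb v (x + y) = emb v x + emb v y"
proof -
  obtain m where m: "vge v 0 (x * un v ^ m)" "vge v 0 (y * un v ^ m)"
    using ex_clear[OF v, of x] ex_clear[OF v, of y] by (meson le_cases order_trans)
  have xy: "vge v 0 ((x + y) * un v ^ m)" unfolding distrib_right by (rule vge_add[OF v m])
  show ?thesis
    unfolding emb_eq[OF v xy] emb_eq[OF v m(1)] emb_eq[OF v m(2)] distrib_right expn_add[OF v m]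
      fps_to_fls_plus add_divide_distrib ..
qed

lemma emb_mult:
  assumes v: "place k v"
  shows "emb v (x * y) = emb v x * emb v y"
proof -
  obtain m n where m: "vge v 0 (x * un v ^ m)" "vge v 0 (y * un v ^ n)"
    using ex_clear[OF v, of x] ex_clear[OF v, of y] by blast
  have e: "x * y * un v ^ (m + n) = (x * un v ^ m) * (y * un v ^ n)" by (simp add: power_add mult_ac)
  have xy: "vge v 0 (x * y * un v ^ (m + n))" unfolding e using vge_mult[OF v m] by simp
  have "emb v (x * y) = fps_to_fls (expn v (x * un v ^ m) * expn v (y * un v ^ n)) / fls_X ^ (m + n)"
    unfolding emb_eq[OF v xy] unfolding e expn_mult[OF v m] ..
  also have "\<dots> = emb v x * emb v y"
    unfolding emb_eq[OF v m(1)] emb_eq[OF v m(2)] fls_times_fps_to_fls power_add times_divide_times_eq ..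
  finally show ?thesis .
qed

lemma emb_const:
  assumes v: "place k v" and c: "c \<in> k"
  shows "emb v c = fls_const c"
proof -
  have "emb v c = fps_to_fls (fps_const c)" using emb_eq[OF v, of c 0] vge_const[OF v c] expn_const[OF v c] by simp
  also have "\<dots> = fls_const c" by (intro fls_eqI) auto
  finally show ?thesis .
qed

lemma emb_0 [simp]: "place k v \<Longrightarrow> emb v 0 = 0"
  using emb_const[of v 0] by simp

lemma emb_1 [simp]: "place k v \<Longrightarrow> emb v 1 = 1"
  using emb_const[of v 1] by simp

lemma emb_sum: "place k v \<Longrightarrow> emb v (sum f I) = (\<Sum>i\<in>I. emb v (f i))"
  by (induction I rule: infinite_finite_induct) (auto simp: emb_add)

lemma emb_un: "place k v \<Longrightarrow> emb v (un v) = fls_X"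
  using emb_eq[of v "un v" 0] un[of v] expn_un[of v] by (simp add: vge_def)

lemma emb_power: "place k v \<Longrightarrow> emb v (x ^ n) = emb v x ^ n"
  by (induction n) (auto simp: emb_mult)

lemma emb_nonzero: "place k v \<Longrightarrow> x \<noteq> 0 \<Longrightarrow> emb v x \<noteq> 0"
  using emb_mult[of v x "inverse x"] by auto

lemma emb_inverse: "place k v \<Longrightarrow> x \<noteq> 0 \<Longrightarrow> emb v (inverse x) = inverse (emb v x)"
  using emb_mult[of v x "inverse x"] by (metis emb_1 inverse_unique right_inverse)

lemma emb_uminus: "place k v \<Longrightarrow> emb v (- x) = - emb v x"
  using emb_add[of v x "- x"] by (simp add: eq_neg_iff_add_eq_0 add.commute)

lemma emb_inj: "place k v \<Longrightarrow> emb v x = emb v y \<Longrightarrow> x = y"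
  using emb_nonzero[of v "x - y"] emb_add[of v x "- y"] emb_uminus[of v y] by auto

lemma emb_unit:
  assumes v: "place k v" and x: "v x = 0" "x \<noteq> 0"
  shows "fls_subdegree (emb v x) = 0"
proof -
  have xi: "vge v 0 x" using x by (simp add: vge_def)
  have "res v x \<noteq> 0"
  proof
    assume "res v x = 0"
    then show False using res(2)[OF v xi] x by (simp add: vge_def)
  qed
  moreover have "emb v x = fps_to_fls (expn v x)" using emb_eq[OF v, of x 0] xi by simp
  ultimately show ?thesis by (intro fls_subdegree_eqI) (auto simp: expn_0)
qed

lemma emb_subdegree:
  assumes v: "place k v" and x: "x \<noteq> 0"
  shows "fls_subdegree (emb v x) = v x"
proof -
  obtain m :: nat where m: "v x + int m \<ge> 0" using that[of "nat (- v x)"] by simp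
  define n where "n = nat (v x + int m)"
  define u where "u = x * un v ^ m / un v ^ n"
  have un0: "un v ^ j \<noteq> 0" for j using un[OF v] by simp
  have vu: "v u = 0" "u \<noteq> 0"
    using placeD(2)[OF v x un0, of m] v_divide[OF v _ un0, of "x * un v ^ m" n] x un0 v_power[OF v un(1)[OF v]] un[OF v] m
    by (auto simp: u_def n_def)
  have "x * un v ^ m = u * un v ^ n" using un0 by (simp add: u_def)
  then have "emb v x * fls_X ^ m = emb v u * fls_X ^ n"
    by (metis emb_mult[OF v] emb_power[OF v] emb_un[OF v])
  then have "fls_subdegree (emb v x) + int m = fls_subdegree (emb v u) + int n"
    by (metis fls_subdegree_mult_fls_X_power(2) emb_nonzero[OF v] x vu(2))
  then show ?thesis using emb_unit[OF v vu] m by (simp add: n_def)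
qed

lemma emb_deriv_order:
  assumes v: "place k v" and x: "v x \<noteq> 0"
  shows "fls_deriv (emb v x) \<noteq> 0" "fls_subdegree (fls_deriv (emb v x)) = v x - 1"
proof -
  have x0: "x \<noteq> 0" using x placeD(1)[OF v] by auto
  have s: "fls_subdegree (emb v x) \<noteq> 0" using emb_subdegree[OF v x0] x by simp
  then show "fls_subdegree (fls_deriv (emb v x)) = v x - 1"
    using fls_subdegree_deriv[OF s] emb_subdegree[OF v x0] by simp
  show "fls_deriv (emb v x) \<noteq> 0"
  proof
    assume "fls_deriv (emb v x) = 0"
    then have "emb v x = fls_const (fls_nth (emb v x) 0)" by (simp only: fls_deriv_eq_0_iff)
    then have "fls_subdegree (emb v x) = 0" by (metis fls_const_subdegree)
    then show False using s by simp
  qed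
qed

text \<open>Subtracting the residue makes the order nonzero, and in characteristic zero the
  derivative then keeps its leading term.\<close>

lemma emb_deriv_nonzero:
  assumes v: "place k v" and x: "x \<notin> k"
  shows "fls_deriv (emb v x) \<noteq> 0"
proof (cases "v x = 0")
  case False
  then show ?thesis by (rule emb_deriv_order(1)[OF v])
next
  case True
  then have xi: "vge v 0 x" by (simp add: vge_def)
  define y where "y = x - res v x"
  have y0: "y \<noteq> 0" using x res(1)[OF v xi] by (auto simp: y_def)
  then have "v y \<noteq> 0" using res(2)[OF v xi] by (auto simp: y_def vge_def)
  then have "fls_deriv (emb v y) \<noteq> 0" by (rule emb_deriv_order(1)[OF v])
  moreover have "emb v x = emb v y + fls_const (res v x)"
    using emb_add[OF v, of y "res v x"] emb_const[OF v res(1)[OF v xi]] by (simp add: y_def)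
  ultimately show ?thesis by simp
qed

end

section \<open>The derivation d/dt\<close>

context ffield_gen
begin

text \<open>Encodes dx = y dt, tested on the expansions at all places at once. Existence of
  \<open>y\<close> is a theorem (\<open>ex_is_der\<close>), and orders of derivatives can be read
  off from the expansions.\<close>

definition is_der :: "'a \<Rightarrow> 'a \<Rightarrow> bool" where
  "is_der x y \<longleftrightarrow> (\<forall>v. place k v \<longrightarrow> fls_deriv (emb v x) = emb v y * fls_deriv (emb v t))"

lemma is_der_add: "is_der x y \<Longrightarrow> is_der x' y' \<Longrightarrow> is_der (x + x') (y + y')"
  unfolding is_der_def by (simp add: emb_add distrib_right)

lemma is_der_mult: "is_der x y \<Longrightarrow> is_der x' y' \<Longrightarrow> is_der (x * x') (x * y' + y * x')"
  unfolding is_der_def by (simp add: emb_add emb_mult algebra_simps)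

lemma is_der_const: "c \<in> k \<Longrightarrow> is_der c 0"
  unfolding is_der_def by (simp add: emb_const)

lemma is_der_t: "is_der t 1"
  unfolding is_der_def by simp

lemma is_der_sum: "(\<And>i. i \<in> I \<Longrightarrow> is_der (f i) (g i)) \<Longrightarrow> is_der (sum f I) (sum g I)"
  by (induction I rule: infinite_finite_induct) (auto intro: is_der_add is_der_const)

lemma is_der_inverse:
  assumes x: "is_der x y" and x0: "x \<noteq> 0"
  shows "is_der (inverse x) (- (inverse x * inverse x * y))"
  unfolding is_der_def
proof (intro allI impI)
  fix v assume v: "place k v"
  have e0: "emb v x \<noteq> 0" by (rule emb_nonzero[OF v x0])
  have "fls_deriv (emb v x * emb v (inverse x)) = 0" using x0 v by (simp flip: emb_mult[OF v])
  then have "emb v x * fls_deriv (emb v (inverse x)) = - (fls_deriv (emb v x) * emb v (inverse x))"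
    by (simp add: eq_neg_iff_add_eq_0)
  also have "\<dots> = - (emb v y * fls_deriv (emb v t) * inverse (emb v x))"
    using x v by (simp add: is_der_def emb_inverse[OF v x0])
  finally have e: "emb v x * fls_deriv (emb v (inverse x)) = - (emb v y * fls_deriv (emb v t) * inverse (emb v x))" .
  have gen: "a * - (b * c * a) = - (a * a * b) * c" for a b c :: "'a fls" by (simp add: algebra_simps)
  have "fls_deriv (emb v (inverse x)) = inverse (emb v x) * (emb v x * fls_deriv (emb v (inverse x)))"
    unfolding mult.assoc[symmetric] left_inverse[OF e0] mult_1_left ..
  also have "\<dots> = - (inverse (emb v x) * inverse (emb v x) * emb v y) * fls_deriv (emb v t)"
    unfolding e by (rule gen)
  also have "\<dots> = emb v (- (inverse x * inverse x * y)) * fls_deriv (emb v t)"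
    by (simp only: emb_uminus[OF v] emb_mult[OF v] emb_inverse[OF v x0])
  finally show "fls_deriv (emb v (inverse x)) = emb v (- (inverse x * inverse x * y)) * fls_deriv (emb v t)" .
qed

lemma subfield_diff: "subfield {x. \<exists>y. is_der x y}"
  unfolding subfield_def
proof (intro conjI ballI)
  show "0 \<in> {x. \<exists>y. is_der x y}" "1 \<in> {x. \<exists>y. is_der x y}" using is_der_const by auto
  fix x assume "x \<in> {x. \<exists>y. is_der x y}"
  then obtain x' where x: "is_der x x'" by blast
  have "is_der (- 1 * x) (- 1 * x' + 0 * x)" by (rule is_der_mult[OF is_der_const x]) auto
  then show "- x \<in> {x. \<exists>y. is_der x y}" by auto
  show "inverse x \<in> {x. \<exists>y. is_der x y}"
    using is_der_inverse[OF x] is_der_const[OF k.zero] by (cases "x = 0") auto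
  fix y assume "y \<in> {x. \<exists>y. is_der x y}"
  then obtain y' where y: "is_der y y'" by blast
  show "x + y \<in> {x. \<exists>y. is_der x y}" "x * y \<in> {x. \<exists>y. is_der x y}"
    using is_der_add[OF x y] is_der_mult[OF x y] by blast+
qed

lemma F_is_der: "x \<in> F \<Longrightarrow> \<exists>y. is_der x y"
  using k.rat_fun_field_min[OF subfield_diff, of t] is_der_const is_der_t by blast

text \<open>The derivative of an algebraic element is read off from its minimal polynomial over \<open>k(t)\<close>,
  simultaneously at all places.\<close>

lemma ex_is_der: "\<exists>y. is_der x y"
proof -
  define A where "A = {p. pol_over F p \<and> p \<noteq> 0 \<and> poly p x = 0}"
  have "\<not> lin_nondeg_over F {..N} (\<lambda>i. x ^ i)"
    using kdim_ge[OF fin_dim_Kx[OF t], of "{..N}" "\<lambda>i. x ^ i"] by auto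
  then obtain a i0 where a: "\<forall>i\<in>{..N}. a i \<in> F" "(\<Sum>i\<le>N. a i * x ^ i) = 0" "i0 \<le> N" "a i0 \<noteq> 0"
    unfolding lin_nondeg_over_def by auto
  define p0 where "p0 = (\<Sum>i\<le>N. Polynomial.monom (a i) i)"
  have "Polynomial.coeff p0 i0 = a i0" using a(3) by (simp add: p0_def coeff_sum)
  then have "p0 \<in> A" unfolding A_def
    using a by (auto simp: p0_def poly_sum poly_monom intro!: F.pol_sum F.pol_monom)
  then obtain p where p: "p \<in> A" and min: "\<And>q. q \<in> A \<Longrightarrow> Polynomial.degree p \<le> Polynomial.degree q"
    using ex_has_least_nat[of "\<lambda>p. p \<in> A" p0 Polynomial.degree] by auto
  have pF: "pol_over F p" and p0: "p \<noteq> 0" and px: "poly p x = 0" using p by (auto simp: A_def)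
  have d: "Polynomial.degree p \<noteq> 0"
  proof
    assume "Polynomial.degree p = 0"
    then obtain c where "p = [:c:]" by (rule degree_eq_zeroE)
    then show False using p0 px by simp
  qed
  \<comment> \<open>Separability: in characteristic zero \<open>pderiv p\<close> is nonzero of
    smaller degree, so minimality of \<open>p\<close> excludes \<open>x\<close> as a root.\<close>
  have dpx: "poly (pderiv p) x \<noteq> 0"
  proof
    assume "poly (pderiv p) x = 0"
    moreover have "pderiv p \<noteq> 0" using d by (simp add: pderiv_eq_0_iff)
    ultimately have "pderiv p \<in> A" using F.pol_pderiv[OF pF] by (simp add: A_def)
    from min[OF this] show False using d by (simp add: degree_pderiv)
  qed
  define n where "n = Polynomial.degree p"
  have "\<exists>b. is_der (Polynomial.coeff p i) b" for i using F_is_der pF by (simp add: pol_over_def)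
  then obtain b where b: "\<And>i. is_der (Polynomial.coeff p i) (b i)" by metis
  define y where "y = - (\<Sum>i\<le>n. b i * x ^ i) / poly (pderiv p) x"
  have "is_der x y"
    unfolding is_der_def
  proof (intro allI impI)
    fix v assume v: "place k v"
    have "0 = fls_deriv (emb v (poly p x))" using px v by simp
    also have "\<dots> = (\<Sum>i\<le>n. fls_deriv (emb v (Polynomial.coeff p i) * emb v x ^ i))"
      by (simp add: poly_altdef n_def emb_sum[OF v] emb_mult[OF v] emb_power[OF v] fls_deriv_sum del: fls_deriv_mult)
    also have "\<dots> = (\<Sum>i\<le>n. emb v (b i * x ^ i) * fls_deriv (emb v t) +
        emb v (Polynomial.coeff p i * (of_nat i * x ^ (i - 1))) * fls_deriv (emb v x))"
    proof (rule sum.cong[OF refl])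
      fix i
      have c: "emb v (of_nat i) = of_nat i" using emb_const[OF v k.of_nat[of i]] by (simp add: fls_of_nat)
      have "fls_deriv (emb v x ^ i) = of_nat i * emb v x ^ (i - 1) * fls_deriv (emb v x)"
        by (simp add: fls_deriv_power)
      then show "fls_deriv (emb v (Polynomial.coeff p i) * emb v x ^ i) = emb v (b i * x ^ i) * fls_deriv (emb v t) +
        emb v (Polynomial.coeff p i * (of_nat i * x ^ (i - 1))) * fls_deriv (emb v x)"
        using b[of i] v by (simp add: is_der_def emb_mult[OF v] emb_power[OF v] c algebra_simps)
    qed
    also have "\<dots> = emb v (\<Sum>i\<le>n. b i * x ^ i) * fls_deriv (emb v t) + emb v (poly (pderiv p) x) * fls_deriv (emb v x)"
    proof -
      have "poly (pderiv p) x = (\<Sum>i\<le>n. Polynomial.coeff p i * (of_nat i * x ^ (i - 1)))"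
      proof -
        have nS: "n = Suc (n - 1)" using d by (simp add: n_def)
        have "poly (pderiv p) x = (\<Sum>i\<le>n - 1. Polynomial.coeff (pderiv p) i * x ^ i)"
          by (rule poly_eq_sum_atMost) (simp add: degree_pderiv n_def)
        also have "\<dots> = (\<Sum>i\<le>n - 1. Polynomial.coeff p (Suc i) * (of_nat (Suc i) * x ^ (Suc i - 1)))"
          by (rule sum.cong) (auto simp: coeff_pderiv mult_ac)
        also have "\<dots> = (\<Sum>i\<le>Suc (n - 1). Polynomial.coeff p i * (of_nat i * x ^ (i - 1)))"
          by (subst sum.atMost_Suc_shift) simp
        finally show ?thesis unfolding nS[symmetric] .
      qed
      then show ?thesis by (simp add: sum.distrib sum_distrib_right emb_sum[OF v])
    qed
    finally have e: "emb v (poly (pderiv p) x) * fls_deriv (emb v x) = - (emb v (\<Sum>i\<le>n. b i * x ^ i) * fls_deriv (emb v t))"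
      by (simp add: eq_neg_iff_add_eq_0 add.commute)
    have "poly (pderiv p) x * y = - (\<Sum>i\<le>n. b i * x ^ i)" using dpx by (simp add: y_def)
    then have "emb v (poly (pderiv p) x) * emb v y = - emb v (\<Sum>i\<le>n. b i * x ^ i)"
      by (metis emb_mult[OF v] emb_uminus[OF v])
    then have "emb v (poly (pderiv p) x) * (emb v y * fls_deriv (emb v t)) = - (emb v (\<Sum>i\<le>n. b i * x ^ i) * fls_deriv (emb v t))"
      by (simp add: mult.assoc[symmetric])
    then have "emb v (poly (pderiv p) x) * fls_deriv (emb v x) = emb v (poly (pderiv p) x) * (emb v y * fls_deriv (emb v t))"
      using e by simp
    then show "fls_deriv (emb v x) = emb v y * fls_deriv (emb v t)"
      using emb_nonzero[OF v dpx] by simp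
  qed
  then show ?thesis by blast
qed

definition der :: "'a \<Rightarrow> 'a" where "der x = (SOME y. is_der x y)"

lemma der: "is_der x (der x)"
  unfolding der_def by (rule someI_ex[OF ex_is_der])

lemma der_eqI:
  assumes "is_der x y"
  shows "der x = y"
proof -
  obtain v where v: "place k v" "v t > 0" using ex_zero[OF t] by blast
  have "emb v (der x) * fls_deriv (emb v t) = emb v y * fls_deriv (emb v t)"
    using der[of x] assms v(1) unfolding is_der_def by metis
  then have "emb v (der x) = emb v y" using emb_deriv_nonzero[OF v(1) t] by simp
  then show ?thesis by (rule emb_inj[OF v(1)])
qed

lemma der_mult: "der (x * y) = x * der y + der x * y"
  by (intro der_eqI is_der_mult der)

lemma der_const: "c \<in> k \<Longrightarrow> der c = 0"
  by (intro der_eqI is_der_const)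

lemma der_cmult: "c \<in> k \<Longrightarrow> der (c * x) = c * der x"
  by (simp add: der_mult der_const)

lemma der_sum: "der (sum f I) = (\<Sum>i\<in>I. der (f i))"
  by (intro der_eqI is_der_sum der)

lemma der_0 [simp]: "der 0 = 0"
  by (rule der_const) simp

lemma der_eq_0D:
  assumes "der x = 0"
  shows "x \<in> k"
proof (rule ccontr)
  assume x: "x \<notin> k"
  obtain v where v: "place k v" "v t > 0" using ex_zero[OF t] by blast
  have "fls_deriv (emb v x) = 0" using der[of x] assms v(1) unfolding is_der_def by simp
  then show False using emb_deriv_nonzero[OF v(1) x] by simp
qed

lemma subdegree_dt:
  assumes v: "place k v"
  shows "fls_subdegree (fls_deriv (emb v t)) = - dord v"
proof (cases "v t < 0")
  case True
  then show ?thesis using emb_deriv_order(2)[OF v, of t] v_inverse[OF v t0] by (simp add: dord_def ram_def xi_def)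
next
  case False
  have r: "res v t \<in> k" using res(1)[OF v, of t] False by (simp add: vge_def)
  have "v (t - res v t) > 0" using xi(3)[OF v] False by (simp add: xi_def)
  then have "fls_subdegree (fls_deriv (emb v (t - res v t))) = v (t - res v t) - 1"
    by (intro emb_deriv_order(2)[OF v]) simp
  moreover have "emb v t = emb v (t - res v t) + fls_const (res v t)"
    using emb_add[OF v, of "t - res v t" "res v t"] emb_const[OF v r] by simp
  ultimately show ?thesis using False by (simp add: dord_def ram_def xi_def)
qed

text \<open>dx has order at least \<open>n - 1\<close>, and dt has order
  \<open>- dord v\<close>.\<close>

lemma vge_der:
  assumes v: "place k v" and x: "vge v n x"
  shows "vge v (n - 1 + dord v) (der x)"
proof (cases "der x = 0")
  case False
  then have x0: "x \<noteq> 0" by auto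
  have e: "fls_deriv (emb v x) = emb v (der x) * fls_deriv (emb v t)" using der v unfolding is_der_def by blast
  have n0: "fls_deriv (emb v x) \<noteq> 0" unfolding e using emb_nonzero[OF v False] emb_deriv_nonzero[OF v t] by simp
  have "fls_subdegree (fls_deriv (emb v x)) = v (der x) - dord v"
    unfolding e using emb_nonzero[OF v False] emb_deriv_nonzero[OF v t]
    by (simp add: emb_subdegree[OF v False] subdegree_dt[OF v])
  moreover have "fls_subdegree (fls_deriv (emb v x)) \<ge> v x - 1"
    by (rule fls_subdegree_geI[OF n0]) (simp add: emb_subdegree[OF v x0, symmetric])
  ultimately show ?thesis using x x0 by (simp add: vge_def)
qed simp

lemma der_un:
  assumes v: "place k v"
  shows "der (un v) \<noteq> 0" "v (der (un v)) = dord v"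
proof -
  have e: "1 = emb v (der (un v)) * fls_deriv (emb v t)"
    using der[of "un v"] v unfolding is_der_def by (metis emb_un[OF v] fls_deriv_X)
  then show d0: "der (un v) \<noteq> 0" using v by auto
  have "fls_subdegree (1 :: 'a fls) = v (der (un v)) - dord v"
    unfolding e using emb_nonzero[OF v d0] emb_deriv_nonzero[OF v t]
    by (simp add: emb_subdegree[OF v d0] subdegree_dt[OF v])
  then show "v (der (un v)) = dord v" by simp
qed

text \<open>Derivation with respect to the uniformizer at \<open>v\<close>. It preserves integrality
  (\<open>lder_integral\<close>), so it avoids the loss of 1 that each \<open>der\<close>
  causes.\<close>

definition lder :: "('a \<Rightarrow> int) \<Rightarrow> 'a \<Rightarrow> 'a" where
  "lder v x = der x / der (un v)"

lemma lder_integral: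
  assumes v: "place k v" and x: "vge v 0 x"
  shows "vge v 0 (lder v x)"
proof (cases "lder v x = 0")
  case False
  have e: "fls_deriv (emb v x) = emb v (der x) * fls_deriv (emb v t)"
    and e1: "1 = emb v (der (un v)) * fls_deriv (emb v t)"
    using der[of x] der[of "un v"] v unfolding is_der_def by (auto simp: emb_un[OF v])
  have "der x = lder v x * der (un v)" using der_un(1)[OF v] by (simp add: lder_def)
  then have "fls_deriv (emb v x) = emb v (lder v x) * (emb v (der (un v)) * fls_deriv (emb v t))"
    unfolding e by (simp add: emb_mult[OF v])
  then have l: "fls_deriv (emb v x) = emb v (lder v x)" using e1 by simp
  have "emb v x = fps_to_fls (expn v x)" using emb_eq[OF v, of x 0] x by simp
  then have "emb v (lder v x) = fps_to_fls (fps_deriv (expn v x))" using l by (simp add: fls_deriv_fps_to_fls)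
  then have "fls_subdegree (emb v (lder v x)) \<ge> 0" by (simp add: fls_subdegree_fls_to_fps_gt0)
  then show ?thesis using emb_subdegree[OF v False] by (simp add: vge_def)
qed simp

end

section \<open>Wronskians\<close>

context ffield_gen
begin

definition wmat :: "nat \<Rightarrow> (nat \<Rightarrow> 'a) \<Rightarrow> 'a mat" where
  "wmat D e = mat D D (\<lambda>(i, j). (der ^^ i) (e j))"

definition wronskian :: "nat \<Rightarrow> (nat \<Rightarrow> 'a) \<Rightarrow> 'a" where
  "wronskian D e = Determinant.det (wmat D e)"

lemma wmat_carrier [simp]: "wmat D e \<in> carrier_mat D D"
  by (simp add: wmat_def)

lemma vec_eq_0I: "v \<in> carrier_vec n \<Longrightarrow> (\<And>i. i < n \<Longrightarrow> v $ i = 0) \<Longrightarrow> v = 0\<^sub>v n"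
  by (intro eq_vecI) auto

text \<open>Induction on the size: if the smaller Wronskian is nonzero and the larger one vanishes,
  the coefficients of the column relation turn out to be constants.\<close>

lemma wronskian_nonzero:
  assumes "lin_nondeg_over k {..<D} e"
  shows "wronskian D e \<noteq> 0"
  using assms
proof (induction D)
  case 0
  then show ?case by (simp add: wronskian_def wmat_def)
next
  case (Suc D)
  have ID: "lin_nondeg_over k {..<D} e" by (rule k.lin_nondeg_over_mono[OF Suc.prems]) auto
  have W: "wronskian D e \<noteq> 0" by (rule Suc.IH[OF ID])
  have inj: "\<forall>j<D. c j = 0" if c: "\<And>i. i < D \<Longrightarrow> (\<Sum>j<D. (der ^^ i) (e j) * c j) = 0" for c
  proof (rule ccontr)
    assume n: "\<not> ?thesis"
    define w where "w = vec D c"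
    have "w \<noteq> 0\<^sub>v D"
    proof
      assume "w = 0\<^sub>v D"
      then have "\<forall>j<D. c j = 0" unfolding w_def by (metis index_vec index_zero_vec(1))
      then show False using n by blast
    qed
    moreover have "wmat D e *\<^sub>v w = 0\<^sub>v D"
    proof (rule vec_eq_0I)
      show "wmat D e *\<^sub>v w \<in> carrier_vec D" by (rule mult_mat_vec_carrier[OF wmat_carrier]) (simp add: w_def)
    qed (use c in \<open>auto simp: w_def wmat_def scalar_prod_def atLeast0LessThan\<close>)
    moreover have "w \<in> carrier_vec D" by (simp add: w_def)
    ultimately have "wronskian D e = 0"
      unfolding wronskian_def by (intro iffD2[OF det_0_iff_vec_prod_zero[OF wmat_carrier]] exI[of _ w] conjI)
    then show False using W by simp
  qed
  show ?case
  proof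
    assume "wronskian (Suc D) e = 0"
    then obtain w where w: "w \<in> carrier_vec (Suc D)" "w \<noteq> 0\<^sub>v (Suc D)" "wmat (Suc D) e *\<^sub>v w = 0\<^sub>v (Suc D)"
      unfolding wronskian_def using det_0_iff_vec_prod_zero[OF wmat_carrier, of "Suc D" e] by blast
    have rel: "(\<Sum>j<Suc D. (der ^^ i) (e j) * w $ j) = 0" if i: "i < Suc D" for i
    proof -
      have "(wmat (Suc D) e *\<^sub>v w) $ i = (\<Sum>j<Suc D. (der ^^ i) (e j) * w $ j)"
        using w(1) i by (simp add: wmat_def scalar_prod_def atLeast0LessThan)
      then show ?thesis using w(3) i by simp
    qed
    have wD: "w $ D \<noteq> 0"
    proof
      assume w0: "w $ D = 0"
      have "\<forall>j<D. w $ j = 0" by (rule inj) (use rel w0 in simp)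
      then have "w = 0\<^sub>v (Suc D)" by (intro vec_eq_0I w(1)) (use w0 in \<open>auto simp: less_Suc_eq\<close>)
      then show False using w(2) by simp
    qed
    \<comment> \<open>With the last coefficient normalized to 1, differentiating the relations
      leaves relations among the first \<open>D\<close> columns with coefficients
      \<open>der (c j)\<close>, which vanish by \<open>inj\<close>.\<close>
    define c where "c = (\<lambda>j. w $ j / w $ D)"
    have cD: "c D = 1" using wD by (simp add: c_def)
    have crel: "(\<Sum>j<Suc D. (der ^^ i) (e j) * c j) = 0" if "i < Suc D" for i
      using rel[OF that] by (simp add: c_def sum_divide_distrib[symmetric] add_divide_distrib[symmetric])
    have "(\<Sum>j<D. (der ^^ i) (e j) * der (c j)) = 0" if i: "i < D" for i
    proof -
      have "0 = der (\<Sum>j<Suc D. (der ^^ i) (e j) * c j)" using crel[of i] i by simp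
      also have "\<dots> = (\<Sum>j<Suc D. (der ^^ i) (e j) * der (c j)) + (\<Sum>j<Suc D. (der ^^ Suc i) (e j) * c j)"
        unfolding der_sum der_mult by (simp add: sum.distrib add_ac)
      also have "(\<Sum>j<Suc D. (der ^^ Suc i) (e j) * c j) = 0" by (rule crel) (use i in simp)
      finally show ?thesis using der_const[OF k.one] cD by simp
    qed
    then have "\<forall>j<D. der (c j) = 0" by (rule inj)
    then have ck: "c j \<in> k" if "j < Suc D" for j
      using that cD der_eq_0D by (cases "j = D") (auto simp: less_Suc_eq)
    have "(\<Sum>j<Suc D. c j * e j) = 0" using crel[of 0] by (simp add: mult.commute)
    then have "c D = 0" by (rule lin_nondeg_overD[OF Suc.prems, rotated]) (use ck in auto)
    then show False using cD by simp
  qed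
qed

lemma der_pow_sum_const:
  "(\<And>j. j \<in> J \<Longrightarrow> c j \<in> k) \<Longrightarrow> (der ^^ i) (\<Sum>j\<in>J. c j * e j) = (\<Sum>j\<in>J. c j * (der ^^ i) (e j))"
  by (induction i) (auto simp: der_sum der_cmult intro!: sum.cong)

lemma wronskian_change:
  assumes P: "\<And>i j. i < D \<Longrightarrow> j < D \<Longrightarrow> P i j \<in> k" and e': "\<And>j. j < D \<Longrightarrow> e' j = (\<Sum>l<D. P l j * e l)"
  obtains c where "c \<in> k" "wronskian D e' = wronskian D e * c"
proof -
  define Q where "Q = mat D D (\<lambda>(l, j). P l j)"
  have Q: "Q \<in> carrier_mat D D" by (simp add: Q_def)
  have "wmat D e' = wmat D e * Q"
  proof (rule eq_matI)
    fix i j assume "i < dim_row (wmat D e * Q)" "j < dim_col (wmat D e * Q)"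
    then have ij: "i < D" "j < D" by (auto simp: wmat_def Q_def)
    then have "(der ^^ i) (e' j) = (\<Sum>l<D. P l j * (der ^^ i) (e l))"
      unfolding e'[OF ij(2)] using P by (intro der_pow_sum_const) auto
    then show "wmat D e' $$ (i, j) = (wmat D e * Q) $$ (i, j)"
      using ij by (simp add: wmat_def Q_def scalar_prod_def atLeast0LessThan mult.commute)
  qed (auto simp: wmat_def Q_def)
  then have "wronskian D e' = wronskian D e * Determinant.det Q"
    unfolding wronskian_def by (simp add: det_mult[OF wmat_carrier Q])
  moreover have "Determinant.det Q \<in> k"
    unfolding det_def'[OF Q]
  proof (intro k.sum k.mult k.prod)
    fix p i assume p: "p \<in> {p. p permutes {0..<D}}" and i: "i \<in> {0..<D}"
    then have "p i < D" using permutes_in_image[of p "{0..<D}" i] by simp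
    then show "Q $$ (i, p i) \<in> k" using P i by (simp add: Q_def)
  qed (auto simp: sign_def)
  ultimately show thesis using that by blast
qed

lemma vge_der_pow:
  assumes v: "place k v" and x: "vge v n x"
  shows "vge v (n + int i * (dord v - 1)) ((der ^^ i) x)"
proof (induction i)
  case (Suc i)
  have e: "n + int (Suc i) * (dord v - 1) = n + int i * (dord v - 1) - 1 + dord v" by (simp add: algebra_simps)
  have f: "(der ^^ Suc i) x = der ((der ^^ i) x)" by simp
  show ?case unfolding e f by (rule vge_der[OF v Suc])
qed (use x in simp)

lemma sum_nat_int: "(\<Sum>i<D. int i) = int (D * (D - 1) div 2)"
proof (induction D)
  case (Suc D)
  have "even (D * (D - 1))" by (cases D) auto
  then have "Suc D * D div 2 = D * (D - 1) div 2 + D"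
    by (cases D) (auto simp: algebra_simps)
  then show ?case using Suc by simp
qed simp

text \<open>Each term of the determinant takes one entry from every row and column: column bounds
  add up, and row \<open>i\<close> costs \<open>i * (dord v - 1)\<close>. Columns may have different
  bounds, as is needed at the places of \<open>S\<close>.\<close>

lemma wronskian_columns:
  assumes v: "place k v" and e: "\<And>j. j < D \<Longrightarrow> vge v (n j) (e j)"
  shows "vge v ((\<Sum>j<D. n j) + (dord v - 1) * int (D * (D - 1) div 2)) (wronskian D e)"
  unfolding wronskian_def det_def'[OF wmat_carrier]
proof (rule vge_sum[OF v])
  fix p assume "p \<in> {p. p permutes {0..<D}}"
  then have p: "p permutes {0..<D}" by simp
  then have pD: "p i < D" if "i < D" for i using permutes_in_image[OF p, of i] that by simp
  have "vge v (\<Sum>i=0..<D. n (p i) + int i * (dord v - 1)) (\<Prod>i=0..<D. wmat D e $$ (i, p i))"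
    by (rule vge_prod[OF v]) (use pD e vge_der_pow[OF v] in \<open>auto simp: wmat_def\<close>)
  also have "(\<Sum>i=0..<D. n (p i) + int i * (dord v - 1)) = (\<Sum>j<D. n j) + (dord v - 1) * int (D * (D - 1) div 2)"
  proof -
    have "(\<Sum>i=0..<D. n (p i)) = (\<Sum>j=0..<D. n j)" using sum.permute[OF p, of n] by (simp add: comp_def)
    then show ?thesis unfolding sum_nat_int[symmetric]
      by (simp add: sum.distrib sum_distrib_right[symmetric] atLeast0LessThan mult.commute)
  qed
  finally show "vge v ((\<Sum>j<D. n j) + (dord v - 1) * int (D * (D - 1) div 2)) (signof p * (\<Prod>i=0..<D. wmat D e $$ (i, p i)))"
    by (intro vge_cmult[OF v]) (auto simp: sign_def)
qed

text \<open>Pulling out a common factor \<open>\<tau>\<^sup>\<mu>\<close> and passing to the local derivation is a triangular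
  transformation of the rows.\<close>

lemma lder_triangular:
  fixes v and a :: 'a
  assumes v: "place k v"
  shows "\<exists>C. (\<forall>i. C i i = a * der (un v) ^ i) \<and> (\<forall>i l. i < l \<longrightarrow> C i l = 0)
    \<and> (\<forall>i f. (der ^^ i) (a * f) = (\<Sum>l\<le>i. C i l * (lder v ^^ l) f))"
proof -
  define u where "u = der (un v)"
  have u0: "u \<noteq> 0" using der_un(1)[OF v] by (simp add: u_def)
  have der_l: "der f = u * lder v f" for f using u0 by (simp add: lder_def u_def)
  define C where "C = rec_nat (\<lambda>l::nat. if l = 0 then a else 0)
     (\<lambda>_ R l. der (R l) + (if l = 0 then 0 else R (l - 1) * u))"
  have C0: "C 0 = (\<lambda>l. if l = 0 then a else 0)" by (simp add: C_def)
  have CS: "C (Suc i) = (\<lambda>l. der (C i l) + (if l = 0 then 0 else C i (l - 1) * u))" for i unfolding C_def by simp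
  have tri: "C i l = 0" if "i < l" for i l
    using that
  proof (induction i arbitrary: l)
    case 0
    then show ?case by (simp add: C0)
  next
    case (Suc i)
    then have "C i l = 0" "C i (l - 1) = 0" by auto
    then show ?case by (simp add: CS)
  qed
  have diag: "C i i = a * u ^ i" for i
  proof (induction i)
    case (Suc i)
    have "C i (Suc i) = 0" by (rule tri) simp
    then show ?case using Suc by (simp add: CS mult_ac)
  qed (simp add: C0)
  have rel: "(der ^^ i) (a * f) = (\<Sum>l\<le>i. C i l * (lder v ^^ l) f)" for i f
  proof (induction i)
    case 0
    then show ?case by (simp add: C0)
  next
    case (Suc i)
    have "(der ^^ Suc i) (a * f) = (\<Sum>l\<le>i. der (C i l * (lder v ^^ l) f))" by (simp add: Suc der_sum)
    also have "\<dots> = (\<Sum>l\<le>i. der (C i l) * (lder v ^^ l) f + C i l * u * (lder v ^^ Suc l) f)"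
    proof (rule sum.cong[OF refl])
      fix l
      have "der ((lder v ^^ l) f) = u * (lder v ^^ Suc l) f" using der_l by simp
      then show "der (C i l * (lder v ^^ l) f) = der (C i l) * (lder v ^^ l) f + C i l * u * (lder v ^^ Suc l) f"
        unfolding der_mult by (simp only: mult.assoc add.commute)
    qed
    also have "\<dots> = (\<Sum>l\<le>i. der (C i l) * (lder v ^^ l) f) + (\<Sum>l\<le>i. C i l * u * (lder v ^^ Suc l) f)"
      by (rule sum.distrib)
    also have "(\<Sum>l\<le>i. der (C i l) * (lder v ^^ l) f) = (\<Sum>l\<le>Suc i. der (C i l) * (lder v ^^ l) f)"
      using tri[of i "Suc i"] by simp
    also have "(\<Sum>l\<le>i. C i l * u * (lder v ^^ Suc l) f) = (\<Sum>l\<le>Suc i. (if l = 0 then 0 else C i (l - 1) * u) * (lder v ^^ l) f)"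
      by (subst sum.atMost_Suc_shift) simp
    finally show ?case by (simp only: CS sum.distrib distrib_right)
  qed
  show ?thesis using tri diag rel unfolding u_def by (intro exI[of _ C]) blast
qed

text \<open>A common factor can be taken out of all columns, after which \<open>lder\<close> keeps
  the entries integral and row \<open>i\<close> costs only \<open>i * dord v\<close>. The gain of
  one per differentiation over \<open>wronskian_columns\<close> is what confines the extra cost to
  \<open>S\<close>.\<close>

lemma wronskian_common:
  assumes v: "place k v" and e: "\<And>j. j < D \<Longrightarrow> vge v \<mu> (e j)"
  shows "vge v (int D * \<mu> + dord v * int (D * (D - 1) div 2)) (wronskian D e)"
proof -
  define a where "a = un v powi \<mu>"
  have a: "a \<noteq> 0" "v a = \<mu>" using un[OF v] v_powi[OF v un(1)[OF v]] by (auto simp: a_def)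
  define f where "f = (\<lambda>j. e j / a)"
  have fi: "vge v 0 (f j)" if "j < D" for j
  proof -
    have "vge v (\<mu> + - \<mu>) (e j * inverse a)"
      by (rule vge_mult[OF v e[OF that]]) (use a v_inverse[OF v a(1)] in \<open>simp add: vge_def\<close>)
    then show ?thesis by (simp add: f_def divide_inverse)
  qed
  obtain C where C: "\<And>i. C i i = a * der (un v) ^ i" "\<And>i l. i < l \<Longrightarrow> C i l = 0"
    "\<And>i f. (der ^^ i) (a * f) = (\<Sum>l\<le>i. C i l * (lder v ^^ l) f)" using lder_triangular[OF v, of a] by blast
  define M where "M = mat D D (\<lambda>(i, l). C i l)"
  define G where "G = mat D D (\<lambda>(l, j). (lder v ^^ l) (f j))"
  have MG: "M \<in> carrier_mat D D" "G \<in> carrier_mat D D" by (auto simp: M_def G_def)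
  have "wmat D e = M * G"
  proof (rule eq_matI)
    fix i j assume "i < dim_row (M * G)" "j < dim_col (M * G)"
    then have ij: "i < D" "j < D" using MG by auto
    have "(der ^^ i) (e j) = (\<Sum>l\<le>i. C i l * (lder v ^^ l) (f j))"
      using C(3)[of i "f j"] a(1) by (simp add: f_def)
    also have "\<dots> = (\<Sum>l<D. C i l * (lder v ^^ l) (f j))"
      by (rule sum.mono_neutral_left) (use ij C(2) in auto)
    finally show "wmat D e $$ (i, j) = (M * G) $$ (i, j)"
      using ij by (simp add: wmat_def M_def G_def scalar_prod_def atLeast0LessThan)
  qed (auto simp: wmat_def M_def G_def)
  then have W: "wronskian D e = Determinant.det M * Determinant.det G"
    unfolding wronskian_def by (simp add: det_mult[OF MG])
  have "Determinant.det M = (\<Prod>i<D. a * der (un v) ^ i)"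
  proof -
    have "Determinant.det M = prod_list (diag_mat M)"
      by (rule det_lower_triangular[OF _ MG(1)]) (use C(2) in \<open>auto simp: M_def\<close>)
    also have "\<dots> = (\<Prod>i<D. M $$ (i, i))"
      unfolding diag_mat_def using MG(1) by (simp add: prod.distinct_set_conv_list[symmetric] atLeast0LessThan)
    also have "\<dots> = (\<Prod>i<D. a * der (un v) ^ i)" by (rule prod.cong) (auto simp: M_def C(1))
    finally show ?thesis .
  qed
  moreover have "v (\<Prod>i<D. a * der (un v) ^ i) = (\<Sum>i<D. \<mu> + int i * dord v)"
  proof -
    have "v (a * der (un v) ^ i) = \<mu> + int i * dord v" for i
      using placeD(2)[OF v a(1), of "der (un v) ^ i"] der_un[OF v] v_power[OF v der_un(1)[OF v], of i] a(2) by simp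
    then show ?thesis using v_prod[OF v, of "{..<D}" "\<lambda>i. a * der (un v) ^ i"] a(1) der_un(1)[OF v] by simp
  qed
  moreover have "(\<Sum>i<D. \<mu> + int i * dord v) = int D * \<mu> + dord v * int (D * (D - 1) div 2)"
    unfolding sum_nat_int[symmetric] by (simp add: sum.distrib sum_distrib_right[symmetric] mult.commute)
  ultimately have "vge v (int D * \<mu> + dord v * int (D * (D - 1) div 2)) (Determinant.det M)" by (simp add: vge_def)
  moreover have "vge v 0 (Determinant.det G)"
    unfolding det_def'[OF MG(2)]
  proof (intro vge_sum[OF v] vge_cmult[OF v])
    fix p assume "p \<in> {p. p permutes {0..<D}}"
    then have p: "p permutes {0..<D}" by simp
    have l: "vge v 0 ((lder v ^^ l) (f j))" if "j < D" for l j
      by (induction l) (use fi[OF that] lder_integral[OF v] in auto)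
    have "vge v (\<Sum>i\<in>{0..<D}. 0) (\<Prod>i=0..<D. G $$ (i, p i))"
    proof (rule vge_prod[OF v])
      fix i assume i: "i \<in> {0..<D}"
      then have "p i < D" using permutes_in_image[OF p, of i] by simp
      then show "vge v 0 (G $$ (i, p i))" using l i by (simp add: G_def)
    qed simp
    then show "vge v 0 (\<Prod>i=0..<D. G $$ (i, p i))" by simp
  qed (auto simp: sign_def)
  ultimately show ?thesis unfolding W using vge_mult[OF v] by fastforce
qed

end

section \<open>Unique factorization relative to a subring\<close>

text \<open>Polynomials in the first \<open>n\<close> variables form a proper subset of a type with
  infinitely many variables, so all divisibility notions are relative to a subring given as a
  set.\<close>

definition sset :: "'b::idom set \<Rightarrow> bool" where
  "sset S \<longleftrightarrow> 0 \<in> S \<and> 1 \<in> S \<and> (\<forall>a\<in>S. \<forall>b\<in>S. a + b \<in> S \<and> a * b \<in> S \<and> a - b \<in> S)"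

definition dv :: "'b::idom set \<Rightarrow> 'b \<Rightarrow> 'b \<Rightarrow> bool" where
  "dv S a b \<longleftrightarrow> (\<exists>q\<in>S. b = a * q)"

definition un_in :: "'b::idom set \<Rightarrow> 'b \<Rightarrow> bool" where
  "un_in S u \<longleftrightarrow> u \<in> S \<and> dv S u 1"

definition pr :: "'b::idom set \<Rightarrow> 'b \<Rightarrow> bool" where
  "pr S p \<longleftrightarrow> p \<in> S \<and> p \<noteq> 0 \<and> \<not> un_in S p \<and> (\<forall>a\<in>S. \<forall>b\<in>S. dv S p (a * b) \<longrightarrow> dv S p a \<or> dv S p b)"

definition irr :: "'b::idom set \<Rightarrow> 'b \<Rightarrow> bool" where
  "irr S f \<longleftrightarrow> f \<in> S \<and> f \<noteq> 0 \<and> \<not> un_in S f \<and> (\<forall>a\<in>S. \<forall>b\<in>S. f = a * b \<longrightarrow> un_in S a \<or> un_in S b)"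

inductive pf :: "'b::idom set \<Rightarrow> 'b \<Rightarrow> bool" for S where
  unit: "un_in S u \<Longrightarrow> pf S u"
| prime: "pr S p \<Longrightarrow> pf S f \<Longrightarrow> pf S (p * f)"

definition ufd :: "'b::idom set \<Rightarrow> bool" where
  "ufd S \<longleftrightarrow> (\<forall>f\<in>S. f \<noteq> 0 \<longrightarrow> pf S f)"

lemma ssetD:
  assumes "sset S"
  shows "0 \<in> S" "1 \<in> S" "a \<in> S \<Longrightarrow> b \<in> S \<Longrightarrow> a + b \<in> S" "a \<in> S \<Longrightarrow> b \<in> S \<Longrightarrow> a * b \<in> S"
    "a \<in> S \<Longrightarrow> b \<in> S \<Longrightarrow> a - b \<in> S"
  using assms unfolding sset_def by blast+

lemma sset_sum: "sset S \<Longrightarrow> (\<And>i. i \<in> I \<Longrightarrow> f i \<in> S) \<Longrightarrow> sum f I \<in> S"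
  by (induction I rule: infinite_finite_induct) (auto intro: ssetD)

lemma dvI: "q \<in> S \<Longrightarrow> b = a * q \<Longrightarrow> dv S a b"
  unfolding dv_def by blast

lemma dvE: "dv S a b \<Longrightarrow> (\<And>q. q \<in> S \<Longrightarrow> b = a * q \<Longrightarrow> P) \<Longrightarrow> P"
  unfolding dv_def by blast

lemma dv_add:
  assumes S: "sset S" and "dv S a b" "dv S a c"
  shows "dv S a (b + c)"
proof -
  obtain q r where "q \<in> S" "b = a * q" "r \<in> S" "c = a * r" using assms(2,3) unfolding dv_def by blast
  then show ?thesis by (intro dvI[of "q + r"] ssetD[OF S]) (auto simp: algebra_simps)
qed

lemma dv_diff:
  assumes S: "sset S" and "dv S a b" "dv S a c"
  shows "dv S a (b - c)"
proof -
  obtain q r where "q \<in> S" "b = a * q" "r \<in> S" "c = a * r" using assms(2,3) unfolding dv_def by blast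
  then show ?thesis by (intro dvI[of "q - r"] ssetD(5)[OF S]) (auto simp: algebra_simps)
qed

lemma dv_mult:
  assumes S: "sset S" and "dv S a b" "c \<in> S"
  shows "dv S a (b * c)"
proof -
  obtain q where "q \<in> S" "b = a * q" using assms(2) unfolding dv_def by blast
  then show ?thesis using assms(3) by (intro dvI[of "q * c"] ssetD(4)[OF S]) (auto simp: algebra_simps)
qed

lemma dv_mult_left: "sset S \<Longrightarrow> dv S a b \<Longrightarrow> c \<in> S \<Longrightarrow> dv S a (c * b)"
  using dv_mult[of S a b c] by (simp add: mult.commute)

lemma dv_sum:
  assumes S: "sset S" and "\<And>i. i \<in> I \<Longrightarrow> dv S a (f i)"
  shows "dv S a (sum f I)"
  using assms(2)
proof (induction I rule: infinite_finite_induct)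
  case (insert i I)
  then show ?case by (simp add: dv_add[OF S])
qed (auto intro!: dvI[OF ssetD(1)[OF S]])

lemma un_mult:
  assumes S: "sset S" and "un_in S u" "un_in S v"
  shows "un_in S (u * v)"
proof -
  obtain a b where "a \<in> S" "1 = u * a" "b \<in> S" "1 = v * b" "u \<in> S" "v \<in> S"
    using assms(2,3) unfolding un_in_def dv_def by blast
  then show ?thesis
    unfolding un_in_def by (auto intro!: dvI[of "a * b"] ssetD(4)[OF S] simp: mult_ac)
qed

lemma pf_in:
  assumes S: "sset S" and "pf S f"
  shows "f \<in> S \<and> f \<noteq> 0"
  using assms(2) by (induction rule: pf.induct) (auto simp: un_in_def dv_def pr_def intro: ssetD(4)[OF S])

lemma pf_mult:
  assumes S: "sset S" and "pf S f" "pf S g"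
  shows "pf S (f * g)"
proof -
  have u: "pf S (u * g)" if "un_in S u" "pf S g" for u g
    using that(2)
  proof induction
    case (unit w)
    then show ?case by (intro pf.unit un_mult S that(1))
  next
    case (prime p g)
    from pf.prime[OF prime(1) prime(3)] have "pf S (p * (u * g))" .
    then show ?case by (simp add: mult.left_commute)
  qed
  show ?thesis using assms(2)
  proof induction
    case (unit w)
    then show ?case using u assms(3) by blast
  next
    case (prime p f)
    then show ?case by (simp add: mult.assoc pf.prime)
  qed
qed

text \<open>An additive measure that vanishes only on units bounds the length of factorizations into
  irreducibles; these are then required to be prime.\<close>

lemma ufdI:
  fixes m :: "'b::idom \<Rightarrow> nat"
  assumes S: "sset S" and ip: "\<And>f. irr S f \<Longrightarrow> pr S f"
    and m: "\<And>f g. f \<in> S \<Longrightarrow> g \<in> S \<Longrightarrow> f \<noteq> 0 \<Longrightarrow> g \<noteq> 0 \<Longrightarrow> m (f * g) = m f + m g"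
    and m0: "\<And>f. f \<in> S \<Longrightarrow> f \<noteq> 0 \<Longrightarrow> m f = 0 \<Longrightarrow> un_in S f"
  shows "ufd S"
  unfolding ufd_def
proof (intro ballI impI)
  fix f assume "f \<in> S" "f \<noteq> 0"
  then show "pf S f"
  proof (induction "m f" arbitrary: f rule: less_induct)
    case less
    show ?case
    proof (cases "un_in S f")
      case True
      then show ?thesis by (rule pf.unit)
    next
      case nu: False
      show ?thesis
      proof (cases "irr S f")
        case True
        have "un_in S 1" unfolding un_in_def using ssetD(2)[OF S] by (auto intro: dvI[of 1])
        then have "pf S (f * 1)" by (intro pf.prime ip True pf.unit)
        then show ?thesis by simp
      next
        case False
        then obtain a b where ab: "a \<in> S" "b \<in> S" "f = a * b" "\<not> un_in S a" "\<not> un_in S b"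
          using less.prems nu unfolding irr_def by blast
        then have 0: "a \<noteq> 0" "b \<noteq> 0" using less.prems by auto
        have "m a \<noteq> 0" "m b \<noteq> 0" using m0 ab 0 by blast+
        then have "pf S a" "pf S b" using less.hyps[of a] less.hyps[of b] m[OF ab(1,2) 0] ab 0 by auto
        then show ?thesis unfolding ab(3) by (rule pf_mult[OF S])
      qed
    qed
  qed
qed

lemma pr_unit_mult:
  assumes S: "sset S" and p: "pr S p" and u: "un_in S u"
  shows "pr S (p * u)"
proof -
  obtain w where w: "w \<in> S" "u * w = 1" using u unfolding un_in_def dv_def by metis
  have uS: "u \<in> S" and u0: "u \<noteq> 0" using u w by (auto simp: un_in_def)
  have pS: "p \<in> S" "p \<noteq> 0" "\<not> un_in S p" using p by (auto simp: pr_def)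
  have iff: "dv S (p * u) a \<longleftrightarrow> dv S p a" for a
  proof
    assume "dv S (p * u) a"
    then obtain q where "q \<in> S" "a = p * u * q" by (rule dvE)
    then show "dv S p a" using uS by (intro dvI[of "u * q"] ssetD(4)[OF S]) (auto simp: mult.assoc)
  next
    assume "dv S p a"
    then obtain q where q: "q \<in> S" "a = p * q" by (rule dvE)
    have "p * q = p * u * (w * q)" using w(2) by (metis mult.assoc mult.right_neutral)
    then show "dv S (p * u) a" using q w by (intro dvI[of "w * q"] ssetD(4)[OF S]) auto
  qed
  have "\<not> un_in S (p * u)" using pS iff[of 1] unfolding un_in_def by blast
  then show ?thesis
    using p pS u0 uS iff ssetD(4)[OF S, of p u] unfolding pr_def by auto
qed

text \<open>Euclid's lemma, by removing the primes of \<open>f\<close> one at a time: none of them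
  divides \<open>g\<close>, so each divides \<open>q\<close>.\<close>

lemma coprime_dv:
  assumes S: "sset S" and f: "pf S f" and q: "q \<in> S" and g: "g \<in> S"
    and d: "dv S f (q * g)" and cop: "\<And>h. h \<in> S \<Longrightarrow> dv S h f \<Longrightarrow> dv S h g \<Longrightarrow> un_in S h"
  shows "dv S f q"
  using f q d cop
proof (induction arbitrary: q rule: pf.induct)
  case (unit u)
  then obtain w where "w \<in> S" "1 = u * w" unfolding un_in_def dv_def by blast
  then show ?case using unit by (intro dvI[of "w * q"] ssetD(4)[OF S]) (auto simp flip: mult.assoc)
next
  case (prime p f)
  have pS: "p \<in> S" "p \<noteq> 0" "\<not> un_in S p" using prime(1) by (auto simp: pr_def)
  have fS: "f \<in> S" using pf_in[OF S prime(2)] by blast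
  have "dv S p (p * f)" using fS by (intro dvI) auto
  then have ng: "\<not> dv S p g" using prime.prems(3)[of p] pS by blast
  obtain r where r: "r \<in> S" "q * g = p * f * r" using prime.prems(2) by (rule dvE)
  then have "dv S p (q * g)" using fS by (intro dvI[of "f * r"] ssetD(4)[OF S]) (auto simp: mult.assoc)
  then have "dv S p q" using prime(1) ng prime.prems(1) g unfolding pr_def by blast
  then obtain q' where q': "q' \<in> S" "q = p * q'" by (rule dvE)
  have "p * (q' * g) = p * (f * r)" using r(2) q'(2) by (simp add: mult.assoc)
  then have "q' * g = f * r" using pS by simp
  then have "dv S f (q' * g)" using r(1) by (intro dvI)
  moreover have "un_in S h" if "h \<in> S" "dv S h f" "dv S h g" for h
    using prime.prems(3)[OF that(1) dv_mult_left[OF S that(2) pS(1)] that(3)] .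
  ultimately have "dv S f q'" using prime.IH[OF q'(1)] by blast
  then obtain s where "s \<in> S" "q' = f * s" by (rule dvE)
  then show ?case using q' by (intro dvI[of s]) (auto simp: mult.assoc)
qed

section \<open>Gauss's theorem on polynomials over a factorial ring\<close>

definition polys :: "'b::idom set \<Rightarrow> 'b poly set" where
  "polys V = {p. \<forall>i. Polynomial.coeff p i \<in> V}"

lemma sset_polys_of:
  assumes V: "sset V"
  shows "sset (polys V)"
  unfolding sset_def polys_def
  using ssetD[OF V] by (auto simp: coeff_mult coeff_1 intro!: sset_sum[OF V])

locale ufd_coeffs =
  fixes V :: "'b::idom set"
  assumes V: "sset V" and u: "ufd V"
begin

lemma polysD: "p \<in> polys V \<Longrightarrow> Polynomial.coeff p i \<in> V"
  by (simp add: polys_def)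

lemmas sset_polys = sset_polys_of[OF V]

lemma polys_const: "c \<in> V \<Longrightarrow> [:c:] \<in> polys V"
  using ssetD(1)[OF V] by (auto simp: polys_def coeff_pCons split: nat.splits)

lemma polys_smult: "c \<in> V \<Longrightarrow> p \<in> polys V \<Longrightarrow> Polynomial.smult c p \<in> polys V"
  using ssetD(4)[OF V] by (auto simp: polys_def)

lemma polys_monom: "c \<in> V \<Longrightarrow> Polynomial.monom c n \<in> polys V"
  using ssetD(1)[OF V] by (auto simp: polys_def)

lemma dv_const_iff:
  assumes f: "f \<in> polys V"
  shows "dv (polys V) [:c:] f \<longleftrightarrow> (\<forall>i. dv V c (Polynomial.coeff f i))"
proof
  assume "dv (polys V) [:c:] f"
  then obtain q where "q \<in> polys V" "f = [:c:] * q" by (rule dvE)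
  then show "\<forall>i. dv V c (Polynomial.coeff f i)" by (auto intro!: dvI polysD)
next
  assume "\<forall>i. dv V c (Polynomial.coeff f i)"
  then obtain q where q: "\<And>i. q i \<in> V" "\<And>i. Polynomial.coeff f i = c * q i" unfolding dv_def by metis
  define g where "g = (\<Sum>i\<le>Polynomial.degree f. Polynomial.monom (q i) i)"
  have "g \<in> polys V" unfolding g_def by (intro sset_sum[OF sset_polys] polys_monom q)
  moreover have "f = [:c:] * g"
  proof (rule poly_eqI)
    fix i show "Polynomial.coeff f i = Polynomial.coeff ([:c:] * g) i"
      using q(2)[of i] by (cases "i \<le> Polynomial.degree f") (auto simp: g_def coeff_sum coeff_eq_0)
  qed
  ultimately show "dv (polys V) [:c:] f" by (rule dvI)
qed

lemma un_const: "un_in V c \<Longrightarrow> un_in (polys V) [:c:]"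
proof -
  assume c: "un_in V c"
  then obtain d where "d \<in> V" "1 = c * d" unfolding un_in_def dv_def by blast
  then show ?thesis using c polys_const
    unfolding un_in_def by (auto intro!: dvI[of "[:d:]"] simp: one_pCons mult.commute)
qed

lemma un_polysD:
  assumes "un_in (polys V) f"
  obtains c where "f = [:c:]" "un_in V c"
proof -
  obtain g where fg: "f \<in> polys V" "g \<in> polys V" "1 = f * g" using assms unfolding un_in_def dv_def by blast
  then have "f \<noteq> 0" "g \<noteq> 0" by auto
  then have "Polynomial.degree f + Polynomial.degree g = 0" using fg(3) degree_mult_eq[of f g] by simp
  then obtain c d where cd: "f = [:c:]" "g = [:d:]" by (metis add_is_0 degree_eq_zeroE)
  then have "1 = c * d" using fg(3) by (simp add: one_pCons mult.commute)
  moreover have "c \<in> V" "d \<in> V" using polysD[OF fg(1), of 0] polysD[OF fg(2), of 0] cd by auto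
  ultimately show thesis using that[OF cd(1)] dvI[of d V 1 c] unfolding un_in_def by simp
qed

text \<open>If \<open>i\<close> and \<open>j\<close> index the first coefficients of
  \<open>a\<close> and \<open>b\<close> not divisible by \<open>c\<close>, then in coefficient
  \<open>i + j\<close> of the product every other summand is divisible by \<open>c\<close>.\<close>

lemma gauss:
  assumes c: "pr V c"
  shows "pr (polys V) [:c:]"
proof -
  have cV: "c \<in> V" "c \<noteq> 0" "\<not> un_in V c" using c by (auto simp: pr_def)
  have "\<not> un_in (polys V) [:c:]" using un_polysD cV(3) by (metis pCons_eq_iff)
  moreover have "dv (polys V) [:c:] a \<or> dv (polys V) [:c:] b"
    if a: "a \<in> polys V" and b: "b \<in> polys V" and d: "dv (polys V) [:c:] (a * b)" for a b
  proof (rule ccontr)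
    assume "\<not> ?thesis"
    then have ex: "\<exists>i. \<not> dv V c (Polynomial.coeff a i)" "\<exists>i. \<not> dv V c (Polynomial.coeff b i)"
      using dv_const_iff[OF a] dv_const_iff[OF b] by blast+
    define i where "i = (LEAST i. \<not> dv V c (Polynomial.coeff a i))"
    define j where "j = (LEAST i. \<not> dv V c (Polynomial.coeff b i))"
    have i: "\<not> dv V c (Polynomial.coeff a i)" "\<And>l. l < i \<Longrightarrow> dv V c (Polynomial.coeff a l)"
      using LeastI_ex[OF ex(1)] not_less_Least unfolding i_def by blast+
    have j: "\<not> dv V c (Polynomial.coeff b j)" "\<And>l. l < j \<Longrightarrow> dv V c (Polynomial.coeff b l)"
      using LeastI_ex[OF ex(2)] not_less_Least unfolding j_def by blast+
    have ab: "dv V c (Polynomial.coeff (a * b) (i + j))"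
      using d dv_const_iff[of "a * b"] ssetD(4)[OF sset_polys a b] by blast
    have "dv V c (\<Sum>l\<in>{..i + j} - {i}. Polynomial.coeff a l * Polynomial.coeff b (i + j - l))"
    proof (rule dv_sum[OF V])
      fix l assume l: "l \<in> {..i + j} - {i}"
      show "dv V c (Polynomial.coeff a l * Polynomial.coeff b (i + j - l))"
      proof (cases "l < i")
        case True
        then show ?thesis by (intro dv_mult[OF V] i polysD[OF b])
      next
        case False
        then have "i + j - l < j" using l by auto
        then show ?thesis by (intro dv_mult_left[OF V] j polysD[OF a])
      qed
    qed
    moreover have "Polynomial.coeff (a * b) (i + j) = Polynomial.coeff a i * Polynomial.coeff b j
       + (\<Sum>l\<in>{..i + j} - {i}. Polynomial.coeff a l * Polynomial.coeff b (i + j - l))"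
      unfolding coeff_mult by (subst sum.remove[of _ i]) auto
    ultimately have "dv V c (Polynomial.coeff a i * Polynomial.coeff b j)" using dv_diff[OF V ab] by fastforce
    then show False using c i j polysD[OF a] polysD[OF b] unfolding pr_def by blast
  qed
  ultimately show ?thesis using cV polys_const unfolding pr_def by auto
qed

text \<open>Division without inverses: each step multiplies \<open>a\<close> by the leading
  coefficient of \<open>g\<close>, and these factors are collected in \<open>c\<close>.\<close>

lemma pseudo_division:
  assumes g: "g \<in> polys V" "g \<noteq> 0" and a: "a \<in> polys V"
  shows "\<exists>c q r. c \<in> V \<and> c \<noteq> 0 \<and> q \<in> polys V \<and> r \<in> polys V \<and> Polynomial.smult c a = q * g + r
     \<and> (r = 0 \<or> Polynomial.degree r < Polynomial.degree g)"
  using a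
proof (induction "Polynomial.degree a" arbitrary: a rule: less_induct)
  case less
  show ?case
  proof (cases "Polynomial.degree a < Polynomial.degree g")
    case True
    then show ?thesis using less.prems ssetD[OF V] ssetD(1)[OF sset_polys]
      by (intro exI[of _ 1] exI[of _ 0] exI[of _ a]) auto
  next
    case False
    define l where "l = lead_coeff g"
    have l: "l \<in> V" "l \<noteq> 0" using g polysD by (auto simp: l_def)
    define s where "s = Polynomial.monom (lead_coeff a) (Polynomial.degree a - Polynomial.degree g)"
    have s: "s \<in> polys V" unfolding s_def by (intro polys_monom polysD less.prems)
    define a1 where "a1 = Polynomial.smult l a - s * g"
    have a1: "a1 \<in> polys V" unfolding a1_def by (intro ssetD[OF sset_polys] polys_smult l less.prems s g)
    have "Polynomial.degree (s * g) \<le> Polynomial.degree a"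
      using False degree_mult_le[of s g] degree_monom_le[of "lead_coeff a" "Polynomial.degree a - Polynomial.degree g"]
      unfolding s_def by linarith
    then have "Polynomial.degree a1 \<le> Polynomial.degree a"
      unfolding a1_def by (intro degree_diff_le) (auto intro: degree_smult_le)
    moreover have "Polynomial.coeff a1 (Polynomial.degree a) = 0"
    proof -
      have "Polynomial.coeff (s * g) (Polynomial.degree a - Polynomial.degree g + Polynomial.degree g) = lead_coeff a * l"
        unfolding s_def l_def by (simp add: coeff_monom_mult)
      then show ?thesis using False by (simp add: a1_def l_def mult.commute)
    qed
    ultimately have "a1 = 0 \<or> Polynomial.degree a1 < Polynomial.degree a" by (rule eq_zero_or_degree_less)
    then show ?thesis
    proof
      assume "a1 = 0"
      then have "Polynomial.smult l a = s * g + 0" by (simp add: a1_def)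
      then show ?thesis using l s ssetD(1)[OF sset_polys] by blast
    next
      assume "Polynomial.degree a1 < Polynomial.degree a"
      then obtain c q r where *: "c \<in> V" "c \<noteq> 0" "q \<in> polys V" "r \<in> polys V" "Polynomial.smult c a1 = q * g + r"
         "r = 0 \<or> Polynomial.degree r < Polynomial.degree g" using less.hyps a1 by blast
      have "Polynomial.smult (c * l) a = Polynomial.smult c a1 + Polynomial.smult c (s * g)"
        unfolding a1_def by (simp add: smult_diff_right)
      also have "\<dots> = (q + Polynomial.smult c s) * g + r" unfolding *(5) by (simp add: algebra_simps)
      finally show ?thesis
        using * l s by (intro exI[of _ "c * l"] exI[of _ "q + Polynomial.smult c s"] exI[of _ r])
          (auto intro: ssetD[OF V] ssetD[OF sset_polys] polys_smult)
    qed
  qed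
qed

text \<open>Each prime of \<open>c\<close> divides \<open>f * T\<close> and not \<open>f\<close>,
  hence \<open>T\<close> by \<open>gauss\<close>; cancelling it shortens \<open>c\<close>.\<close>

lemma cancel_const:
  assumes "pf V c" "T \<in> polys V" "b \<in> polys V" "f \<in> polys V" "f * T = Polynomial.smult c b"
    and np: "\<And>p. pr V p \<Longrightarrow> \<not> dv (polys V) [:p:] f"
  shows "dv (polys V) f b"
  using assms(1,2,5)
proof (induction arbitrary: T rule: pf.induct)
  case (unit c)
  then obtain d where d: "d \<in> V" "1 = c * d" unfolding un_in_def dv_def by blast
  have "f * Polynomial.smult d T = Polynomial.smult (d * c) b" using unit(3) by (simp only: mult_smult_right smult_smult)
  also have "d * c = 1" using d by (simp add: mult.commute)
  finally show ?case using polys_smult[OF d(1) unit(2)] by (intro dvI[of "Polynomial.smult d T"]) auto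
next
  case (prime p c)
  have pp: "pr (polys V) [:p:]" by (rule gauss[OF prime(1)])
  have p0: "p \<noteq> 0" using prime(1) by (simp add: pr_def)
  have cV: "c \<in> V" using pf_in[OF V prime(2)] by blast
  have "f * T = [:p:] * Polynomial.smult c b" using prime.prems(2) by (simp add: mult.commute)
  then have "dv (polys V) [:p:] (f * T)" by (rule dvI[OF polys_smult[OF cV assms(3)]])
  then have "dv (polys V) [:p:] T" using pp np[OF prime(1)] assms(4) prime.prems(1) unfolding pr_def by blast
  then obtain T1 where T1: "T1 \<in> polys V" "T = [:p:] * T1" by (rule dvE)
  have "[:p:] * (f * T1) = [:p:] * Polynomial.smult c b" using prime.prems(2) T1(2) by (simp add: mult.left_commute mult.commute[of c])
  then have "f * T1 = Polynomial.smult c b" using p0 by (simp only: mult_left_cancel pCons_eq_0_iff simp_thms)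
  then show ?case using prime.IH[OF T1(1)] by blast
qed

text \<open>By \<open>gauss\<close> each prime of \<open>c\<close> divides \<open>q\<close> or
  \<open>g\<close> and is cancelled there; what is taken out of \<open>g\<close> is recorded in
  \<open>e\<close>.\<close>

lemma split_const:
  assumes "pf V c" "f \<in> polys V" "q \<in> polys V" "g \<in> polys V" "Polynomial.smult c f = q * g"
  shows "\<exists>e q' g'. e \<in> V \<and> e \<noteq> 0 \<and> q' \<in> polys V \<and> g' \<in> polys V \<and> g = Polynomial.smult e g' \<and> f = q' * g'"
  using assms(1,3,4,5)
proof (induction arbitrary: q g rule: pf.induct)
  case (unit c)
  then obtain d where d: "d \<in> V" "1 = c * d" unfolding un_in_def dv_def by blast
  have "Polynomial.smult d q * g = Polynomial.smult (d * c) f" by (simp add: unit(4)[symmetric])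
  also have "d * c = 1" using d by (simp add: mult.commute)
  finally have "f = Polynomial.smult d q * g" by simp
  then show ?case using unit d polys_smult ssetD[OF V]
    by (intro exI[of _ 1] exI[of _ "Polynomial.smult d q"] exI[of _ g]) auto
next
  case (prime p c)
  have pp: "pr (polys V) [:p:]" by (rule gauss[OF prime(1)])
  have p0: "p \<noteq> 0" "p \<in> V" using prime(1) by (simp_all add: pr_def)
  have cV: "c \<in> V" using pf_in[OF V prime(2)] by blast
  have "q * g = [:p:] * Polynomial.smult c f" using prime.prems(3) by (simp add: mult.commute)
  then have "dv (polys V) [:p:] (q * g)" by (rule dvI[OF polys_smult[OF cV assms(2)]])
  then have "dv (polys V) [:p:] q \<or> dv (polys V) [:p:] g" using pp prime.prems unfolding pr_def by blast
  then show ?case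
  proof
    assume "dv (polys V) [:p:] q"
    then obtain q1 where q1: "q1 \<in> polys V" "q = [:p:] * q1" by (rule dvE)
    have "[:p:] * Polynomial.smult c f = [:p:] * (q1 * g)" using prime.prems(3) q1(2) by (simp add: mult.commute[of c])
    then have "Polynomial.smult c f = q1 * g" using p0 by (simp only: mult_left_cancel pCons_eq_0_iff simp_thms)
    then show ?case using prime.IH[OF q1(1) prime.prems(2)] by blast
  next
    assume "dv (polys V) [:p:] g"
    then obtain g1 where g1: "g1 \<in> polys V" "g = [:p:] * g1" by (rule dvE)
    have "[:p:] * Polynomial.smult c f = [:p:] * (q * g1)" using prime.prems(3) g1(2) by (simp add: mult.commute[of c])
    then have "Polynomial.smult c f = q * g1" using p0 by (simp only: mult_left_cancel pCons_eq_0_iff simp_thms)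
    then obtain e q' g' where *: "e \<in> V" "e \<noteq> 0" "q' \<in> polys V" "g' \<in> polys V" "g1 = Polynomial.smult e g'" "f = q' * g'"
      using prime.IH[OF prime.prems(1) g1(1)] by blast
    have "g = Polynomial.smult (p * e) g'" using g1(2) *(5) by (simp add: mult.commute)
    moreover have "p * e \<in> V" "p * e \<noteq> 0" using * p0 ssetD(4)[OF V] by auto
    ultimately show ?case using * by blast
  qed
qed

text \<open>A constant is handled by \<open>gauss\<close>. In positive degree an element
  \<open>g\<close> of least degree in the ideal of \<open>f\<close> and \<open>a\<close> divides
  constant multiples of both; this replaces division over the fraction field. Irreducibility leaves
  two cases: \<open>g\<close> is a constant multiple of an associate of \<open>f\<close>, and
  \<open>f\<close> divides \<open>a\<close>; or \<open>g\<close> is constant, and the Bezout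
  identity times \<open>b\<close> shows that \<open>f\<close> divides \<open>b\<close>.\<close>

lemma irr_pr:
  assumes f: "irr (polys V) f"
  shows "pr (polys V) f"
proof -
  let ?P = "polys V"
  have fP: "f \<in> ?P" "f \<noteq> 0" "\<not> un_in ?P f" using f by (auto simp: irr_def)
  have fd: "un_in ?P a \<or> un_in ?P b" if "a \<in> ?P" "b \<in> ?P" "f = a * b" for a b
    using f that unfolding irr_def by blast
  show ?thesis
  proof (cases "Polynomial.degree f = 0")
    case True
    then obtain c where c: "f = [:c:]" by (rule degree_eq_zeroE)
    have cV: "c \<in> V" "c \<noteq> 0" using polysD[OF fP(1), of 0] fP(2) c by auto
    then have "pf V c" using u by (simp add: ufd_def)
    then show ?thesis
    proof cases
      case unit
      then show ?thesis using un_const fP(3) c by blast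
    next
      case (prime p g)
      have gV: "g \<in> V" using pf_in[OF V prime(3)] by blast
      have pV: "p \<in> V" "\<not> un_in V p" using prime(2) by (auto simp: pr_def)
      have fpg: "f = [:p:] * [:g:]" using c prime(1) by simp
      have "\<not> un_in ?P [:p:]" using un_polysD pV(2) by (metis pCons_eq_iff)
      then have "un_in ?P [:g:]" using fd[OF polys_const[OF pV(1)] polys_const[OF gV] fpg] by blast
      then show ?thesis unfolding fpg by (rule pr_unit_mult[OF sset_polys gauss[OF prime(2)]])
    qed
  next
    case deg: False
    have np: "\<not> dv ?P [:p:] f" if p: "pr V p" for p
    proof
      assume "dv ?P [:p:] f"
      then obtain g where g: "g \<in> ?P" "f = [:p:] * g" by (rule dvE)
      have "p \<in> V" "\<not> un_in V p" using p by (auto simp: pr_def)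
      then have "\<not> un_in ?P [:p:]" "[:p:] \<in> ?P" using un_polysD polys_const by (metis pCons_eq_iff)+
      then have "un_in ?P g" using fd g by blast
      then obtain c where "g = [:c:]" using un_polysD by blast
      then show False using g(2) deg by simp
    qed
    have main: "dv ?P f b" if a: "a \<in> ?P" and b: "b \<in> ?P" and d: "dv ?P f (a * b)" and na: "\<not> dv ?P f a" for a b
    proof -
      define I where "I = {f * u + a * w | u w. u \<in> ?P \<and> w \<in> ?P}"
      have IP: "x \<in> ?P" if "x \<in> I" for x
        using that unfolding I_def by (auto intro!: ssetD[OF sset_polys] fP a)
      have fI: "f \<in> I" unfolding I_def using ssetD[OF sset_polys] by (intro CollectI exI[of _ 1] exI[of _ 0]) auto
      have aI: "a \<in> I" unfolding I_def using ssetD[OF sset_polys] by (intro CollectI exI[of _ 0] exI[of _ 1]) auto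
      obtain g where g: "g \<in> I" "g \<noteq> 0" and gmin: "\<And>h. h \<in> I \<Longrightarrow> h \<noteq> 0 \<Longrightarrow> Polynomial.degree g \<le> Polynomial.degree h"
        using ex_has_least_nat[of "\<lambda>g. g \<in> I \<and> g \<noteq> 0" f Polynomial.degree] fI fP(2) by blast
      obtain gu gw where guw: "gu \<in> ?P" "gw \<in> ?P" "g = f * gu + a * gw" using g(1) unfolding I_def by blast
      have red: "\<exists>c q. c \<in> V \<and> c \<noteq> 0 \<and> q \<in> ?P \<and> Polynomial.smult c x = q * g" if x: "x \<in> I" for x
      proof -
        obtain c q r where *: "c \<in> V" "c \<noteq> 0" "q \<in> ?P" "r \<in> ?P" "Polynomial.smult c x = q * g + r"
           "r = 0 \<or> Polynomial.degree r < Polynomial.degree g"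
          using pseudo_division[OF IP[OF g(1)] g(2) IP[OF x]] by blast
        obtain xu xw where xuw: "xu \<in> ?P" "xw \<in> ?P" "x = f * xu + a * xw" using x unfolding I_def by blast
        have "r = f * (Polynomial.smult c xu - q * gu) + a * (Polynomial.smult c xw - q * gw)"
        proof -
          have "r = Polynomial.smult c x - q * g" using *(5) by simp
          then show ?thesis unfolding xuw(3) guw(3) by (simp add: algebra_simps smult_add_right)
        qed
        then have "r \<in> I"
          unfolding I_def using *(1,3) xuw guw by (auto intro!: ssetD[OF sset_polys] polys_smult)
        then have "r = 0" using *(6) gmin[of r] by fastforce
        then show ?thesis using * by auto
      qed
      obtain c q where cq: "c \<in> V" "c \<noteq> 0" "q \<in> ?P" "Polynomial.smult c f = q * g" using red[OF fI] by blast
      have "pf V c" using u cq by (simp add: ufd_def)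
      then obtain e q' g' where eq: "e \<in> V" "e \<noteq> 0" "q' \<in> ?P" "g' \<in> ?P" "g = Polynomial.smult e g'" "f = q' * g'"
        using split_const[OF _ fP(1) cq(3) IP[OF g(1)] cq(4)] by blast
      from fd[OF eq(3,4,6)] show ?thesis
      proof
        assume "un_in ?P q'"
        then obtain w where w: "w \<in> ?P" "1 = q' * w" unfolding un_in_def dv_def by blast
        have g'f: "g' = f * w" unfolding eq(6) using w(2) by (metis mult.assoc mult.commute mult_1)
        obtain c2 q2 where c2: "c2 \<in> V" "c2 \<noteq> 0" "q2 \<in> ?P" "Polynomial.smult c2 a = q2 * g" using red[OF aI] by blast
        have "f * (Polynomial.smult e w * q2) = Polynomial.smult c2 a"
          unfolding c2(4) eq(5) g'f by (simp add: mult_ac)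
        moreover have "pf V c2" using u c2 by (simp add: ufd_def)
        moreover have "Polynomial.smult e w * q2 \<in> ?P" by (intro ssetD(4)[OF sset_polys] polys_smult eq w c2)
        ultimately have "dv ?P f a" using cancel_const[OF _ _ a fP(1) _ np] by blast
        then show ?thesis using na by blast
      next
        assume "un_in ?P g'"
        then obtain d' where "g' = [:d':]" "un_in V d'" using un_polysD by blast
        then have gd: "g = [:e * d':]" and dV: "e * d' \<in> V" using eq ssetD(4)[OF V] by (auto simp: un_in_def)
        have d0: "e * d' \<noteq> 0" using g(2) gd by auto
        obtain z where z: "z \<in> ?P" "a * b = f * z" using d by (rule dvE)
        have "f * (gu * b + z * gw) = (f * gu + a * gw) * b" using z(2) by (simp add: algebra_simps)
        also have "\<dots> = Polynomial.smult (e * d') b" unfolding guw(3)[symmetric] gd by simp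
        finally have "f * (gu * b + z * gw) = Polynomial.smult (e * d') b" .
        moreover have "pf V (e * d')" using u dV d0 by (simp add: ufd_def)
        moreover have "gu * b + z * gw \<in> ?P" by (intro ssetD[OF sset_polys] guw b z)
        ultimately show ?thesis using cancel_const[OF _ _ b fP(1) _ np] by blast
      qed
    qed
    then show ?thesis using fP unfolding pr_def by blast
  qed
qed

end

section \<open>Multivariate polynomials\<close>

lemma mpoly_sum_single: "F = (\<Sum>a\<in>Poly_Mapping.keys F. Poly_Mapping.single a (Poly_Mapping.lookup F a))"
proof (rule poly_mapping_eqI)
  fix b
  have "Poly_Mapping.lookup (\<Sum>a\<in>Poly_Mapping.keys F. Poly_Mapping.single a (Poly_Mapping.lookup F a)) b
     = (\<Sum>a\<in>Poly_Mapping.keys F. if a = b then Poly_Mapping.lookup F a else 0)"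
    unfolding lookup_sum by (rule sum.cong) (auto simp: lookup_single when_def)
  then show "Poly_Mapping.lookup F b = Poly_Mapping.lookup (\<Sum>a\<in>Poly_Mapping.keys F. Poly_Mapping.single a (Poly_Mapping.lookup F a)) b"
    by (simp add: in_keys_iff)
qed

lemma lookup_times_keys:
  fixes F G :: "'a::comm_ring_1 mpoly"
  shows "Poly_Mapping.lookup (F * G) c = (\<Sum>a\<in>Poly_Mapping.keys F. \<Sum>b\<in>Poly_Mapping.keys G.
      if c = a + b then Poly_Mapping.lookup F a * Poly_Mapping.lookup G b else 0)"
proof -
  have "F * G = (\<Sum>a\<in>Poly_Mapping.keys F. Poly_Mapping.single a (Poly_Mapping.lookup F a)) *
     (\<Sum>b\<in>Poly_Mapping.keys G. Poly_Mapping.single b (Poly_Mapping.lookup G b))"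
    using mpoly_sum_single[of F] mpoly_sum_single[of G] by simp
  then have "F * G = (\<Sum>a\<in>Poly_Mapping.keys F. \<Sum>b\<in>Poly_Mapping.keys G.
     Poly_Mapping.single (a + b) (Poly_Mapping.lookup F a * Poly_Mapping.lookup G b))"
    by (simp add: sum_product mult_single)
  then show ?thesis
    by (simp add: lookup_sum lookup_single when_def) (intro sum.cong, auto)
qed

definition lead :: "((nat \<Rightarrow>\<^sub>0 nat) \<Rightarrow> nat) \<Rightarrow> 'a::zero mpoly \<Rightarrow> (nat \<Rightarrow>\<^sub>0 nat) \<Rightarrow> bool" where
  "lead w F \<alpha> \<longleftrightarrow> \<alpha> \<in> Poly_Mapping.keys F \<and> (\<forall>\<beta>\<in>Poly_Mapping.keys F. w \<beta> < w \<alpha> \<or> w \<beta> = w \<alpha> \<and> \<beta> \<le> \<alpha>)"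

lemma ex_lead:
  assumes "F \<noteq> 0"
  shows "\<exists>\<alpha>. lead w F \<alpha>"
proof -
  let ?K = "Poly_Mapping.keys F"
  have K: "finite ?K" "?K \<noteq> {}" using assms by auto
  define m where "m = Max (w ` ?K)"
  define J where "J = {\<alpha> \<in> ?K. w \<alpha> = m}"
  have "m \<in> w ` ?K" unfolding m_def by (rule Max_in) (use K in auto)
  then have J: "finite J" "J \<noteq> {}" using K by (auto simp: J_def)
  have "lead w F (Max J)"
    unfolding lead_def
  proof (intro conjI ballI)
    have MJ: "Max J \<in> J" by (rule Max_in[OF J])
    then show "Max J \<in> ?K" by (simp add: J_def)
    fix \<beta> assume \<beta>: "\<beta> \<in> ?K"
    then have "w \<beta> \<le> m" unfolding m_def using K by simp
    moreover have "\<beta> \<le> Max J" if "w \<beta> = m" using \<beta> that J by (intro Max_ge) (auto simp: J_def)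
    ultimately show "w \<beta> < w (Max J) \<or> w \<beta> = w (Max J) \<and> \<beta> \<le> Max J" using MJ by (auto simp: J_def)
  qed
  then show ?thesis by blast
qed

text \<open>The order on exponents is compatible with addition, so only the two leading terms
  produce the exponent \<open>\<alpha> + \<beta>\<close>, and nothing cancels.\<close>

lemma lead_mult:
  fixes F G :: "'a::field mpoly"
  assumes w: "\<And>\<alpha> \<beta>. w (\<alpha> + \<beta>) = w \<alpha> + w \<beta>" and F: "lead w F \<alpha>" and G: "lead w G \<beta>"
  shows "lead w (F * G) (\<alpha> + \<beta>)"
proof -
  have u: "\<alpha>' = \<alpha> \<and> \<beta>' = \<beta>" if k: "\<alpha>' \<in> Poly_Mapping.keys F" "\<beta>' \<in> Poly_Mapping.keys G" and e: "\<alpha> + \<beta> = \<alpha>' + \<beta>'" for \<alpha>' \<beta>'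
  proof -
    have "w \<alpha> + w \<beta> = w \<alpha>' + w \<beta>'" using arg_cong[OF e, of w] w by simp
    then have "\<alpha>' \<le> \<alpha>" "\<beta>' \<le> \<beta>" using F G k unfolding lead_def by fastforce+
    then show ?thesis using e add_less_le_mono[of \<alpha>' \<alpha> \<beta>' \<beta>] add_le_less_mono[of \<alpha>' \<alpha> \<beta>' \<beta>]
      by (metis add_left_cancel order_le_less order_less_irrefl)
  qed
  have ak: "\<alpha> \<in> Poly_Mapping.keys F" "\<beta> \<in> Poly_Mapping.keys G" using F G by (auto simp: lead_def)
  have "Poly_Mapping.lookup (F * G) (\<alpha> + \<beta>) = (\<Sum>a\<in>Poly_Mapping.keys F. \<Sum>b\<in>Poly_Mapping.keys G.
      if a = \<alpha> then (if b = \<beta> then Poly_Mapping.lookup F a * Poly_Mapping.lookup G b else 0) else 0)"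
    unfolding lookup_times_keys using u by (intro sum.cong refl) auto
  also have "\<dots> = (\<Sum>a\<in>Poly_Mapping.keys F. if a = \<alpha> then Poly_Mapping.lookup F a * Poly_Mapping.lookup G \<beta> else 0)"
    by (rule sum.cong[OF refl]) (use ak in auto)
  also have "\<dots> = Poly_Mapping.lookup F \<alpha> * Poly_Mapping.lookup G \<beta>" using ak by simp
  finally have "\<alpha> + \<beta> \<in> Poly_Mapping.keys (F * G)" using ak by (simp add: in_keys_iff)
  moreover have "w \<gamma> < w (\<alpha> + \<beta>) \<or> w \<gamma> = w (\<alpha> + \<beta>) \<and> \<gamma> \<le> \<alpha> + \<beta>" if "\<gamma> \<in> Poly_Mapping.keys (F * G)" for \<gamma>
  proof -
    obtain a b where "\<gamma> = a + b" "a \<in> Poly_Mapping.keys F" "b \<in> Poly_Mapping.keys G"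
      using \<open>\<gamma> \<in> Poly_Mapping.keys (F * G)\<close> keys_mult[of F G] by blast
    then show ?thesis using F G unfolding lead_def by (auto simp: w intro: add_mono) (metis add_mono add_less_le_mono add_le_less_mono add_less_mono less_imp_le_nat order_refl)+
  qed
  ultimately show ?thesis unfolding lead_def by blast
qed

definition wdeg :: "((nat \<Rightarrow>\<^sub>0 nat) \<Rightarrow> nat) \<Rightarrow> 'a::zero mpoly \<Rightarrow> nat" where
  "wdeg w F = Max (w ` Poly_Mapping.keys F)"

lemma wdeg_lead: "lead w F \<alpha> \<Longrightarrow> wdeg w F = w \<alpha>"
  unfolding wdeg_def lead_def by (intro Max_eqI) (auto intro: less_imp_le)

lemma wdeg_mult:
  fixes F G :: "'a::field mpoly"
  assumes w: "\<And>\<alpha> \<beta>. w (\<alpha> + \<beta>) = w \<alpha> + w \<beta>" and "F \<noteq> 0" "G \<noteq> 0"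
  shows "wdeg w (F * G) = wdeg w F + wdeg w G"
proof -
  obtain \<alpha> \<beta> where ab: "lead w F \<alpha>" "lead w G \<beta>" using ex_lead assms(2,3) by metis
  then show ?thesis using lead_mult[OF w ab] by (simp add: wdeg_lead w)
qed

lemma keys_add_nat: "Poly_Mapping.keys (\<alpha> + \<beta>) = Poly_Mapping.keys \<alpha> \<union> Poly_Mapping.keys (\<beta> :: nat \<Rightarrow>\<^sub>0 nat)"
  by (auto simp: in_keys_iff lookup_add)

lemma mono_deg_superset:
  "finite J \<Longrightarrow> Poly_Mapping.keys \<alpha> \<subseteq> J \<Longrightarrow> mono_deg \<alpha> = (\<Sum>j\<in>J. Poly_Mapping.lookup \<alpha> j)"
  unfolding mono_deg_def by (rule sum.mono_neutral_left) (auto simp: in_keys_iff)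

lemma mono_deg_add: "mono_deg (\<alpha> + \<beta>) = mono_deg \<alpha> + mono_deg \<beta>"
proof -
  let ?J = "Poly_Mapping.keys \<alpha> \<union> Poly_Mapping.keys \<beta>"
  show ?thesis
    using mono_deg_superset[of ?J \<alpha>] mono_deg_superset[of ?J \<beta>] mono_deg_superset[of ?J "\<alpha> + \<beta>"]
    by (simp add: keys_add_nat lookup_add sum.distrib)
qed

lemma total_degree_wdeg: "total_degree F = wdeg mono_deg F"
  by (simp add: total_degree_def wdeg_def)

lemma total_degree_mult:
  "F \<noteq> 0 \<Longrightarrow> G \<noteq> 0 \<Longrightarrow> total_degree (F * G) = total_degree F + total_degree (G :: 'a::field mpoly)"
  unfolding total_degree_wdeg by (rule wdeg_mult) (auto simp: mono_deg_add)

lemma mono_deg_le_total: "\<alpha> \<in> Poly_Mapping.keys F \<Longrightarrow> mono_deg \<alpha> \<le> total_degree F"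
  unfolding total_degree_def by simp

lemma mono_deg_eq_0: "mono_deg \<alpha> = 0 \<Longrightarrow> \<alpha> = 0"
  unfolding mono_deg_def by (rule poly_mapping_eqI) (auto simp: in_keys_iff)

lemma total_degree_0D:
  assumes "total_degree F = 0" "F \<noteq> 0"
  obtains c where "F = Poly_Mapping.single 0 c" "c \<noteq> 0"
proof -
  have k: "Poly_Mapping.keys F \<subseteq> {0}" using mono_deg_le_total[of _ F] assms(1) mono_deg_eq_0 by fastforce
  have "F = Poly_Mapping.single 0 (Poly_Mapping.lookup F 0)"
  proof (rule poly_mapping_eqI)
    fix a show "Poly_Mapping.lookup F a = Poly_Mapping.lookup (Poly_Mapping.single 0 (Poly_Mapping.lookup F 0)) a"
      using k by (cases "a = 0") (auto simp: lookup_single when_def in_keys_iff)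
  qed
  then show thesis using that assms(2) by (metis single_zero)
qed

lemma in_vars_add: "in_vars n F \<Longrightarrow> in_vars n G \<Longrightarrow> in_vars n (F + G)"
  unfolding in_vars_def using keys_add[of F G] by blast

lemma in_vars_diff: "in_vars n F \<Longrightarrow> in_vars n G \<Longrightarrow> in_vars n (F - (G :: 'a::ab_group_add mpoly))"
  unfolding in_vars_def using keys_diff[of F G] by blast

lemma in_vars_mult: "in_vars n F \<Longrightarrow> in_vars n G \<Longrightarrow> in_vars n (F * (G :: 'a::comm_ring_1 mpoly))"
  unfolding in_vars_def
proof
  fix \<gamma> assume FG: "\<forall>\<alpha>\<in>Poly_Mapping.keys F. Poly_Mapping.keys \<alpha> \<subseteq> {..<n}" "\<forall>\<alpha>\<in>Poly_Mapping.keys G. Poly_Mapping.keys \<alpha> \<subseteq> {..<n}"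
    and "\<gamma> \<in> Poly_Mapping.keys (F * G)"
  then obtain a b where "\<gamma> = a + b" "a \<in> Poly_Mapping.keys F" "b \<in> Poly_Mapping.keys G" using keys_mult[of F G] by blast
  then show "Poly_Mapping.keys \<gamma> \<subseteq> {..<n}" using FG keys_add_nat[of a b] by auto
qed

lemma in_vars_single: "Poly_Mapping.keys \<alpha> \<subseteq> {..<n} \<Longrightarrow> in_vars n (Poly_Mapping.single \<alpha> c)"
  by (auto simp: in_vars_def split: if_splits)

definition VV :: "nat \<Rightarrow> 'a::field mpoly set" where "VV n = {F. in_vars n F}"

lemma sset_VV: "sset (VV n)"
  unfolding sset_def VV_def
  by (auto intro: in_vars_add in_vars_diff in_vars_mult simp: in_vars_def[of _ 0] in_vars_def[of _ 1])

lemma unit_single: "c \<noteq> 0 \<Longrightarrow> un_in (VV n) (Poly_Mapping.single 0 (c :: 'a::field))"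
  unfolding un_in_def VV_def
  by (auto intro!: in_vars_single dvI[of "Poly_Mapping.single 0 (inverse c)"] simp: mult_single single_one)

lemma ufd_VV_0: "ufd (VV 0 :: 'a::field mpoly set)"
  unfolding ufd_def
proof (intro ballI impI)
  fix F :: "'a mpoly" assume F: "F \<in> VV 0" "F \<noteq> 0"
  then obtain \<alpha> where a: "lead mono_deg F \<alpha>" using ex_lead by blast
  have "\<alpha> = 0" using F a by (auto simp: VV_def in_vars_def lead_def)
  then have "total_degree F = 0" unfolding total_degree_wdeg wdeg_lead[OF a] by (simp add: mono_deg_def)
  then obtain c where "F = Poly_Mapping.single 0 c" "c \<noteq> 0" using total_degree_0D F(2) by blast
  then show "pf (VV 0) F" using unit_single by (auto intro: pf.unit)
qed

abbreviation Xv :: "nat \<Rightarrow> 'a::field mpoly" where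
  "Xv n \<equiv> Poly_Mapping.single (Poly_Mapping.single n 1) 1"

lemma Xv_power: "Xv n ^ i = (Poly_Mapping.single (Poly_Mapping.single n i) 1 :: 'a::field mpoly)"
  by (induction i) (auto simp: mult_single single_add[symmetric])

lemma in_vars_mono: "in_vars n F \<Longrightarrow> n \<le> m \<Longrightarrow> in_vars m F"
  unfolding in_vars_def by fastforce

lemma lookup_times_Xv:
  fixes c :: "'a::field mpoly"
  assumes c: "in_vars n c" and \<alpha>: "Poly_Mapping.keys \<alpha> \<subseteq> {..<n}"
  shows "Poly_Mapping.lookup (c * Xv n ^ i) (\<alpha> + Poly_Mapping.single n j) = (if i = j then Poly_Mapping.lookup c \<alpha> else 0)"
proof -
  have e: "\<alpha> + Poly_Mapping.single n j = a + Poly_Mapping.single n i \<longleftrightarrow> a = \<alpha> \<and> i = j" if "a \<in> Poly_Mapping.keys c" for a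
  proof
    assume eq: "\<alpha> + Poly_Mapping.single n j = a + Poly_Mapping.single n i"
    have "n \<notin> Poly_Mapping.keys a" "n \<notin> Poly_Mapping.keys \<alpha>" using c \<alpha> that unfolding in_vars_def by auto
    then have "i = j" using arg_cong[OF eq, of "\<lambda>\<beta>. Poly_Mapping.lookup \<beta> n"] by (simp add: lookup_add in_keys_iff)
    then show "a = \<alpha> \<and> i = j" using eq by simp
  qed auto
  have "Poly_Mapping.lookup (c * Xv n ^ i) (\<alpha> + Poly_Mapping.single n j)
     = (\<Sum>a\<in>Poly_Mapping.keys c. if \<alpha> + Poly_Mapping.single n j = a + Poly_Mapping.single n i then Poly_Mapping.lookup c a else 0)"
    unfolding Xv_power lookup_times_keys by (intro sum.cong refl) (simp only: keys_single, simp)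
  also have "\<dots> = (\<Sum>a\<in>Poly_Mapping.keys c. if a = \<alpha> then (if i = j then Poly_Mapping.lookup c a else 0) else 0)"
    by (rule sum.cong[OF refl]) (use e in auto)
  also have "\<dots> = (if i = j then Poly_Mapping.lookup c \<alpha> else 0)" by (auto simp: in_keys_iff)
  finally show ?thesis .
qed

text \<open>The monomials with exponent \<open>j\<close> in the new variable recover coefficient
  \<open>j\<close> of \<open>p\<close>. Together with \<open>poly_Xv_surj\<close> this identifies
  \<open>VV (Suc n)\<close> with the polynomials over \<open>VV n\<close>.\<close>

lemma poly_Xv_inj:
  fixes p :: "'a::field mpoly poly"
  assumes p: "p \<in> polys (VV n)" and 0: "poly p (Xv n) = 0"
  shows "p = 0"
proof (rule poly_eqI)
  fix j
  have pc: "in_vars n (Polynomial.coeff p i)" for i using p by (simp add: polys_def VV_def)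
  have "Poly_Mapping.lookup (Polynomial.coeff p j) \<alpha> = 0" for \<alpha>
  proof (cases "Poly_Mapping.keys \<alpha> \<subseteq> {..<n}")
    case True
    have "0 = Poly_Mapping.lookup (poly p (Xv n)) (\<alpha> + Poly_Mapping.single n j)" using 0 by simp
    also have "\<dots> = (\<Sum>i\<le>Polynomial.degree p. if i = j then Poly_Mapping.lookup (Polynomial.coeff p i) \<alpha> else 0)"
      unfolding poly_altdef lookup_sum using lookup_times_Xv[OF pc True] by simp
    also have "\<dots> = Poly_Mapping.lookup (Polynomial.coeff p j) \<alpha>" by (auto simp: coeff_eq_0)
    finally show ?thesis by simp
  next
    case False
    then show ?thesis using pc[of j] unfolding in_vars_def by (auto simp: in_keys_iff)
  qed
  then show "Polynomial.coeff p j = Polynomial.coeff 0 j" by (auto intro: poly_mapping_eqI)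
qed

lemma poly_Xv_in:
  fixes p :: "'a::field mpoly poly"
  assumes "p \<in> polys (VV n)"
  shows "poly p (Xv n) \<in> VV (Suc n)"
  unfolding poly_altdef
proof (rule sset_sum[OF sset_VV], rule ssetD(4)[OF sset_VV])
  fix i
  show "Polynomial.coeff p i \<in> VV (Suc n)" using assms in_vars_mono[of n _ "Suc n"] by (auto simp: polys_def VV_def)
  show "Xv n ^ i \<in> (VV (Suc n) :: 'a mpoly set)" unfolding Xv_power VV_def by (auto intro!: in_vars_single split: if_splits)
qed

lemma poly_Xv_surj:
  fixes F :: "'a::field mpoly"
  assumes F: "F \<in> VV (Suc n)"
  obtains p where "p \<in> polys (VV n)" "F = poly p (Xv n)"
proof -
  have S: "sset (polys (VV n) :: 'a mpoly poly set)"
    by (rule sset_polys_of[OF sset_VV])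
  have 1: "\<exists>p \<in> polys (VV n). Poly_Mapping.single a c = poly p (Xv n)"
    if a: "Poly_Mapping.keys a \<subseteq> {..<Suc n}" for a and c :: 'a
  proof -
    define b where "b = a - Poly_Mapping.single n (Poly_Mapping.lookup a n)"
    have b: "Poly_Mapping.lookup b i = (if i = n then 0 else Poly_Mapping.lookup a i)" for i
      by (auto simp: b_def minus_poly_mapping.rep_eq lookup_single when_def)
    have ab: "a = b + Poly_Mapping.single n (Poly_Mapping.lookup a n)"
      by (rule poly_mapping_eqI) (auto simp: lookup_add b lookup_single when_def)
    have bk: "Poly_Mapping.keys b \<subseteq> {..<n}" using a by (auto simp: in_keys_iff b subset_iff less_Suc_eq split: if_splits)
    have "Polynomial.monom (Poly_Mapping.single b c) (Poly_Mapping.lookup a n) \<in> polys (VV n)"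
      using bk by (auto simp: polys_def VV_def in_vars_single in_vars_def[of _ 0])
    moreover have "Poly_Mapping.single a c = poly (Polynomial.monom (Poly_Mapping.single b c) (Poly_Mapping.lookup a n)) (Xv n)"
      unfolding poly_monom Xv_power mult_single using ab by simp
    ultimately show ?thesis by blast
  qed
  have "\<exists>p. \<forall>a\<in>Poly_Mapping.keys F. p a \<in> polys (VV n) \<and> Poly_Mapping.single a (Poly_Mapping.lookup F a) = poly (p a) (Xv n)"
    by (rule bchoice) (use 1 F in \<open>auto simp: VV_def in_vars_def Bex_def\<close>)
  then obtain p where p: "\<forall>a\<in>Poly_Mapping.keys F. p a \<in> polys (VV n) \<and> Poly_Mapping.single a (Poly_Mapping.lookup F a) = poly (p a) (Xv n)" by blast
  have "F = poly (\<Sum>a\<in>Poly_Mapping.keys F. p a) (Xv n)"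
    unfolding poly_sum using p by (subst mpoly_sum_single[of F]) (auto intro: sum.cong)
  moreover have "(\<Sum>a\<in>Poly_Mapping.keys F. p a) \<in> polys (VV n)" by (rule sset_sum[OF S]) (use p in blast)
  ultimately show thesis using that by blast
qed

text \<open>Induction on the number of variables: polynomials over \<open>VV n\<close> are factorial
  by \<open>irr_pr\<close>, and factorizations are transported by evaluation at the new
  variable.\<close>

lemma ufd_VV: "ufd (VV n :: 'a::field mpoly set)"
proof (induction n)
  case 0
  show ?case by (rule ufd_VV_0)
next
  case (Suc n)
  interpret ufd_coeffs "VV n :: 'a mpoly set" by unfold_locales (rule sset_VV, rule Suc)
  let ?P = "polys (VV n) :: 'a mpoly poly set" and ?W = "VV (Suc n) :: 'a mpoly set"
  define \<Phi> where "\<Phi> = (\<lambda>p :: 'a mpoly poly. poly p (Xv n))"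
  have mult: "\<Phi> (p * q) = \<Phi> p * \<Phi> q" and one: "\<Phi> 1 = 1" for p q by (auto simp: \<Phi>_def)
  have inj0: "p = 0" if "p \<in> ?P" "\<Phi> p = 0" for p using poly_Xv_inj that by (auto simp: \<Phi>_def)
  have inj: "p = q" if pq: "p \<in> ?P" "q \<in> ?P" "\<Phi> p = \<Phi> q" for p q
    using inj0[of "p - q"] ssetD(5)[OF sset_polys pq(1,2)] pq(3) by (simp add: \<Phi>_def)
  have into: "\<Phi> p \<in> ?W" if "p \<in> ?P" for p using poly_Xv_in that by (auto simp: \<Phi>_def)
  have surj: "\<exists>p\<in>?P. F = \<Phi> p" if "F \<in> ?W" for F using poly_Xv_surj[OF that] by (auto simp: \<Phi>_def)
  have dvT: "dv ?W (\<Phi> p) (\<Phi> q) \<longleftrightarrow> dv ?P p q" if "p \<in> ?P" "q \<in> ?P" for p q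
  proof
    assume "dv ?W (\<Phi> p) (\<Phi> q)"
    then obtain r where r: "r \<in> ?P" "\<Phi> q = \<Phi> p * \<Phi> r" using surj unfolding dv_def by metis
    then have "q = p * r" using inj[of q "p * r"] that ssetD(4)[OF sset_polys] mult by simp
    then show "dv ?P p q" using r by (intro dvI)
  next
    assume "dv ?P p q"
    then show "dv ?W (\<Phi> p) (\<Phi> q)" unfolding dv_def using mult into by metis
  qed
  have unT: "un_in ?W (\<Phi> p) \<longleftrightarrow> un_in ?P p" if "p \<in> ?P" for p
    unfolding un_in_def using dvT[OF that ssetD(2)[OF sset_polys]] into that one by simp
  have prT: "pr ?W (\<Phi> p)" if p: "pr ?P p" for p
  proof -
    have pP: "p \<in> ?P" "p \<noteq> 0" "\<not> un_in ?P p" using p by (auto simp: pr_def)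
    have "dv ?W (\<Phi> p) a \<or> dv ?W (\<Phi> p) b" if ab: "a \<in> ?W" "b \<in> ?W" "dv ?W (\<Phi> p) (a * b)" for a b
    proof -
      obtain x y where xy: "x \<in> ?P" "a = \<Phi> x" "y \<in> ?P" "b = \<Phi> y" using surj ab by metis
      then have "dv ?P p (x * y)" using ab(3) dvT[OF pP(1), of "x * y"] ssetD(4)[OF sset_polys] mult by simp
      then show ?thesis using p xy dvT[OF pP(1)] unfolding pr_def by blast
    qed
    then show ?thesis using pP inj0 into unT unfolding pr_def by blast
  qed
  have pfT: "pf ?W (\<Phi> f)" if "pf ?P f" for f
    using that
  proof induction
    case (unit u)
    then show ?case using unT by (auto intro: pf.unit simp: un_in_def)
  next
    case (prime p f)
    then show ?case unfolding mult by (intro pf.prime prT)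
  qed
  have "ufd ?P"
  \<comment> \<open>The degree in the new variable would not do, since its constants need not be
    units; total degree 0 means a nonzero scalar.\<close>
  proof (rule ufdI[where m = "\<lambda>f. total_degree (\<Phi> f)"])
    show "total_degree (\<Phi> (f * g)) = total_degree (\<Phi> f) + total_degree (\<Phi> g)"
      if "f \<in> ?P" "g \<in> ?P" "f \<noteq> 0" "g \<noteq> 0" for f g
      unfolding mult using that inj0 by (intro total_degree_mult) auto
    show "un_in ?P f" if f: "f \<in> ?P" "f \<noteq> 0" "total_degree (\<Phi> f) = 0" for f
    proof -
      have "\<Phi> f \<noteq> 0" using inj0 f by blast
      then obtain c where "\<Phi> f = Poly_Mapping.single 0 c" "c \<noteq> 0" using total_degree_0D[OF f(3)] by blast
      then show ?thesis using unit_single[of c "Suc n"] unT[OF f(1)] by simp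
    qed
  qed (use sset_polys irr_pr in auto)
  then show ?case unfolding ufd_def using surj pfT by (metis \<Phi>_def poly_0)
qed

text \<open>\<open>Q * F2\<close> is a multiple of \<open>F1\<close>, so unique factorization and
  coprimality put \<open>F1\<close> into \<open>Q\<close>.\<close>

lemma coprime_syzygy:
  fixes F1 F2 P Q :: "'a::field mpoly"
  assumes vars: "in_vars n F1" "in_vars n F2" "in_vars n P" "in_vars n Q"
    and cop: "mpoly_coprime F1 F2" and F1: "F1 \<noteq> 0" and e: "P * F1 + Q * F2 = 0"
  obtains R where "in_vars n R" "Q = F1 * R"
proof -
  have PV: "- P \<in> VV n" using vars in_vars_diff[of n 0 P] by (simp add: VV_def in_vars_def[of _ 0])
  have "Q * F2 = F1 * (- P)" using e by (simp add: eq_neg_iff_add_eq_0 algebra_simps)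
  then have d: "dv (VV n) F1 (Q * F2)" using PV by (intro dvI)
  have "F1 \<in> VV n" using vars(1) by (simp add: VV_def)
  then have "pf (VV n) F1" using ufd_VV[of n] F1 unfolding ufd_def by blast
  then have "dv (VV n) F1 Q"
  proof (rule coprime_dv[OF sset_VV _ _ _ d])
    fix H :: "'a mpoly" assume H: "H \<in> VV n" "dv (VV n) H F1" "dv (VV n) H F2"
    then have "H dvd F1" "H dvd F2" unfolding dv_def by auto
    then have "total_degree H = 0" "H \<noteq> 0" using cop F1 unfolding mpoly_coprime_def by auto
    then obtain c where "H = Poly_Mapping.single 0 c" "c \<noteq> 0" by (rule total_degree_0D)
    then show "un_in (VV n) H" using unit_single by simp
  qed (use vars in \<open>auto simp: VV_def\<close>)
  then show thesis using that by (auto simp: dv_def VV_def)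
qed

section \<open>Counting monomials\<close>

lemma binomial_sum_diff: "(\<Sum>i<e. (a + i) choose k) + (a choose Suc k) = (a + e) choose Suc k"
  by (induction e) auto

text \<open>For \<open>k = n - 2\<close> and \<open>b = m + n - 2 * d\<close> the right-hand side is
  \<open>M'_num n d m\<close>, which thus is a sum of \<open>d * d\<close> binomials of degree
  \<open>n - 2\<close> in \<open>m\<close>.\<close>

lemma binomial_second_diff:
  "int (\<Sum>i<d. \<Sum>j<d. (b + i + j) choose k)
     = int ((b + 2 * d) choose (k + 2)) - 2 * int ((b + d) choose (k + 2)) + int (b choose (k + 2))"
proof -
  have 1: "int (\<Sum>j<d. (b + i + j) choose k) = int ((b + d + i) choose Suc k) - int ((b + i) choose Suc k)" for i
    using arg_cong[OF binomial_sum_diff[where e = d and a = "b + i" and k = k], of int] by (simp add: ac_simps)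
  have "int (\<Sum>i<d. \<Sum>j<d. (b + i + j) choose k)
     = int (\<Sum>i<d. (b + d + i) choose Suc k) - int (\<Sum>i<d. (b + i) choose Suc k)"
    unfolding of_nat_sum[of _ "{..<d}"] sum_subtractf[symmetric] using 1 by (intro sum.cong refl) (simp add: of_nat_sum)
  also have "\<dots> = (int ((b + d + d) choose (k + 2)) - int ((b + d) choose (k + 2))) - (int ((b + d) choose (k + 2)) - int (b choose (k + 2)))"
    using arg_cong[OF binomial_sum_diff[where e = d and a = "b + d" and k = "Suc k"], of int]
      arg_cong[OF binomial_sum_diff[where e = d and a = b and k = "Suc k"], of int]
    by simp
  finally have *: "int (\<Sum>i<d. \<Sum>j<d. (b + i + j) choose k) = \<dots>" .
  have "b + 2 * d = b + d + d" by linarith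
  show ?thesis unfolding \<open>b + 2 * d = b + d + d\<close> using * by simp
qed

lemma M'_num_bigo:
  assumes n: "n \<ge> 1"
  shows "(\<lambda>m. real_of_int (M'_num n d m)) \<in> O(\<lambda>m. real m powr (real n - 2))"
proof (cases "n = 1")
  case True
  \<comment> \<open>In one variable the second difference of a linear function vanishes; the target
    exponent is negative here, and exact vanishing settles it.\<close>
  have "M'_num n d m = 0" if "m \<ge> 2 * d" for m using that True by (simp add: M'_num_def M_num_def)
  then have "\<forall>\<^sub>F m in sequentially. real_of_int (M'_num n d m) = 0" by (auto intro: eventually_sequentiallyI[of "2 * d"])
  then show ?thesis by (intro bigoI[of _ 0]) (auto elim: eventually_mono)
next
  case False
  define q where "q = n - 2"
  have nq: "n = q + 2" using n False by (simp add: q_def)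
  have "norm (real_of_int (M'_num n d m)) \<le> real (d * d * (n + 1) ^ q) * norm (real m powr (real n - 2))"
    if m: "m \<ge> max 1 (2 * d)" for m
  proof -
    define b where "b = m + n - 2 * d"
    have b: "b + 2 * d = m + n" "b + d = m + n - d" "b = m + n - 2 * d" using m by (auto simp: b_def)
    have e: "M'_num n d m = int (\<Sum>i<d. \<Sum>j<d. (b + i + j) choose q)"
      unfolding binomial_second_diff b(1,2) using b(3) by (simp add: M'_num_def M_num_def nq)
    have "(b + i + j) choose q \<le> ((n + 1) * m) ^ q" if "i < d" "j < d" for i j
    proof (cases "q \<le> b + i + j")
      case True
      then have "(b + i + j) choose q \<le> (b + i + j) ^ q" by (rule binomial_le_pow)
      also have "\<dots> \<le> ((n + 1) * m) ^ q"
      proof (rule power_mono)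
        have "n * 1 \<le> n * m" using m by (intro mult_le_mono) auto
        moreover have "(n + 1) * m = n * m + m" by simp
        ultimately show "b + i + j \<le> (n + 1) * m" using b(1) that by linarith
      qed simp
      finally show ?thesis .
    qed (simp add: binomial_eq_0)
    then have "(\<Sum>i<d. \<Sum>j<d. (b + i + j) choose q) \<le> (\<Sum>i<d. \<Sum>j<d. ((n + 1) * m) ^ q)" by (intro sum_mono) auto
    then have "(\<Sum>i<d. \<Sum>j<d. (b + i + j) choose q) \<le> d * d * (n + 1) ^ q * m ^ q" unfolding power_mult_distrib by (simp add: mult.assoc)
    then have "real (\<Sum>i<d. \<Sum>j<d. (b + i + j) choose q) \<le> real (d * d * (n + 1) ^ q * m ^ q)" by (simp only: of_nat_le_iff)
    moreover have "real m powr (real n - 2) = real (m ^ q)" using m nq by (simp add: powr_realpow)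
    moreover have "norm (real_of_int (int N)) = real N" for N by simp
    ultimately show ?thesis unfolding e by (simp del: of_nat_sum)
  qed
  then show ?thesis by (intro bigoI[where c = "real (d * d * (n + 1) ^ q)"] eventually_sequentiallyI)
qed

text \<open>A slack entry \<open>m - mono_deg \<alpha>\<close> turns the bound on the degree into an
  equation, so lists with prescribed sum are counted.\<close>

lemma card_exps_upto: "finite (exps_upto n m) \<and> card (exps_upto n m) = (m + n) choose n"
proof -
  let ?L = "{l :: nat list. length l = Suc n \<and> sum_list l = m}"
  define \<Phi> where "\<Phi> = (\<lambda>\<alpha> :: nat \<Rightarrow>\<^sub>0 nat. map (Poly_Mapping.lookup \<alpha>) [0..<n] @ [m - mono_deg \<alpha>])"
  define \<Psi> where "\<Psi> = (\<lambda>l :: nat list. \<Sum>j<n. Poly_Mapping.single j (l ! j))"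
  have md: "mono_deg \<alpha> = (\<Sum>j<n. Poly_Mapping.lookup \<alpha> j)" if "Poly_Mapping.keys \<alpha> \<subseteq> {..<n}" for \<alpha>
    by (rule mono_deg_superset) (use that in auto)
  have sl: "sum_list (map f [0..<n]) = (\<Sum>j<n. f j)" for f :: "nat \<Rightarrow> nat"
    by (simp add: interv_sum_list_conv_sum_set_nat atLeast0LessThan)
  have lp: "Poly_Mapping.lookup (\<Psi> l) i = (if i < n then l ! i else 0)" for l i
    by (simp add: \<Psi>_def lookup_sum lookup_single when_def)
  have k: "Poly_Mapping.keys (\<Psi> l) \<subseteq> {..<n}" for l by (auto simp: in_keys_iff lp split: if_splits)
  have 1: "\<Phi> \<alpha> \<in> ?L" "\<Psi> (\<Phi> \<alpha>) = \<alpha>" if "\<alpha> \<in> exps_upto n m" for \<alpha>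
  proof -
    have \<alpha>: "Poly_Mapping.keys \<alpha> \<subseteq> {..<n}" "mono_deg \<alpha> \<le> m" using that by (auto simp: exps_upto_def)
    show "\<Phi> \<alpha> \<in> ?L" using \<alpha>(2) md[OF \<alpha>(1)] sl by (simp add: \<Phi>_def)
    show "\<Psi> (\<Phi> \<alpha>) = \<alpha>"
    proof (rule poly_mapping_eqI)
      fix i show "Poly_Mapping.lookup (\<Psi> (\<Phi> \<alpha>)) i = Poly_Mapping.lookup \<alpha> i"
        using \<alpha>(1) by (auto simp: lp \<Phi>_def nth_append in_keys_iff subset_iff)
    qed
  qed
  have 2: "\<Psi> l \<in> exps_upto n m" "\<Phi> (\<Psi> l) = l" if l: "l \<in> ?L" for l
  proof -
    have bl: "l = butlast l @ [last l]" and len: "length (butlast l) = n" using l by (auto simp: append_butlast_last_id[symmetric] simp del: append_butlast_last_id) (metis append_butlast_last_id length_0_conv nat.distinct(1))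
    have mp: "map (Poly_Mapping.lookup (\<Psi> l)) [0..<n] = butlast l"
      by (rule nth_equalityI) (use len in \<open>auto simp: lp nth_butlast\<close>)
    have s: "sum_list l = sum_list (butlast l) + last l" by (subst bl) simp
    have mdl: "mono_deg (\<Psi> l) = sum_list (butlast l)" unfolding md[OF k] sl[symmetric] mp ..
    show "\<Psi> l \<in> exps_upto n m" using k mdl s l by (simp add: exps_upto_def)
    have "sum_list l = m" using l by simp
    then have "last l = m - mono_deg (\<Psi> l)" using mdl s by linarith
    then show "\<Phi> (\<Psi> l) = l" unfolding \<Phi>_def mp using bl by simp
  qed
  have "bij_betw \<Phi> (exps_upto n m) ?L" by (rule bij_betw_byWitness[where f' = \<Psi>]) (use 1 2 in blast)+
  moreover have "finite ?L" by (rule finite_subset[OF _ finite_lists_length_eq[of "{..m}" "Suc n"]]) (auto dest: member_le_sum_list)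
  ultimately have "finite (exps_upto n m)" "card (exps_upto n m) = card ?L" by (auto simp: bij_betw_finite bij_betw_same_card)
  moreover have "card ?L = (m + n) choose n" using card_length_sum_list[of "Suc n" m] binomial_symmetric[of n "m + n"] by simp
  ultimately show ?thesis by simp
qed

text \<open>\<open>F1 R\<close> has a monomial divisible by the leading monomial \<open>\<mu>\<close> of \<open>F1\<close>; discarding those
  multiples of \<open>\<mu>\<close> for \<open>F2\<close> therefore leaves a linearly independent family.\<close>

lemma multiples_family:
  fixes F1 F2 :: "'a::field mpoly"
  assumes F1_vars: "in_vars n F1" and F2_vars: "in_vars n F2" and cop: "mpoly_coprime F1 F2"
    and F1: "F1 \<noteq> 0" and F2: "F2 \<noteq> 0" and deg1: "total_degree F1 = d" and md: "m \<ge> 2 * d"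
  obtains \<phi> :: "nat \<Rightarrow> 'a mpoly" where
    "int (nat (M_num n d m)) = M_num n d m"
    "\<forall>s<nat (M_num n d m). \<exists>i\<in>exps_upto n (m - d). \<phi> s = Poly_Mapping.single i 1 * F1 \<or> \<phi> s = Poly_Mapping.single i 1 * F2"
    "\<forall>c. (\<Sum>s<nat (M_num n d m). Poly_Mapping.single 0 (c s) * \<phi> s) = 0 \<longrightarrow> (\<forall>s<nat (M_num n d m). c s = 0)"
proof -
  obtain \<mu> where \<mu>: "lead mono_deg F1 \<mu>" using ex_lead F1 by blast
  have \<mu>d: "mono_deg \<mu> = d" using wdeg_lead[OF \<mu>] deg1 by (simp add: total_degree_wdeg)
  have \<mu>n: "Poly_Mapping.keys \<mu> \<subseteq> {..<n}" using \<mu> F1_vars by (auto simp: lead_def in_vars_def)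
  define B where "B = exps_upto n (m - d)"
  define C where "C = (\<lambda>j. \<mu> + j) ` exps_upto n (m - 2 * d)"
  have B: "finite B" "card B = (m + n - d) choose n" using card_exps_upto[of n "m - d"] md by (auto simp: B_def)
  have C: "card C = (m + n - 2 * d) choose n"
    unfolding C_def using card_exps_upto[of n "m - 2 * d"] md by (subst card_image) (auto simp: inj_on_def)
  have CB: "C \<subseteq> B"
    unfolding C_def B_def using md \<mu>n by (auto simp: exps_upto_def mono_deg_add \<mu>d keys_add_nat)
  have mC: "i \<in> C" if "i \<in> B" "i = \<mu> + j" for i j
  proof -
    have "j \<in> exps_upto n (m - 2 * d)"
      using that md by (auto simp: B_def exps_upto_def mono_deg_add \<mu>d keys_add_nat)
    then show ?thesis unfolding C_def that(2) by (rule imageI)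
  qed
  \<comment> \<open>The left summand indexes multiples of \<open>F1\<close>, the right one multiples
    of \<open>F2\<close>; the size \<open>2 * card B - card C\<close> is
    \<open>M_num n d m\<close>.\<close>
  define \<Phi> where "\<Phi> = B <+> (B - C)"
  have fin: "finite \<Phi>" using B by (simp add: \<Phi>_def)
  have "int (card \<Phi>) = M_num n d m"
    using B C CB card_mono[OF B(1) CB] by (simp add: \<Phi>_def card_Plus card_Diff_subset finite_subset M_num_def)
  then have M: "card \<Phi> = nat (M_num n d m)" "int (nat (M_num n d m)) = M_num n d m" by auto
  obtain h where h: "bij_betw h {..<nat (M_num n d m)} \<Phi>"
    using ex_bij_betw_nat_finite[OF fin] M(1) by (metis atLeast0LessThan)
  define \<psi> where "\<psi> = case_sum (\<lambda>i. Poly_Mapping.single i 1 * F1) (\<lambda>i. Poly_Mapping.single i 1 * F2)"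
  have "\<exists>i\<in>exps_upto n (m - d). \<psi> (h s) = Poly_Mapping.single i 1 * F1 \<or> \<psi> (h s) = Poly_Mapping.single i 1 * F2"
    if "s < nat (M_num n d m)" for s
  proof -
    have "h s \<in> \<Phi>" using h that by (auto simp: bij_betw_def)
    then show ?thesis unfolding \<Phi>_def B_def \<psi>_def by (elim PlusE) auto
  qed
  moreover have "c s = 0" if sum: "(\<Sum>s<nat (M_num n d m). Poly_Mapping.single 0 (c s) * \<psi> (h s)) = 0" and s: "s < nat (M_num n d m)" for c s
  proof -
    define e where "e = (\<lambda>x. c (the_inv_into {..<nat (M_num n d m)} h x))"
    have eh: "e (h s) = c s" if "s < nat (M_num n d m)" for s
      using h that by (simp add: e_def the_inv_into_f_f bij_betw_def)
    have "(\<Sum>x\<in>\<Phi>. Poly_Mapping.single 0 (e x) * \<psi> x) = (\<Sum>s<nat (M_num n d m). Poly_Mapping.single 0 (c s) * \<psi> (h s))"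
      unfolding sum.reindex_bij_betw[OF h, symmetric] using eh by (intro sum.cong) auto
    then have 0: "(\<Sum>x\<in>\<Phi>. Poly_Mapping.single 0 (e x) * \<psi> x) = 0" using sum by simp
    define P where "P = (\<Sum>i\<in>B. Poly_Mapping.single i (e (Inl i)))"
    define Q where "Q = (\<Sum>i\<in>B - C. Poly_Mapping.single i (e (Inr i)))"
    have lP: "Poly_Mapping.lookup P i = (if i \<in> B then e (Inl i) else 0)" for i
      using B by (simp add: P_def lookup_sum lookup_single when_def)
    have lQ: "Poly_Mapping.lookup Q i = (if i \<in> B - C then e (Inr i) else 0)" for i
      using B by (simp add: Q_def lookup_sum lookup_single when_def)
    have "(\<Sum>x\<in>\<Phi>. Poly_Mapping.single 0 (e x) * \<psi> x) = P * F1 + Q * F2"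
      unfolding \<Phi>_def P_def Q_def sum_distrib_right using B
      by (simp add: sum.Plus \<psi>_def mult_single flip: mult.assoc)
    then have PQ: "P * F1 + Q * F2 = 0" using 0 by simp
    have "Poly_Mapping.keys P \<subseteq> B" "Poly_Mapping.keys Q \<subseteq> B"
      by (auto simp: in_keys_iff lP lQ split: if_splits)
    then have "in_vars n P" "in_vars n Q" unfolding in_vars_def B_def exps_upto_def by blast+
    then obtain R where R: "in_vars n R" "Q = F1 * R" using coprime_syzygy[OF F1_vars F2_vars _ _ cop F1 PQ] by blast
    have "R = 0"
    proof (rule ccontr)
      assume "R \<noteq> 0"
      then obtain \<nu> where "lead mono_deg R \<nu>" using ex_lead by blast
      then have "lead mono_deg Q (\<mu> + \<nu>)" unfolding R(2) by (rule lead_mult[OF mono_deg_add \<mu>])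
      then have "Poly_Mapping.lookup Q (\<mu> + \<nu>) \<noteq> 0" by (auto simp: lead_def in_keys_iff)
      then show False using mC[of "\<mu> + \<nu>"] by (auto simp: lQ split: if_splits)
    qed
    then have Q0: "Q = 0" using R by simp
    then have P0: "P = 0" using PQ F1 by simp
    have "e x = 0" if "x \<in> \<Phi>" for x
      using that unfolding \<Phi>_def using lP lQ P0 Q0 by (elim PlusE) (metis lookup_zero)+
    moreover have "h s \<in> \<Phi>" using h s by (auto simp: bij_betw_def)
    ultimately show ?thesis using eh[OF s] by simp
  qed
  ultimately show thesis using that[of "\<lambda>s. \<psi> (h s)"] M(2) by blast
qed

section \<open>Minors\<close>

text \<open>A minimal set of columns on which the rows stay independent is square.\<close>

lemma ex_nonzero_minor:
  fixes A :: "nat \<Rightarrow> 'i \<Rightarrow> 'a::field"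
  assumes X: "finite X" and ind: "\<And>c s. (\<And>x. x \<in> X \<Longrightarrow> (\<Sum>s<M. c s * A s x) = 0) \<Longrightarrow> s < M \<Longrightarrow> c s = 0"
  obtains col where "\<And>j. j < M \<Longrightarrow> col j \<in> X" "det (mat M M (\<lambda>(s, j). A s (col j))) \<noteq> 0"
proof -
  interpret sf: subfld "UNIV :: 'a set" by unfold_locales (simp add: subfield_def)
  define good where "good J \<longleftrightarrow> J \<subseteq> X \<and> (\<forall>c. (\<forall>x\<in>J. (\<Sum>s<M. c s * A s x) = 0) \<longrightarrow> (\<forall>s<M. c s = 0))" for J
  have "good X" using ind by (auto simp: good_def)
  then obtain J where J: "good J" and Jmin: "\<And>J'. good J' \<Longrightarrow> card J \<le> card J'"
    using ex_has_least_nat[of good X card] by blast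
  have JX: "J \<subseteq> X" "finite J" using J X finite_subset by (auto simp: good_def)
  have Ji: "c s = 0" if "\<And>x. x \<in> J \<Longrightarrow> (\<Sum>s<M. c s * A s x) = 0" "s < M" for c s
    using J that unfolding good_def by blast
  have "\<not> card J < M"
  proof
    assume "card J < M"
    then have "\<exists>c. (\<forall>j\<in>{..<M}. c j \<in> (UNIV :: 'a set)) \<and> (\<exists>j\<in>{..<M}. c j \<noteq> 0) \<and> (\<forall>i\<in>J. (\<Sum>j\<in>{..<M}. c j * A j i) = 0)"
      using JX by (intro sf.homogeneous_system) auto
    then obtain c where "\<exists>j<M. c j \<noteq> 0" "\<forall>i\<in>J. (\<Sum>j<M. c j * A j i) = 0" by auto
    then show False using Ji[of c] by blast
  qed
  moreover have "\<not> M < card J"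
  proof
    assume lt: "M < card J"
    \<comment> \<open>By minimality each column has a row combination that vanishes on exactly the
      other columns. More than \<open>M\<close> such vectors are dependent, and evaluating the
      dependence at one column gives a contradiction.\<close>
    have "\<exists>c. \<forall>y\<in>J. (\<Sum>s<M. c s * A s y) = 0 \<longleftrightarrow> y \<noteq> x" if x: "x \<in> J" for x
    proof -
      have "\<not> good (J - {x})" using Jmin[of "J - {x}"] x JX card_Diff1_less[of J x] by force
      then obtain c s where c: "\<forall>y\<in>J - {x}. (\<Sum>s<M. c s * A s y) = 0" "s < M" "c s \<noteq> 0"
        using JX unfolding good_def by blast
      then have "(\<Sum>s<M. c s * A s x) \<noteq> 0" using Ji[of c s] by (metis DiffI singletonD)
      then show ?thesis using c by blast
    qed
    then obtain c where c: "\<And>x y. x \<in> J \<Longrightarrow> y \<in> J \<Longrightarrow> (\<Sum>s<M. c x s * A s y) = 0 \<longleftrightarrow> y \<noteq> x" by metis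
    have "\<exists>l. (\<forall>j\<in>J. l j \<in> (UNIV :: 'a set)) \<and> (\<exists>j\<in>J. l j \<noteq> 0) \<and> (\<forall>i\<in>{..<M}. (\<Sum>j\<in>J. l j * c j i) = 0)"
      using JX lt by (intro sf.homogeneous_system) auto
    then obtain l y where l: "y \<in> J" "l y \<noteq> 0" "\<And>s. s < M \<Longrightarrow> (\<Sum>x\<in>J. l x * c x s) = 0" by auto
    have "0 = (\<Sum>s<M. (\<Sum>x\<in>J. l x * c x s) * A s y)" using l(3) by simp
    also have "\<dots> = (\<Sum>x\<in>J. l x * (\<Sum>s<M. c x s * A s y))"
      unfolding sum_distrib_left sum_distrib_right by (subst sum.swap) (simp add: mult.assoc)
    also have "\<dots> = (\<Sum>x\<in>J. if x = y then l x * (\<Sum>s<M. c x s * A s y) else 0)"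
      by (rule sum.cong) (use c l(1) in auto)
    also have "\<dots> = l y * (\<Sum>s<M. c y s * A s y)" using l(1) JX by simp
    finally show False using c[of y y] l by simp
  qed
  ultimately have cJ: "card J = M" by simp
  obtain col where col: "bij_betw col {..<M} J" using ex_bij_betw_nat_finite[OF JX(2)] cJ by (metis atLeast0LessThan)
  let ?A = "mat M M (\<lambda>(s, j). A s (col j))"
  have "det ?A \<noteq> 0"
  proof
    assume "det ?A = 0"
    then have "det (transpose_mat ?A) = 0" by (subst det_transpose[of _ M]) auto
    then obtain w where w: "w \<in> carrier_vec M" "w \<noteq> 0\<^sub>v M" "transpose_mat ?A *\<^sub>v w = 0\<^sub>v M"
      using det_0_iff_vec_prod_zero[of "transpose_mat ?A" M] by auto
    have "(\<Sum>s<M. vec_index w s * A s x) = 0" if "x \<in> J" for x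
    proof -
      obtain j where j: "j < M" "x = col j" using col \<open>x \<in> J\<close> by (auto simp: bij_betw_def)
      have "0 = vec_index (transpose_mat ?A *\<^sub>v w) j" using w(3) j by simp
      also have "\<dots> = (\<Sum>s<M. A s x * vec_index w s)"
        using j w(1) by (simp add: scalar_prod_def atLeast0LessThan)
      finally show ?thesis by (simp add: mult.commute)
    qed
    then have "vec_index w s = 0" if "s < M" for s using Ji[of "vec_index w" s] \<open>s < M\<close> by blast
    then show False using w(1,2) by (metis eq_vecI carrier_vecD index_zero_vec)
  qed
  then show thesis using that[of col] col JX by (auto simp: bij_betw_def)
qed

text \<open>Laplace expansion along column \<open>i\<close>, whose cofactors do not see the
  replacement.\<close>

lemma det_replace_column:
  fixes A :: "nat \<Rightarrow> nat \<Rightarrow> 'a::field"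
  assumes i: "i < M"
  shows "(\<Sum>s<M. w s * cofactor (mat M M (\<lambda>(s, j). A s j)) s i) = det (mat M M (\<lambda>(s, j). if j = i then w s else A s j))"
proof -
  let ?B = "mat M M (\<lambda>(s, j). if j = i then w s else A s j)" and ?A = "mat M M (\<lambda>(s, j). A s j)"
  have "cofactor ?B s i = cofactor ?A s i" if s: "s < M" for s
  proof -
    have "mat_delete ?B s i = mat_delete ?A s i"
      unfolding mat_delete_def by (rule eq_matI) auto
    then show ?thesis by (simp add: cofactor_def)
  qed
  moreover have "det ?B = (\<Sum>s<M. ?B $$ (s, i) * cofactor ?B s i)"
    by (rule laplace_expansion_column[of _ M]) (use i in auto)
  ultimately show ?thesis using i by simp
qed

section \<open>The spaces of coefficient products\<close>

context ffield
begin

lemma kspan_add_scaled: "x \<in> kspan k X \<Longrightarrow> c \<in> k \<Longrightarrow> y \<in> X \<Longrightarrow> x + c * y \<in> kspan k X"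
proof -
  assume "x \<in> kspan k X" and c: "c \<in> k" "y \<in> X"
  then obtain N :: nat and e z where e: "\<forall>j<N. e j \<in> k \<and> z j \<in> X" "x = (\<Sum>j<N. e j * z j)"
    unfolding kspan_def by blast
  have s: "x + c * y = (\<Sum>j<Suc N. (e(N := c)) j * (z(N := y)) j)" unfolding e(2) by simp
  have "\<forall>j<Suc N. (e(N := c)) j \<in> k \<and> (z(N := y)) j \<in> X" using e(1) c by (auto simp: less_Suc_eq)
  then show ?thesis unfolding kspan_def using s by blast
qed

lemma kspan_0: "0 \<in> kspan k X"
  unfolding kspan_def by (auto intro!: exI[of _ "0 :: nat"])

lemma subsp_kspan: "subsp k (kspan k X)"
  unfolding subsp_def
proof (intro conjI ballI)
  fix x y assume x: "x \<in> kspan k X" and "y \<in> kspan k X"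
  then obtain N :: nat and e z where e: "\<forall>j<N. e j \<in> k \<and> z j \<in> X" "y = (\<Sum>j<N. e j * z j)"
    unfolding kspan_def by blast
  have "m \<le> N \<Longrightarrow> x + (\<Sum>j<m. e j * z j) \<in> kspan k X" for m
  proof (induction m)
    case (Suc m)
    then have "x + (\<Sum>j<m. e j * z j) + e m * z m \<in> kspan k X" using e(1) by (intro kspan_add_scaled) auto
    then show ?case by (simp add: add.assoc)
  qed (use x in simp)
  then show "x + y \<in> kspan k X" using e(2) by simp
next
  fix c x assume c: "c \<in> k" and "x \<in> kspan k X"
  then obtain N :: nat and e z where e: "\<forall>j<N. e j \<in> k \<and> z j \<in> X" "x = (\<Sum>j<N. e j * z j)"
    unfolding kspan_def by blast
  have "c * x = (\<Sum>j<N. (c * e j) * z j)" unfolding e(2) sum_distrib_left by (simp add: mult.assoc)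
  moreover have "\<forall>j<N. c * e j \<in> k \<and> z j \<in> X" using e(1) c by blast
  ultimately show "c * x \<in> kspan k X" unfolding kspan_def mem_Collect_eq
    by (intro exI[of _ N] exI[of _ "\<lambda>j. c * e j"] exI[of _ z]) simp
qed (rule kspan_0)

lemma kspan_superset: "y \<in> X \<Longrightarrow> y \<in> kspan k X"
  using kspan_add_scaled[OF kspan_0, of 1 y X] by simp

lemma kspan_least: "subsp k W \<Longrightarrow> X \<subseteq> W \<Longrightarrow> x \<in> kspan k X \<Longrightarrow> x \<in> W"
  unfolding kspan_def by (auto intro!: subsp_sum subsp_scale)

lemma fin_dim_kspan:
  assumes X: "finite X"
  shows "fin_dim k (kspan k X)"
proof (rule k.kdim_le_span(2)[OF X])
  fix w assume w: "w \<in> kspan k X"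
  let ?W = "{\<Sum>x\<in>X. a x * x | a. \<forall>x\<in>X. a x \<in> k}"
  have "w \<in> ?W"
  proof (rule kspan_least[OF _ _ w])
    show "subsp k ?W"
      unfolding subsp_def
    proof (intro conjI ballI)
      show "0 \<in> ?W" unfolding mem_Collect_eq by (rule exI[of _ "\<lambda>_. 0"]) simp
      fix z w assume "z \<in> ?W" "w \<in> ?W"
      then obtain a b where a: "z = (\<Sum>x\<in>X. a x * x)" "\<forall>x\<in>X. a x \<in> k" and b: "w = (\<Sum>x\<in>X. b x * x)" "\<forall>x\<in>X. b x \<in> k"
        unfolding mem_Collect_eq by (elim exE conjE)
      have "z + w = (\<Sum>x\<in>X. (a x + b x) * x)" unfolding a(1) b(1) by (simp add: sum.distrib distrib_right)
      moreover have "\<forall>x\<in>X. a x + b x \<in> k" using a(2) b(2) by blast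
      ultimately show "z + w \<in> ?W" unfolding mem_Collect_eq by (intro exI[of _ "\<lambda>x. a x + b x"] conjI)
    next
      fix e z assume e: "e \<in> k" and "z \<in> ?W"
      then obtain a where a: "z = (\<Sum>x\<in>X. a x * x)" "\<forall>x\<in>X. a x \<in> k"
        unfolding mem_Collect_eq by (elim exE conjE)
      have "e * z = (\<Sum>x\<in>X. (e * a x) * x)" unfolding a(1) by (simp add: sum_distrib_left mult.assoc)
      moreover have "\<forall>x\<in>X. e * a x \<in> k" using a(2) e by blast
      ultimately show "e * z \<in> ?W" unfolding mem_Collect_eq by (intro exI[of _ "\<lambda>x. e * a x"] conjI)
    qed
    show "X \<subseteq> ?W"
    proof
      fix y assume y: "y \<in> X"
      have "y = (\<Sum>x\<in>X. (if x = y then 1 else 0) * x)" using X y by (simp add: if_distrib[of "\<lambda>c. c * _"] cong: if_cong)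
      then show "y \<in> ?W" unfolding mem_Collect_eq by (intro exI[of _ "\<lambda>x. if x = y then 1 else 0"]) auto
    qed
  qed
  then show "\<exists>a. (\<forall>x\<in>X. a x \<in> k) \<and> w = (\<Sum>x\<in>X. a x * x)" by blast
qed

end

locale coeff_space = ffield k for k :: "'a::field_char_0 set" +
  fixes F1 F2 :: "'a mpoly"
  assumes one1: "1 \<in> coeff_set F1" and one2: "1 \<in> coeff_set F2"
begin

abbreviation coeffs_all :: "'a set" where "coeffs_all \<equiv> coeff_set F1 \<union> coeff_set F2"

abbreviation gens :: "nat \<Rightarrow> 'a set" where
  "gens s \<equiv> {(\<Prod>a\<in>coeffs_all. a ^ e a) | e. (\<Sum>a\<in>coeffs_all. e a) = s}"

lemma gensI: "x = (\<Prod>a\<in>coeffs_all. a ^ e a) \<Longrightarrow> (\<Sum>a\<in>coeffs_all. e a) = s \<Longrightarrow> x \<in> gens s"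
  unfolding mem_Collect_eq by (intro exI[of _ e] conjI)

lemma gensE:
  assumes "x \<in> gens s"
  obtains e where "x = (\<Prod>a\<in>coeffs_all. a ^ e a)" "(\<Sum>a\<in>coeffs_all. e a) = s"
  using assms unfolding mem_Collect_eq by (elim exE conjE)

abbreviation Vs :: "nat \<Rightarrow> 'a set" where "Vs s \<equiv> Vspace k F1 F2 s"

lemma finite_coeffs: "finite (coeff_set F)"
  by (simp add: coeff_set_def)

lemma coeffs_nonzero: "a \<in> coeff_set F \<Longrightarrow> a \<noteq> 0"
  by (auto simp: coeff_set_def in_keys_iff)

lemma finite_coeffs_all: "finite coeffs_all"
  by (simp add: finite_coeffs)

lemma finite_gens: "finite (gens s)"
proof -
  have "gens s \<subseteq> (\<lambda>e. \<Prod>a\<in>coeffs_all. a ^ e a) ` (PiE coeffs_all (\<lambda>_. {..s}))"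
  proof
    fix x assume "x \<in> gens s"
    then obtain e where e: "x = (\<Prod>a\<in>coeffs_all. a ^ e a)" "(\<Sum>a\<in>coeffs_all. e a) = s" by blast
    have "restrict e coeffs_all \<in> PiE coeffs_all (\<lambda>_. {..s})"
      using member_le_sum[of _ coeffs_all e] finite_coeffs_all e(2) by (auto simp del: Un_iff)
    moreover have "x = (\<Prod>a\<in>coeffs_all. a ^ restrict e coeffs_all a)" unfolding e(1) by (rule prod.cong) auto
    ultimately show "x \<in> (\<lambda>e. \<Prod>a\<in>coeffs_all. a ^ e a) ` (PiE coeffs_all (\<lambda>_. {..s}))" by blast
  qed
  then show ?thesis by (rule finite_subset) (intro finite_imageI finite_PiE finite_coeffs_all, simp)
qed

lemma fin_dim_Vs: "fin_dim k (Vs s)"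
  unfolding Vspace_def by (rule fin_dim_kspan[OF finite_gens])

lemma subsp_Vs: "subsp k (Vs s)"
  unfolding Vspace_def by (rule subsp_kspan)

lemma coeff_in_Vs1: "a \<in> coeffs_all \<Longrightarrow> a \<in> Vs 1"
proof -
  assume a: "a \<in> coeffs_all"
  have "(\<Prod>x\<in>coeffs_all. x ^ (if x = a then 1 else 0 :: nat)) = (\<Prod>x\<in>coeffs_all. if x = a then x else 1)"
    by (rule prod.cong) auto
  also have "\<dots> = a" using a finite_coeffs_all by (simp del: Un_iff)
  finally have "a = (\<Prod>x\<in>coeffs_all. x ^ (if x = a then 1 else 0 :: nat))" by simp
  moreover have "(\<Sum>x\<in>coeffs_all. if x = a then 1 else 0 :: nat) = 1" using a finite_coeffs_all by (simp del: Un_iff)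
  ultimately have "a \<in> gens 1" by (rule gensI)
  then show ?thesis unfolding Vspace_def by (rule kspan_superset)
qed

lemma one_in_Vs0: "1 \<in> Vs 0"
  unfolding Vspace_def by (intro kspan_superset CollectI exI[of _ "\<lambda>_. 0"]) simp

lemma Vs_mult:
  assumes "x \<in> Vs a" "y \<in> Vs b"
  shows "x * y \<in> Vs (a + b)"
proof -
  have g: "u * w \<in> Vs (a + b)" if u: "u \<in> gens a" and w: "w \<in> gens b" for u w
  proof -
    obtain e where e: "u = (\<Prod>a\<in>coeffs_all. a ^ e a)" "(\<Sum>a\<in>coeffs_all. e a) = a" using u by (rule gensE)
    obtain f where f: "w = (\<Prod>a\<in>coeffs_all. a ^ f a)" "(\<Sum>a\<in>coeffs_all. f a) = b" using w by (rule gensE)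
    from e f have "u * w = (\<Prod>a\<in>coeffs_all. a ^ (e a + f a))" "(\<Sum>a\<in>coeffs_all. e a + f a) = a + b"
      by (simp_all add: power_add prod.distrib sum.distrib)
    then have "u * w \<in> gens (a + b)" by (rule gensI)
    then show ?thesis unfolding Vspace_def by (rule kspan_superset)
  qed
  have sub: "subsp k {z. z * w \<in> Vs (a + b)}" for w
    using subsp_Vs[of "a + b"] unfolding subsp_def by (auto simp: algebra_simps)
  have 1: "x * w \<in> Vs (a + b)" if "w \<in> gens b" for w
    using kspan_least[OF sub[of w], of "gens a" x] assms(1) g that unfolding Vspace_def by blast
  have "gens b \<subseteq> {z. z * x \<in> Vs (a + b)}" using 1 by (auto simp: mult.commute)
  then have "y \<in> {z. z * x \<in> Vs (a + b)}"
    using kspan_least[OF sub[of x], of "gens b" y] assms(2) unfolding Vspace_def by blast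
  then show ?thesis by (simp add: mult.commute)
qed

text \<open>The normalization that 1 is a coefficient enters here: \<open>x * 1\<close> has one more
  factor.\<close>

lemma Vs_mono: "a \<le> b \<Longrightarrow> x \<in> Vs a \<Longrightarrow> x \<in> Vs b"
proof (induction b)
  case (Suc b)
  show ?case
  proof (cases "a \<le> b")
    case True
    then have "x * 1 \<in> Vs (b + 1)" using Suc one1 by (intro Vs_mult coeff_in_Vs1) auto
    then show ?thesis by simp
  qed (use Suc.prems in \<open>simp add: le_Suc_eq\<close>)
qed simp

lemma Vs_prod: "(\<And>i. i \<in> I \<Longrightarrow> f i \<in> Vs 1) \<Longrightarrow> finite I \<Longrightarrow> prod f I \<in> Vs (card I)"
proof (induction I rule: infinite_finite_induct)
  case (insert i I)
  have "f i * prod f I \<in> Vs (1 + card I)" using insert by (intro Vs_mult) auto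
  then show ?case using insert by simp
qed (auto intro: one_in_Vs0)

lemma Vs_det:
  assumes A: "A \<in> carrier_mat m m" and e: "\<And>i j. i < m \<Longrightarrow> j < m \<Longrightarrow> A $$ (i, j) \<in> Vs 1"
  shows "Determinant.det A \<in> Vs m"
  unfolding det_def'[OF A]
proof (rule subsp_sum[OF subsp_Vs], rule subsp_scale[OF subsp_Vs])
  fix p assume "p \<in> {p. p permutes {0..<m}}"
  then have "p i < m" if "i < m" for i using permutes_in_image[of p "{0..<m}" i] that by simp
  then show "(\<Prod>i = 0..<m. A $$ (i, p i)) \<in> Vs m" using Vs_prod[of "{0..<m}" "\<lambda>i. A $$ (i, p i)"] e by simp
  show "signof p \<in> k" by (auto simp: sign_def)
qed

text \<open>A determinant of size \<open>m - 1\<close>, placed in the larger space of index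
  \<open>m\<close> so that multiplication leads from index \<open>M * (r - 1)\<close> exactly to
  \<open>M * r\<close>.\<close>

lemma Vs_cofactor:
  assumes A: "A \<in> carrier_mat m m" and e: "\<And>i j. i < m \<Longrightarrow> j < m \<Longrightarrow> A $$ (i, j) \<in> Vs 1"
    and ij: "i < m" "j < m"
  shows "cofactor A i j \<in> Vs m"
proof -
  have "Determinant.det (mat_delete A i j) \<in> Vs (m - 1)"
  proof (rule Vs_det)
    show "mat_delete A i j \<in> carrier_mat (m - 1) (m - 1)" using A by (simp add: mat_delete_def)
    show "mat_delete A i j $$ (i', j') \<in> Vs 1" if "i' < m - 1" "j' < m - 1" for i' j'
      using that A e by (auto simp: mat_delete_def)
  qed
  then have "Determinant.det (mat_delete A i j) \<in> Vs m" by (rule Vs_mono[rotated]) simp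
  moreover have "(- 1) ^ (i + j) \<in> k" by (intro k.power k.uminus k.one)
  ultimately show ?thesis unfolding cofactor_def by (intro subsp_scale[OF subsp_Vs])
qed

text \<open>The local height, nonnegative because 1 is a coefficient. The sum \<open>hv\<close>
  bounds the coefficients of both polynomials at once.\<close>

definition hc :: "'a mpoly \<Rightarrow> ('a \<Rightarrow> int) \<Rightarrow> int" where
  "hc F v = - Min (v ` coeff_set F)"

definition hv :: "('a \<Rightarrow> int) \<Rightarrow> int" where "hv v = hc F1 v + hc F2 v"

lemma hc_ge: "a \<in> coeff_set F \<Longrightarrow> - hc F v \<le> v a"
  by (simp add: hc_def finite_coeffs)

lemma hc_nonneg: "place k v \<Longrightarrow> 1 \<in> coeff_set F \<Longrightarrow> 0 \<le> hc F v"
  using hc_ge[of 1 F v] placeD(4)[of v 1] by auto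

lemma hv_nonneg: "place k v \<Longrightarrow> 0 \<le> hv v"
  using hc_nonneg one1 one2 by (simp add: hv_def)

lemma coeff_vge: "place k v \<Longrightarrow> a \<in> coeffs_all \<Longrightarrow> vge v (- hv v) a"
  using hc_ge[of a F1 v] hc_ge[of a F2 v] hc_nonneg[of v F1] hc_nonneg[of v F2] one1 one2
  by (auto simp: vge_def hv_def)

lemma Vs_vge:
  assumes v: "place k v" and x: "x \<in> Vs s"
  shows "vge v (- int s * hv v) x"
proof -
  have sub: "subsp k {x. vge v (- int s * hv v) x}"
    unfolding subsp_def using vge_add[OF v] vge_cmult[OF v] by auto
  have "gens s \<subseteq> {x. vge v (- int s * hv v) x}"
  proof
    fix x assume "x \<in> gens s"
    then obtain e where e: "x = (\<Prod>a\<in>coeffs_all. a ^ e a)" "(\<Sum>a\<in>coeffs_all. e a) = s" by blast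
    have "vge v (\<Sum>a\<in>coeffs_all. int (e a) * (- hv v)) (\<Prod>a\<in>coeffs_all. a ^ e a)"
      by (intro vge_prod[OF v] vge_power[OF v] coeff_vge[OF v] finite_coeffs_all)
    also have "(\<Sum>a\<in>coeffs_all. int (e a) * (- hv v)) = - int s * hv v"
      unfolding sum_distrib_right[symmetric] of_nat_sum[symmetric] e(2) by simp
    finally show "x \<in> {x. vge v (- int s * hv v) x}" using e(1) by simp
  qed
  then show ?thesis using kspan_least[OF sub, of "gens s" x] x unfolding Vspace_def by blast
qed

lemma finite_coeff_places: "finite {v \<in> places k. \<exists>a\<in>coeff_set F. v a \<noteq> 0}"
proof -
  have "{v \<in> places k. \<exists>a\<in>coeff_set F. v a \<noteq> 0} = (\<Union>a\<in>coeff_set F. {v \<in> places k. v a \<noteq> 0})" by blast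
  also have "finite \<dots>" by (intro finite_UN_I finite_coeffs finite_support coeffs_nonzero)
  finally show ?thesis .
qed

lemma mpoly_height_eq:
  assumes T: "finite T" "T \<subseteq> places k" "{v \<in> places k. \<exists>a\<in>coeff_set F. v a \<noteq> 0} \<subseteq> T" and ne: "coeff_set F \<noteq> {}"
  shows "mpoly_height k F = (\<Sum>v\<in>T. hc F v)"
proof -
  have "hc F v = 0" if "v \<in> T - {v \<in> places k. \<exists>a\<in>coeff_set F. v a \<noteq> 0}" for v
  proof -
    have "v ` coeff_set F = {0}" using that T(2) ne by auto
    then show ?thesis by (simp add: hc_def)
  qed
  then have "(\<Sum>v\<in>T. hc F v) = (\<Sum>v\<in>{v \<in> places k. \<exists>a\<in>coeff_set F. v a \<noteq> 0}. hc F v)"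
    by (intro sum.mono_neutral_right T) auto
  then show ?thesis by (simp add: mpoly_height_def hc_def sum_negf)
qed

text \<open>The second form, with positive parts, is the product formula; it measures the omitted
  monomials, which have to be bounded from above.\<close>

lemma height_eq:
  assumes x: "x \<noteq> 0" and T: "finite T" "T \<subseteq> places k" "{v \<in> places k. v x \<noteq> 0} \<subseteq> T"
  shows "height k x = (\<Sum>v\<in>T. max 0 (- v x))" "height k x = (\<Sum>v\<in>T. max 0 (v x))"
proof -
  show 1: "height k x = (\<Sum>v\<in>T. max 0 (- v x))"
    unfolding height_def by (rule sum.mono_neutral_left) (use T in auto)
  have "(\<Sum>v\<in>T. max 0 (v x)) - (\<Sum>v\<in>T. max 0 (- v x)) = (\<Sum>v\<in>T. v x)"
    unfolding sum_subtractf[symmetric] by (rule sum.cong) auto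
  then show "height k x = (\<Sum>v\<in>T. max 0 (v x))" using 1 product_formula[OF x T] by simp
qed

lemma dV_mono:
  assumes "a \<le> b"
  shows "dV k F1 F2 a \<le> dV k F1 F2 b"
  unfolding dV_def by (rule k.kdim_mono[OF fin_dim_Vs subsetI]) (rule Vs_mono[OF assms])

lemma dV_pos: "1 \<le> dV k F1 F2 s"
proof -
  have 1: "1 \<in> Vs s" using Vs_mono[OF _ one_in_Vs0] by simp
  have "card {0 :: nat} \<le> kdim k (Vs s)"
    by (rule kdim_ge[where y = "\<lambda>_. 1" and I = "{0 :: nat}", OF fin_dim_Vs]) (simp_all add: 1 lin_nondeg_over_def)
  then show ?thesis by (simp add: dV_def)
qed

end

section \<open>The gcd inequality\<close>

lemma lookup_single_mult:
  fixes F :: "'a::field mpoly"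
  shows "Poly_Mapping.lookup (Poly_Mapping.single i c * F) (i + b) = c * Poly_Mapping.lookup F b"
proof (cases "c = 0")
  case False
  then have "Poly_Mapping.lookup (Poly_Mapping.single i c * F) (i + b)
     = (\<Sum>b'\<in>Poly_Mapping.keys F. if b' = b then c * Poly_Mapping.lookup F b' else 0)"
    unfolding lookup_times_keys by (auto simp: lookup_single intro!: sum.cong)
  then show ?thesis by (auto simp: in_keys_iff)
qed simp

lemma lookup_const_mult: "Poly_Mapping.lookup (Poly_Mapping.single 0 c * F) x = c * Poly_Mapping.lookup (F :: 'a::field mpoly) x"
  using lookup_single_mult[of 0 c F x] by simp

lemma keys_single_mult: "Poly_Mapping.keys (Poly_Mapping.single i c * F) \<subseteq> (\<lambda>b. i + b) ` Poly_Mapping.keys (F :: 'a::field mpoly)"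
  using keys_mult[of "Poly_Mapping.single i c" F] by (auto split: if_splits)

lemma mono_eval_superset:
  "finite J \<Longrightarrow> Poly_Mapping.keys x \<subseteq> J \<Longrightarrow> mono_eval g x = (\<Prod>j\<in>J. g j ^ Poly_Mapping.lookup x j)"
  unfolding mono_eval_def by (rule prod.mono_neutral_left) (auto simp: in_keys_iff)

lemma mono_eval_add: "mono_eval g (a + b) = mono_eval g a * mono_eval g b"
proof -
  let ?J = "Poly_Mapping.keys a \<union> Poly_Mapping.keys b"
  show ?thesis
    using mono_eval_superset[of ?J a g] mono_eval_superset[of ?J b g] mono_eval_superset[of ?J "a + b" g]
    by (simp add: keys_add_nat lookup_add power_add prod.distrib)
qed

lemma mpoly_eval_superset:
  "finite J \<Longrightarrow> Poly_Mapping.keys F \<subseteq> J \<Longrightarrow> mpoly_eval F g = (\<Sum>x\<in>J. Poly_Mapping.lookup F x * mono_eval g x)"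
  unfolding mpoly_eval_def by (rule sum.mono_neutral_left) (auto simp: in_keys_iff)

lemma mpoly_eval_monomial_mult:
  fixes F :: "'a::field mpoly"
  shows "mpoly_eval (Poly_Mapping.single i 1 * F) g = mono_eval g i * mpoly_eval F g"
proof -
  have "mpoly_eval (Poly_Mapping.single i 1 * F) g
     = (\<Sum>x\<in>(\<lambda>b. i + b) ` Poly_Mapping.keys F. Poly_Mapping.lookup (Poly_Mapping.single i 1 * F) x * mono_eval g x)"
    by (rule mpoly_eval_superset[OF _ keys_single_mult]) simp
  also have "\<dots> = (\<Sum>b\<in>Poly_Mapping.keys F. mono_eval g i * (Poly_Mapping.lookup F b * mono_eval g b))"
    by (subst sum.reindex) (auto simp: inj_on_def lookup_single_mult mono_eval_add intro!: sum.cong)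
  finally show ?thesis by (simp add: mpoly_eval_def sum_distrib_left)
qed

text \<open>The family \<open>\<phi>\<close> enters only through its shape and its independence,
  which separates the estimate from the algebra behind \<open>multiples_family\<close>.\<close>

locale gcd_bound = ffield_gen k t + coeff_space k F1 F2
  for k :: "'a::field_char_0 set" and t :: 'a and F1 F2 :: "'a mpoly" +
  fixes S :: "('a \<Rightarrow> int) set" and n d m r M :: nat and g :: "nat \<Rightarrow> 'a" and \<phi> :: "nat \<Rightarrow> 'a mpoly"
  assumes S: "finite S" "S \<subseteq> places k"
    and vars: "in_vars n F1" "in_vars n F2"
    and deg: "total_degree F1 = d" "total_degree F2 = d"
    and dm: "d \<le> m" and r: "r > 0"
    and gS: "\<And>j. j < n \<Longrightarrow> g j \<in> S_units k S"
    and nd: "lin_nondeg_over (Vspace k F1 F2 (M * r + 1)) (exps_upto n m) (mono_eval g)"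
    and phi: "\<And>s. s < M \<Longrightarrow>
       \<exists>i\<in>exps_upto n (m - d). \<phi> s = Poly_Mapping.single i 1 * F1 \<or> \<phi> s = Poly_Mapping.single i 1 * F2"
    and phi_indep: "\<And>c s. (\<Sum>s<M. Poly_Mapping.single 0 (c s) * \<phi> s) = 0 \<Longrightarrow> s < M \<Longrightarrow> c s = 0"
begin

abbreviation X :: "(nat \<Rightarrow>\<^sub>0 nat) set" where "X \<equiv> exps_upto n m"
definition A :: "nat \<Rightarrow> (nat \<Rightarrow>\<^sub>0 nat) \<Rightarrow> 'a" where "A s x = Poly_Mapping.lookup (\<phi> s) x"
definition y :: "nat \<Rightarrow> 'a" where "y s = mpoly_eval (\<phi> s) g"

lemma finite_X: "finite X"
  using card_exps_upto by blast

lemma phi_cases: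
  assumes "s < M"
  obtains i F where "i \<in> exps_upto n (m - d)" "F = F1 \<or> F = F2" "\<phi> s = Poly_Mapping.single i 1 * F"
    "in_vars n F" "total_degree F = d"
  using phi[OF assms] vars deg by metis

lemma keys_phi: "s < M \<Longrightarrow> Poly_Mapping.keys (\<phi> s) \<subseteq> X"
proof
  fix x assume s: "s < M" and x: "x \<in> Poly_Mapping.keys (\<phi> s)"
  obtain i F where i: "i \<in> exps_upto n (m - d)" "\<phi> s = Poly_Mapping.single i 1 * F" "in_vars n F" "total_degree F = d"
    using phi_cases[OF s] by metis
  obtain b where b: "b \<in> Poly_Mapping.keys F" "x = i + b" using x keys_single_mult[of i 1 F] i(2) by auto
  have "mono_deg b \<le> d" using mono_deg_le_total[OF b(1)] i(4) by simp
  then show "x \<in> X" using b i(1,3) dm by (auto simp: exps_upto_def keys_add_nat mono_deg_add in_vars_def)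
qed

lemma A_in: "s < M \<Longrightarrow> A s x \<in> Vs 1"
proof (cases "x \<in> Poly_Mapping.keys (\<phi> s)")
  case True
  assume s: "s < M"
  obtain i F where i: "\<phi> s = Poly_Mapping.single i 1 * F" "F = F1 \<or> F = F2" using phi_cases[OF s] by metis
  obtain b where b: "b \<in> Poly_Mapping.keys F" "x = i + b" using True keys_single_mult[of i 1 F] i(1) by auto
  have "A s x = Poly_Mapping.lookup F b" using i(1) b(2) by (simp add: A_def lookup_single_mult)
  also have "\<dots> \<in> coeffs_all" using b(1) i(2) by (auto simp: coeff_set_def)
  finally show ?thesis by (rule coeff_in_Vs1)
next
  case False
  then show ?thesis using subsp_zero[OF subsp_Vs] by (simp add: A_def in_keys_iff)
qed

lemma y_eq: "s < M \<Longrightarrow> y s = (\<Sum>x\<in>X. A s x * mono_eval g x)"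
  unfolding y_def A_def by (rule mpoly_eval_superset[OF finite_X keys_phi])

lemma g_nonzero: "j < n \<Longrightarrow> g j \<noteq> 0"
  using gS by (auto simp: S_units_def)

lemma mono_eval_X: "x \<in> exps_upto n m' \<Longrightarrow> mono_eval g x = (\<Prod>j<n. g j ^ Poly_Mapping.lookup x j)"
  by (rule mono_eval_superset) (auto simp: exps_upto_def)

lemma mono_eval_nonzero: "x \<in> exps_upto n m' \<Longrightarrow> mono_eval g x \<noteq> 0"
  by (simp add: mono_eval_X g_nonzero)

lemma v_mono_eval:
  assumes "place k v" "x \<in> exps_upto n m'"
  shows "v (mono_eval g x) = (\<Sum>j<n. int (Poly_Mapping.lookup x j) * v (g j))"
  unfolding mono_eval_X[OF assms(2)] using g_nonzero
  by (subst v_prod[OF assms(1)]) (auto simp: v_power[OF assms(1)])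

lemma v_mono_eval_0:
  assumes "v \<in> places k - S" "x \<in> exps_upto n m'"
  shows "v (mono_eval g x) = 0"
proof -
  have "v (g j) = 0" if "j < n" for j using assms(1) gS[OF that] unfolding S_units_def by blast
  then show ?thesis using v_mono_eval[of v x m'] assms by (simp add: places_def)
qed

text \<open>Products of the \<open>e s\<close> with coefficients of \<open>\<phi>\<close> lie in V(M
  r + 1), so nondegeneracy kills the coefficient of every monomial; \<open>phi_indep\<close>, which
  holds over all of K, concludes.\<close>

lemma ND:
  assumes e: "\<And>s. s < M \<Longrightarrow> e s \<in> Vs (M * r)" and 0: "(\<Sum>s<M. e s * y s) = 0" and s: "s < M"
  shows "e s = 0"
proof (rule phi_indep[OF _ s])
  have "(\<Sum>s<M. e s * y s) = (\<Sum>s<M. \<Sum>x\<in>X. e s * (A s x * mono_eval g x))"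
    using y_eq by (simp add: sum_distrib_left)
  also have "\<dots> = (\<Sum>x\<in>X. (\<Sum>s<M. e s * A s x) * mono_eval g x)"
    by (subst sum.swap) (simp add: sum_distrib_right mult.assoc)
  finally have 1: "(\<Sum>x\<in>X. (\<Sum>s<M. e s * A s x) * mono_eval g x) = 0" using 0 by simp
  have 2: "(\<Sum>s<M. e s * A s x) = 0" if "x \<in> X" for x
    by (rule lin_nondeg_overD[OF nd _ 1 that]) (auto intro!: subsp_sum[OF subsp_Vs] Vs_mult[OF e A_in, simplified])
  show "(\<Sum>s<M. Poly_Mapping.single 0 (e s) * \<phi> s) = 0"
  proof (rule poly_mapping_eqI)
    fix x
    have "Poly_Mapping.lookup (\<Sum>s<M. Poly_Mapping.single 0 (e s) * \<phi> s) x = (\<Sum>s<M. e s * A s x)"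
      by (simp add: lookup_sum A_def lookup_const_mult)
    also have "\<dots> = 0"
    proof (cases "x \<in> X")
      case False
      then have "A s x = 0" if "s < M" for s using keys_phi[OF that] by (auto simp: A_def in_keys_iff)
      then show ?thesis by simp
    qed (rule 2)
    finally show "Poly_Mapping.lookup (\<Sum>s<M. Poly_Mapping.single 0 (e s) * \<phi> s) x = Poly_Mapping.lookup 0 x" by simp
  qed
qed

abbreviation dr :: nat where "dr \<equiv> dV k F1 F2 (M * r)"
abbreviation dr1 :: nat where "dr1 \<equiv> dV k F1 F2 (M * (r - 1))"

definition U :: "'a set" where "U = {\<Sum>s<M. e s * y s | e. \<forall>s<M. e s \<in> Vs (M * r)}"

lemma UI: "(\<And>s. s < M \<Longrightarrow> e s \<in> Vs (M * r)) \<Longrightarrow> (\<Sum>s<M. e s * y s) \<in> U"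
  unfolding U_def mem_Collect_eq by (intro exI[of _ e]) simp

lemma UE:
  assumes "z \<in> U"
  obtains e where "\<forall>s<M. e s \<in> Vs (M * r)" "z = (\<Sum>s<M. e s * y s)"
  using assms unfolding U_def mem_Collect_eq by (elim exE conjE)

text \<open>The products of a basis of V(M r) with the \<open>y s\<close> form a basis of
  \<open>U\<close>: independence is \<open>ND\<close> followed by independence inside V(M
  r).\<close>

lemma U_dim: "fin_dim k U" "kdim k U = dr * M"
proof -
  let ?I = "{..<dr} \<times> {..<M}"
  obtain b where b: "\<forall>j<dr. b j \<in> Vs (M * r)" "lin_nondeg_over k {..<dr} b"
    using kdim_attained[OF fin_dim_Vs, of "M * r"] unfolding dV_def by metis
  let ?z = "\<lambda>(a, s). b a * y s"
  have swap: "(\<Sum>i\<in>?I. c i * ?z i) = (\<Sum>s<M. (\<Sum>a<dr. c (a, s) * b a) * y s)" for c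
  proof -
    have "(\<Sum>i\<in>?I. c i * ?z i) = (\<Sum>a<dr. \<Sum>s<M. c (a, s) * (b a * y s))"
      by (simp add: sum.cartesian_product split_def)
    also have "\<dots> = (\<Sum>s<M. (\<Sum>a<dr. c (a, s) * b a) * y s)"
      by (subst sum.swap) (simp add: sum_distrib_right mult.assoc)
    finally show ?thesis .
  qed
  have span: "\<exists>c. (\<forall>i\<in>?I. c i \<in> k) \<and> w = (\<Sum>i\<in>?I. c i * ?z i)" if w: "w \<in> U" for w
  proof -
    obtain e where e: "\<forall>s<M. e s \<in> Vs (M * r)" "w = (\<Sum>s<M. e s * y s)" using w by (rule UE)
    have "\<exists>c. (\<forall>j<dr. c j \<in> k) \<and> e s = (\<Sum>j<dr. c j * b j)" if "s < M" for s
      using k.kdim_basis_span[OF fin_dim_Vs, of "M * r" b "e s"] b e(1) that by (simp add: dV_def)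
    then have "\<forall>s\<in>{..<M}. \<exists>c. (\<forall>j<dr. c j \<in> k) \<and> e s = (\<Sum>j<dr. c j * b j)" by blast
    then obtain c where c: "\<forall>s\<in>{..<M}. (\<forall>j<dr. c s j \<in> k) \<and> e s = (\<Sum>j<dr. c s j * b j)" by (rule bchoice[THEN exE])
    show ?thesis
      by (rule exI[of _ "\<lambda>(a, s). c s a"]) (use c e(2) in \<open>simp add: swap[where c = "\<lambda>(a, s). c s a"]\<close>)
  qed
  show fd: "fin_dim k U" by (rule k.kdim_le_span(2)[where I = ?I and z = ?z]) (use span in auto)
  have le: "kdim k U \<le> card ?I" by (rule k.kdim_le_span(1)[where I = ?I and z = ?z]) (use span in auto)
  have ge: "card ?I \<le> kdim k U"
  proof (rule kdim_ge[OF fd, where y = ?z])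
    fix i assume "i \<in> ?I"
    then obtain a s0 where i: "i = (a, s0)" "a < dr" "s0 < M" by auto
    have "(\<Sum>s<M. (if s = s0 then b a else 0) * y s) \<in> U"
      by (rule UI) (use b i subsp_zero[OF subsp_Vs] in auto)
    moreover have "(\<Sum>s<M. (if s = s0 then b a else 0) * y s) = b a * y s0"
      using i by (simp add: if_distrib[of "\<lambda>c. c * _"] cong: if_cong)
    ultimately show "?z i \<in> U" using i by simp
  next
    show "lin_nondeg_over k ?I ?z"
    proof (rule lin_nondeg_overI)
      fix c i assume c: "\<And>i. i \<in> ?I \<Longrightarrow> c i \<in> k" "(\<Sum>i\<in>?I. c i * ?z i) = 0" and "i \<in> ?I"
      then obtain a s where i: "i = (a, s)" "a < dr" "s < M" by auto
      have z: "(\<Sum>s<M. (\<Sum>a<dr. c (a, s) * b a) * y s) = 0" using c(2) unfolding swap .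
      have "(\<Sum>a<dr. c (a, s) * b a) = 0"
        by (rule ND[where e = "\<lambda>s. \<Sum>a<dr. c (a, s) * b a", OF _ z i(3)])
           (use b c(1) in \<open>auto intro!: subsp_sum[OF subsp_Vs] subsp_scale[OF subsp_Vs]\<close>)
      then have "c (a, s) = 0"
        using lin_nondeg_overD[OF b(2), where a = "\<lambda>a. c (a, s)" and i = a] c(1) i by auto
      then show "c i = 0" using i by simp
    qed
  qed simp
  show "kdim k U = dr * M" using le ge by simp
qed

text \<open>Up to the factor \<open>m\<close>, \<open>em\<close> bounds all monomials at
  \<open>g\<close> from below (for basis elements without adapted order) and \<open>ep\<close> from
  above (for omitted monomials). Over \<open>S\<close> both sum to the total height of the
  \<open>g j\<close>.\<close>

definition em :: "('a \<Rightarrow> int) \<Rightarrow> int" where "em v = (\<Sum>j<n. max 0 (- v (g j)))"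
definition ep :: "('a \<Rightarrow> int) \<Rightarrow> int" where "ep v = (\<Sum>j<n. max 0 (v (g j)))"

lemma v_mono_eval_bounds:
  assumes v: "place k v" and x: "x \<in> X"
  shows "v (mono_eval g x) \<le> int m * ep v" "- (int m * em v) \<le> v (mono_eval g x)"
proof -
  have le: "Poly_Mapping.lookup x j \<le> m" if "j < n" for j
  proof -
    have "Poly_Mapping.lookup x j \<le> (\<Sum>j<n. Poly_Mapping.lookup x j)" by (rule member_le_sum) (use that in auto)
    also have "\<dots> = mono_deg x" by (rule mono_deg_superset[symmetric]) (use x in \<open>auto simp: exps_upto_def\<close>)
    finally show ?thesis using x by (simp add: exps_upto_def)
  qed
  have "int (Poly_Mapping.lookup x j) * v (g j) \<le> int m * max 0 (v (g j))" if "j < n" for j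
  proof -
    have "int (Poly_Mapping.lookup x j) * v (g j) \<le> int (Poly_Mapping.lookup x j) * max 0 (v (g j))"
      by (rule mult_left_mono) auto
    also have "\<dots> \<le> int m * max 0 (v (g j))" using le[OF that] by (intro mult_right_mono) auto
    finally show ?thesis .
  qed
  then show "v (mono_eval g x) \<le> int m * ep v"
    unfolding v_mono_eval[OF v x] ep_def sum_distrib_left by (intro sum_mono) auto
  have "- (int m * max 0 (- v (g j))) \<le> int (Poly_Mapping.lookup x j) * v (g j)" if "j < n" for j
  proof -
    have "int (Poly_Mapping.lookup x j) * (- v (g j)) \<le> int (Poly_Mapping.lookup x j) * max 0 (- v (g j))"
      by (rule mult_left_mono) auto
    also have "\<dots> \<le> int m * max 0 (- v (g j))" using le[OF that] by (intro mult_right_mono) auto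
    finally show ?thesis by simp
  qed
  then show "- (int m * em v) \<le> v (mono_eval g x)"
    unfolding v_mono_eval[OF v x] em_def sum_distrib_left sum_negf[symmetric] by (intro sum_mono) auto
qed

lemma U_vge:
  assumes v: "place k v" and z: "z \<in> U" and b: "\<And>s. s < M \<Longrightarrow> vge v b (y s)"
  shows "vge v (- int (M * r) * hv v + b) z"
proof -
  obtain e where e: "\<forall>s<M. e s \<in> Vs (M * r)" "z = (\<Sum>s<M. e s * y s)" using z by (rule UE)
  show ?thesis unfolding e(2) by (intro vge_sum[OF v] vge_mult[OF v] Vs_vge[OF v] b) (use e(1) in auto)
qed

lemma y_vge:
  assumes v: "place k v" and s: "s < M"
  shows "vge v (- hv v - int m * em v) (y s)"
  unfolding y_eq[OF s]
proof (rule vge_sum[OF v])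
  fix x assume x: "x \<in> X"
  have "vge v (- int 1 * hv v) (A s x)" by (intro Vs_vge[OF v] A_in s)
  moreover have "vge v (- (int m * em v)) (mono_eval g x)" using v_mono_eval_bounds(2)[OF v x] by (simp add: vge_def)
  ultimately have "vge v (- int 1 * hv v + - (int m * em v)) (A s x * mono_eval g x)" by (rule vge_mult[OF v])
  then show "vge v (- hv v - int m * em v) (A s x * mono_eval g x)" by simp
qed

definition gc :: "('a \<Rightarrow> int) \<Rightarrow> int" where
  "gc v = min (max 0 (v (mpoly_eval F1 g))) (max 0 (v (mpoly_eval F2 g)))"

text \<open>Outside \<open>S\<close> the monomials are units at \<open>g\<close>, so
  \<open>y s\<close> inherits the order of the value of \<open>F1\<close> or
  \<open>F2\<close>.\<close>

lemma y_vge_gcd: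
  assumes v: "v \<in> places k - S" and s: "s < M"
  shows "vge v (gc v - hv v) (y s)"
proof -
  have pv: "place k v" using v by (simp add: places_def)
  obtain i F where i: "i \<in> exps_upto n (m - d)" "F = F1 \<or> F = F2" "\<phi> s = Poly_Mapping.single i 1 * F"
    "in_vars n F" using phi_cases[OF s] by metis
  have "vge v (gc v - hv v) (mpoly_eval F g)"
  \<comment> \<open>By the convention \<open>v 0 = 0\<close>, a vanishing value of \<open>F1\<close>
    or \<open>F2\<close> also falls under the first case.\<close>
  proof (cases "gc v = 0")
    case True
    have "vge v (- hv v + 0) (Poly_Mapping.lookup F x * mono_eval g x)" if x: "x \<in> Poly_Mapping.keys F" for x
    proof (intro vge_mult[OF pv] coeff_vge[OF pv])
      have "x \<in> exps_upto n (mono_deg x)" using x i(4) by (auto simp: exps_upto_def in_vars_def)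
      then show "vge v 0 (mono_eval g x)" using v_mono_eval_0[OF v] by (auto simp: vge_def)
      show "Poly_Mapping.lookup F x \<in> coeffs_all" using x i(2) by (auto simp: coeff_set_def)
    qed
    then show ?thesis unfolding mpoly_eval_def True by (intro vge_sum[OF pv]) simp
  next
    case False
    then have "gc v \<le> v (mpoly_eval F g)" using i(2) unfolding gc_def by auto
    then show ?thesis using hv_nonneg[OF pv] by (simp add: vge_def)
  qed
  moreover have "vge v 0 (mono_eval g i)" using v_mono_eval_0[OF v i(1)] by (simp add: vge_def)
  ultimately have "vge v (0 + (gc v - hv v)) (mono_eval g i * mpoly_eval F g)" by (intro vge_mult[OF pv])
  then show ?thesis unfolding y_def i(3) mpoly_eval_monomial_mult by simp
qed

section \<open>Minors of minimal weight\<close>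

definition minor :: "(nat \<Rightarrow> nat \<Rightarrow>\<^sub>0 nat) \<Rightarrow> 'a" where
  "minor c = Determinant.det (mat M M (\<lambda>(s, j). A s (c j)))"

text \<open>Minimality of the total weight is used through exchanges of a single column, where all
  other weights cancel.\<close>

lemma ex_minimal_minor:
  obtains c where "\<And>j. j < M \<Longrightarrow> c j \<in> X" "minor c \<noteq> 0"
    "\<And>i x. i < M \<Longrightarrow> x \<in> X \<Longrightarrow> minor (fun_upd c i x) \<noteq> 0 \<Longrightarrow> (w (c i) :: int) \<le> w x"
proof -
  define P where "P = {c \<in> PiE {..<M} (\<lambda>_. X). minor c \<noteq> 0}"
  have "e s = 0" if "\<And>x. x \<in> X \<Longrightarrow> (\<Sum>s<M. e s * A s x) = 0" "s < M" for e s
  proof (rule phi_indep[OF _ that(2)], rule poly_mapping_eqI)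
    fix x
    have "Poly_Mapping.lookup (\<Sum>s<M. Poly_Mapping.single 0 (e s) * \<phi> s) x = (\<Sum>s<M. e s * A s x)"
      by (simp add: lookup_sum A_def lookup_const_mult)
    also have "\<dots> = 0"
    proof (cases "x \<in> X")
      case False
      then have "A s x = 0" if "s < M" for s using keys_phi[OF that] by (auto simp: A_def in_keys_iff)
      then show ?thesis by simp
    qed (rule that(1))
    finally show "Poly_Mapping.lookup (\<Sum>s<M. Poly_Mapping.single 0 (e s) * \<phi> s) x = Poly_Mapping.lookup 0 x" by simp
  qed
  then obtain c0 where c0: "\<forall>j<M. c0 j \<in> X" "Determinant.det (mat M M (\<lambda>(s, j). A s (c0 j))) \<noteq> 0"
    by (rule ex_nonzero_minor[where M = M and A = A, OF finite_X]) blast+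
  have "mat M M (\<lambda>(s, j). A s (restrict c0 {..<M} j)) = mat M M (\<lambda>(s, j). A s (c0 j))" by (rule eq_matI) auto
  then have "restrict c0 {..<M} \<in> P" using c0 by (simp add: P_def minor_def)
  moreover have fP: "finite P" unfolding P_def by (rule finite_subset[OF _ finite_PiE[of "{..<M}" "\<lambda>_. X"]]) (auto simp: finite_X)
  moreover define W where "W = (\<lambda>c. \<Sum>j<M. w (c j))"
  ultimately have "Min (W ` P) \<in> W ` P" by (intro Min_in) auto
  then obtain c where c: "c \<in> P" "W c = Min (W ` P)" by auto
  have min: "W c \<le> W c'" if "c' \<in> P" for c' unfolding c(2) using fP that by simp
  show thesis
  proof (rule that[of c])
    show "c j \<in> X" if "j < M" for j using c(1) that by (auto simp: P_def PiE_def)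
    show "minor c \<noteq> 0" using c(1) by (simp add: P_def)
    fix i x assume i: "i < M" and x: "x \<in> X" and nz: "minor (fun_upd c i x) \<noteq> 0"
    have "fun_upd c i x \<in> P" using c(1) i x nz by (auto simp: P_def PiE_def extensional_def)
    then have "W c \<le> W (fun_upd c i x)" by (rule min)
    moreover have "(\<Sum>j\<in>{..<M} - {i}. w (fun_upd c i x j)) = (\<Sum>j\<in>{..<M} - {i}. w (c j))" by (rule sum.cong) auto
    ultimately show "w (c i) \<le> w x" unfolding W_def using i by (simp add: sum.remove[of "{..<M}" i])
  qed
qed

lemma minor_in: "minor c \<in> Vs M"
  unfolding minor_def by (rule Vs_det) (simp_all add: A_in del: One_nat_def)

lemma minor_identical: "i < M \<Longrightarrow> j < M \<Longrightarrow> i \<noteq> j \<Longrightarrow> c i = c j \<Longrightarrow> minor c = 0"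
  unfolding minor_def by (rule det_identical_columns[of _ M i j]) (auto intro!: eq_vecI)

abbreviation DD :: nat where "DD \<equiv> dr * M"
abbreviation BB :: int where "BB \<equiv> int (DD * (DD - 1) div 2)"

text \<open>The transition matrix between two bases of \<open>U\<close> is constant, and its
  determinant, a nonzero constant, has order 0.\<close>

lemma wronskian_U:
  assumes f: "\<forall>j<DD. f j \<in> U" "lin_nondeg_over k {..<DD} f"
    and z: "\<forall>j<DD. z j \<in> U" "lin_nondeg_over k {..<DD} z" and v: "place k v"
  shows "v (wronskian DD z) = v (wronskian DD f)" "wronskian DD z \<noteq> 0"
proof -
  have "\<exists>c. (\<forall>l<DD. c l \<in> k) \<and> z j = (\<Sum>l<DD. c l * f l)" if "j < DD" for j
    using k.kdim_basis_span[OF U_dim(1), of f "z j"] f z(1) that by (simp add: U_dim(2))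
  then have "\<forall>j\<in>{..<DD}. \<exists>c. (\<forall>l<DD. c l \<in> k) \<and> z j = (\<Sum>l<DD. c l * f l)" by blast
  then obtain P where P: "\<forall>j\<in>{..<DD}. (\<forall>l<DD. P j l \<in> k) \<and> z j = (\<Sum>l<DD. P j l * f l)" by (rule bchoice[THEN exE])
  obtain c where c: "c \<in> k" "wronskian DD z = wronskian DD f * c"
    by (rule wronskian_change[where D = DD and P = "\<lambda>l j. P j l" and e = f and e' = z]) (use P in auto)
  show nz: "wronskian DD z \<noteq> 0" by (rule wronskian_nonzero[OF z(2)])
  then have "c \<noteq> 0" "wronskian DD f \<noteq> 0" using c by auto
  then show "v (wronskian DD z) = v (wronskian DD f)" using c placeD(2,4)[OF v] by simp
qed

text \<open>All of \<open>U\<close> shares the bound that \<open>y_vge_gcd\<close> gives, so the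
  stronger \<open>wronskian_common\<close> applies.\<close>

lemma local_bound_outside:
  assumes f: "\<forall>j<DD. f j \<in> U" "lin_nondeg_over k {..<DD} f" and v: "v \<in> places k - S"
  shows "int DD * (gc v - int (M * r + 1) * hv v) + dord v * BB \<le> v (wronskian DD f)"
proof -
  have pv: "place k v" using v by (simp add: places_def)
  have "vge v (- int (M * r) * hv v + (gc v - hv v)) (f j)" if "j < DD" for j
    by (rule U_vge[OF pv]) (use f that y_vge_gcd[OF v] in auto)
  then have "vge v (gc v - int (M * r + 1) * hv v) (f j)" if "j < DD" for j using that by (simp add: algebra_simps)
  from wronskian_common[where D = DD and e = f, OF pv this] show ?thesis
    using wronskian_nonzero[OF f(2)] by (simp add: vge_def)
qed

lemma local_bound:
  assumes f: "\<forall>j<DD. f j \<in> U" "lin_nondeg_over k {..<DD} f" and v: "place k v"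
  shows "int dr1 * (\<Sum>x\<in>X. v (mono_eval g x)) - int dr1 * (int (card X) - int M) * int m * ep v
     - (int DD - int (dr1 * M)) * int m * em v - int DD * int (M * r + 1) * hv v + (dord v - 1) * BB \<le> v (wronskian DD f)"
    and "M \<le> card X"
proof -
  obtain c where cX: "\<And>j. j < M \<Longrightarrow> c j \<in> X" and c0: "minor c \<noteq> 0" and
    cmin: "\<And>i x. i < M \<Longrightarrow> x \<in> X \<Longrightarrow> minor (fun_upd c i x) \<noteq> 0 \<Longrightarrow> v (mono_eval g (c i)) \<le> v (mono_eval g x)"
    using ex_minimal_minor[where w = "\<lambda>x. v (mono_eval g x)"] by metis
  have c_inj: "inj_on c {..<M}" using minor_identical[of _ _ c] c0 unfolding inj_on_def by blast
  then have cim: "c ` {..<M} \<subseteq> X" "card (c ` {..<M}) = M" using cX by (auto simp: card_image)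
  show MX: "M \<le> card X" using card_mono[OF finite_X cim(1)] cim(2) by simp
  define Am where "Am = mat M M (\<lambda>(s, j). A s (c j))"
  define cof where "cof = (\<lambda>s i. cofactor Am s i)"
  have cofV: "cof s i \<in> Vs M" if "s < M" "i < M" for s i
    unfolding cof_def by (rule Vs_cofactor) (use that in \<open>simp_all add: Am_def A_in del: One_nat_def\<close>)
  \<comment> \<open>Cramer's rule. The element \<open>e i\<close> below involves only monomials
    whose exchange for \<open>c i\<close> leaves a nonzero minor, and these have at least the order
    of \<open>c i\<close>.\<close>
  have cofA: "(\<Sum>s<M. A s x * cof s i) = minor (fun_upd c i x)" if "i < M" for i x
  proof -
    have "(\<Sum>s<M. A s x * cof s i) = Determinant.det (mat M M (\<lambda>(s, j). if j = i then A s x else A s (c j)))"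
      unfolding cof_def Am_def by (rule det_replace_column[OF that])
    also have "mat M M (\<lambda>(s, j). if j = i then A s x else A s (c j)) = mat M M (\<lambda>(s, j). A s (fun_upd c i x j))"
      by (rule eq_matI) auto
    finally show ?thesis by (simp add: minor_def)
  qed
  have kron: "(\<Sum>s<M. A s (c j) * cof s i) = (if i = j then minor c else 0)" if "i < M" "j < M" for i j
    unfolding cofA[OF that(1)] using minor_identical[of i j "fun_upd c i (c j)"] that by auto
  define e where "e = (\<lambda>i. \<Sum>s<M. cof s i * y s)"
  have e_vge: "vge v (- int M * hv v + v (mono_eval g (c i))) (e i)" if i: "i < M" for i
  proof -
    have "e i = (\<Sum>s<M. \<Sum>x\<in>X. cof s i * (A s x * mono_eval g x))"
      by (simp add: e_def y_eq sum_distrib_left)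
    also have "\<dots> = (\<Sum>x\<in>X. (\<Sum>s<M. A s x * cof s i) * mono_eval g x)"
      by (subst sum.swap) (simp add: sum_distrib_left mult_ac)
    also have "\<dots> = (\<Sum>x\<in>X. minor (fun_upd c i x) * mono_eval g x)" by (simp add: cofA[OF i])
    finally have ei: "e i = (\<Sum>x\<in>X. minor (fun_upd c i x) * mono_eval g x)" .
    show ?thesis unfolding ei
    proof (rule vge_sum[OF v])
      fix x assume x: "x \<in> X"
      show "vge v (- int M * hv v + v (mono_eval g (c i))) (minor (fun_upd c i x) * mono_eval g x)"
      proof (cases "minor (fun_upd c i x) = 0")
        case False
        then have "vge v (v (mono_eval g (c i))) (mono_eval g x)" using cmin[OF i x] by (simp add: vge_def)
        then show ?thesis by (intro vge_mult[OF v] Vs_vge[OF v] minor_in)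
      qed simp
    qed
  qed
  obtain b where b: "\<forall>j<dr1. b j \<in> Vs (M * (r - 1))" "lin_nondeg_over k {..<dr1} b"
    using kdim_attained[OF fin_dim_Vs, of "M * (r - 1)"] unfolding dV_def by metis
  have Mr: "M * (r - 1) + M = M * r" using r by (cases r) auto
  have VM: "x * z \<in> Vs (M * r)" if "x \<in> Vs (M * (r - 1))" "z \<in> Vs M" for x z
    using Vs_mult[OF that] unfolding Mr .
  let ?I = "{..<dr1} \<times> {..<M}"
  let ?z = "\<lambda>(a, i). b a * e i"
  have zU: "?z q \<in> U" if q: "q \<in> ?I" for q
  proof -
    obtain a i where ai: "q = (a, i)" "a < dr1" "i < M" using q by auto
    have "(\<Sum>s<M. (b a * cof s i) * y s) \<in> U"
      by (rule UI) (use VM b cofV ai in blast)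
    then show ?thesis unfolding ai e_def by (simp add: sum_distrib_left mult.assoc)
  qed
  \<comment> \<open>\<open>ND\<close> removes the \<open>y s\<close> from a relation; pairing with
    column \<open>c j\<close> inverts the cofactors and leaves
    \<open>\<gamma> j * minor c\<close>.\<close>
  have znd: "lin_nondeg_over k ?I ?z"
  proof (rule lin_nondeg_overI)
    fix l q assume l: "\<And>i. i \<in> ?I \<Longrightarrow> l i \<in> k" "(\<Sum>i\<in>?I. l i * ?z i) = 0" and "q \<in> ?I"
    then obtain a j where q: "q = (a, j)" "a < dr1" "j < M" by auto
    define \<gamma> where "\<gamma> = (\<lambda>i. \<Sum>a<dr1. l (a, i) * b a)"
    have \<gamma>V: "\<gamma> i \<in> Vs (M * (r - 1))" if "i < M" for i
      unfolding \<gamma>_def by (intro subsp_sum[OF subsp_Vs] subsp_scale[OF subsp_Vs]) (use l(1) b that in auto)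
    have "0 = (\<Sum>a<dr1. \<Sum>i<M. l (a, i) * (b a * e i))"
      using l(2) by (simp add: sum.cartesian_product split_def)
    also have "\<dots> = (\<Sum>i<M. \<gamma> i * e i)"
      unfolding \<gamma>_def by (subst sum.swap) (simp add: sum_distrib_right mult.assoc)
    also have "\<dots> = (\<Sum>i<M. \<Sum>s<M. \<gamma> i * cof s i * y s)" by (simp add: e_def sum_distrib_left mult.assoc)
    also have "\<dots> = (\<Sum>s<M. (\<Sum>i<M. \<gamma> i * cof s i) * y s)" by (subst sum.swap) (simp add: sum_distrib_right)
    finally have 0: "(\<Sum>s<M. (\<Sum>i<M. \<gamma> i * cof s i) * y s) = 0" by simp
    have eps: "(\<Sum>i<M. \<gamma> i * cof s i) = 0" if "s < M" for s
      by (rule ND[where e = "\<lambda>s. \<Sum>i<M. \<gamma> i * cof s i", OF _ 0 that], rule subsp_sum[OF subsp_Vs])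
         (use VM \<gamma>V cofV in blast)
    have "0 = (\<Sum>s<M. A s (c j) * (\<Sum>i<M. \<gamma> i * cof s i))" using eps by simp
    also have "\<dots> = (\<Sum>i<M. \<gamma> i * (\<Sum>s<M. A s (c j) * cof s i))"
      unfolding sum_distrib_left by (subst sum.swap) (simp add: mult_ac)
    also have "\<dots> = (\<Sum>i<M. if i = j then \<gamma> i * minor c else 0)" by (rule sum.cong) (use kron q in auto)
    also have "\<dots> = \<gamma> j * minor c" using q by simp
    finally have "\<gamma> j = 0" using c0 by simp
    then have "l (a, j) = 0"
      using lin_nondeg_overD[OF b(2), where a = "\<lambda>a. l (a, j)" and i = a] l(1) q by (auto simp: \<gamma>_def)
    then show "l q = 0" using q by simp
  qed
  define s where "s = dr1 * M"
  have cI: "card ?I = s" by (simp add: s_def)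
  obtain \<pi> where \<pi>: "bij_betw \<pi> {..<s} ?I"
    using ex_bij_betw_nat_finite[of ?I] cI by (metis atLeast0LessThan finite_SigmaI finite_lessThan)
  have \<pi>I: "\<pi> q \<in> ?I" if "q < s" for q using \<pi> that by (auto simp: bij_betw_def)
  have "lin_nondeg_over k {..<s} (?z \<circ> \<pi>)" using znd lin_nondeg_over_reindex[OF \<pi>] by blast
  moreover have "\<forall>q<s. (?z \<circ> \<pi>) q \<in> U" using zU \<pi>I by (auto simp del: SigmaE2 mem_Sigma_iff)
  ultimately obtain w where w: "\<forall>j<s. w j = (?z \<circ> \<pi>) j" "\<forall>j<DD. w j \<in> U" "lin_nondeg_over k {..<DD} w"
    using k.extend_basis[OF U_dim(1), of s "?z \<circ> \<pi>"] unfolding U_dim(2) by blast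
  have sD: "s \<le> DD" unfolding s_def by (intro mult_le_mono dV_mono) auto
  define p where "p = (\<lambda>q. v (mono_eval g (c (snd (\<pi> q)))))"
  \<comment> \<open>The bound valid for every element of \<open>U\<close>; it serves the
    \<open>DD - s\<close> elements by which the basis was extended.\<close>
  define z0 where "z0 = - int (M * r + 1) * hv v - int m * em v"
  define N where "N = (\<lambda>q. if q < s then - int (M * r) * hv v + p q else z0)"
  have "vge v (N q) (w q)" if q: "q < DD" for q
  proof (cases "q < s")
    case True
    obtain a i where ai: "\<pi> q = (a, i)" "a < dr1" "i < M" using \<pi>I[OF True] by auto
    have "vge v (- int (M * (r - 1)) * hv v + (- int M * hv v + v (mono_eval g (c i)))) (b a * e i)"
      by (intro vge_mult[OF v] Vs_vge[OF v] e_vge ai) (use b ai in auto)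
    also have "- int (M * (r - 1)) * hv v + (- int M * hv v + v (mono_eval g (c i))) = N q"
      unfolding N_def p_def Mr[symmetric] ai using True by (simp add: algebra_simps)
    finally show ?thesis using w(1) True ai by simp
  next
    case False
    have "vge v (- int (M * r) * hv v + (- hv v - int m * em v)) (w q)"
      by (rule U_vge[OF v]) (use w q y_vge[OF v] in auto)
    then show ?thesis using False by (simp add: N_def z0_def algebra_simps)
  qed
  from wronskian_columns[where D = DD and e = w and n = N, OF v this] have W: "(\<Sum>q<DD. N q) + (dord v - 1) * BB \<le> v (wronskian DD f)"
    using wronskian_U[OF f w(2,3) v] by (simp add: vge_def)
  have sumN: "(\<Sum>q<DD. N q) = (\<Sum>q<s. - int (M * r) * hv v + p q) + (int DD - int s) * z0"
  proof -
    have "{..<DD} = {..<s} \<union> {s..<DD}" using sD by auto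
    moreover have "sum N ({..<s} \<union> {s..<DD}) = sum N {..<s} + sum N {s..<DD}" by (rule sum.union_disjoint) auto
    ultimately have "(\<Sum>q<DD. N q) = (\<Sum>q<s. N q) + (\<Sum>q\<in>{s..<DD}. N q)" by (simp only:)
    then show ?thesis using sD by (simp add: N_def of_nat_diff)
  qed
  have "(\<Sum>q<s. p q) = (\<Sum>i\<in>?I. v (mono_eval g (c (snd i))))" unfolding p_def by (rule sum.reindex_bij_betw[OF \<pi>])
  also have "\<dots> = (\<Sum>a<dr1. \<Sum>i<M. v (mono_eval g (c i)))"
    by (subst sum.cartesian_product) (simp add: split_def)
  also have "\<dots> = int dr1 * (\<Sum>i<M. v (mono_eval g (c i)))" by simp
  finally have sump: "(\<Sum>q<s. p q) = int dr1 * (\<Sum>i<M. v (mono_eval g (c i)))" .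
  \<comment> \<open>The chosen monomials are all of \<open>X\<close> without
    \<open>card X - M\<close> omitted ones, each of order at most \<open>m * ep v\<close>.\<close>
  have sumc: "(\<Sum>i<M. v (mono_eval g (c i))) \<ge> (\<Sum>x\<in>X. v (mono_eval g x)) - (int (card X) - int M) * (int m * ep v)"
  proof -
    have "(\<Sum>x\<in>X. v (mono_eval g x)) = (\<Sum>x\<in>X - c ` {..<M}. v (mono_eval g x)) + (\<Sum>x\<in>c ` {..<M}. v (mono_eval g x))"
      by (rule sum.subset_diff[OF cim(1) finite_X])
    moreover have "(\<Sum>x\<in>c ` {..<M}. v (mono_eval g x)) = (\<Sum>i<M. v (mono_eval g (c i)))"
      by (simp add: sum.reindex[OF c_inj])
    moreover have "(\<Sum>x\<in>X - c ` {..<M}. v (mono_eval g x)) \<le> of_nat (card (X - c ` {..<M})) * (int m * ep v)"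
      by (rule sum_bounded_above) (use v_mono_eval_bounds(1)[OF v] in auto)
    moreover have "card (X - c ` {..<M}) = card X - M" using cim finite_X by (simp add: card_Diff_subset finite_subset)
    ultimately show ?thesis using MX by (simp add: of_nat_diff)
  qed
  have "int dr1 * ((\<Sum>x\<in>X. v (mono_eval g x)) - (int (card X) - int M) * (int m * ep v)) \<le> (\<Sum>q<s. p q)"
    unfolding sump by (rule mult_left_mono[OF sumc]) simp
  \<comment> \<open>Adapted elements lose \<open>M * r\<close> local heights, the others one more;
    the difference is given away to obtain a uniform term.\<close>
  moreover have "0 \<le> int s * hv v" using hv_nonneg[OF v] by simp
  moreover have "(\<Sum>q<DD. N q) = (\<Sum>q<s. p q) + int s * hv v - int DD * int (M * r + 1) * hv v - (int DD - int s) * int m * em v"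
    unfolding sumN z0_def by (simp add: sum.distrib sum_subtractf algebra_simps)
  ultimately show "int dr1 * (\<Sum>x\<in>X. v (mono_eval g x)) - int dr1 * (int (card X) - int M) * int m * ep v
     - (int DD - int (dr1 * M)) * int m * em v - int DD * int (M * r + 1) * hv v + (dord v - 1) * BB \<le> v (wronskian DD f)"
    using W unfolding s_def[symmetric] by (simp add: algebra_simps)
qed

text \<open>The local bounds are summed against the product formula for the Wronskian. The
  \<open>S\<close>-parts of all monomials add up to 0, because the monomials at \<open>g\<close> are
  \<open>S\<close>-units.\<close>

theorem gcd_inequality:
  "int DD * N_gcd k S (mpoly_eval F1 g) (mpoly_eval F2 g)
    \<le> int DD * int (M * r + 1) * (mpoly_height k F1 + mpoly_height k F2)
      + BB * (2 * genus k - 2 + int (card S))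
      + (int dr1 * (int (card X) - int M) + (int DD - int (dr1 * M))) * int m * (\<Sum>j<n. height k (g j))"
    (is "_ * ?N \<le> _ * (?h1 + ?h2) + _ + ?E * _ * ?H")
proof -
  obtain f where f: "\<forall>j<DD. f j \<in> U" "lin_nondeg_over k {..<DD} f"
    using kdim_attained[OF U_dim(1)] unfolding U_dim(2) by metis
  let ?W = "wronskian DD f"
  have W0: "?W \<noteq> 0" by (rule wronskian_nonzero[OF f(2)])
  let ?G = "{v \<in> places k - S. v (mpoly_eval F1 g) > 0 \<and> v (mpoly_eval F2 g) > 0}"
  have fG: "finite ?G"
  proof (cases "mpoly_eval F1 g = 0")
    case True
    \<comment> \<open>A vanishing value has order 0 by convention and contributes no place.\<close>
    then have "?G = {}" by (auto simp: places_def placeD(1))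
    then show ?thesis by (simp only: finite.emptyI)
  next
    case False
    show ?thesis by (rule finite_subset[OF _ finite_support[OF False]]) auto
  qed
  define T where "T = S \<union> {v \<in> places k. dord v \<noteq> 0} \<union> {v \<in> places k. v ?W \<noteq> 0}
     \<union> {v \<in> places k. \<exists>a\<in>coeff_set F1. v a \<noteq> 0} \<union> {v \<in> places k. \<exists>a\<in>coeff_set F2. v a \<noteq> 0} \<union> ?G"
  have T: "finite T" "T \<subseteq> places k"
    unfolding T_def using S ramification_bound(1) finite_support[OF W0] finite_coeff_places fG by auto
  have ST: "S \<subseteq> T" by (auto simp: T_def)
  have sumW: "(\<Sum>v\<in>T. v ?W) = 0" by (rule product_formula[OF W0 T]) (auto simp: T_def)
  have sumd: "(\<Sum>v\<in>T. dord v) \<ge> 2 - 2 * genus k" by (rule ramification_bound(2)[OF T]) (auto simp: T_def)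
  have "?h1 = (\<Sum>v\<in>T. hc F1 v)" "?h2 = (\<Sum>v\<in>T. hc F2 v)"
    by (rule mpoly_height_eq[OF T]; use one1 one2 in \<open>auto simp: T_def\<close>)+
  then have sumh: "(\<Sum>v\<in>T. hv v) = ?h1 + ?h2" by (simp add: hv_def sum.distrib)
  have gsup: "{v \<in> places k. v (g j) \<noteq> 0} \<subseteq> S" if "j < n" for j using gS[OF that] by (auto simp: S_units_def)
  have sumem: "(\<Sum>v\<in>S. em v) = ?H" "(\<Sum>v\<in>S. ep v) = ?H"
    unfolding em_def ep_def sum.swap[of _ _ S] using height_eq[OF g_nonzero S gsup] by simp_all
  have "(\<Sum>v\<in>S. v (mono_eval g x)) = 0" if x: "x \<in> X" for x
    by (rule product_formula[OF mono_eval_nonzero[OF x] S]) (use v_mono_eval_0[OF _ x] in blast)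
  then have sumX: "(\<Sum>v\<in>S. \<Sum>x\<in>X. v (mono_eval g x)) = 0" unfolding sum.swap[of _ X S] by simp
  have sumG: "(\<Sum>v\<in>T - S. gc v) = ?N"
    unfolding N_gcd_def gc_def
    by (rule sum.mono_neutral_right) (use T in \<open>auto simp: T_def\<close>)
  \<comment> \<open>The final \<open>BB\<close> is the additional loss of one per differentiation at
    a place of \<open>S\<close>.\<close>
  define P where "P = (\<lambda>v. int dr1 * (\<Sum>x\<in>X. v (mono_eval g x)) - int dr1 * (int (card X) - int M) * int m * ep v
     - (int DD - int (dr1 * M)) * int m * em v - BB)"
  define Q where "Q = (\<lambda>v. if v \<in> S then P v else int DD * gc v)"
  have "Q v - int DD * int (M * r + 1) * hv v + dord v * BB \<le> v ?W" if v: "v \<in> T" for v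
  proof (cases "v \<in> S")
    case True
    then have "place k v" using S by (auto simp: places_def)
    from local_bound(1)[OF f this] show ?thesis using True by (simp add: Q_def P_def algebra_simps)
  next
    case False
    then have "v \<in> places k - S" using v T by blast
    from local_bound_outside[OF f this] show ?thesis using False by (simp add: Q_def algebra_simps)
  qed
  then have "(\<Sum>v\<in>T. Q v - int DD * int (M * r + 1) * hv v + dord v * BB) \<le> (\<Sum>v\<in>T. v ?W)" by (rule sum_mono)
  also have "(\<Sum>v\<in>T. Q v - int DD * int (M * r + 1) * hv v + dord v * BB)
     = (\<Sum>v\<in>T. Q v) - int DD * int (M * r + 1) * (?h1 + ?h2) + (\<Sum>v\<in>T. dord v) * BB"
    by (simp only: sum.distrib sum_subtractf sum_distrib_left[symmetric] sum_distrib_right[symmetric] sumh)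
  also have "(\<Sum>v\<in>T. Q v) = (\<Sum>v\<in>T - S. Q v) + (\<Sum>v\<in>S. Q v)" by (rule sum.subset_diff[OF ST T(1)])
  also have "(\<Sum>v\<in>T - S. Q v) = int DD * ?N" unfolding sumG[symmetric] sum_distrib_left by (rule sum.cong) (auto simp: Q_def)
  also have "(\<Sum>v\<in>S. Q v) = (\<Sum>v\<in>S. P v)" by (rule sum.cong) (auto simp: Q_def)
  also have "\<dots> = - (?E * int m * ?H) - int (card S) * BB"
    unfolding P_def sum_subtractf sum_distrib_left[symmetric] sumem sumX by (simp add: algebra_simps)
  finally have 1: "int DD * ?N + (- (?E * int m * ?H) - int (card S) * BB) - int DD * int (M * r + 1) * (?h1 + ?h2)
     + (\<Sum>v\<in>T. dord v) * BB \<le> 0" unfolding sumW .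
  have "(2 - 2 * genus k) * BB \<le> (\<Sum>v\<in>T. dord v) * BB" by (rule mult_right_mono[OF sumd]) simp
  then show ?thesis using 1 by (simp add: algebra_simps)
qed

end

text \<open>Division by \<open>b\<close>, the dimension for \<open>r - 1\<close>. The factor
  \<open>a / b \<ge> 1\<close> on the left is dropped; on the right \<open>M * r + 1\<close> grows
  to \<open>1 + M * (r + 1)\<close> and \<open>B\<close> to its bound, which gives the stated
  constants.\<close>

lemma gcd_inequality_arith:
  fixes M N h \<mu> M' m H H' a b r B :: real
  assumes b: "1 \<le> b" "b \<le> a" and pos: "0 \<le> M" "0 \<le> N" "0 \<le> h" "0 \<le> \<mu>" "0 \<le> m" "0 \<le> M'" "0 \<le> r"
    and H: "H \<le> H'" and B: "B \<le> (a * M)\<^sup>2 / 2"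
    and le: "a * M * N \<le> a * M * (M * r + 1) * h + B * \<mu> + (b * M' + (a * M - b * M)) * m * H"
  shows "M * N \<le> (M' + a / b * M - M) * m * H' + (a / b * (1 + M * (r + 1))) * M * h + (a\<^sup>2 * M / (2 * b)) * M * \<mu>"
proof -
  let ?R = "(M' + a / b * M - M) * m * H' + (a / b * (1 + M * (r + 1))) * M * h + (a\<^sup>2 * M / (2 * b)) * M * \<mu>"
  have R: "b * ?R = (b * M' + (a * M - b * M)) * m * H' + a * M * (1 + M * (r + 1)) * h + (a * M)\<^sup>2 / 2 * \<mu>"
    using b by (simp add: field_simps power2_eq_square)
  have "b * (M * N) \<le> a * (M * N)" using b pos by (intro mult_right_mono) auto
  also have "\<dots> \<le> a * M * (M * r + 1) * h + B * \<mu> + (b * M' + (a * M - b * M)) * m * H" using le by (simp add: mult.assoc)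
  also have "a * M * (M * r + 1) * h \<le> a * M * (1 + M * (r + 1)) * h"
  proof (rule mult_right_mono[OF mult_left_mono])
    show "M * r + 1 \<le> 1 + M * (r + 1)" using pos by (simp add: algebra_simps)
    show "0 \<le> a * M" using b pos by simp
  qed (rule pos)
  also have "B * \<mu> \<le> (a * M)\<^sup>2 / 2 * \<mu>" by (rule mult_right_mono[OF B pos(4)])
  also have "(b * M' + (a * M - b * M)) * m * H \<le> (b * M' + (a * M - b * M)) * m * H'"
  proof (rule mult_left_mono[OF H])
    have "b * M \<le> a * M" using b pos by (intro mult_right_mono)
    then show "0 \<le> (b * M' + (a * M - b * M)) * m" using b pos by simp
  qed
  finally have "b * (M * N) \<le> b * ?R" unfolding R by simp
  then show ?thesis using b by (simp only: mult_le_cancel_left_pos)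
qed

theorem theorem6p3:
  fixes k :: "'a::field_char_0 set"
    and S :: "('a \<Rightarrow> int) set"
    and F1 F2 :: "'a mpoly"
    and n d :: nat
  assumes k_closed: "alg_closed_subfield k"
    and K_fun_field: "function_field_over k"
    and S_fin: "finite S" and S_sub: "S \<subseteq> places k"
    and F1_vars: "in_vars n F1" and F2_vars: "in_vars n F2"
    and cop: "mpoly_coprime F1 F2"
    and one1: "1 \<in> coeff_set F1" and one2: "1 \<in> coeff_set F2"
    and deg1: "total_degree F1 = d" and deg2: "total_degree F2 = d"
    and d_pos: "d > 0"
  shows "(\<lambda>m. real_of_int (M'_num n d m)) \<in> O(\<lambda>m. real m powr (real n - 2))
    \<and> (\<forall>(g :: nat \<Rightarrow> 'a) (m :: nat) (r :: nat).
         (\<forall>j<n. g j \<in> S_units k S) \<and> m \<ge> 2 * d \<and> r > 0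
         \<and> lin_nondeg_over (Vspace k F1 F2 (nat (M_num n d m) * r + 1)) (exps_upto n m) (mono_eval g)
       \<longrightarrow>
       (let M = M_num n d m; M' = M'_num n d m;
            dr = real (dV k F1 F2 (nat M * r)); dr1 = real (dV k F1 F2 (nat M * (r - 1)));
            c = dr / dr1 * (1 + real_of_int M * (real r + 1));
            c' = dr ^ 2 * real_of_int M / (2 * dr1)
        in real_of_int M * real_of_int (N_gcd k S (mpoly_eval F1 g) (mpoly_eval F2 g))
           \<le> (real_of_int M' + dr / dr1 * real_of_int M - real_of_int M) * real m * real n
                * real_of_int (Max ((\<lambda>j. height k (g j)) ` {..<n}))
             + c * real_of_int M * real_of_int (mpoly_height k F1 + mpoly_height k F2)
             + c' * real_of_int M * real_of_int (max 0 (2 * genus k - 2 + int (card S)))))"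
proof (intro conjI allI impI)
  interpret ffield k by unfold_locales (rule k_closed, rule K_fun_field)
  interpret coeff_space k F1 F2 by unfold_locales (rule one1, rule one2)
  have ne: "F1 \<noteq> 0" "F2 \<noteq> 0" using one1 one2 by (auto simp: coeff_set_def)
  have "n \<noteq> 0"
  proof
    assume "n = 0"
    then have "Poly_Mapping.keys F1 \<subseteq> {0}" using F1_vars by (auto simp: in_vars_def)
    moreover have "Poly_Mapping.keys F1 \<noteq> {}" using ne(1) by simp
    ultimately have "Poly_Mapping.keys F1 = {0}" by blast
    then have "total_degree F1 = 0" by (simp add: total_degree_def mono_deg_def)
    then show False using deg1 d_pos by simp
  qed
  then show "(\<lambda>m. real_of_int (M'_num n d m)) \<in> O(\<lambda>m. real m powr (real n - 2))" by (intro M'_num_bigo) simp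
  fix g :: "nat \<Rightarrow> 'a" and m r :: nat
  assume H: "(\<forall>j<n. g j \<in> S_units k S) \<and> m \<ge> 2 * d \<and> r > 0
         \<and> lin_nondeg_over (Vspace k F1 F2 (nat (M_num n d m) * r + 1)) (exps_upto n m) (mono_eval g)"
  define M where "M = nat (M_num n d m)"
  have md: "m \<ge> 2 * d" using H by blast
  obtain \<phi> :: "nat \<Rightarrow> 'a mpoly" where \<phi>0: "int (nat (M_num n d m)) = M_num n d m"
    "\<forall>s<nat (M_num n d m).
       \<exists>i\<in>exps_upto n (m - d). \<phi> s = Poly_Mapping.single i 1 * F1 \<or> \<phi> s = Poly_Mapping.single i 1 * F2"
    "\<forall>c. (\<Sum>s<nat (M_num n d m). Poly_Mapping.single 0 (c s) * \<phi> s) = 0 \<longrightarrow> (\<forall>s<nat (M_num n d m). c s = 0)"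
    by (rule multiples_family[OF F1_vars F2_vars cop ne deg1 md])
  note \<phi> = \<phi>0[folded M_def] and Mi = \<phi>0(1)[folded M_def]
  \<comment> \<open>Any nonconstant \<open>t\<close> serves: it does not occur in
    \<open>gcd_inequality\<close>, where dt has been estimated by the genus.\<close>
  obtain t where t: "t \<notin> k" using ex_notin by blast
  interpret gcd_bound k t F1 F2 S n d m r M g \<phi>
    by unfold_locales (use t S_fin S_sub F1_vars F2_vars deg1 deg2 H \<phi> in \<open>auto simp: M_def[symmetric]\<close>)
  let ?N = "N_gcd k S (mpoly_eval F1 g) (mpoly_eval F2 g)"
  let ?h = "mpoly_height k F1 + mpoly_height k F2" and ?H = "\<Sum>j<n. height k (g j)"
  let ?\<mu> = "max 0 (2 * genus k - 2 + int (card S))"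
  have M': "int (card X) - int M = M'_num n d m" using card_exps_upto[of n m] Mi by (simp add: M'_num_def)
  \<comment> \<open>A basis and a place are produced to read off \<open>M \<le> card X\<close>, that
    is, that \<open>M'\<close> is nonnegative.\<close>
  obtain f where "\<forall>j<DD. f j \<in> U" "lin_nondeg_over k {..<DD} f"
    using kdim_attained[OF U_dim(1)] unfolding U_dim(2) by metis
  moreover obtain v where "place k v" using ex_zero[OF t] by blast
  ultimately have MX: "M \<le> card X" by (rule local_bound(2))
  have hF: "0 \<le> mpoly_height k F" if "1 \<in> coeff_set F" for F
  proof -
    have "mpoly_height k F = (\<Sum>v\<in>{v \<in> places k. \<exists>a\<in>coeff_set F. v a \<noteq> 0}. hc F v)"
      by (rule mpoly_height_eq[OF finite_coeff_places]) (use that in auto)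
    also have "\<dots> \<ge> 0" by (rule sum_nonneg) (use hc_nonneg that in \<open>auto simp: places_def\<close>)
    finally show ?thesis .
  qed
  have "BB * (2 * genus k - 2 + int (card S)) \<le> BB * ?\<mu>" by (intro mult_left_mono) auto
  with gcd_inequality have main: "int DD * ?N \<le> int DD * int (M * r + 1) * ?h + BB * ?\<mu>
      + (int dr1 * M'_num n d m + (int DD - int (dr1 * M))) * int m * ?H" unfolding M' by linarith
  \<comment> \<open>The factor \<open>n\<close> of the statement arises from replacing the sum of
    the heights by their maximum.\<close>
  have "?H \<le> of_nat (card {..<n}) * Max ((\<lambda>j. height k (g j)) ` {..<n})" by (rule sum_bounded_above) simp
  then have Hmax: "real_of_int ?H \<le> real n * real_of_int (Max ((\<lambda>j. height k (g j)) ` {..<n}))"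
    by (metis card_lessThan of_int_le_iff of_int_mult of_int_of_nat_eq)
  have "BB \<le> int (DD * DD) div 2" unfolding zdiv_int[of _ 2, simplified, symmetric] by (intro of_nat_mono div_le_mono mult_le_mono) auto
  then have "real_of_int BB \<le> real (DD * DD) / 2" by linarith
  then have B: "real_of_int BB \<le> (real dr * real M)\<^sup>2 / 2" by (simp add: power2_eq_square)
  have "real M * real_of_int ?N
     \<le> (real_of_int (M'_num n d m) + real dr / real dr1 * real M - real M) * real m
          * (real n * real_of_int (Max ((\<lambda>j. height k (g j)) ` {..<n})))
        + (real dr / real dr1 * (1 + real M * (real r + 1))) * real M * real_of_int ?h
        + ((real dr)\<^sup>2 * real M / (2 * real dr1)) * real M * real_of_int ?\<mu>"
  proof (rule gcd_inequality_arith[OF _ _ _ _ _ _ _ _ _ Hmax B])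
    show "1 \<le> real dr1" using dV_pos by simp
    show "real dr1 \<le> real dr" using dV_mono[of "M * (r - 1)" "M * r"] by simp
    show "0 \<le> real_of_int ?N" 
    proof -
      have "0 \<le> ?N" unfolding N_gcd_def by (rule sum_nonneg) simp
      then show ?thesis by simp
    qed
    show "0 \<le> real_of_int ?h" using hF[OF one1] hF[OF one2] by simp
    show "0 \<le> real_of_int (M'_num n d m)" using M' MX by linarith
    show "real dr * real M * real_of_int ?N \<le> real dr * real M * (real M * real r + 1) * real_of_int ?h + real_of_int BB * real_of_int ?\<mu>
       + (real dr1 * real_of_int (M'_num n d m) + (real dr * real M - real dr1 * real M)) * real m * real_of_int ?H"
    proof -
      have "real_of_int (int DD * ?N) \<le> real_of_int (int DD * int (M * r + 1) * ?h + BB * ?\<mu>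
        + (int dr1 * M'_num n d m + (int DD - int (dr1 * M))) * int m * ?H)" using main by (simp only: of_int_le_iff)
      then show ?thesis
        by (simp only: of_int_add of_int_mult of_int_diff of_int_of_nat_eq of_nat_mult of_nat_add of_nat_1 of_int_1)
    qed
  qed auto
  then show "let M = M_num n d m; M' = M'_num n d m;
            dr = real (dV k F1 F2 (nat M * r)); dr1 = real (dV k F1 F2 (nat M * (r - 1)));
            c = dr / dr1 * (1 + real_of_int M * (real r + 1));
            c' = dr ^ 2 * real_of_int M / (2 * dr1)
        in real_of_int M * real_of_int (N_gcd k S (mpoly_eval F1 g) (mpoly_eval F2 g))
           \<le> (real_of_int M' + dr / dr1 * real_of_int M - real_of_int M) * real m * real n
                * real_of_int (Max ((\<lambda>j. height k (g j)) ` {..<n}))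
             + c * real_of_int M * real_of_int (mpoly_height k F1 + mpoly_height k F2)
             + c' * real_of_int M * real_of_int (max 0 (2 * genus k - 2 + int (card S)))"
    unfolding Let_def M_def[symmetric] Mi[symmetric] by (simp only: of_int_of_nat_eq mult.assoc nat_int)
qed

end
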